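(* Let $T>0$, $\sigma>0$, $x_0\in\mathbb{R}$, $N\in\mathbb{N}$. Let $b:[0,T]\times\mathbb{R}\times\mathcal{P}_2(\mathbb{R})\to\mathbb{R}$ be such that $t\mapsto b(t,x,\mu)$ is continuous on $[0,T]$ for all $x\in\mathbb{R}$, $\mu\in\mathcal{P}_2(\mathbb{R})$, and such that there exist $L>0$ and $q\in\mathbb{N}$, $q>1$, with, for all $t\in[0,T]$, $x,x'\in\mathbb{R}$, $\mu,\mu'\in\mathcal{P}_2(\mathbb{R})$, $$(x-x')\big(b(t,x,\mu)-b(t,x',\mu)\big)\le L|x-x'|^2,\qquad |b(t,x,\mu)-b(t,x,\mu')|\le W^{(2)}(\mu,\mu'),$$ $$|b(t,x,\mu)-b(t,x',\mu)|\le L(1+|x|^q+|x'|^q)|x-x'|.$$ Let $G$ be a non-negative functional, continuous in the uniform topology, on the space of continuous functions $x:[0,T]\to\mathbb{R}$ with $x(0)=x_0$, such that $\log G(x)\le C_1+C_2\sup_{t\in[0,T]}|x_t|^\alpha$ for all such $x$, for some constants $C_1,C_2>0$ and $\alpha\in[1,2)$. Fix $\tilde\omega\in\tilde\Omega$ (and thus the measure flow $\mu^N$), and let $\overline X$, $\overline G$ and $L(h;\mu^N)$ be as defined in the context. Assume that there exists $u\in\mathbb{H}_T$ with $\overline G(u)>0$. Then the following hold ($\tilde{\mathbb{P}}$-a.s.): (i) Let $h\in\mathbb{H}_T$ be such that $\dot h$ is of finite variation. Then $$L(h;\mu^N)=\sup_{u\in\mathbb{H}_T}\Big\{2\log\overline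 G(u)-\int_0^T\dot h_t\dot u_t\,dt+\frac12\int_0^T\dot h_t^2\,dt-\frac12\int_0^T\dot u_t^2\,dt\Big\}.\qquad(\ast)$$ (ii) There exists $h^*\in\mathbb{H}_T$ which minimizes, over $h\in\mathbb{H}_T$, the right-hand side of $(\ast)$. (iii) There exists a maximizer $h^{**}\in\mathbb{H}_T$ of the problem $$\sup_{u\in\mathbb{H}_T}\Big\{2\log\overline G(u)-\int_0^T\dot u_t^2\,dt\Big\}.\qquad(\ast\ast)$$ If $$L(h^{**};\mu^N)=2\log\overline G(h^{**})-\int_0^T(\dot h^{**}_t)^2\,dt,$$ then $h^{**}$ defines an asymptotically optimal measure change and is the unique maximizer of $(\ast\ast)$.
   Context: $\mathcal{P}_2(\mathbb{R})$ is the set of probability measures on $\mathbb{R}$ with finite second moment and $W^{(2)}$ is the Wasserstein-2 distance on it. $\mathbb{W}_T$ is the space of continuous functions $[0,T]\to\mathbb{R}$ vanishing at $0$, with the uniform topology. $\mathbb{H}_T\subset\mathbb{W}_T$ is the Cameron–Martin space of functions $h=\int_0^\cdot\dot h_t\,dt$ with $\int_0^T|\dot h_t|^2dt<\infty$. Convention: $\log 0=-\infty$. Probability spaces. $W$ is a standard one-dimensional Brownian motion on $(\Omega,\mathcal{F},\mathbb{P})$. On a second ("copy") probability space $(\tilde\Omega,\tilde{\mathcal F},(\tilde{\mathcal F}_t),\tilde{\mathbb P})$, carrying an $N$-dimensional Brownian motion generating the filtration, one simulates with a numerical scheme in time (e.g. Euler) an $N$-particle system $Y^{1,N},\dots,Y^{N,N}$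 approximating $dY^{i}_t=b(t,Y^i_t,\frac1N\sum_j\delta_{Y^j_t})dt+\sigma\,d\tilde W^i_t$, $Y^i_0=x_0$; set $\mu^N_t=\frac1N\sum_{i=1}^N\delta_{Y^{i,N}_t}$. For each $\tilde\omega$ the paths $t\mapsto Y^{i,N}_t(\tilde\omega)$ are Borel and bounded on $[0,T]$. Everything is considered on the product space $(\Omega,\mathcal F,\mathbb P)\otimes(\tilde\Omega,\tilde{\mathcal F},\tilde{\mathbb P})$, so $\mu^N$ is independent of $W$. Decoupled SDE: $\overline X$ is the solution of $$d\overline X_t=b(t,\overline X_t,\mu^N_t)\,dt+\sigma\,dW_t,\qquad \overline X_0=x_0.$$ Since $\sigma$ is constant, $\overline X$ is a functional of the driving path: for $w\in\mathbb{W}_T$, $\overline X(w)$ solves $\overline X_t(w)=x_0+\int_0^tb(s,\overline X_s(w),\mu^N_s)ds+\sigma w_t$. Put $\overline G(w):=G(\overline X(w))$ (which also depends on $\mu^N$). Small-noise functional: for $h\in\mathbb{H}_T$, $$L(h;\mu^N):=\limsup_{\epsilon\to0}\epsilon\log\mathbb{E}_{\mathbb P\otimes\tilde{\mathbb P}}\Big[\exp\Big(\tfrac1\epsilon\Big(2\log\overline G(\sqrt\epsilon W)-\int_0^T\sqrt\epsilon\,\dot h_t\,dW_t+\tfrac12\int_0^T\dot h_t^2dt\Big)\Big)\Big|\tilde{\mathcal F}_T\Big].$$ Asymptotic optimality (conditionally on $\mu^N$). Let $\vartheta(\epsilon):=\mathbb{E}[\exp(\log\overline G(\sqrt\epsilon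 W)/\epsilon)\,|\,\tilde{\mathcal F}_T]$ for $\epsilon>0$. A family of estimators (random variables) $\{\hat\vartheta(\epsilon)\}_{\epsilon>0}$ is asymptotically relatively unbiased if $(\mathbb{E}[\hat\vartheta(\epsilon)]-\vartheta(\epsilon))/\vartheta(\epsilon)\to0$ as $\epsilon\to0$. A family of asymptotically relatively unbiased estimators $\{\hat\vartheta_0(\epsilon)\}$ is asymptotically optimal if $$\limsup_{\epsilon\to0}\epsilon\log\mathbb{E}[\hat\vartheta_0(\epsilon)^2]=\inf_{\{\hat\vartheta(\epsilon)\}}\limsup_{\epsilon\to0}\epsilon\log\mathbb{E}[\hat\vartheta(\epsilon)^2],$$ the infimum being over all asymptotically relatively unbiased families. A function $h\in\mathbb{H}_T$ defines an asymptotically optimal measure change if the importance sampling family $\hat\vartheta_h(\epsilon)=\exp(\log\overline G(\sqrt\epsilon W)/\epsilon)\,\frac{d\mathbb P}{d\mathbb Q^\epsilon_h}$, considered under $\mathbb{Q}_h^\epsilon$ with $\frac{d\mathbb Q^\epsilon_h}{d\mathbb P}=\exp\big(\frac{1}{\sqrt\epsilon}\int_0^T\dot h_tdW_t-\frac1{2\epsilon}\int_0^T\dot h_t^2dt\big)$ (so that its second moment is the expectation inside the definition of $L(h;\mu^N)$), is asymptotically optimal. *)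

theory Defs
  imports "HOL-Probability.Probability"
begin

section \<open>Probability measures on the line\<close>

definition P2 :: "real measure set" where
  "P2 = {\<mu>. prob_space \<mu> \<and> sets \<mu> = sets borel \<and> integrable \<mu> (\<lambda>x. x\<^sup>2)}"

definition couplings :: "real measure \<Rightarrow> real measure \<Rightarrow> (real \<times> real) measure set" where
  "couplings \<mu> \<nu> = {\<pi>. sets \<pi> = sets (borel \<Otimes>\<^sub>M borel)
      \<and> distr \<pi> borel fst = \<mu> \<and> distr \<pi> borel snd = \<nu>}"

definition wasserstein2 :: "real measure \<Rightarrow> real measure \<Rightarrow> real" where
  "wasserstein2 \<mu> \<nu> = sqrt (INF \<pi>\<in>couplings \<mu> \<nu>. (LINT z|\<pi>. (fst z - snd z)\<^sup>2))"

definition empirical_measure :: "nat \<Rightarrow> (nat \<Rightarrow> real) \<Rightarrow> real measure" where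
  "empirical_measure N y = distr (uniform_count_measure {..<N}) borel y"

definition empirical_flow ::
    "nat \<Rightarrow> (nat \<Rightarrow> real \<Rightarrow> 'c \<Rightarrow> real) \<Rightarrow> 'c \<Rightarrow> real \<Rightarrow> real measure" where
  "empirical_flow N Y \<omega>' t = empirical_measure N (\<lambda>i. Y i t \<omega>')"

section \<open>Path spaces\<close>

text \<open>The elements of \<open>cfunspace\<close> are extensional functions on the compact interval, so two
  paths are equal as soon as they agree on it; the metric is the supremum distance.\<close>

abbreviation path_metric :: "real \<Rightarrow> (real \<Rightarrow> real) metric" where
  "path_metric T \<equiv> cfunspace (top_of_set {0..T}) euclidean_metric"

definition paths_from :: "real \<Rightarrow> real \<Rightarrow> (real \<Rightarrow> real) set" where
  "paths_from T x0 = {x \<in> mspace (path_metric T). x 0 = x0}"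

abbreviation wiener_space :: "real \<Rightarrow> (real \<Rightarrow> real) set" where
  "wiener_space T \<equiv> paths_from T 0"

definition cm_density :: "real \<Rightarrow> (real \<Rightarrow> real) \<Rightarrow> (real \<Rightarrow> real) \<Rightarrow> bool" where
  "cm_density T h g \<longleftrightarrow> set_borel_measurable lborel {0..T} g
     \<and> set_integrable lborel {0..T} (\<lambda>s. (g s)\<^sup>2)
     \<and> (\<forall>t\<in>{0..T}. h t = (LINT s:{0..t}|lborel. g s))"

definition cm_space :: "real \<Rightarrow> (real \<Rightarrow> real) set" where
  "cm_space T = {h \<in> wiener_space T. \<exists>g. cm_density T h g}"

text \<open>\<open>cm_deriv T h\<close> is some version of the density of \<open>h\<close>; it is determined almost everywhere
  on \<open>{0..T}\<close>, which is all that integrals of it depend on.\<close>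

definition cm_deriv :: "real \<Rightarrow> (real \<Rightarrow> real) \<Rightarrow> real \<Rightarrow> real" where
  "cm_deriv T h = (SOME g. cm_density T h g)"

definition cm_inner :: "real \<Rightarrow> (real \<Rightarrow> real) \<Rightarrow> (real \<Rightarrow> real) \<Rightarrow> real" where
  "cm_inner T h u = (LINT t:{0..T}|lborel. cm_deriv T h t * cm_deriv T u t)"

definition finite_variation :: "real \<Rightarrow> (real \<Rightarrow> real) \<Rightarrow> bool" where
  "finite_variation T g \<longleftrightarrow> (\<exists>V. \<forall>ts. sorted ts \<and> set ts \<subseteq> {0..T} \<longrightarrow>
     (\<Sum>i<length ts - 1. \<bar>g (ts ! Suc i) - g (ts ! i)\<bar>) \<le> V)"

definition cm_deriv_finite_variation :: "real \<Rightarrow> (real \<Rightarrow> real) \<Rightarrow> bool" where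
  "cm_deriv_finite_variation T h \<longleftrightarrow> (\<exists>g. cm_density T h g \<and> finite_variation T g)"

section \<open>Brownian motion and the Wiener integral\<close>

definition brownian_motion :: "'a measure \<Rightarrow> (real \<Rightarrow> 'a \<Rightarrow> real) \<Rightarrow> bool" where
  "brownian_motion M W \<longleftrightarrow> prob_space M
     \<and> (\<forall>t\<ge>0. W t \<in> borel_measurable M)
     \<and> (\<forall>\<omega>\<in>space M. W 0 \<omega> = 0 \<and> continuous_on {0..} (\<lambda>t. W t \<omega>))
     \<and> (\<forall>s t. 0 \<le> s \<and> s < t \<longrightarrow>
          distributed M lborel (\<lambda>\<omega>. W t \<omega> - W s \<omega>) (\<lambda>x. ennreal (normal_density 0 (sqrt (t - s)) x)))
     \<and> (\<forall>(n::nat) t. 0 \<le> t 0 \<and> (\<forall>i<n. t i \<le> t (Suc i)) \<longrightarrow>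
          prob_space.indep_vars M (\<lambda>_. borel) (\<lambda>i \<omega>. W (t (Suc i)) \<omega> - W (t i) \<omega>) {..<n})"

definition brownian_motion_dim :: "nat \<Rightarrow> 'a measure \<Rightarrow> (nat \<Rightarrow> real \<Rightarrow> 'a \<Rightarrow> real) \<Rightarrow> bool" where
  "brownian_motion_dim N M B \<longleftrightarrow> (\<forall>i<N. brownian_motion M (B i))
     \<and> prob_space.indep_vars M (\<lambda>_. Pi\<^sub>M {0..} (\<lambda>_. borel)) (\<lambda>i \<omega>. \<lambda>t\<in>{0..}. B i t \<omega>) {..<N}"

definition natural_filtration ::
    "nat \<Rightarrow> 'a measure \<Rightarrow> (nat \<Rightarrow> real \<Rightarrow> 'a \<Rightarrow> real) \<Rightarrow> real \<Rightarrow> 'a measure" where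
  "natural_filtration N M B t =
     sigma (space M) {B i s -` A \<inter> space M | i s A. i < N \<and> 0 \<le> s \<and> s \<le> t \<and> A \<in> sets borel}"

text \<open>A list of triples \<open>(c, a, b)\<close> encodes the step function that is the sum of the functions
  \<open>c * indicator {a<..b}\<close>.\<close>

definition step_fun :: "(real \<times> real \<times> real) list \<Rightarrow> real \<Rightarrow> real" where
  "step_fun cs t = (\<Sum>(c, a, b)\<leftarrow>cs. c * indicator {a<..b} t)"

definition step_integral ::
    "(real \<Rightarrow> 'a \<Rightarrow> real) \<Rightarrow> (real \<times> real \<times> real) list \<Rightarrow> 'a \<Rightarrow> real" where
  "step_integral W cs \<omega> = (\<Sum>(c, a, b)\<leftarrow>cs. c * (W b \<omega> - W a \<omega>))"

definition is_wiener_integral ::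
    "'a measure \<Rightarrow> (real \<Rightarrow> 'a \<Rightarrow> real) \<Rightarrow> real \<Rightarrow> (real \<Rightarrow> real) \<Rightarrow> ('a \<Rightarrow> real) \<Rightarrow> bool" where
  "is_wiener_integral M W T f I \<longleftrightarrow> I \<in> borel_measurable M
     \<and> (\<exists>cs :: nat \<Rightarrow> (real \<times> real \<times> real) list.
          (\<forall>n. \<forall>(c, a, b)\<in>set (cs n). 0 \<le> a \<and> a \<le> b \<and> b \<le> T)
        \<and> (\<lambda>n. \<integral>\<^sup>+t\<in>{0..T}. ennreal ((f t - step_fun (cs n) t)\<^sup>2) \<partial>lborel) \<longlonglongrightarrow> 0
        \<and> (\<lambda>n. \<integral>\<^sup>+\<omega>. ennreal ((I \<omega> - step_integral W (cs n) \<omega>)\<^sup>2) \<partial>M) \<longlonglongrightarrow> 0)"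

text \<open>For square integrable \<open>f\<close> this is a version of the integral of \<open>f\<close> against \<open>W\<close>, unique almost
  surely by the isometry property.\<close>

definition wiener_integral ::
    "'a measure \<Rightarrow> (real \<Rightarrow> 'a \<Rightarrow> real) \<Rightarrow> real \<Rightarrow> (real \<Rightarrow> real) \<Rightarrow> 'a \<Rightarrow> real" where
  "wiener_integral M W T f = (SOME I. is_wiener_integral M W T f I)"

definition scaled_path :: "(real \<Rightarrow> 'a \<Rightarrow> real) \<Rightarrow> real \<Rightarrow> real \<Rightarrow> 'a \<Rightarrow> real \<Rightarrow> real" where
  "scaled_path W T \<epsilon> \<omega> = (\<lambda>t\<in>{0..T}. sqrt \<epsilon> * W t \<omega>)"

section \<open>Extended logarithm and exponential\<close>

definition elog :: "ennreal \<Rightarrow> ereal" where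
  "elog x = (if x = 0 then -\<infinity> else if x = \<top> then \<infinity> else ereal (ln (enn2real x)))"

definition eexp :: "ereal \<Rightarrow> ennreal" where
  "eexp x = (case x of ereal r \<Rightarrow> ennreal (exp r) | PInfty \<Rightarrow> \<top> | MInfty \<Rightarrow> 0)"

definition log_rate :: "(real \<Rightarrow> ennreal) \<Rightarrow> ereal" where
  "log_rate f = Limsup (at_right 0) (\<lambda>\<epsilon>. ereal \<epsilon> * elog (f \<epsilon>))"

section \<open>Conditional expectation given the copy space\<close>

text \<open>On a product space, the conditional expectation given a sub-sigma-algebra of the second
  factor. The upper limits below run over uncountably many functions, so a version has to be fixed
  simultaneously for all of them: the second coordinate is frozen and the first one integrated out.
  The lemma confirms that this is a version of \<open>nn_cond_exp\<close>.\<close>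

definition copy_cond_exp :: "'a measure \<Rightarrow> ('a \<times> 'c \<Rightarrow> ennreal) \<Rightarrow> 'c \<Rightarrow> ennreal" where
  "copy_cond_exp P f \<omega>' = (\<integral>\<^sup>+\<omega>. f (\<omega>, \<omega>') \<partial>P)"

lemma copy_cond_exp_version:
  assumes P: "prob_space P" and M': "prob_space M'" and F: "subalgebra M' F"
    and f: "f \<in> borel_measurable (P \<Otimes>\<^sub>M F)"
  shows "AE z in P \<Otimes>\<^sub>M M'.
    copy_cond_exp P f (snd z) =
      nn_cond_exp (P \<Otimes>\<^sub>M M') (vimage_algebra (space (P \<Otimes>\<^sub>M M')) snd F) f z"
proof -
  interpret P: prob_space P by fact
  interpret M': prob_space M' by fact
  interpret PM: pair_prob_space P M' ..
  let ?M = "P \<Otimes>\<^sub>M M'" and ?F = "vimage_algebra (space (P \<Otimes>\<^sub>M M')) snd F"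
  have sp: "space F = space M'" and ss: "sets F \<subseteq> sets M'"
    using F by (auto simp: subalgebra_def)
  have id_F: "(\<lambda>x. x) \<in> M' \<rightarrow>\<^sub>M F"
    by (rule measurable_from_subalg[OF F]) simp
  have snd_F: "snd \<in> ?M \<rightarrow>\<^sub>M F"
    by (rule measurable_compose[OF measurable_snd id_F])
  have sub: "subalgebra ?M ?F"
    unfolding subalgebra_def
  proof (intro conjI subsetI)
    fix A assume "A \<in> sets ?F"
    then show "A \<in> sets ?M"
      using measurable_sets[OF snd_F] measurable_space[OF snd_F]
      by (auto simp: sets_vimage_algebra2 Pi_iff)
  qed simp
  interpret finite_measure_subalgebra ?M ?F
    by (unfold_locales) (rule sub)
  have f1: "f \<in> borel_measurable ?M"
  proof -
    have "(\<lambda>z. (fst z, snd z)) \<in> ?M \<rightarrow>\<^sub>M P \<Otimes>\<^sub>M F"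
      by (rule measurable_Pair[OF measurable_fst snd_F])
    from measurable_compose[OF this f] show ?thesis by simp
  qed
  have gF: "copy_cond_exp P f \<in> borel_measurable F"
  proof -
    have "(\<lambda>(x, y). f (y, x)) \<in> borel_measurable (F \<Otimes>\<^sub>M P)"
      using f by measurable
    from P.borel_measurable_nn_integral[OF this] show ?thesis
      by (simp add: copy_cond_exp_def[abs_def])
  qed
  have gM: "copy_cond_exp P f \<in> borel_measurable M'"
    by (rule measurable_from_subalg[OF F gF])
  show ?thesis
  proof (rule nn_cond_exp_charact)
    show "f \<in> borel_measurable ?M" by fact
    have "snd \<in> ?F \<rightarrow>\<^sub>M F"
      by (rule measurable_vimage_algebra1) (use measurable_space[OF snd_F] in auto)
    then show "(\<lambda>z. copy_cond_exp P f (snd z)) \<in> borel_measurable ?F"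
      using gF by (rule measurable_compose)
  next
    fix A assume "A \<in> sets ?F"
    then obtain B where B: "B \<in> sets F" and A: "A = snd -` B \<inter> space ?M"
      using sets_vimage_algebra2[of snd "space ?M" F] measurable_space[OF snd_F] by auto
    have BM: "B \<in> sets M'" using B ss by auto
    have ind: "indicator A z = (indicator B (snd z) :: ennreal)" if "z \<in> space ?M" for z
      using that A by (auto simp: indicator_def)
    have "(\<integral>\<^sup>+z\<in>A. f z \<partial>?M) = (\<integral>\<^sup>+z. f z * indicator B (snd z) \<partial>?M)"
      by (intro nn_integral_cong) (simp add: ind)
    also have "\<dots> = (\<integral>\<^sup>+y. (\<integral>\<^sup>+x. f (x, y) * indicator B y \<partial>P) \<partial>M')"
      using f1 BM by (subst PM.nn_integral_snd[symmetric]) auto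
    also have "\<dots> = (\<integral>\<^sup>+y. copy_cond_exp P f y * indicator B y \<partial>M')"
      unfolding copy_cond_exp_def using f1
      by (intro nn_integral_cong nn_integral_multc) auto
    also have "\<dots> = (\<integral>\<^sup>+y. (\<integral>\<^sup>+x. copy_cond_exp P f y * indicator B y \<partial>P) \<partial>M')"
      by (simp add: P.emeasure_space_1)
    also have "\<dots> = (\<integral>\<^sup>+z. copy_cond_exp P f (snd z) * indicator B (snd z) \<partial>?M)"
      using gM BM by (subst PM.nn_integral_snd[symmetric]) auto
    also have "\<dots> = (\<integral>\<^sup>+z\<in>A. copy_cond_exp P f (snd z) \<partial>?M)"
      by (intro nn_integral_cong) (simp add: ind)
    finally show "(\<integral>\<^sup>+z\<in>A. f z \<partial>?M) = (\<integral>\<^sup>+z\<in>A. copy_cond_exp P f (snd z) \<partial>?M)" .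
  qed
qed

section \<open>The decoupled equation and the small-noise functional\<close>

definition decoupled_solution ::
    "real \<Rightarrow> (real \<Rightarrow> real \<Rightarrow> real measure \<Rightarrow> real) \<Rightarrow> real \<Rightarrow> real \<Rightarrow> (real \<Rightarrow> real measure)
      \<Rightarrow> (real \<Rightarrow> real) \<Rightarrow> (real \<Rightarrow> real) \<Rightarrow> bool" where
  "decoupled_solution T b \<sigma> x0 \<mu> w x \<longleftrightarrow> x \<in> mspace (path_metric T)
     \<and> set_integrable lborel {0..T} (\<lambda>s. b s (x s) (\<mu> s))
     \<and> (\<forall>t\<in>{0..T}. x t = x0 + (LINT s:{0..t}|lborel. b s (x s) (\<mu> s)) + \<sigma> * w t)"

definition Xbar ::
    "real \<Rightarrow> (real \<Rightarrow> real \<Rightarrow> real measure \<Rightarrow> real) \<Rightarrow> real \<Rightarrow> real \<Rightarrow> (real \<Rightarrow> real measure)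
      \<Rightarrow> (real \<Rightarrow> real) \<Rightarrow> real \<Rightarrow> real" where
  "Xbar T b \<sigma> x0 \<mu> w = (THE x. decoupled_solution T b \<sigma> x0 \<mu> w x)"

definition Gbar ::
    "real \<Rightarrow> (real \<Rightarrow> real \<Rightarrow> real measure \<Rightarrow> real) \<Rightarrow> real \<Rightarrow> real \<Rightarrow> ((real \<Rightarrow> real) \<Rightarrow> real)
      \<Rightarrow> (real \<Rightarrow> real measure) \<Rightarrow> (real \<Rightarrow> real) \<Rightarrow> real" where
  "Gbar T b \<sigma> x0 G \<mu> w = G (Xbar T b \<sigma> x0 \<mu> w)"

definition log_Gbar ::
    "real \<Rightarrow> (real \<Rightarrow> real \<Rightarrow> real measure \<Rightarrow> real) \<Rightarrow> real \<Rightarrow> real \<Rightarrow> ((real \<Rightarrow> real) \<Rightarrow> real)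
      \<Rightarrow> (real \<Rightarrow> real measure) \<Rightarrow> (real \<Rightarrow> real) \<Rightarrow> ereal" where
  "log_Gbar T b \<sigma> x0 G \<mu> w = elog (ennreal (Gbar T b \<sigma> x0 G \<mu> w))"

definition small_noise_L ::
    "'a measure \<Rightarrow> (real \<Rightarrow> 'a \<Rightarrow> real) \<Rightarrow> real \<Rightarrow> (real \<Rightarrow> real \<Rightarrow> real measure \<Rightarrow> real) \<Rightarrow> real
      \<Rightarrow> real \<Rightarrow> ((real \<Rightarrow> real) \<Rightarrow> real) \<Rightarrow> ('c \<Rightarrow> real \<Rightarrow> real measure) \<Rightarrow> (real \<Rightarrow> real) \<Rightarrow> 'c \<Rightarrow> ereal" where
  "small_noise_L P W T b \<sigma> x0 G \<mu> h \<omega>' =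
     log_rate (\<lambda>\<epsilon>. copy_cond_exp P
       (\<lambda>(\<omega>, \<omega>''). eexp (ereal (1 / \<epsilon>) *
          (2 * log_Gbar T b \<sigma> x0 G (\<mu> \<omega>'') (scaled_path W T \<epsilon> \<omega>)
           - ereal (sqrt \<epsilon> * wiener_integral P W T (cm_deriv T h) \<omega>)
           + ereal (1/2 * cm_inner T h h)))) \<omega>')"

definition variational_rhs ::
    "real \<Rightarrow> (real \<Rightarrow> real \<Rightarrow> real measure \<Rightarrow> real) \<Rightarrow> real \<Rightarrow> real \<Rightarrow> ((real \<Rightarrow> real) \<Rightarrow> real)
      \<Rightarrow> (real \<Rightarrow> real measure) \<Rightarrow> (real \<Rightarrow> real) \<Rightarrow> ereal" where
  "variational_rhs T b \<sigma> x0 G \<mu> h =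
     (SUP u\<in>cm_space T. 2 * log_Gbar T b \<sigma> x0 G \<mu> u - ereal (cm_inner T h u)
        + ereal (1/2 * cm_inner T h h) - ereal (1/2 * cm_inner T u u))"

definition simplified_objective ::
    "real \<Rightarrow> (real \<Rightarrow> real \<Rightarrow> real measure \<Rightarrow> real) \<Rightarrow> real \<Rightarrow> real \<Rightarrow> ((real \<Rightarrow> real) \<Rightarrow> real)
      \<Rightarrow> (real \<Rightarrow> real measure) \<Rightarrow> (real \<Rightarrow> real) \<Rightarrow> ereal" where
  "simplified_objective T b \<sigma> x0 G \<mu> u = 2 * log_Gbar T b \<sigma> x0 G \<mu> u - ereal (cm_inner T u u)"

definition is_maximizer :: "'b set \<Rightarrow> ('b \<Rightarrow> ereal) \<Rightarrow> 'b \<Rightarrow> bool" where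
  "is_maximizer S f u \<longleftrightarrow> u \<in> S \<and> (\<forall>v\<in>S. f v \<le> f u)"

section \<open>Asymptotically optimal measure changes\<close>

definition theta ::
    "'a measure \<Rightarrow> (real \<Rightarrow> 'a \<Rightarrow> real) \<Rightarrow> real \<Rightarrow> (real \<Rightarrow> real \<Rightarrow> real measure \<Rightarrow> real) \<Rightarrow> real
      \<Rightarrow> real \<Rightarrow> ((real \<Rightarrow> real) \<Rightarrow> real) \<Rightarrow> ('c \<Rightarrow> real \<Rightarrow> real measure) \<Rightarrow> 'c \<Rightarrow> real \<Rightarrow> real" where
  "theta P W T b \<sigma> x0 G \<mu> \<omega>' \<epsilon> = enn2real (copy_cond_exp P
     (\<lambda>(\<omega>, \<omega>''). eexp (log_Gbar T b \<sigma> x0 G (\<mu> \<omega>'') (scaled_path W T \<epsilon> \<omega>) / ereal \<epsilon>)) \<omega>')"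

text \<open>A family of estimators is a pair \<open>(Q, Z)\<close>: for each \<open>\<epsilon>\<close> a random variable \<open>Z \<epsilon>\<close> on the
  measurable space of \<open>P\<close> together with the probability measure \<open>Q \<epsilon>\<close> under which it is sampled
  and under which its moments are taken. The infimum defining optimality runs over all such pairs,
  so that importance sampling families are among the competitors. The copy-space point is fixed
  throughout, so all moments are conditional ones.\<close>

definition asymp_rel_unbiased ::
    "'a measure \<Rightarrow> (real \<Rightarrow> real) \<Rightarrow> (real \<Rightarrow> 'a measure) \<Rightarrow> (real \<Rightarrow> 'a \<Rightarrow> real) \<Rightarrow> bool" where
  "asymp_rel_unbiased P \<theta> Q Z \<longleftrightarrow>
     (\<forall>\<epsilon>>0. prob_space (Q \<epsilon>) \<and> sets (Q \<epsilon>) = sets P \<and> integrable (Q \<epsilon>) (Z \<epsilon>))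
     \<and> ((\<lambda>\<epsilon>. ((LINT \<omega>|Q \<epsilon>. Z \<epsilon> \<omega>) - \<theta> \<epsilon>) / \<theta> \<epsilon>) \<longlongrightarrow> 0) (at_right 0)"

definition second_moment_rate :: "(real \<Rightarrow> 'a measure) \<Rightarrow> (real \<Rightarrow> 'a \<Rightarrow> real) \<Rightarrow> ereal" where
  "second_moment_rate Q Z = log_rate (\<lambda>\<epsilon>. \<integral>\<^sup>+\<omega>. ennreal ((Z \<epsilon> \<omega>)\<^sup>2) \<partial>Q \<epsilon>)"

definition asymp_optimal ::
    "'a measure \<Rightarrow> (real \<Rightarrow> real) \<Rightarrow> (real \<Rightarrow> 'a measure) \<Rightarrow> (real \<Rightarrow> 'a \<Rightarrow> real) \<Rightarrow> bool" where
  "asymp_optimal P \<theta> Q Z \<longleftrightarrow> asymp_rel_unbiased P \<theta> Q Z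
     \<and> second_moment_rate Q Z =
         (INF (Q', Z')\<in>{(Q', Z'). asymp_rel_unbiased P \<theta> Q' Z'}. second_moment_rate Q' Z')"

definition girsanov_density ::
    "'a measure \<Rightarrow> (real \<Rightarrow> 'a \<Rightarrow> real) \<Rightarrow> real \<Rightarrow> (real \<Rightarrow> real) \<Rightarrow> real \<Rightarrow> 'a \<Rightarrow> real" where
  "girsanov_density P W T h \<epsilon> \<omega> =
     exp (1 / sqrt \<epsilon> * wiener_integral P W T (cm_deriv T h) \<omega> - 1 / (2 * \<epsilon>) * cm_inner T h h)"

definition changed_measure ::
    "'a measure \<Rightarrow> (real \<Rightarrow> 'a \<Rightarrow> real) \<Rightarrow> real \<Rightarrow> (real \<Rightarrow> real) \<Rightarrow> real \<Rightarrow> 'a measure" where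
  "changed_measure P W T h \<epsilon> = density P (\<lambda>\<omega>. ennreal (girsanov_density P W T h \<epsilon> \<omega>))"

definition importance_estimator ::
    "'a measure \<Rightarrow> (real \<Rightarrow> 'a \<Rightarrow> real) \<Rightarrow> real \<Rightarrow> (real \<Rightarrow> real \<Rightarrow> real measure \<Rightarrow> real) \<Rightarrow> real
      \<Rightarrow> real \<Rightarrow> ((real \<Rightarrow> real) \<Rightarrow> real) \<Rightarrow> (real \<Rightarrow> real measure) \<Rightarrow> (real \<Rightarrow> real)
      \<Rightarrow> real \<Rightarrow> 'a \<Rightarrow> real" where
  "importance_estimator P W T b \<sigma> x0 G \<mu> h \<epsilon> \<omega> =
     enn2real (eexp (log_Gbar T b \<sigma> x0 G \<mu> (scaled_path W T \<epsilon> \<omega>) / ereal \<epsilon>))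
       * (1 / girsanov_density P W T h \<epsilon> \<omega>)"

definition optimal_measure_change ::
    "'a measure \<Rightarrow> (real \<Rightarrow> 'a \<Rightarrow> real) \<Rightarrow> real \<Rightarrow> (real \<Rightarrow> real \<Rightarrow> real measure \<Rightarrow> real) \<Rightarrow> real
      \<Rightarrow> real \<Rightarrow> ((real \<Rightarrow> real) \<Rightarrow> real) \<Rightarrow> ('c \<Rightarrow> real \<Rightarrow> real measure) \<Rightarrow> 'c
      \<Rightarrow> (real \<Rightarrow> real) \<Rightarrow> bool" where
  "optimal_measure_change P W T b \<sigma> x0 G \<mu> \<omega>' h \<longleftrightarrow>
     asymp_optimal P (theta P W T b \<sigma> x0 G \<mu> \<omega>')
       (changed_measure P W T h) (importance_estimator P W T b \<sigma> x0 G (\<mu> \<omega>') h)"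

end

theory Submission
  imports Defs "HOL-Complex_Analysis.Great_Picard" "HOL-Real_Asymp.Real_Asymp"
begin

text \<open>One-sided comparison makes the solution \<open>X w\<close> of the decoupled equation a Lipschitz function of
  the driving path \<open>w\<close>, of linear growth. Hence \<open>g = G \<circ> X\<close> is continuous on Wiener space and
  \<open>log g\<close> grows subquadratically, and everything follows from a Laplace principle for such \<open>g\<close> and
  arbitrary \<open>h\<close> in the Cameron--Martin space: the logarithm of the expectation of
  \<open>g (sqrt \<epsilon> * W) powr (1 / \<epsilon>) * exp (- I h / sqrt \<epsilon>)\<close>, \<open>I h\<close> being the Wiener integral, multiplied by \<open>\<epsilon>\<close>
  tends to the supremum of \<open>ln (g u) - \<langle>h, u\<rangle> - \<langle>u, u\<rangle> / 2\<close>.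

  For the lower bound one tilts by the Girsanov density of a piecewise linear \<open>u\<close>. The tilted moment
  generating functions of Wiener integrals are explicit, and dyadic chaining turns the resulting
  increment bounds into uniform closeness of \<open>sqrt \<epsilon> * W\<close> to \<open>u\<close>. For the upper bound
  \<open>sqrt \<epsilon> * W\<close> is replaced by its dyadic interpolation, whose energy is a chi-square variable, and \<open>I h\<close> by
  the integral of the dyadic averages of the derivative of \<open>h\<close>, which is the inner product of \<open>h\<close> with
  the interpolation. Both errors are negligible on the exponential scale, and paths of bounded energy
  form a compact set.

  The functional minimized in (ii) is a supremum of quadratic functionals with the same leading part,
  hence strongly convex. The maximizer in (iii) exists by compactness, is optimal because
  \<open>(E Z)\<^sup>2 \<le> E Z\<^sup>2\<close> for every competitor \<open>Z\<close>, and is unique because the Laplace principle at \<open>h\<close>, tested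
  with another maximizer \<open>k\<close>, gives \<open>\<langle>h - k, h - k\<rangle> \<le> 0\<close>.\<close>

section \<open>Square-integrable functions\<close>

text \<open>No large deviation principle for Brownian motion and no weak topology is invoked. The
  dyadic energies \<open>sqnorm (lborel_upto T) (pdiff T (2^k) w)\<close> take their place: they
  increase with k, involve finitely many values of w, and are bounded exactly for Cameron--Martin
  paths. Pythagoras turns their convergence into convergence of densities, and bounds on them pass
  to pointwise limits. The obstacle in the upper bound is that the weight is unbounded, through g
  and through the Wiener integral. On the exceptional event only its second moment is available, of
  some finite order exp (M / \<epsilon>), so the rate of that event has to be chosen after M. This
  is possible because the interpolation error and the error of the Wiener integral have rates that
  grow without bound as the mesh is refined; the mesh is fixed before \<epsilon> tends to 0, and
  prefactors depending on it are absorbed. The second moment of the estimator contains the square of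
  g. The class of functionals is therefore closed under powers, and the asymptotics are used for g
  with h = 0 and for its square with general h.\<close>

definition square_integrable :: "'a measure \<Rightarrow> ('a \<Rightarrow> real) \<Rightarrow> bool" where
  "square_integrable M f \<longleftrightarrow> f \<in> borel_measurable M \<and> integrable M (\<lambda>x. (f x)\<^sup>2)"

definition sqnorm :: "'a measure \<Rightarrow> ('a \<Rightarrow> real) \<Rightarrow> real" where
  "sqnorm M f = (LINT x|M. (f x)\<^sup>2)"

lemma square_integrable_integrable_square:
  "square_integrable M f \<Longrightarrow> integrable M (\<lambda>x. (f x)\<^sup>2)"
  by (simp add: square_integrable_def)

lemma sqnorm_nonneg: "0 \<le> sqnorm M f"
  unfolding sqnorm_def by simp

lemma square_integrable_mult:
  assumes f: "square_integrable M f" and g: "square_integrable M g"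
  shows "integrable M (\<lambda>x. f x * g x)"
proof (rule Bochner_Integration.integrable_bound)
  show "integrable M (\<lambda>x. (f x)\<^sup>2 + (g x)\<^sup>2)"
    using f g by (auto simp: square_integrable_def)
  show "(\<lambda>x. f x * g x) \<in> borel_measurable M"
    using f g by (auto simp: square_integrable_def)
  have "\<bar>a * c\<bar> \<le> a\<^sup>2 + c\<^sup>2" for a c :: real
  proof -
    have "0 \<le> (\<bar>a\<bar> - \<bar>c\<bar>)\<^sup>2" by simp
    then have "2 * (\<bar>a\<bar> * \<bar>c\<bar>) \<le> a\<^sup>2 + c\<^sup>2" by (simp add: power2_diff)
    moreover have "0 \<le> \<bar>a\<bar> * \<bar>c\<bar>" by simp
    ultimately show ?thesis unfolding abs_mult by linarith
  qed
  then show "AE x in M. norm (f x * g x) \<le> norm ((f x)\<^sup>2 + (g x)\<^sup>2)" by simp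
qed

lemma square_integrable_cmult: "square_integrable M f \<Longrightarrow> square_integrable M (\<lambda>x. c * f x)"
  by (auto simp: square_integrable_def power_mult_distrib)

lemma square_integrable_add:
  assumes f: "square_integrable M f" and g: "square_integrable M g"
  shows "square_integrable M (\<lambda>x. f x + g x)"
proof -
  have "integrable M (\<lambda>x. (f x)\<^sup>2 + (g x)\<^sup>2 + 2 * (f x * g x))"
    using f g square_integrable_mult[OF f g] by (auto simp: square_integrable_def)
  moreover have "(f x)\<^sup>2 + (g x)\<^sup>2 + 2 * (f x * g x) = (f x + g x)\<^sup>2" for x
    by (simp add: power2_sum)
  ultimately show ?thesis
    using f g by (auto simp: square_integrable_def)
qed

lemma square_integrable_diff:
  assumes f: "square_integrable M f" and g: "square_integrable M g"
  shows "square_integrable M (\<lambda>x. f x - g x)"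
  using square_integrable_add[OF f square_integrable_cmult[OF g, of "-1"]] by simp

lemma square_integrable_zero: "square_integrable M (\<lambda>x. 0)"
  by (simp add: square_integrable_def)

lemma square_integrable_sum:
  "(\<And>i. i \<in> I \<Longrightarrow> square_integrable M (f i)) \<Longrightarrow> square_integrable M (\<lambda>x. \<Sum>i\<in>I. f i x)"
  by (induction I rule: infinite_finite_induct)
     (auto intro: square_integrable_add square_integrable_zero)

lemma sqnorm_cmult: "sqnorm M (\<lambda>x. c * f x) = c\<^sup>2 * sqnorm M f"
  by (simp add: sqnorm_def power_mult_distrib)

lemma sqnorm_add:
  assumes f: "square_integrable M f" and g: "square_integrable M g"
  shows "sqnorm M (\<lambda>x. f x + g x) = sqnorm M f + 2 * (LINT x|M. f x * g x) + sqnorm M g"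
proof -
  have "sqnorm M (\<lambda>x. f x + g x) = (LINT x|M. ((f x)\<^sup>2 + 2 * (f x * g x)) + (g x)\<^sup>2)"
    unfolding sqnorm_def by (rule Bochner_Integration.integral_cong) (auto simp: power2_sum)
  also have "\<dots> = (LINT x|M. (f x)\<^sup>2 + 2 * (f x * g x)) + sqnorm M g"
    unfolding sqnorm_def
    using square_integrable_mult[OF f g] f g by (intro Bochner_Integration.integral_add) (auto simp: square_integrable_def)
  also have "(LINT x|M. (f x)\<^sup>2 + 2 * (f x * g x)) = sqnorm M f + (LINT x|M. 2 * (f x * g x))"
    unfolding sqnorm_def
    using square_integrable_mult[OF f g] f g by (intro Bochner_Integration.integral_add) (auto simp: square_integrable_def)
  finally show ?thesis by simp
qed

lemma sqnorm_diff:
  assumes f: "square_integrable M f" and g: "square_integrable M g"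
  shows "sqnorm M (\<lambda>x. f x - g x) = sqnorm M f - 2 * (LINT x|M. f x * g x) + sqnorm M g"
  using sqnorm_add[OF f square_integrable_cmult[OF g, of "-1"]] sqnorm_cmult[of M "-1" g] by simp

lemma sqnorm_diff_commute: "sqnorm M (\<lambda>x. f x - g x) = sqnorm M (\<lambda>x. g x - f x)"
  by (simp add: sqnorm_def power2_commute)

lemma sqnorm_add_le:
  assumes f: "square_integrable M f" and g: "square_integrable M g"
  shows "sqnorm M (\<lambda>x. f x + g x) \<le> 2 * sqnorm M f + 2 * sqnorm M g"
  using sqnorm_add[OF f g] sqnorm_diff[OF f g] sqnorm_nonneg[of M "\<lambda>x. f x - g x"] by linarith

text \<open>The squared norm of f - t * g is a nonnegative quadratic in t; its value at the vertex t
  = B / C gives the inequality.\<close>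

lemma square_integrable_Cauchy_Schwarz:
  assumes f: "square_integrable M f" and g: "square_integrable M g"
  shows "\<bar>LINT x|M. f x * g x\<bar> \<le> sqrt (sqnorm M f) * sqrt (sqnorm M g)"
proof -
  define A B C where "A = sqnorm M f" and "B = (LINT x|M. f x * g x)" and "C = sqnorm M g"
  have q: "0 \<le> A - 2 * t * B + t\<^sup>2 * C" for t
    using sqnorm_diff[OF f square_integrable_cmult[OF g, of t]] sqnorm_nonneg[of M "\<lambda>x. f x - t * g x"]
    by (simp add: A_def B_def C_def sqnorm_cmult mult.left_commute[of _ t] mult.assoc)
  have "B\<^sup>2 \<le> A * C"
  proof (cases "C = 0")
    case True
    have "B = 0"
    proof (rule ccontr)
      assume "B \<noteq> 0"
      \<comment> \<open>For C = 0 the quadratic is affine in t, and at this t it equals -1.\<close>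
      with q[of "(A + 1) / (2 * B)"] True show False by (simp add: field_simps)
    qed
    with True show ?thesis by simp
  next
    case False
    then have C: "C > 0" using sqnorm_nonneg[of M g] by (simp add: C_def)
    have "0 \<le> A - 2 * (B / C) * B + (B / C)\<^sup>2 * C" by (rule q)
    also have "\<dots> = A - B\<^sup>2 / C" using C by (simp add: power2_eq_square field_simps)
    finally show ?thesis using C by (simp add: field_simps)
  qed
  then have "\<bar>B\<bar> \<le> sqrt (A * C)" by (rule real_le_rsqrt[of "\<bar>B\<bar>", unfolded power2_abs])
  then show ?thesis by (simp add: real_sqrt_mult A_def B_def C_def)
qed

lemma sqnorm_tendsto_inner:
  assumes f: "\<And>n. square_integrable M (f n)" and f0: "square_integrable M f0"
    and g: "square_integrable M g"
    and lim: "(\<lambda>n. sqnorm M (\<lambda>x. f n x - f0 x)) \<longlonglongrightarrow> 0"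
  shows "(\<lambda>n. LINT x|M. f n x * g x) \<longlonglongrightarrow> (LINT x|M. f0 x * g x)"
proof -
  have "(\<lambda>n. (LINT x|M. f n x * g x) - (LINT x|M. f0 x * g x)) \<longlonglongrightarrow> 0"
  proof (rule tendsto_rabs_zero_cancel, rule tendsto_sandwich[where f="\<lambda>_. 0"])
    show "(\<lambda>n. sqrt (sqnorm M (\<lambda>x. f n x - f0 x)) * sqrt (sqnorm M g)) \<longlonglongrightarrow> 0"
      using tendsto_mult_left_zero[OF tendsto_real_sqrt[OF lim, simplified]] by blast
    show "\<forall>\<^sub>F n in sequentially. \<bar>(LINT x|M. f n x * g x) - (LINT x|M. f0 x * g x)\<bar>
        \<le> sqrt (sqnorm M (\<lambda>x. f n x - f0 x)) * sqrt (sqnorm M g)"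
    proof (rule always_eventually, rule allI)
      fix n
      have "(LINT x|M. f n x * g x) - (LINT x|M. f0 x * g x) = (LINT x|M. (f n x - f0 x) * g x)"
        using square_integrable_mult[OF f[of n] g] square_integrable_mult[OF f0 g]
        by (simp add: left_diff_distrib)
      then show "\<bar>(LINT x|M. f n x * g x) - (LINT x|M. f0 x * g x)\<bar>
        \<le> sqrt (sqnorm M (\<lambda>x. f n x - f0 x)) * sqrt (sqnorm M g)"
        using square_integrable_Cauchy_Schwarz[OF square_integrable_diff[OF f[of n] f0] g] by simp
    qed
  qed auto
  then show ?thesis by (simp add: LIM_zero_cancel)
qed

lemma sqnorm_tendsto:
  assumes f: "\<And>n. square_integrable M (f n)" and f0: "square_integrable M f0"
    and lim: "(\<lambda>n. sqnorm M (\<lambda>x. f n x - f0 x)) \<longlonglongrightarrow> 0"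
  shows "(\<lambda>n. sqnorm M (f n)) \<longlonglongrightarrow> sqnorm M f0"
proof -
  have "(\<lambda>n. sqnorm M (\<lambda>x. f n x - f0 x) + 2 * (LINT x|M. f n x * f0 x) - sqnorm M f0)
      \<longlonglongrightarrow> 0 + 2 * (LINT x|M. f0 x * f0 x) - sqnorm M f0"
    by (intro tendsto_intros lim sqnorm_tendsto_inner[OF f f0 f0 lim])
  moreover have "sqnorm M (\<lambda>x. f n x - f0 x) + 2 * (LINT x|M. f n x * f0 x) - sqnorm M f0 = sqnorm M (f n)" for n
    using sqnorm_diff[OF f[of n] f0] by simp
  moreover have "(LINT x|M. f0 x * f0 x) = sqnorm M f0" by (simp add: sqnorm_def power2_eq_square)
  ultimately show ?thesis by simp
qed

lemma nn_integral_square: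
  assumes "square_integrable M f"
  shows "(\<integral>\<^sup>+x. ennreal ((f x)\<^sup>2) \<partial>M) = ennreal (sqnorm M f)"
  unfolding sqnorm_def using assms
  by (intro nn_integral_eq_integral) (auto simp: square_integrable_def)

lemma square_integrableI_nn:
  assumes "f \<in> borel_measurable M" "(\<integral>\<^sup>+x. ennreal ((f x)\<^sup>2) \<partial>M) < \<infinity>"
  shows "square_integrable M f"
  unfolding square_integrable_def using assms
  by (auto intro!: integrableI_bounded)

text \<open>A rapidly Cauchy subsequence converges almost everywhere because a weighted series of
  its squared increments is integrable; Fatou's lemma then turns the pointwise limit into a limit in
  the norm.\<close>

theorem Riesz_Fischer:
  assumes f: "\<And>n. square_integrable M (f n)"
    and cauchy: "\<And>e. e > 0 \<Longrightarrow> \<exists>N. \<forall>m\<ge>N. \<forall>n\<ge>N. sqnorm M (\<lambda>x. f m x - f n x) < e"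
  obtains f0 where "square_integrable M f0" "(\<lambda>n. sqnorm M (\<lambda>x. f n x - f0 x)) \<longlonglongrightarrow> 0"
proof -
  have meas[measurable]: "f n \<in> borel_measurable M" for n
    using f[of n] by (simp add: square_integrable_def)
  have "\<exists>N. \<forall>k. \<forall>m\<ge>N k. \<forall>n\<ge>N k. sqnorm M (\<lambda>x. f m x - f n x) < (1/4)^k"
    by (intro choice allI cauchy) simp
  then obtain N where N: "\<And>k m n. m \<ge> N k \<Longrightarrow> n \<ge> N k \<Longrightarrow> sqnorm M (\<lambda>x. f m x - f n x) < (1/4)^k"
    by blast
  \<comment> \<open>The partial sums make the indices strictly increasing and at least
    \<open>N k\<close>.\<close>
  define r where "r = (\<lambda>k. (\<Sum>j\<le>k. N j) + k)"
  have rN: "r k \<ge> N k" for k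
    unfolding r_def using member_le_sum[of k "{..k}" N] by auto
  have rmono: "strict_mono r"
    by (rule strict_monoI_Suc) (simp add: r_def)
  have rN': "r (Suc k) \<ge> N k" for k
    using rN[of k] strict_monoD[OF rmono, of k "Suc k"] by linarith
  \<comment> \<open>With the weight 2^k the integrals of \<open>2^k * (d k x)\<^sup>2\<close> are
    still summable, with bound (1/2)^k, while the inequality of arithmetic and geometric means
    bounds |d k x| by (1/2)^k plus the weighted square.\<close>
  define d where "d = (\<lambda>k x. f (r (Suc k)) x - f (r k) x)"
  have dmeas[measurable]: "d k \<in> borel_measurable M" for k unfolding d_def by measurable
  have dsq: "square_integrable M (d k)" for k
    unfolding d_def by (intro square_integrable_diff f)
  have dnorm: "sqnorm M (d k) < (1/4)^k" for k
    unfolding d_def by (rule N[OF rN' rN])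
  have "(\<integral>\<^sup>+x. (\<Sum>k. ennreal (2^k * (d k x)\<^sup>2)) \<partial>M) = (\<Sum>k. \<integral>\<^sup>+x. ennreal (2^k * (d k x)\<^sup>2) \<partial>M)"
    by (rule nn_integral_suminf) measurable
  also have "\<dots> \<le> (\<Sum>k. ennreal ((1/2)^k))"
  proof (rule suminf_le)
    fix k
    have "(\<integral>\<^sup>+x. ennreal (2^k * (d k x)\<^sup>2) \<partial>M) = ennreal (LINT x|M. 2^k * (d k x)\<^sup>2)"
      using square_integrable_integrable_square[OF dsq[of k]]
      by (intro nn_integral_eq_integral) auto
    also have "(LINT x|M. 2^k * (d k x)\<^sup>2) = 2^k * sqnorm M (d k)"
      unfolding sqnorm_def by simp
    also have "ennreal (2^k * sqnorm M (d k)) \<le> ennreal (2^k * (1/4)^k)"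
      using dnorm[of k] by (intro ennreal_leI mult_left_mono) auto
    also have "2^k * (1/4)^k = ((1/2)^k :: real)"
      by (simp add: power_mult_distrib[symmetric])
    finally show "(\<integral>\<^sup>+x. ennreal (2^k * (d k x)\<^sup>2) \<partial>M) \<le> ennreal ((1/2)^k)" .
  qed auto
  also have "\<dots> = ennreal (\<Sum>k. (1/2)^k)"
    by (rule suminf_ennreal2) (auto intro!: summable_geometric)
  also have "\<dots> < \<infinity>" by simp
  finally have fin: "(\<integral>\<^sup>+x. (\<Sum>k. ennreal (2^k * (d k x)\<^sup>2)) \<partial>M) < \<infinity>" .
  have AEfin: "AE x in M. (\<Sum>k. ennreal (2^k * (d k x)\<^sup>2)) \<noteq> \<infinity>"
    by (rule nn_integral_noteq_infinite) (use fin in auto)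
  define f0 where "f0 = (\<lambda>x. lim (\<lambda>k. f (r k) x))"
  have f0_meas[measurable]: "f0 \<in> borel_measurable M" unfolding f0_def by measurable
  have AElim: "AE x in M. (\<lambda>k. f (r k) x) \<longlonglongrightarrow> f0 x"
    using AEfin
  proof eventually_elim
    case (elim x)
    have "summable (\<lambda>k. 2^k * (d k x)\<^sup>2)"
      by (rule summable_suminf_not_top) (use elim in auto)
    then have "summable (\<lambda>k. (1/2)^k + 2^k * (d k x)\<^sup>2)"
      by (intro summable_add summable_geometric) auto
    then have "summable (\<lambda>k. \<bar>d k x\<bar>)"
    proof (rule summable_comparison_test')
      fix k :: nat assume "k \<ge> 0"
      have "(2::real)^k * (1/2)^k = 1" by (simp add: power_mult_distrib[symmetric])
      then have h: "(2::real)^k * ((1/2)^k)\<^sup>2 = (1/2)^k" "2^k * ((1/2)^k * \<bar>d k x\<bar>) = \<bar>d k x\<bar>"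
        by (simp_all add: power2_eq_square flip: mult.assoc)
      have "0 \<le> 2^k * ((1/2)^k - \<bar>d k x\<bar>)\<^sup>2" by simp
      also have "\<dots> = 2^k * ((1/2)^k)\<^sup>2 - 2 * (2^k * ((1/2)^k * \<bar>d k x\<bar>)) + 2^k * (d k x)\<^sup>2"
        by (simp only: power2_diff power2_abs) algebra
      also have "\<dots> = (1/2)^k - 2 * \<bar>d k x\<bar> + 2^k * (d k x)\<^sup>2"
        by (simp only: h)
      finally show "norm \<bar>d k x\<bar> \<le> (1/2)^k + 2^k * (d k x)\<^sup>2"
        using abs_ge_zero[of "d k x"] by simp
    qed
    then have "summable (\<lambda>k. d k x)" by (rule summable_rabs_cancel)
    then have "convergent (\<lambda>n. \<Sum>k<n. d k x)" by (simp add: summable_iff_convergent)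
    moreover have "(\<Sum>k<n. d k x) = f (r n) x - f (r 0) x" for n
      unfolding d_def by (rule sum_lessThan_telescope)
    ultimately have "convergent (\<lambda>n. f (r n) x - f (r 0) x)" by simp
    then have "convergent (\<lambda>n. (f (r n) x - f (r 0) x) + f (r 0) x)"
      by (intro convergent_add convergent_const)
    then show ?case by (simp add: f0_def convergent_LIMSEQ_iff)
  qed
  \<comment> \<open>Fatou along the subsequence: the distance to the limit is at most the liminf of
    the distances to its members.\<close>
  have bound: "(\<integral>\<^sup>+x. ennreal ((f n x - f0 x)\<^sup>2) \<partial>M) \<le> ennreal ((1/4)^k)" if n: "n \<ge> N k" for n k
  proof -
    have "(\<integral>\<^sup>+x. ennreal ((f n x - f0 x)\<^sup>2) \<partial>M) = (\<integral>\<^sup>+x. liminf (\<lambda>j. ennreal ((f n x - f (r j) x)\<^sup>2)) \<partial>M)"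
    proof (rule nn_integral_cong_AE)
      show "AE x in M. ennreal ((f n x - f0 x)\<^sup>2) = liminf (\<lambda>j. ennreal ((f n x - f (r j) x)\<^sup>2))"
        using AElim
      proof eventually_elim
        case (elim x)
        have "(\<lambda>j. ennreal ((f n x - f (r j) x)\<^sup>2)) \<longlonglongrightarrow> ennreal ((f n x - f0 x)\<^sup>2)"
          by (intro tendsto_intros elim)
        then show ?case using lim_imp_Liminf[OF sequentially_bot] by metis
      qed
    qed
    also have "\<dots> \<le> liminf (\<lambda>j. \<integral>\<^sup>+x. ennreal ((f n x - f (r j) x)\<^sup>2) \<partial>M)"
      by (rule nn_integral_liminf) measurable
    also have "\<dots> \<le> liminf (\<lambda>j. ennreal ((1/4)^k))"
    proof (rule Liminf_mono)
      show "\<forall>\<^sub>F j in sequentially. (\<integral>\<^sup>+x. ennreal ((f n x - f (r j) x)\<^sup>2) \<partial>M) \<le> ennreal ((1/4)^k)"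
        using eventually_ge_at_top[of "N k"]
      proof eventually_elim
        case (elim j)
        have "r j \<ge> N k" using seq_suble[OF rmono, of j] elim by linarith
        then have "sqnorm M (\<lambda>x. f n x - f (r j) x) \<le> (1/4)^k" using N[OF n] less_imp_le by blast
        then show ?case
          by (subst nn_integral_square) (auto intro!: square_integrable_diff f ennreal_leI)
      qed
    qed
    also have "\<dots> = ennreal ((1/4)^k)" by (simp add: Liminf_const)
    finally show ?thesis .
  qed
  have diff: "square_integrable M (\<lambda>x. f (N 0) x - f0 x)"
    by (rule square_integrableI_nn) (use bound[of 0 "N 0"] in \<open>auto intro: le_less_trans\<close>)
  have f0: "square_integrable M f0"
    using square_integrable_diff[OF f[of "N 0"] diff] by simp
  have bound': "sqnorm M (\<lambda>x. f n x - f0 x) \<le> (1/4)^k" if "n \<ge> N k" for n k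
    using bound[OF that] nn_integral_square[OF square_integrable_diff[OF f[of n] f0]]
    by (simp add: ennreal_le_iff del: ennreal_power)
  have "(\<lambda>n. sqnorm M (\<lambda>x. f n x - f0 x)) \<longlonglongrightarrow> 0"
  proof (rule LIMSEQ_I)
    fix e :: real assume "e > 0"
    then obtain k where k: "(1/4)^k < e" using real_arch_pow_inv[of e "1/4"] by auto
    show "\<exists>no. \<forall>n\<ge>no. norm (sqnorm M (\<lambda>x. f n x - f0 x) - 0) < e"
      using bound'[of k] k sqnorm_nonneg[of M] by (intro exI[of _ "N k"]) (auto intro: le_less_trans)
  qed
  with f0 show ?thesis using that by blast
qed

section \<open>The Cameron--Martin space\<close>

text \<open>Set integrals over {0..T} become integrals over a finite measure space, to which the
  general facts on \<open>sqnorm\<close> apply.\<close>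

abbreviation lborel_upto :: "real \<Rightarrow> real measure" where
  "lborel_upto T \<equiv> restrict_space lborel {0..T}"

text \<open>The integral up to t is written as the inner product of f with an indicator over the
  whole of {0..T}, so that Cauchy-Schwarz and convergence in the norm apply to it directly.\<close>

definition primitive :: "real \<Rightarrow> (real \<Rightarrow> real) \<Rightarrow> real \<Rightarrow> real" where
  "primitive T f t = (LINT s|lborel_upto T. f s * indicator {0..t} s)"

lemma finite_measure_lborel_upto: "finite_measure (lborel_upto T)"
  by (rule finite_measureI) (simp add: emeasure_restrict_space space_restrict_space emeasure_lborel_Icc_eq)

lemma square_integrable_indicator:
  assumes "A \<in> sets borel"
  shows "square_integrable (lborel_upto T) (indicator A)"
proof -
  interpret finite_measure "lborel_upto T" by (rule finite_measure_lborel_upto)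
  have A: "indicator A \<in> borel_measurable (lborel_upto T)"
    by (rule measurable_restrict_space1) (use assms in simp)
  moreover have "integrable (lborel_upto T) (indicator A :: real \<Rightarrow> real)"
    by (rule integrable_const_bound[where B=1]) (use A in \<open>auto simp: indicator_def\<close>)
  moreover have "(\<lambda>x. (indicator A x :: real)\<^sup>2) = indicator A"
    by (auto simp: indicator_def fun_eq_iff)
  ultimately show ?thesis by (simp add: square_integrable_def)
qed

lemma square_integrable_integrable:
  assumes "square_integrable (lborel_upto T) f"
  shows "integrable (lborel_upto T) f"
  using square_integrable_mult[OF assms square_integrable_indicator[of UNIV]] by simp

lemma square_integrable_integrable_indicator:
  assumes "square_integrable (lborel_upto T) f" "A \<in> sets borel"
  shows "integrable (lborel_upto T) (\<lambda>x. f x * indicator A x)"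
  using square_integrable_mult[OF assms(1) square_integrable_indicator[OF assms(2)]] by simp

lemma set_integral_eq_primitive:
  assumes "t \<le> T"
  shows "(LINT s:{0..t}|lborel. f s) = primitive T f t"
proof -
  have "primitive T f t = (LINT s|lborel. indicator {0..T} s *\<^sub>R (f s * indicator {0..t} s))"
    unfolding primitive_def by (subst integral_restrict_space) auto
  also have "\<dots> = (LINT s|lborel. indicator {0..t} s *\<^sub>R f s)"
    using assms by (intro Bochner_Integration.integral_cong) (auto simp: indicator_def)
  finally show ?thesis by (simp add: set_lebesgue_integral_def)
qed

lemma cm_density_iff:
  "cm_density T h g \<longleftrightarrow> square_integrable (lborel_upto T) g \<and> (\<forall>t\<in>{0..T}. h t = primitive T g t)"
proof -
  have "set_borel_measurable lborel {0..T} g \<longleftrightarrow> g \<in> borel_measurable (lborel_upto T)"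
    by (simp add: set_borel_measurable_def borel_measurable_restrict_space_iff)
  moreover have "set_integrable lborel {0..T} (\<lambda>s. (g s)\<^sup>2) \<longleftrightarrow> integrable (lborel_upto T) (\<lambda>s. (g s)\<^sup>2)"
    by (simp add: set_integrable_def integrable_restrict_space)
  ultimately show ?thesis
    by (auto simp: cm_density_def square_integrable_def set_integral_eq_primitive)
qed

lemma set_integral_eq_restrict:
  "(LINT t:{0..T}|lborel. f t) = (LINT t|lborel_upto T. f t)" for f :: "real \<Rightarrow> real"
  by (simp add: set_lebesgue_integral_def integral_restrict_space)

text \<open>The difference d integrates to 0 over every {..t}. These sets are stable under
  intersection and generate the Borel sets, so by Dynkin's argument d integrates to 0 over every
  Borel set and vanishes almost everywhere.\<close>

lemma square_integrable_primitive_unique: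
  assumes f: "square_integrable (lborel_upto T) f" and g: "square_integrable (lborel_upto T) g"
    and eq: "\<And>t. t \<in> {0..T} \<Longrightarrow> primitive T f t = primitive T g t" and T: "T \<ge> 0"
  shows "AE x in lborel_upto T. f x = g x"
proof -
  let ?U = "lborel_upto T"
  define d where "d = (\<lambda>x. f x - g x)"
  have d: "square_integrable ?U d" unfolding d_def by (rule square_integrable_diff[OF f g])
  have int: "integrable ?U d" by (rule square_integrable_integrable[OF d])
  have sint: "set_integrable ?U A d" if "A \<in> sets borel" for A
    using square_integrable_integrable_indicator[OF d that]
    by (simp add: set_integrable_def mult.commute)
  have dt: "primitive T d t = 0" if "t \<in> {0..T}" for t
    using eq[OF that] square_integrable_integrable_indicator[OF f, of "{0..t}"]
      square_integrable_integrable_indicator[OF g, of "{0..t}"]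
    by (simp add: d_def primitive_def left_diff_distrib)
  have base: "(LINT x:{..t}|?U. d x) = 0" for t
  proof -
    have "(LINT x:{..t}|?U. d x) = (if t < 0 then 0 else primitive T d (min t T))"
    proof (cases "t < 0")
      case True
      have "(LINT x:{..t}|?U. d x) = (LINT x|?U. 0)"
        unfolding set_lebesgue_integral_def using True
        by (intro Bochner_Integration.integral_cong) (auto simp: indicator_def space_restrict_space)
      with True show ?thesis by simp
    next
      case False
      have "(LINT x:{..t}|?U. d x) = primitive T d (min t T)"
        unfolding set_lebesgue_integral_def primitive_def using False
        by (intro Bochner_Integration.integral_cong) (auto simp: indicator_def space_restrict_space)
      with False show ?thesis by simp
    qed
    then show ?thesis using dt[of "min t T"] T by auto
  qed
  have total: "(LINT x|?U. d x) = 0"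
  proof -
    have "(LINT x|?U. d x) = primitive T d T"
      unfolding primitive_def
      by (intro Bochner_Integration.integral_cong) (auto simp: indicator_def space_restrict_space)
    then show ?thesis using dt[of T] T by simp
  qed
  have all: "(LINT x:A|?U. d x) = 0" if "A \<in> sets borel" for A
  proof -
    have A: "A \<in> sigma_sets UNIV (range (\<lambda>a::real. {..a}))"
      using that by (simp add: borel_eq_atMost)
    show ?thesis
    proof (rule sigma_sets_induct_disjoint[OF _ _ A, where P="\<lambda>A. (LINT x:A|?U. d x) = 0"])
      show "Int_stable (range (\<lambda>a::real. {..a}))"
        by (auto simp: Int_stable_def)
      show "range (\<lambda>a::real. {..a}) \<subseteq> Pow UNIV" by simp
      show "(LINT x:A|?U. d x) = 0" if "A \<in> range (\<lambda>a::real. {..a})" for A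
        using that base by auto
      show "(LINT x:{}|?U. d x) = 0" by (simp add: set_lebesgue_integral_def)
      show "(LINT x:UNIV - A|?U. d x) = 0"
        if A: "A \<in> sigma_sets UNIV (range (\<lambda>a::real. {..a}))" and 0: "(LINT x:A|?U. d x) = 0" for A
      proof -
        have A': "A \<in> sets borel" using A by (simp add: borel_eq_atMost)
        have "(LINT x:UNIV - A|?U. d x) = (LINT x|?U. d x - indicator A x *\<^sub>R d x)"
          unfolding set_lebesgue_integral_def
          by (intro Bochner_Integration.integral_cong) (auto simp: indicator_def)
        also have "\<dots> = (LINT x|?U. d x) - (LINT x:A|?U. d x)"
          unfolding set_lebesgue_integral_def using int sint[OF A']
          by (intro Bochner_Integration.integral_diff) (auto simp: set_integrable_def)
        finally show ?thesis using total 0 by simp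
      qed
      show "(LINT x:(\<Union>i. A i)|?U. d x) = 0"
        if disj: "disjoint_family A"
          and A: "range A \<subseteq> sigma_sets UNIV (range (\<lambda>a::real. {..a}))"
          and 0: "\<And>i. (LINT x:A i|?U. d x) = 0" for A :: "nat \<Rightarrow> real set"
      proof -
        have A': "A i \<in> sets borel" for i using A by (auto simp: borel_eq_atMost)
        \<comment> \<open>Intersecting with {0..T} produces sets of the restricted space and leaves
          the integrands unchanged there.\<close>
        have ind: "indicator (\<Union>i. A i \<inter> {0..T}) x *\<^sub>R d x = indicator (\<Union>i. A i) x *\<^sub>R d x"
          "indicator (A i \<inter> {0..T}) x *\<^sub>R d x = indicator (A i) x *\<^sub>R d x" if "x \<in> space ?U" for x i
          using that by (auto simp: indicator_def space_restrict_space)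
        have "(LINT x:(\<Union>i. A i)|?U. d x) = (LINT x:(\<Union>i. A i \<inter> {0..T})|?U. d x)"
          unfolding set_lebesgue_integral_def
          by (intro Bochner_Integration.integral_cong) (simp_all only: ind refl)
        also have "\<dots> = (\<Sum>i. LINT x:(A i \<inter> {0..T})|?U. d x)"
        proof (rule lebesgue_integral_countable_add)
          show "A i \<inter> {0..T} \<in> sets ?U" for i
            using A'[of i] by (auto simp: sets_restrict_space)
          show "A i \<inter> {0..T} \<inter> (A j \<inter> {0..T}) = {}" if "i \<noteq> j" for i j
            using disj that by (auto simp: disjoint_family_on_def)
          show "set_integrable ?U (\<Union>i. A i \<inter> {0..T}) d"
            by (rule sint) (use A' in auto)
        qed
        also have "\<dots> = (\<Sum>i. LINT x:A i|?U. d x)"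
          unfolding set_lebesgue_integral_def
          by (intro suminf_cong Bochner_Integration.integral_cong) (simp_all only: ind refl)
        also have "\<dots> = 0" using 0 by simp
        finally show ?thesis .
      qed
    qed
  qed
  have "AE x in ?U. d x = 0"
  proof (rule sigma_finite_measure.density_zero[OF _ int])
    show "sigma_finite_measure ?U"
      by (rule finite_measure.axioms(1)[OF finite_measure_lborel_upto])
  next
    fix A assume "A \<in> sets ?U"
    then have "A \<in> sets borel" by (auto simp: sets_restrict_space)
    then show "(LINT x:A|?U. d x) = 0" by (rule all)
  qed
  then show ?thesis by (simp add: d_def)
qed

lemma primitive_diff:
  assumes f: "square_integrable (lborel_upto T) f" and "0 \<le> s" "s \<le> t"
  shows "primitive T f t - primitive T f s = (LINT r|lborel_upto T. f r * indicator {s<..t} r)"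
proof -
  have "primitive T f t - primitive T f s
      = (LINT r|lborel_upto T. f r * indicator {0..t} r - f r * indicator {0..s} r)"
    unfolding primitive_def using f
    by (intro Bochner_Integration.integral_diff[symmetric] square_integrable_integrable_indicator) auto
  also have "\<dots> = (LINT r|lborel_upto T. f r * indicator {s<..t} r)"
    using assms by (intro Bochner_Integration.integral_cong) (auto simp: indicator_def)
  finally show ?thesis .
qed

lemma sqnorm_indicator:
  assumes "0 \<le> s" "s \<le> t" "t \<le> T"
  shows "sqnorm (lborel_upto T) (indicator {s<..t}) = t - s"
proof -
  have "indicator {0..T} r *\<^sub>R (indicator {s<..t} r)\<^sup>2 = (indicator {s<..t} r :: real)" for r
    using assms by (auto simp: indicator_def)
  then have "sqnorm (lborel_upto T) (indicator {s<..t}) = (LINT r|lborel. indicator {s<..t} r)"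
    unfolding sqnorm_def by (subst integral_restrict_space) simp_all
  also have "\<dots> = t - s" using assms by simp
  finally show ?thesis .
qed

text \<open>Cauchy-Schwarz against the indicator of {s<..t}, whose norm is sqrt (t - s).\<close>

lemma primitive_Holder:
  assumes f: "square_integrable (lborel_upto T) f" and "0 \<le> s" "s \<le> t" "t \<le> T"
  shows "\<bar>primitive T f t - primitive T f s\<bar> \<le> sqrt (sqnorm (lborel_upto T) f) * sqrt (t - s)"
  using square_integrable_Cauchy_Schwarz[OF f square_integrable_indicator[of "{s<..t}"]]
  unfolding primitive_diff[OF assms(1-3)] by (simp add: sqnorm_indicator assms)

lemma primitive_0: "primitive T f 0 = 0"
proof -
  have "primitive T f 0 = (LINT s:{0..0}|lborel_upto T. f s)"
    by (simp add: primitive_def set_lebesgue_integral_def mult.commute)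
  also have "\<dots> = (LINT s|lborel. indicator {0} s * (indicator {0..T} s * f s))"
    unfolding set_lebesgue_integral_def
    by (subst integral_restrict_space) (auto simp: mult.left_commute)
  also have "\<dots> = 0"
    by (rule integral_eq_zero_AE) (use AE_lborel_singleton[of 0] in \<open>eventually_elim, auto\<close>)
  finally show ?thesis .
qed

lemma primitive_bound:
  assumes "square_integrable (lborel_upto T) f" "t \<in> {0..T}"
  shows "\<bar>primitive T f t\<bar> \<le> sqrt (sqnorm (lborel_upto T) f) * sqrt T"
proof -
  have "\<bar>primitive T f t\<bar> \<le> sqrt (sqnorm (lborel_upto T) f) * sqrt t"
    using primitive_Holder[OF assms(1), of 0 t] assms(2) by (simp add: primitive_0)
  also have "\<dots> \<le> sqrt (sqnorm (lborel_upto T) f) * sqrt T"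
    using assms sqnorm_nonneg by (intro mult_left_mono) auto
  finally show ?thesis .
qed

lemma primitive_continuous:
  assumes f: "square_integrable (lborel_upto T) f"
  shows "continuous_on {0..T} (primitive T f)"
proof -
  define C where "C = sqrt (sqnorm (lborel_upto T) f)"
  have C: "C \<ge> 0" by (simp add: C_def sqnorm_nonneg)
  have b: "\<bar>primitive T f t - primitive T f s\<bar> \<le> C * sqrt \<bar>t - s\<bar>" if "s \<in> {0..T}" "t \<in> {0..T}" for s t
    using primitive_Holder[OF f, of s t] primitive_Holder[OF f, of t s] that
    by (cases "s \<le> t") (auto simp: C_def abs_minus_commute)
  show ?thesis
    unfolding continuous_on_def
  proof
    fix s assume s: "s \<in> {0..T}"
    have "((\<lambda>t. primitive T f t - primitive T f s) \<longlongrightarrow> 0) (at s within {0..T})"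
    proof (rule tendsto_rabs_zero_cancel, rule tendsto_sandwich[where f="\<lambda>_. 0"])
      have "((\<lambda>t. C * sqrt \<bar>t - s\<bar>) \<longlongrightarrow> C * sqrt \<bar>s - s\<bar>) (at s within {0..T})"
        by (intro tendsto_intros)
      then show "((\<lambda>t. C * sqrt \<bar>t - s\<bar>) \<longlongrightarrow> 0) (at s within {0..T})" by simp
      show "\<forall>\<^sub>F t in at s within {0..T}. \<bar>primitive T f t - primitive T f s\<bar> \<le> C * sqrt \<bar>t - s\<bar>"
        using b[OF s] by (auto simp: eventually_at_filter)
    qed auto
    then show "(primitive T f \<longlongrightarrow> primitive T f s) (at s within {0..T})"
      by (simp add: LIM_zero_cancel)
  qed
qed

text \<open>Since {0..T} is compact, boundedness is automatic, and only continuity and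
  extensionality remain of the membership in the metric space.\<close>

lemma paths_from_iff:
  assumes "T \<ge> 0"
  shows "x \<in> paths_from T x0 \<longleftrightarrow> continuous_on {0..T} x \<and> x \<in> extensional {0..T} \<and> x 0 = x0"
proof -
  have "continuous_map (top_of_set {0..T}) (mtopology_of euclidean_metric) x \<longleftrightarrow> continuous_on {0..T} x"
    by (simp add: mtopology_of_euclidean)
  then show ?thesis
    unfolding paths_from_def by (subst compactin_mspace_cfunspace) auto
qed

section \<open>Paths with square-integrable densities and their inner product\<close>

definition cm_path :: "real \<Rightarrow> (real \<Rightarrow> real) \<Rightarrow> real \<Rightarrow> real" where
  "cm_path T g = restrict (primitive T g) {0..T}"

lemma cm_density_cm_path:
  "square_integrable (lborel_upto T) g \<Longrightarrow> cm_density T (cm_path T g) g"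
  by (simp add: cm_density_iff cm_path_def)

lemma cm_path_in_cm_space:
  assumes "square_integrable (lborel_upto T) g" "T \<ge> 0"
  shows "cm_path T g \<in> cm_space T"
proof -
  have "continuous_on {0..T} (cm_path T g)"
    by (rule continuous_on_eq[OF primitive_continuous[OF assms(1)]]) (simp add: cm_path_def)
  then have "cm_path T g \<in> wiener_space T"
    using assms(2) by (simp add: paths_from_iff) (simp add: cm_path_def primitive_0)
  then show ?thesis
    using cm_density_cm_path[OF assms(1)] by (auto simp: cm_space_def)
qed

lemma cm_density_cm_deriv: "h \<in> cm_space T \<Longrightarrow> cm_density T h (cm_deriv T h)"
  unfolding cm_space_def cm_deriv_def by (auto intro: someI[where P="cm_density T h"])

lemma square_integrable_cm_deriv:
  "h \<in> cm_space T \<Longrightarrow> square_integrable (lborel_upto T) (cm_deriv T h)"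
  using cm_density_cm_deriv by (auto simp: cm_density_iff)

lemma cm_space_primitive:
  "h \<in> cm_space T \<Longrightarrow> t \<in> {0..T} \<Longrightarrow> h t = primitive T (cm_deriv T h) t"
  using cm_density_cm_deriv by (auto simp: cm_density_iff)

lemma cm_space_wiener: "h \<in> cm_space T \<Longrightarrow> h \<in> wiener_space T"
  by (simp add: cm_space_def)

lemma cm_deriv_unique:
  assumes "cm_density T h g" "h \<in> cm_space T" "T \<ge> 0"
  shows "AE x in lborel_upto T. cm_deriv T h x = g x"
  using assms(1) cm_density_cm_deriv[OF assms(2)] assms(3)
  by (intro square_integrable_primitive_unique) (auto simp: cm_density_iff)

lemma cm_inner_eq: "cm_inner T h u = (LINT s|lborel_upto T. cm_deriv T h s * cm_deriv T u s)"
  by (simp add: cm_inner_def set_integral_eq_restrict)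

lemma cm_inner_self: "cm_inner T h h = sqnorm (lborel_upto T) (cm_deriv T h)"
  by (simp add: cm_inner_eq sqnorm_def power2_eq_square)

text \<open>\<open>cm_deriv\<close> is an unspecified version of the density; with this, inner
  products can be computed from any explicit version.\<close>

lemma cm_inner_density:
  assumes h: "h \<in> cm_space T" "cm_density T h f" and u: "u \<in> cm_space T" "cm_density T u g" and "T \<ge> 0"
  shows "cm_inner T h u = (LINT s|lborel_upto T. f s * g s)"
  unfolding cm_inner_eq
proof (rule integral_cong_AE)
  show "AE s in lborel_upto T. cm_deriv T h s * cm_deriv T u s = f s * g s"
    using cm_deriv_unique[OF h(2,1) \<open>T \<ge> 0\<close>] cm_deriv_unique[OF u(2,1) \<open>T \<ge> 0\<close>] by eventually_elim simp
  show "(\<lambda>s. cm_deriv T h s * cm_deriv T u s) \<in> borel_measurable (lborel_upto T)"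
    using square_integrable_cm_deriv[OF h(1)] square_integrable_cm_deriv[OF u(1)] 
    by (auto simp: square_integrable_def)
  show "(\<lambda>s. f s * g s) \<in> borel_measurable (lborel_upto T)"
    using h(2) u(2) by (auto simp: cm_density_iff square_integrable_def)
qed

lemma cm_inner_cm_path:
  assumes "square_integrable (lborel_upto T) f" "square_integrable (lborel_upto T) g" "T \<ge> 0"
  shows "cm_inner T (cm_path T f) (cm_path T g) = (LINT s|lborel_upto T. f s * g s)"
  using assms by (intro cm_inner_density cm_density_cm_path cm_path_in_cm_space)

lemma cm_path_cm_deriv:
  assumes "h \<in> cm_space T" "T \<ge> 0" shows "cm_path T (cm_deriv T h) = h"
proof -
  have "h \<in> extensional {0..T}" using assms cm_space_wiener[of h T] by (simp add: paths_from_iff)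
  then show ?thesis
    using cm_space_primitive[OF assms(1)] by (auto simp: cm_path_def fun_eq_iff extensional_def)
qed

text \<open>The distance of the densities dominates the uniform distance of the paths, and agreement
  on {0..T} is equality because paths are extensional.\<close>

lemma cm_eqI:
  assumes h: "h \<in> cm_space T" and k: "k \<in> cm_space T" and "T \<ge> 0"
    and 0: "sqnorm (lborel_upto T) (\<lambda>s. cm_deriv T h s - cm_deriv T k s) \<le> 0"
  shows "h = k"
proof -
  have d: "square_integrable (lborel_upto T) (\<lambda>s. cm_deriv T h s - cm_deriv T k s)"
    using h k by (intro square_integrable_diff square_integrable_cm_deriv)
  have "primitive T (cm_deriv T h) t = primitive T (cm_deriv T k) t" if t: "t \<in> {0..T}" for t
  proof -
    have "\<bar>primitive T (\<lambda>s. cm_deriv T h s - cm_deriv T k s) t\<bar> \<le> 0"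
      using primitive_bound[OF d t] antisym[OF 0 sqnorm_nonneg] by simp
    moreover have "primitive T (\<lambda>s. cm_deriv T h s - cm_deriv T k s) t
        = primitive T (cm_deriv T h) t - primitive T (cm_deriv T k) t"
      unfolding primitive_def left_diff_distrib using h k
      by (intro Bochner_Integration.integral_diff square_integrable_integrable_indicator
          square_integrable_cm_deriv) auto
    ultimately show ?thesis by simp
  qed
  then have "cm_path T (cm_deriv T h) = cm_path T (cm_deriv T k)"
    by (auto simp: cm_path_def restrict_def fun_eq_iff)
  then show ?thesis by (simp add: cm_path_cm_deriv h k \<open>T \<ge> 0\<close>)
qed

section \<open>Dyadic interpolation and compactness\<close>

definition grid :: "real \<Rightarrow> nat \<Rightarrow> nat \<Rightarrow> real" where
  "grid T m i = T * real i / real m"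

text \<open>The derivative of the piecewise linear interpolation. The cells are half-open as in
  \<open>step_fun\<close>, so each point lies in at most one of them and the function is literally a
  step function.\<close>

definition pdiff :: "real \<Rightarrow> nat \<Rightarrow> (real \<Rightarrow> real) \<Rightarrow> real \<Rightarrow> real" where
  "pdiff T m w s = (\<Sum>i<m. (w (grid T m (Suc i)) - w (grid T m i)) / (T / real m)
     * indicator {grid T m i<..grid T m (Suc i)} s)"

text \<open>Being a primitive, the interpolation starts at 0; at the grid points it has the values
  of w minus w 0.\<close>

definition interp :: "real \<Rightarrow> nat \<Rightarrow> (real \<Rightarrow> real) \<Rightarrow> real \<Rightarrow> real" where
  "interp T m w = cm_path T (pdiff T m w)"

lemma grid_0 [simp]: "grid T m 0 = 0" by (simp add: grid_def)

lemma grid_m [simp]: "m > 0 \<Longrightarrow> grid T m m = T" by (simp add: grid_def)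

lemma grid_Suc: "grid T m (Suc i) = grid T m i + T / real m"
  by (simp add: grid_def add_divide_distrib distrib_left)

lemma grid_mono: "T \<ge> 0 \<Longrightarrow> i \<le> j \<Longrightarrow> grid T m i \<le> grid T m j"
  by (simp add: grid_def divide_right_mono mult_left_mono)

lemma grid_bounds: "T \<ge> 0 \<Longrightarrow> m > 0 \<Longrightarrow> i \<le> m \<Longrightarrow> grid T m i \<in> {0..T}"
  using grid_mono[of T 0 i m] grid_mono[of T i m m] by simp

lemma grid_refine: "k > 0 \<Longrightarrow> grid T (m * k) (i * k) = grid T m i"
  by (simp add: grid_def)

lemma grid_cell_unique:
  assumes "T \<ge> 0" "s \<in> {grid T m i<..grid T m (Suc i)}" "s \<in> {grid T m j<..grid T m (Suc j)}"
  shows "i = j"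
proof (rule ccontr)
  assume "i \<noteq> j"
  then consider "Suc i \<le> j" | "Suc j \<le> i" by linarith
  then show False
    using grid_mono[OF assms(1), of "Suc i" j m] grid_mono[OF assms(1), of "Suc j" i m] assms(2,3)
    by cases auto
qed

lemma grid_cell_exists:
  assumes "T > 0" "m > 0" "t \<in> {0..T}"
  obtains i where "i < m" "t \<in> {grid T m i..grid T m (Suc i)}"
proof (cases "t = T")
  \<comment> \<open>At t = T the floor used in the other case would give the index m, which lies
    beyond the last cell.\<close>
  case True
  have "t \<in> {grid T m (m - 1)..grid T m (Suc (m - 1))}"
    using grid_bounds[of T m "m - 1"] assms True by simp
  with assms(2) show ?thesis using that[of "m - 1"] by simp
next
  case False
  define i where "i = nat \<lfloor>m * t / T\<rfloor>"
  have nn: "0 \<le> m * t / T" using assms by simp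
  have i: "real i \<le> m * t / T" "m * t / T < real i + 1"
    using nn unfolding i_def by linarith+
  have "m * t / T < m" using False assms by (simp add: divide_less_eq)
  with i(1) have "real i < real m" by linarith
  moreover have "grid T m i \<le> t" "t \<le> grid T m (Suc i)"
    using i assms by (simp_all add: grid_def pos_le_divide_eq pos_divide_le_eq pos_divide_less_eq) (simp_all add: mult.commute less_imp_le distrib_left)
  ultimately show ?thesis using that[of i] by simp
qed

lemma square_integrable_pdiff: "square_integrable (lborel_upto T) (pdiff T m w)"
  unfolding pdiff_def
  by (intro square_integrable_sum square_integrable_cmult square_integrable_indicator) simp

lemma pdiff_cell:
  assumes "T \<ge> 0" "i < m" "s \<in> {grid T m i<..grid T m (Suc i)}"
  shows "pdiff T m w s = (w (grid T m (Suc i)) - w (grid T m i)) / (T / real m)"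
proof -
  have "indicator {grid T m j<..grid T m (Suc j)} s = (if j = i then 1 else 0 :: real)" for j
  proof (cases "j = i")
    case False
    then have "s \<notin> {grid T m j<..grid T m (Suc j)}"
      using grid_cell_unique[OF assms(1,3)] by blast
    with False show ?thesis by simp
  qed (use assms(3) in simp)
  then have "pdiff T m w s = (\<Sum>j<m. if j = i then (w (grid T m (Suc j)) - w (grid T m j)) / (T / real m) else 0)"
    unfolding pdiff_def by (intro sum.cong) auto
  then show ?thesis using assms(2) by simp
qed

text \<open>Pairing with a function that is constant on the cells sees only the increments of the
  primitive of f over them. The orthogonality relations below and the link with step integrals both
  rest on this sum.\<close>

lemma pdiff_inner:
  assumes f: "square_integrable (lborel_upto T) f" and "T \<ge> 0"
  shows "(LINT s|lborel_upto T. pdiff T m w s * f s)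
    = (\<Sum>i<m. (w (grid T m (Suc i)) - w (grid T m i)) / (T / real m)
        * (primitive T f (grid T m (Suc i)) - primitive T f (grid T m i)))"
proof -
  have "(LINT s|lborel_upto T. pdiff T m w s * f s)
      = (LINT s|lborel_upto T. (\<Sum>i<m. (w (grid T m (Suc i)) - w (grid T m i)) / (T / real m)
          * (f s * indicator {grid T m i<..grid T m (Suc i)} s)))"
    by (intro Bochner_Integration.integral_cong) (auto simp: pdiff_def sum_distrib_right sum_distrib_left ac_simps)
  also have "\<dots> = (\<Sum>i<m. (w (grid T m (Suc i)) - w (grid T m i)) / (T / real m)
          * (LINT s|lborel_upto T. f s * indicator {grid T m i<..grid T m (Suc i)} s))"
    using f by (subst Bochner_Integration.integral_sum) (auto intro!: integrable_mult_right square_integrable_integrable_indicator)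
  also have "\<dots> = (\<Sum>i<m. (w (grid T m (Suc i)) - w (grid T m i)) / (T / real m)
        * (primitive T f (grid T m (Suc i)) - primitive T f (grid T m i)))"
    using f assms(2) grid_mono[OF assms(2), of _ "Suc _" m] grid_mono[OF assms(2), of 0 _ m]
    by (intro sum.cong refl) (simp add: primitive_diff)
  finally show ?thesis .
qed

lemma primitive_pdiff_cell:
  assumes "T > 0" "i < m" "t \<in> {grid T m i..grid T m (Suc i)}"
  shows "primitive T (pdiff T m w) t = primitive T (pdiff T m w) (grid T m i)
     + (w (grid T m (Suc i)) - w (grid T m i)) / (T / real m) * (t - grid T m i)"
proof -
  have b: "0 \<le> grid T m i" "grid T m (Suc i) \<le> T"
    using grid_bounds[of T m i] grid_bounds[of T m "Suc i"] assms by auto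
  let ?c = "(w (grid T m (Suc i)) - w (grid T m i)) / (T / real m)"
  have "primitive T (pdiff T m w) t - primitive T (pdiff T m w) (grid T m i)
      = (LINT r|lborel_upto T. pdiff T m w r * indicator {grid T m i<..t} r)"
    using assms b by (intro primitive_diff square_integrable_pdiff) auto
  also have "\<dots> = (LINT r|lborel_upto T. ?c * (indicator {grid T m i<..t} r)\<^sup>2)"
    using assms pdiff_cell[of T i m _ w]
    by (intro Bochner_Integration.integral_cong) (auto simp: indicator_def)
  also have "\<dots> = ?c * sqnorm (lborel_upto T) (indicator {grid T m i<..t})"
    by (simp add: sqnorm_def)
  also have "\<dots> = ?c * (t - grid T m i)"
    using assms b by (subst sqnorm_indicator) auto
  finally show ?thesis by simp
qed

lemma primitive_pdiff_grid:
  assumes "T > 0" "i \<le> m"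
  shows "primitive T (pdiff T m w) (grid T m i) = w (grid T m i) - w 0"
  using assms(2)
proof (induction i)
  case 0
  then show ?case by (simp add: primitive_0)
next
  case (Suc i)
  have "primitive T (pdiff T m w) (grid T m (Suc i)) = primitive T (pdiff T m w) (grid T m i)
     + (w (grid T m (Suc i)) - w (grid T m i)) / (T / real m) * (grid T m (Suc i) - grid T m i)"
    using Suc.prems assms(1) grid_mono[of T i "Suc i" m] by (intro primitive_pdiff_cell) auto
  with Suc assms(1) show ?case by (simp add: grid_Suc)
qed

lemma interp_in_cm_space: "T \<ge> 0 \<Longrightarrow> interp T m w \<in> cm_space T"
  unfolding interp_def by (intro cm_path_in_cm_space square_integrable_pdiff)

lemma interp_density: "cm_density T (interp T m w) (pdiff T m w)"
  unfolding interp_def by (intro cm_density_cm_path square_integrable_pdiff)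

lemma interp_cell:
  assumes "T > 0" "i < m" "t \<in> {grid T m i..grid T m (Suc i)}"
  shows "interp T m w t = w (grid T m i) - w 0
     + (w (grid T m (Suc i)) - w (grid T m i)) / (T / real m) * (t - grid T m i)"
proof -
  have "t \<in> {0..T}"
    using grid_bounds[of T m i] grid_bounds[of T m "Suc i"] assms by auto
  then show ?thesis
    using primitive_pdiff_cell[OF assms] primitive_pdiff_grid[of T i m w] assms
    by (simp add: interp_def cm_path_def)
qed

lemma interp_close:
  assumes "T > 0" "i < m" "t \<in> {grid T m i..grid T m (Suc i)}" "w 0 = 0"
    and e: "\<And>r. r \<in> {grid T m i..grid T m (Suc i)} \<Longrightarrow> \<bar>w r - w (grid T m i)\<bar> \<le> e"
  shows "\<bar>interp T m w t - w t\<bar> \<le> 2 * e"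
proof -
  let ?D = "w (grid T m (Suc i)) - w (grid T m i)"
  define lam where "lam = (t - grid T m i) / (T / real m)"
  have lam: "0 \<le> lam" "lam \<le> 1"
    using assms by (auto simp: lam_def grid_Suc field_simps)
  have "0 \<le> e" using e[OF assms(3)] by linarith
  then have "\<bar>?D * lam\<bar> \<le> e * 1"
    unfolding abs_mult using lam e[of "grid T m (Suc i)"] grid_mono[of T i "Suc i" m] assms
    by (intro mult_mono) auto
  moreover have "interp T m w t - w t = - (w t - w (grid T m i)) + ?D * lam"
    using interp_cell[OF assms(1-3), of w] assms(4) by (simp add: lam_def)
  ultimately show ?thesis using e[OF assms(3)] by linarith
qed

lemma interp_uniform_limit:
  assumes T: "T > 0" and w: "w \<in> wiener_space T" and e: "e > 0"
  shows "\<exists>M. \<forall>m\<ge>M. \<forall>t\<in>{0..T}. \<bar>interp T m w t - w t\<bar> \<le> e"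
proof -
  have c: "continuous_on {0..T} w" and w0: "w 0 = 0" using w T by (auto simp: paths_from_iff)
  have "uniformly_continuous_on {0..T} w" by (rule compact_uniformly_continuous[OF c]) simp
  then obtain d where d: "d > 0" "\<And>s t. s \<in> {0..T} \<Longrightarrow> t \<in> {0..T} \<Longrightarrow> dist t s < d \<Longrightarrow> dist (w t) (w s) < e/2"
    using e unfolding uniformly_continuous_on_def by (meson half_gt_zero)
  obtain M :: nat where M: "T / d < real M" using reals_Archimedean2 by blast
  show ?thesis
  proof (intro exI[of _ "M"] allI impI ballI)
    fix m t assume m: "M \<le> m" and t: "t \<in> {0..T}"
    have "T / d > 0" using T d by simp
    with M m have m0: "m > 0" "T / d < real m" by (auto intro: less_le_trans)
    then have md: "T / m < d" using T d by (simp add: field_simps)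
    obtain i where i: "i < m" "t \<in> {grid T m i..grid T m (Suc i)}"
      by (rule grid_cell_exists[OF T m0(1) t])
    have "\<bar>interp T m w t - w t\<bar> \<le> 2 * (e/2)"
    proof (rule interp_close[where e="e/2" and w=w, OF T i w0])
      fix r assume r: "r \<in> {grid T m i..grid T m (Suc i)}"
      have "r \<in> {0..T}" "grid T m i \<in> {0..T}"
        using grid_bounds[of T m i] grid_bounds[of T m "Suc i"] T i r by auto
      moreover have "dist r (grid T m i) < d" using r md by (auto simp: dist_real_def grid_Suc)
      ultimately show "\<bar>w r - w (grid T m i)\<bar> \<le> e/2"
        using d(2)[of "grid T m i" r] by (simp add: dist_real_def)
    qed
    then show "\<bar>interp T m w t - w t\<bar> \<le> e" by simp
  qed
qed

section \<open>Dyadic energies, lower semicontinuity and compactness\<close>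

lemma sqnorm_pdiff:
  assumes "T > 0"
  shows "sqnorm (lborel_upto T) (pdiff T m w)
    = (\<Sum>i<m. (w (grid T m (Suc i)) - w (grid T m i))\<^sup>2 / (T / real m))"
proof -
  have "sqnorm (lborel_upto T) (pdiff T m w) = (LINT s|lborel_upto T. pdiff T m w s * pdiff T m w s)"
    by (simp add: sqnorm_def power2_eq_square)
  also have "\<dots> = (\<Sum>i<m. (w (grid T m (Suc i)) - w (grid T m i))\<^sup>2 / (T / real m))"
    using assms by (subst pdiff_inner[OF square_integrable_pdiff])
      (auto intro!: sum.cong simp: primitive_pdiff_grid power2_eq_square)
  finally show ?thesis .
qed

lemma pdiff_inner_eq_sqnorm:
  assumes f: "square_integrable (lborel_upto T) f" and T: "T > 0"
    and eq: "\<And>i. i \<le> m \<Longrightarrow> primitive T f (grid T m i) = w (grid T m i) - w 0"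
  shows "(LINT s|lborel_upto T. pdiff T m w s * f s) = sqnorm (lborel_upto T) (pdiff T m w)"
  unfolding sqnorm_pdiff[OF T] using T eq
  by (subst pdiff_inner[OF f]) (auto intro!: sum.cong simp: power2_eq_square)

text \<open>Pythagoras: when the primitive of f matches w - w 0 on the grid,
  \<open>pdiff T m w\<close> is the orthogonal projection of f onto the functions that are constant
  on the cells.\<close>

lemma sqnorm_pdiff_diff:
  assumes f: "square_integrable (lborel_upto T) f" and T: "T > 0"
    and eq: "\<And>i. i \<le> m \<Longrightarrow> primitive T f (grid T m i) = w (grid T m i) - w 0"
  shows "sqnorm (lborel_upto T) (\<lambda>s. pdiff T m w s - f s)
    = sqnorm (lborel_upto T) f - sqnorm (lborel_upto T) (pdiff T m w)"
  using sqnorm_diff[OF square_integrable_pdiff[of T m w] f] pdiff_inner_eq_sqnorm[OF assms] by simp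

lemma sqnorm_pdiff_dyadic_diff:
  assumes T: "T > 0" and jk: "j \<le> k"
  shows "sqnorm (lborel_upto T) (\<lambda>s. pdiff T (2^j) w s - pdiff T (2^k) w s)
    = sqnorm (lborel_upto T) (pdiff T (2^k) w) - sqnorm (lborel_upto T) (pdiff T (2^j) w)"
proof (rule sqnorm_pdiff_diff[OF square_integrable_pdiff T])
  fix i :: nat assume i: "i \<le> 2^j"
  have eq: "(2::nat)^k = 2^j * 2^(k-j)" using jk by (simp add: power_add[symmetric])
  have "i * 2^(k-j) \<le> 2^k" unfolding eq using i by simp
  from primitive_pdiff_grid[OF T this, of w]
  show "primitive T (pdiff T (2^k) w) (grid T (2^j) i) = w (grid T (2^j) i) - w 0"
    unfolding eq by (simp add: grid_refine)
qed

text \<open>Bounded increasing energies converge. By Pythagoras the squared distance of two dyadic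
  densities is the difference of their energies, so the densities are Cauchy; the primitive of their
  limit is the limit of the interpolations, which is w.\<close>

theorem cm_space_if_bounded_energy:
  assumes T: "T > 0" and w: "w \<in> wiener_space T"
    and A: "\<And>k. sqnorm (lborel_upto T) (pdiff T (2^k) w) \<le> A"
  obtains g where "cm_density T w g" "sqnorm (lborel_upto T) g \<le> A"
    "(\<lambda>k. sqnorm (lborel_upto T) (\<lambda>s. pdiff T (2^k) w s - g s)) \<longlonglongrightarrow> 0"
proof -
  let ?U = "lborel_upto T" and ?p = "\<lambda>k. pdiff T (2^k) w"
  define E where "E = (\<lambda>k. sqnorm ?U (?p k))"
  have c: "continuous_on {0..T} w" and w0: "w 0 = 0" using w T by (auto simp: paths_from_iff)
  have inc: "incseq E"
    unfolding incseq_def E_def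
  proof (intro allI impI)
    fix j k :: nat assume "j \<le> k"
    then have "0 \<le> sqnorm ?U (?p k) - sqnorm ?U (?p j)"
      using sqnorm_pdiff_dyadic_diff[OF T, of j k w] by (metis sqnorm_nonneg)
    then show "sqnorm ?U (?p j) \<le> sqnorm ?U (?p k)" by simp
  qed
  have "convergent E"
  proof (rule Bseq_mono_convergent)
    show "Bseq E" by (rule BseqI'[of _ A]) (use A in \<open>simp add: E_def sqnorm_nonneg\<close>)
    show "\<forall>m. \<forall>n\<ge>m. E m \<le> E n" using inc by (simp add: incseq_def)
  qed
  then have "Cauchy E" by (rule convergent_Cauchy)
  have "\<exists>N. \<forall>m\<ge>N. \<forall>n\<ge>N. sqnorm ?U (\<lambda>x. ?p m x - ?p n x) < e" if e: "e > 0" for e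
  proof -
    obtain N where N: "\<And>m n. m \<ge> N \<Longrightarrow> n \<ge> N \<Longrightarrow> dist (E m) (E n) < e"
      using \<open>Cauchy E\<close> e unfolding Cauchy_def by blast
    have "sqnorm ?U (\<lambda>x. ?p m x - ?p n x) < e" if mn: "m \<ge> N" "n \<ge> N" for m n
      using N[OF mn] sqnorm_pdiff_dyadic_diff[OF T, of m n w] sqnorm_pdiff_dyadic_diff[OF T, of n m w]
        sqnorm_diff_commute[of ?U "?p m" "?p n"]
      by (cases "m \<le> n") (auto simp: E_def dist_real_def)
    then show ?thesis by blast
  qed
  then obtain g where g: "square_integrable ?U g" and lim: "(\<lambda>k. sqnorm ?U (\<lambda>x. ?p k x - g x)) \<longlonglongrightarrow> 0"
    by (rule Riesz_Fischer[OF square_integrable_pdiff])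
  have "(\<lambda>k. sqnorm ?U (?p k)) \<longlonglongrightarrow> sqnorm ?U g"
    by (rule sqnorm_tendsto[OF square_integrable_pdiff g lim])
  then have gA: "sqnorm ?U g \<le> A" by (rule LIMSEQ_le_const2) (use A in auto)
  have "w t = primitive T g t" if t: "t \<in> {0..T}" for t
  proof (rule LIMSEQ_unique)
    show "(\<lambda>k. primitive T (?p k) t) \<longlonglongrightarrow> primitive T g t"
      unfolding primitive_def
      by (intro sqnorm_tendsto_inner square_integrable_pdiff g lim square_integrable_indicator) simp
    have "(\<lambda>m. interp T m w t) \<longlonglongrightarrow> w t"
    proof (rule LIMSEQ_I)
      fix e :: real assume "e > 0"
      then obtain M where "\<forall>m\<ge>M. \<forall>t\<in>{0..T}. \<bar>interp T m w t - w t\<bar> \<le> e/2"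
        using interp_uniform_limit[OF T w, of "e/2"] by auto
      then have "\<forall>m\<ge>M. \<bar>interp T m w t - w t\<bar> \<le> e/2" using t by blast
      moreover have "e / 2 < e" using \<open>e > 0\<close> by simp
      ultimately show "\<exists>no. \<forall>m\<ge>no. norm (interp T m w t - w t) < e"
        unfolding real_norm_def by (meson le_less_trans)
    qed
    then have "((\<lambda>m. interp T m w t) \<circ> (\<lambda>k. 2^k)) \<longlonglongrightarrow> w t"
      by (rule LIMSEQ_subseq_LIMSEQ) (simp add: strict_mono_def)
    then have "(\<lambda>k. interp T (2^k) w t) \<longlonglongrightarrow> w t" by (simp add: comp_def)
    then show "(\<lambda>k. primitive T (?p k) t) \<longlonglongrightarrow> w t"
      using t by (simp add: interp_def cm_path_def)
  qed
  with g have "cm_density T w g" by (simp add: cm_density_iff)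
  with gA lim show ?thesis using that by blast
qed

lemma cm_space_pdiff_le:
  assumes T: "T > 0" and h: "h \<in> cm_space T" and "m > 0"
  shows "sqnorm (lborel_upto T) (pdiff T m h) \<le> sqnorm (lborel_upto T) (cm_deriv T h)"
proof -
  have h0: "h 0 = 0" using cm_space_wiener[OF h] T by (simp add: paths_from_iff)
  have "primitive T (cm_deriv T h) (grid T m i) = h (grid T m i) - h 0" if "i \<le> m" for i
    using cm_space_primitive[OF h grid_bounds[of T m i]] T that h0 assms(3) by simp
  from sqnorm_pdiff_diff[OF square_integrable_cm_deriv[OF h] T this]
  show ?thesis using sqnorm_nonneg[of "lborel_upto T" "\<lambda>s. pdiff T m h s - cm_deriv T h s"] by simp
qed

text \<open>The limit supplied by the bounded-energy criterion is a density of h, hence a version of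
  \<open>cm_deriv T h\<close>. This approximation underlies the Wiener integral and both halves of
  the Laplace principle.\<close>

theorem cm_deriv_dyadic_limit:
  assumes T: "T > 0" and h: "h \<in> cm_space T"
  shows "(\<lambda>k. sqnorm (lborel_upto T) (\<lambda>s. pdiff T (2^k) h s - cm_deriv T h s)) \<longlonglongrightarrow> 0"
proof -
  obtain g where g: "cm_density T h g"
    and lim: "(\<lambda>k. sqnorm (lborel_upto T) (\<lambda>s. pdiff T (2^k) h s - g s)) \<longlonglongrightarrow> 0"
    using cm_space_if_bounded_energy[OF T cm_space_wiener[OF h] cm_space_pdiff_le[OF T h]] by auto
  have "sqnorm (lborel_upto T) (\<lambda>s. pdiff T (2^k) h s - cm_deriv T h s)
      = sqnorm (lborel_upto T) (\<lambda>s. pdiff T (2^k) h s - g s)" for k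
    unfolding sqnorm_def
  proof (rule integral_cong_AE)
    show "AE s in lborel_upto T. (pdiff T (2^k) h s - cm_deriv T h s)\<^sup>2 = (pdiff T (2^k) h s - g s)\<^sup>2"
      using cm_deriv_unique[OF g h] T by (auto elim: eventually_mono)
    show "(\<lambda>s. (pdiff T (2^k) h s - cm_deriv T h s)\<^sup>2) \<in> borel_measurable (lborel_upto T)"
      "(\<lambda>s. (pdiff T (2^k) h s - g s)\<^sup>2) \<in> borel_measurable (lborel_upto T)"
      using square_integrable_pdiff[of T "2^k" h] square_integrable_cm_deriv[OF h] g
      by (auto simp: square_integrable_def cm_density_iff)
  qed
  with lim show ?thesis by simp
qed

text \<open>Each dyadic energy is a continuous function of finitely many values and is dominated by
  the full energy, so a bound along infinitely many n passes to every dyadic energy of the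
  limit.\<close>

theorem cm_space_lower_semicontinuous:
  assumes T: "T > 0" and u: "\<And>n. u n \<in> cm_space T" and v: "v \<in> wiener_space T"
    and lim: "\<And>t. t \<in> {0..T} \<Longrightarrow> (\<lambda>n. u n t) \<longlonglongrightarrow> v t"
    and A: "\<exists>\<^sub>F n in sequentially. sqnorm (lborel_upto T) (cm_deriv T (u n)) \<le> A"
  shows "v \<in> cm_space T" "sqnorm (lborel_upto T) (cm_deriv T v) \<le> A"
proof -
  have "sqnorm (lborel_upto T) (pdiff T (2^k) v) \<le> A" for k
  proof (rule ccontr)
    assume "\<not> sqnorm (lborel_upto T) (pdiff T (2^k) v) \<le> A"
    moreover have "(\<lambda>n. sqnorm (lborel_upto T) (pdiff T (2^k) (u n))) \<longlonglongrightarrow> sqnorm (lborel_upto T) (pdiff T (2^k) v)"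
      unfolding sqnorm_pdiff[OF T]
      using T by (intro tendsto_intros lim) (auto intro!: grid_bounds[of T "2^k", simplified] simp: Suc_le_eq)
    ultimately have "\<forall>\<^sub>F n in sequentially. sqnorm (lborel_upto T) (pdiff T (2^k) (u n)) > A"
      by (intro order_tendstoD) auto
    then have "\<forall>\<^sub>F n in sequentially. \<not> sqnorm (lborel_upto T) (cm_deriv T (u n)) \<le> A"
    proof eventually_elim
      case (elim n)
      then show ?case using cm_space_pdiff_le[OF T u, of "2^k" n] by simp
    qed
    with A show False by (simp add: frequently_def)
  qed
  then obtain g where g: "cm_density T v g" "sqnorm (lborel_upto T) g \<le> A"
    using cm_space_if_bounded_energy[OF T v] by blast
  then show v': "v \<in> cm_space T" using v by (auto simp: cm_space_def)
  have "sqnorm (lborel_upto T) (cm_deriv T v) = sqnorm (lborel_upto T) g"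
    using cm_inner_density[OF v' g(1) v' g(1)] T
    by (simp add: cm_inner_self) (simp add: sqnorm_def power2_eq_square)
  with g(2) show "sqnorm (lborel_upto T) (cm_deriv T v) \<le> A" by simp
qed

text \<open>Bounded energy gives a common Hoelder bound with exponent 1/2, hence equicontinuity.
  Arzela--Ascoli yields a uniform limit, and lower semicontinuity puts it back into the
  space.\<close>

theorem cm_space_uniform_subsequence:
  assumes T: "T > 0" and u: "\<And>n. u n \<in> cm_space T"
    and A: "\<And>n. sqnorm (lborel_upto T) (cm_deriv T (u n)) \<le> A"
  obtains v r where "strict_mono (r :: nat \<Rightarrow> nat)" "v \<in> cm_space T"
    "\<forall>e>0. \<exists>N. \<forall>n\<ge>N. \<forall>t\<in>{0..T}. \<bar>u (r n) t - v t\<bar> < e"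
proof -
  have sA: "sqrt (sqnorm (lborel_upto T) (cm_deriv T (u n))) \<le> sqrt A" for n using A by simp
  have Hol: "\<bar>u n t - u n s\<bar> \<le> sqrt A * sqrt \<bar>t - s\<bar>" if "s \<in> {0..T}" "t \<in> {0..T}" for n s t
  proof -
    have *: "\<bar>u n t - u n s\<bar> \<le> sqrt A * sqrt \<bar>t - s\<bar>" if "s \<in> {0..T}" "t \<in> {0..T}" "s \<le> t" for s t
    proof -
      have "\<bar>u n t - u n s\<bar> \<le> sqrt (sqnorm (lborel_upto T) (cm_deriv T (u n))) * sqrt (t - s)"
        using primitive_Holder[OF square_integrable_cm_deriv[OF u[of n]], of s t]
          cm_space_primitive[OF u[of n]] that by auto
      also have "\<dots> \<le> sqrt A * sqrt (t - s)" using that sA by (intro mult_right_mono) auto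
      finally show ?thesis using that by simp
    qed
    show ?thesis using *[of s t] *[of t s] that by (cases "s \<le> t") (auto simp: abs_minus_commute)
  qed
  have u0: "u n 0 = 0" for n using cm_space_wiener[OF u[of n]] T by (simp add: paths_from_iff)
  have A0: "A \<ge> 0" using A[of 0] sqnorm_nonneg order_trans by blast
  have bd: "norm (u n x) \<le> sqrt A * sqrt T" if "x \<in> {0..T}" for n x
  proof -
    have "norm (u n x) \<le> sqrt A * sqrt \<bar>x - 0\<bar>" using Hol[of 0 x n] that T u0[of n] by simp
    also have "\<dots> \<le> sqrt A * sqrt T" using that A0 by (intro mult_left_mono) auto
    finally show ?thesis .
  qed
  have equi: "\<exists>d. 0 < d \<and> (\<forall>n y. y \<in> {0..T} \<and> norm (x - y) < d \<longrightarrow> norm (u n x - u n y) < e)"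
    if "x \<in> {0..T}" "0 < e" for x e
  proof (intro exI conjI allI impI)
    \<comment> \<open>Adding 1 keeps the denominator positive when A = 0.\<close>
    show "0 < (e / (sqrt A + 1))\<^sup>2" using that A0 by (simp add: add_nonneg_eq_0_iff)
    fix n y assume y: "y \<in> {0..T} \<and> norm (x - y) < (e / (sqrt A + 1))\<^sup>2"
    have "norm (u n x - u n y) \<le> sqrt A * sqrt \<bar>x - y\<bar>" using Hol[of y x n] y that by simp
    also have "\<dots> \<le> (sqrt A + 1) * sqrt \<bar>x - y\<bar>" by (intro mult_right_mono) auto
    also have "\<dots> < (sqrt A + 1) * (e / (sqrt A + 1))"
    proof (rule mult_strict_left_mono)
      show "sqrt \<bar>x - y\<bar> < e / (sqrt A + 1)"
        using y that A0 real_sqrt_less_iff[of "\<bar>x - y\<bar>" "(e / (sqrt A + 1))\<^sup>2"] by simp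
    qed (use A0 in \<open>simp add: add_nonneg_pos\<close>)
    also have "\<dots> = e" using real_sqrt_ge_zero[OF A0] by (simp add: add_nonneg_eq_0_iff)
    finally show "norm (u n x - u n y) < e" .
  qed
  obtain g r where g: "continuous_on {0..T} g" "strict_mono (r :: nat \<Rightarrow> nat)"
    and lim: "\<And>e. 0 < e \<Longrightarrow> \<exists>N. \<forall>n x. n \<ge> N \<and> x \<in> {0..T} \<longrightarrow> norm (u (r n) x - g x) < e"
    by (rule Arzela_Ascoli[of "{0..T}" u "sqrt A * sqrt T"]) (use bd equi in auto)
  define v where "v = restrict g {0..T}"
  have unif: "\<exists>N. \<forall>n\<ge>N. \<forall>t\<in>{0..T}. \<bar>u (r n) t - v t\<bar> < e" if "e > 0" for e
  proof -
    obtain N where "\<forall>n x. n \<ge> N \<and> x \<in> {0..T} \<longrightarrow> norm (u (r n) x - g x) < e" using lim[OF \<open>e > 0\<close>] by blast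
    then show ?thesis by (intro exI[of _ N]) (simp add: v_def)
  qed
  have lim': "(\<lambda>n. u (r n) t) \<longlonglongrightarrow> v t" if "t \<in> {0..T}" for t
    using unif that by (intro LIMSEQ_I) (force simp: real_norm_def)
  have "continuous_on {0..T} v"
    by (rule continuous_on_eq[OF g(1)]) (simp add: v_def)
  moreover have "v 0 = 0"
    using LIMSEQ_unique[OF lim'[of 0]] u0 T by auto
  ultimately have "v \<in> wiener_space T"
    using T by (simp add: paths_from_iff) (simp add: v_def)
  then have "v \<in> cm_space T"
    by (rule cm_space_lower_semicontinuous(1)[where u="\<lambda>n. u (r n)" and A=A, OF T u _ lim'])
      (simp_all add: A)
  with g(2) unif show ?thesis using that by blast
qed

section \<open>Equations with monotone drift\<close>

lemma primitive_diff_integrable: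
  assumes f: "integrable (lborel_upto T) f" and "0 \<le> s" "s \<le> t"
  shows "primitive T f t - primitive T f s = (LINT r|lborel_upto T. f r * indicator {s<..t} r)"
proof -
  have i: "integrable (lborel_upto T) (\<lambda>r. f r * indicator A r)" if "A \<in> sets borel" for A
  proof -
    have "integrable (lborel_upto T) (\<lambda>r. indicator (A \<inter> {0..T}) r *\<^sub>R f r)"
      by (rule integrable_mult_indicator[OF _ f]) (use that in \<open>auto simp: sets_restrict_space\<close>)
    moreover have "indicator (A \<inter> {0..T}) r *\<^sub>R f r = f r * indicator A r" if "r \<in> space (lborel_upto T)" for r
      using that by (auto simp: indicator_def space_restrict_space)
    ultimately show ?thesis by (subst Bochner_Integration.integrable_cong[OF refl]) (auto simp only:)
  qed
  have "primitive T f t - primitive T f s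
      = (LINT r|lborel_upto T. f r * indicator {0..t} r - f r * indicator {0..s} r)"
    unfolding primitive_def
    by (intro Bochner_Integration.integral_diff[symmetric] i) auto
  also have "\<dots> = (LINT r|lborel_upto T. f r * indicator {s<..t} r)"
    using assms by (intro Bochner_Integration.integral_cong) (auto simp: indicator_def)
  finally show ?thesis .
qed

text \<open>Integrating a * exp (l * s) gains the factor 1 / l. With l equal to twice the one-sided
  or two-sided Lipschitz constant, this is the source of the factor 1/2 in the comparison below and
  in the fixed point argument.\<close>

lemma primitive_increment_le_exp:
  fixes K a l :: real
  assumes f: "integrable (lborel_upto T) f" and rt: "0 \<le> r" "r \<le> t" "t \<le> T"
    and l: "l > 0" and a: "a \<ge> 0" and K: "K \<ge> 0"
    and le: "\<And>s. s \<in> {r<..t} \<Longrightarrow> f s \<le> K + a * exp (l * s)"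
  shows "primitive T f t - primitive T f r \<le> K * T + a / l * exp (l * t)"
proof -
  define \<psi> where "\<psi> = (\<lambda>s. K + a * exp (l * s))"
  define F where "F = (\<lambda>s. K * s + a / l * exp (l * s))"
  have der: "DERIV F s :> \<psi> s" for s
    unfolding F_def \<psi>_def using l by (auto intro!: derivative_eq_intros)
  have cont: "isCont \<psi> s" for s unfolding \<psi>_def by (intro continuous_intros)
  have bi: "has_bochner_integral lborel (\<lambda>s. \<psi> s * indicator {r..t} s) (F t - F r)"
    by (rule has_bochner_integral_FTC_Icc_real) (use rt der cont in auto)
  have eq: "indicator {0..T} s *\<^sub>R (\<psi> s * indicator {r..t} s) = \<psi> s * indicator {r..t} s" for s
    using rt by (auto simp: indicator_def)
  have int1: "integrable (lborel_upto T) (\<lambda>s. \<psi> s * indicator {r..t} s)"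
    using bi by (subst integrable_restrict_space) (auto simp only: eq intro!: integrable.intros, auto)
  have val: "(LINT s|lborel_upto T. \<psi> s * indicator {r..t} s) = F t - F r"
    using bi by (subst integral_restrict_space) (auto simp only: eq dest: has_bochner_integral_integral_eq, auto)
  have int2: "integrable (lborel_upto T) (\<lambda>s. f s * indicator {r<..t} s)"
  proof -
    have "integrable (lborel_upto T) (\<lambda>s. indicator ({r<..t} \<inter> {0..T}) s *\<^sub>R f s)"
      by (rule integrable_mult_indicator[OF _ f]) (auto simp: sets_restrict_space)
    moreover have "(\<lambda>s. indicator ({r<..t} \<inter> {0..T}) s *\<^sub>R f s) = (\<lambda>s. f s * indicator {r<..t} s)"
      using rt by (auto simp: indicator_def fun_eq_iff)
    ultimately show ?thesis by simp
  qed
  have "primitive T f t - primitive T f r = (LINT s|lborel_upto T. f s * indicator {r<..t} s)"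
    by (rule primitive_diff_integrable[OF f rt(1,2)])
  also have "\<dots> \<le> (LINT s|lborel_upto T. \<psi> s * indicator {r..t} s)"
  proof (rule integral_mono[OF int2 int1])
    fix s
    have "0 \<le> \<psi> s" using K a by (simp add: \<psi>_def)
    then show "f s * indicator {r<..t} s \<le> \<psi> s * indicator {r..t} s"
      using le[of s] by (auto simp: indicator_def \<psi>_def)
  qed
  also have "\<dots> = F t - F r" by (rule val)
  also have "\<dots> \<le> K * T + a / l * exp (l * t)"
  proof -
    have "K * t \<le> K * T" "0 \<le> K * r" "0 \<le> a / l * exp (l * r)"
      using rt K a l by (auto intro: mult_left_mono)
    then show ?thesis by (simp add: F_def)
  qed
  finally show ?thesis .
qed

text \<open>A maximum point of \<open>exp (- 2 * L * t) * d t\<close> is compared with the last earlier zero of \<open>d\<close>, after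
  which the one-sided bound is available; the weight turns the resulting integral inequality into
  \<open>M \<le> C + M / 2\<close>.\<close>

lemma one_sided_comparison:
  fixes d \<phi> \<eta> :: "real \<Rightarrow> real"
  assumes T: "T > 0" and L: "L > 0" and K: "K \<ge> 0" and cont: "continuous_on {0..T} d"
    and int: "integrable (lborel_upto T) \<phi>"
    and eq: "\<And>t. t \<in> {0..T} \<Longrightarrow> d t = d0 + primitive T \<phi> t + \<eta> t"
    and \<eta>: "\<And>t. t \<in> {0..T} \<Longrightarrow> \<bar>\<eta> t\<bar> \<le> m"
    and le: "\<And>s. s \<in> {0..T} \<Longrightarrow> d s > 0 \<Longrightarrow> \<phi> s \<le> K + L * d s"
    and t: "t \<in> {0..T}"
  shows "d t \<le> 2 * (\<bar>d0\<bar> + K * T + 2 * m) * exp (2 * L * T)"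
proof -
  define C where "C = \<bar>d0\<bar> + K * T + 2 * m"
  have m: "m \<ge> 0" using \<eta>[OF t] by linarith
  have C: "C \<ge> 0" using K T m by (simp add: C_def)
  define f where "f = (\<lambda>t. exp (- (2 * L * t)) * d t)"
  have "continuous_on {0..T} f" unfolding f_def by (intro continuous_intros cont)
  then obtain u where u: "u \<in> {0..T}" and umax: "\<And>t. t \<in> {0..T} \<Longrightarrow> f t \<le> f u"
    using continuous_attains_sup[of "{0..T}" f] T by auto
  have dexp: "d s = f s * exp (2 * L * s)" for s
    by (simp add: f_def exp_minus field_simps)
  have "f u \<le> 2 * C"
  proof (cases "d u \<le> 0")
    case True
    then have "f u \<le> 0" by (simp add: f_def mult_nonneg_nonpos)
    with C show ?thesis by linarith
  next
    case False
    then have M: "f u > 0" by (simp add: f_def)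
    have key: "primitive T \<phi> u - primitive T \<phi> r \<le> K * T + L * f u / (2 * L) * exp (2 * L * u)"
      if r: "0 \<le> r" "r \<le> u" and pos: "\<And>s. s \<in> {r<..u} \<Longrightarrow> d s > 0" for r
    proof (rule primitive_increment_le_exp[OF int r])
      fix s assume s: "s \<in> {r<..u}"
      then have s': "s \<in> {0..T}" using r u by auto
      have "\<phi> s \<le> K + L * (f s * exp (2 * L * s))"
        using le[OF s' pos[OF s]] dexp[of s] by simp
      also have "\<dots> \<le> K + L * (f u * exp (2 * L * s))"
        using umax[OF s'] L by simp
      finally show "\<phi> s \<le> K + L * f u * exp (2 * L * s)" by simp
    qed (use u L K M in auto)
    have main: "d u \<le> C + f u / 2 * exp (2 * L * u)"
    proof (cases "\<forall>s\<in>{0<..u}. d s > 0")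
      \<comment> \<open>If d is positive on the whole of {0<..u} there is no earlier zero to start
        from; the comparison starts at time 0, which brings in d0.\<close>
      case True
      then have "primitive T \<phi> u - primitive T \<phi> 0 \<le> K * T + L * f u / (2 * L) * exp (2 * L * u)"
        using u by (intro key) auto
      then show ?thesis
        using eq[OF u] \<eta>[OF u] m L by (simp add: primitive_0 C_def)
    next
      case False
      define Z where "Z = {s\<in>{0..u}. d s \<le> 0}"
      have contu: "continuous_on {0..u} d" by (rule continuous_on_subset[OF cont]) (use u in auto)
      have Zne: "Z \<noteq> {}" using False by (auto simp: Z_def not_less)
      have "closed Z" unfolding Z_def
        by (rule continuous_on_closed_Collect_le[OF contu]) auto
      moreover have bdd: "bdd_above Z" unfolding Z_def by (rule bdd_aboveI[of _ u]) auto
      ultimately have SZ: "Sup Z \<in> Z" using closed_contains_Sup[OF Zne] by blast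
      define r where "r = Sup Z"
      have r: "0 \<le> r" "r \<le> u" "d r \<le> 0" using SZ by (auto simp: r_def Z_def)
      have pos: "d s > 0" if "s \<in> {r<..u}" for s
      proof (rule ccontr)
        assume "\<not> d s > 0"
        then have "s \<in> Z" using that r by (auto simp: Z_def)
        then have "s \<le> r" unfolding r_def using bdd by (rule cSup_upper)
        with that show False by simp
      qed
      have rT: "r \<in> {0..T}" using r u by auto
      have "d u - d r = primitive T \<phi> u - primitive T \<phi> r + (\<eta> u - \<eta> r)"
        using eq[OF u] eq[OF rT] by simp
      then show ?thesis
        using key[OF r(1,2) pos] \<eta>[OF u] \<eta>[OF rT] r(3) L by (simp add: C_def)
    qed
    have "f u * exp (2 * L * u) \<le> C * exp (2 * L * u) + f u / 2 * exp (2 * L * u)"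
    proof -
      have "C * 1 \<le> C * exp (2 * L * u)" using C u L by (intro mult_left_mono) auto
      with main dexp[of u] show ?thesis by linarith
    qed
    then have "f u * exp (2 * L * u) \<le> (C + f u / 2) * exp (2 * L * u)"
      by (simp add: distrib_right)
    then have "f u \<le> C + f u / 2" by simp
    then show ?thesis by simp
  qed
  then have "f t \<le> 2 * C" using umax[OF t] by linarith
  then have "d t \<le> 2 * C * exp (2 * L * t)" using dexp[of t] by simp
  also have "\<dots> \<le> 2 * C * exp (2 * L * T)" using C L t by (intro mult_left_mono) auto
  finally show ?thesis by (simp add: C_def)
qed

lemma primitive_uminus: "primitive T (\<lambda>s. - f s) t = - primitive T f t"
  by (simp add: primitive_def)

text \<open>Truncation at level R. Composed with the drift it yields a globally Lipschitz drift that
  keeps the linear one-sided bounds.\<close>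

definition clip :: "real \<Rightarrow> real \<Rightarrow> real" where
  "clip R x = max (- R) (min R x)"

text \<open>Here \<beta> s x stands for \<open>b s x (\<mu> s)\<close> along a fixed measure flow.
  The flow is merely Borel in time, so measurability along continuous paths is required instead of
  continuity in time.\<close>

locale monotone_drift =
  fixes T L K :: real and q :: nat and \<beta> :: "real \<Rightarrow> real \<Rightarrow> real"
  assumes T: "T > 0" and L: "L > 0" and K: "K \<ge> 0"
    and drift_measurable: "\<And>x. continuous_on {0..T} x \<Longrightarrow> (\<lambda>s. \<beta> s (x s)) \<in> borel_measurable (lborel_upto T)"
    and drift_zero: "\<And>s. s \<in> {0..T} \<Longrightarrow> \<bar>\<beta> s 0\<bar> \<le> K"
    and drift_one_sided: "\<And>s x y. s \<in> {0..T} \<Longrightarrow> (x - y) * (\<beta> s x - \<beta> s y) \<le> L * \<bar>x - y\<bar>\<^sup>2"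
    and drift_growth: "\<And>s x y. s \<in> {0..T} \<Longrightarrow>
          \<bar>\<beta> s x - \<beta> s y\<bar> \<le> L * (1 + \<bar>x\<bar> ^ q + \<bar>y\<bar> ^ q) * \<bar>x - y\<bar>"
begin

definition solves :: "real \<Rightarrow> (real \<Rightarrow> real) \<Rightarrow> (real \<Rightarrow> real) \<Rightarrow> bool" where
  "solves x0 w x \<longleftrightarrow> continuous_on {0..T} x
     \<and> (\<forall>t\<in>{0..T}. x t = x0 + primitive T (\<lambda>s. \<beta> s (x s)) t + w t)"

lemma drift_less:
  assumes "s \<in> {0..T}" "x > y"
  shows "\<beta> s x - \<beta> s y \<le> L * (x - y)"
proof -
  have "(x - y) * (\<beta> s x - \<beta> s y) \<le> (x - y) * (L * (x - y))"
    using drift_one_sided[OF assms(1), of x y] by (simp add: power2_eq_square ac_simps)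
  then show ?thesis using assms(2) by simp
qed

lemma drift_bound:
  assumes "s \<in> {0..T}" "\<bar>x\<bar> \<le> R"
  shows "\<bar>\<beta> s x\<bar> \<le> K + L * (2 + R ^ q) * R"
proof -
  have "\<bar>\<beta> s x - \<beta> s 0\<bar> \<le> L * (1 + \<bar>x\<bar> ^ q + \<bar>0\<bar> ^ q) * \<bar>x - 0\<bar>" by (rule drift_growth[OF assms(1)])
  also have "\<dots> \<le> L * (2 + R ^ q) * R"
  proof (intro mult_mono)
    have "\<bar>x\<bar> ^ q \<le> R ^ q" using assms by (intro power_mono) auto
    moreover have "\<bar>0 :: real\<bar> ^ q \<le> 1" by (cases q) auto
    ultimately show "1 + \<bar>x\<bar> ^ q + \<bar>0\<bar> ^ q \<le> 2 + R ^ q" by linarith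
  qed (use assms L in auto)
  finally show ?thesis using drift_zero[OF assms(1)] by linarith
qed

lemma square_integrable_drift:
  assumes x: "continuous_on {0..T} x"
  shows "square_integrable (lborel_upto T) (\<lambda>s. \<beta> s (x s))"
proof -
  interpret finite_measure "lborel_upto T" by (rule finite_measure_lborel_upto)
  have "bounded (x ` {0..T})" by (intro compact_imp_bounded compact_continuous_image x) simp
  then obtain R where R: "\<And>s. s \<in> {0..T} \<Longrightarrow> \<bar>x s\<bar> \<le> R" unfolding bounded_iff by fastforce
  have "integrable (lborel_upto T) (\<lambda>s. (\<beta> s (x s))\<^sup>2)"
  proof (rule integrable_const_bound[where B="(K + L * (2 + R ^ q) * R)\<^sup>2"])
    show "AE s in lborel_upto T. norm ((\<beta> s (x s))\<^sup>2) \<le> (K + L * (2 + R ^ q) * R)\<^sup>2"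
    proof (rule AE_I2)
      fix s assume "s \<in> space (lborel_upto T)"
      then have s: "s \<in> {0..T}" by (simp add: space_restrict_space)
      then have "\<bar>\<beta> s (x s)\<bar>\<^sup>2 \<le> (K + L * (2 + R ^ q) * R)\<^sup>2"
        using drift_bound[OF s R[OF s]] by (intro power_mono) auto
      then show "norm ((\<beta> s (x s))\<^sup>2) \<le> (K + L * (2 + R ^ q) * R)\<^sup>2" by simp
    qed
  qed (use drift_measurable[OF x] in measurable)
  then show ?thesis using drift_measurable[OF x] by (simp add: square_integrable_def)
qed

text \<open>The common initial value cancels, and the one-sided comparison applies to x - y with K =
  0. The resulting Lipschitz constant depends on L and T only, not on the size of the two
  paths.\<close>

lemma solves_diff_le:
  assumes x: "solves x0 w x" and y: "solves x0 w' y"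
    and m: "\<And>t. t \<in> {0..T} \<Longrightarrow> \<bar>w t - w' t\<bar> \<le> m" and t: "t \<in> {0..T}"
  shows "x t - y t \<le> 4 * m * exp (2 * L * T)"
proof -
  have i: "integrable (lborel_upto T) (\<lambda>s. \<beta> s (x s))" "integrable (lborel_upto T) (\<lambda>s. \<beta> s (y s))"
    using x y square_integrable_integrable[OF square_integrable_drift] by (auto simp: solves_def)
  have "(\<lambda>t. x t - y t) t \<le> 2 * (\<bar>0\<bar> + 0 * T + 2 * m) * exp (2 * L * T)"
  proof (rule one_sided_comparison[OF T L _ _ _ _ m _ t, where \<phi>="\<lambda>s. \<beta> s (x s) - \<beta> s (y s)"])
    show "continuous_on {0..T} (\<lambda>t. x t - y t)"
      using x y by (intro continuous_intros) (auto simp: solves_def)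
    show "x t - y t = 0 + primitive T (\<lambda>s. \<beta> s (x s) - \<beta> s (y s)) t + (w t - w' t)" if "t \<in> {0..T}" for t
    proof -
      have "primitive T (\<lambda>s. \<beta> s (x s) - \<beta> s (y s)) t
        = primitive T (\<lambda>s. \<beta> s (x s)) t - primitive T (\<lambda>s. \<beta> s (y s)) t"
        unfolding primitive_def left_diff_distrib using x y
        by (intro Bochner_Integration.integral_diff square_integrable_integrable_indicator square_integrable_drift)
           (auto simp: solves_def)
      then show ?thesis using x y that by (simp add: solves_def)
    qed
    show "\<beta> s (x s) - \<beta> s (y s) \<le> 0 + L * (x s - y s)" if "s \<in> {0..T}" "0 < x s - y s" for s
      using drift_less[OF that(1), of "y s" "x s"] that(2) by simp
  qed (use i in auto)
  then show ?thesis by simp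
qed

lemma solves_dist_le:
  assumes x: "solves x0 w x" and y: "solves x0 w' y"
    and m: "\<And>t. t \<in> {0..T} \<Longrightarrow> \<bar>w t - w' t\<bar> \<le> m" and t: "t \<in> {0..T}"
  shows "\<bar>x t - y t\<bar> \<le> 4 * m * exp (2 * L * T)"
  using solves_diff_le[OF x y m t] solves_diff_le[OF y x _ t, of m] m by (simp add: abs_minus_commute)

text \<open>Stated for a general \<gamma> because it is applied to \<beta> itself and to its
  truncation. The two bounds are the comparisons for x and for - x.\<close>

lemma linear_growth:
  assumes x: "continuous_on {0..T} x" and int: "integrable (lborel_upto T) (\<lambda>s. \<gamma> s (x s))"
    and eq: "\<And>t. t \<in> {0..T} \<Longrightarrow> x t = x0 + primitive T (\<lambda>s. \<gamma> s (x s)) t + w t"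
    and m: "\<And>t. t \<in> {0..T} \<Longrightarrow> \<bar>w t\<bar> \<le> m" and t: "t \<in> {0..T}"
    and pos: "\<And>s z. s \<in> {0..T} \<Longrightarrow> z > 0 \<Longrightarrow> \<gamma> s z \<le> K + L * z"
    and neg: "\<And>s z. s \<in> {0..T} \<Longrightarrow> z < 0 \<Longrightarrow> - \<gamma> s z \<le> K - L * z"
  shows "\<bar>x t\<bar> \<le> 2 * (\<bar>x0\<bar> + K * T + 2 * m) * exp (2 * L * T)"
proof -
  have "x t \<le> 2 * (\<bar>x0\<bar> + K * T + 2 * m) * exp (2 * L * T)"
    by (rule one_sided_comparison[OF T L K x int eq m _ t]) (use pos in auto)
  moreover have "(\<lambda>t. - x t) t \<le> 2 * (\<bar>- x0\<bar> + K * T + 2 * m) * exp (2 * L * T)"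
  proof (rule one_sided_comparison[OF T L K _ _ _ _ _ t, where \<phi>="\<lambda>s. - \<gamma> s (x s)" and \<eta>="\<lambda>t. - w t"])
    show "- \<gamma> s (x s) \<le> K + L * - x s" if "s \<in> {0..T}" "0 < - x s" for s
      using neg[OF that(1), of "x s"] that(2) by simp
    show "- x t = - x0 + primitive T (\<lambda>s. - \<gamma> s (x s)) t + - w t" if "t \<in> {0..T}" for t
      using eq[OF that] by (simp add: primitive_uminus)
  qed (use x int m in \<open>auto intro: continuous_intros\<close>)
  ultimately show ?thesis by simp
qed

lemma solves_bound:
  assumes x: "solves x0 w x" and m: "\<And>t. t \<in> {0..T} \<Longrightarrow> \<bar>w t\<bar> \<le> m" and t: "t \<in> {0..T}"
  shows "\<bar>x t\<bar> \<le> 2 * (\<bar>x0\<bar> + K * T + 2 * m) * exp (2 * L * T)"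
proof (rule linear_growth[OF _ _ _ m t, where \<gamma>=\<beta>])
  show "\<beta> s z \<le> K + L * z" if "s \<in> {0..T}" "z > 0" for s z
    using drift_less[OF that] drift_zero[OF that(1)] by simp
  show "- \<beta> s z \<le> K - L * z" if "s \<in> {0..T}" "z < 0" for s z
    using drift_less[OF that] drift_zero[OF that(1)] by simp
qed (use x square_integrable_integrable[OF square_integrable_drift] in \<open>auto simp: solves_def\<close>)

text \<open>The truncated drift is globally Lipschitz, and Banach's fixed point theorem solves its
  equation. The linear growth bound does not depend on the truncation level, so with the level
  chosen above it the truncation is never active.\<close>

lemma solves_exists:
  assumes w: "continuous_on {0..T} w"
  shows "\<exists>x. solves x0 w x"
proof -
  have "bounded (w ` {0..T})" by (intro compact_imp_bounded compact_continuous_image w) simp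
  then obtain m where m: "\<And>s. s \<in> {0..T} \<Longrightarrow> \<bar>w s\<bar> \<le> m" unfolding bounded_iff by fastforce
  have m0: "m \<ge> 0" using m[of 0] T by simp
  define R where "R = 2 * (\<bar>x0\<bar> + K * T + 2 * m) * exp (2 * L * T) + 1"
  have R: "R > 0" unfolding R_def using K T m0 by (intro add_nonneg_pos mult_nonneg_nonneg) auto
  define \<gamma> where "\<gamma> = (\<lambda>s x. \<beta> s (clip R x))"
  define \<Lambda> where "\<Lambda> = L * (1 + R ^ q + R ^ q)"
  have \<Lambda>: "\<Lambda> > 0" using L R by (simp add: \<Lambda>_def add_pos_nonneg)
  have clip: "\<bar>clip R x\<bar> \<le> R" "\<bar>clip R x - clip R y\<bar> \<le> \<bar>x - y\<bar>" for x y
    using R by (auto simp: clip_def)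
  have lip: "\<bar>\<gamma> s x - \<gamma> s y\<bar> \<le> \<Lambda> * \<bar>x - y\<bar>" if "s \<in> {0..T}" for s x y
  proof -
    have "\<bar>\<gamma> s x - \<gamma> s y\<bar> \<le> L * (1 + \<bar>clip R x\<bar> ^ q + \<bar>clip R y\<bar> ^ q) * \<bar>clip R x - clip R y\<bar>"
      unfolding \<gamma>_def by (rule drift_growth[OF that])
    also have "\<dots> \<le> \<Lambda> * \<bar>x - y\<bar>"
      unfolding \<Lambda>_def using L clip R by (intro mult_mono add_mono power_mono order_refl) (auto intro!: add_nonneg_nonneg mult_nonneg_nonneg)
    finally show ?thesis .
  qed
  have cc: "continuous_on {0..T} (\<lambda>s. clip R (x s))" if "continuous_on {0..T} x" for x
    unfolding clip_def by (intro continuous_intros that)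
  have sq: "square_integrable (lborel_upto T) (\<lambda>s. \<gamma> s (x s))" if "continuous_on {0..T} x" for x
    unfolding \<gamma>_def by (rule square_integrable_drift[OF cc[OF that]])
  \<comment> \<open>The fixed point theorem is applied to bounded continuous functions on the whole
    line; clamping the time to {0..T} carries the equation there.\<close>
  define c where "c = (\<lambda>t. max 0 (min T t))"
  have c: "c t \<in> {0..T}" for t using T by (simp add: c_def)
  have c_cont: "continuous_on UNIV c" unfolding c_def by (intro continuous_intros)
  define l where "l = 2 * \<Lambda>"
  have l: "l > 0" using \<Lambda> by (simp add: l_def)
  \<comment> \<open>The unknown is y t = exp (- l * t) * x t, so the uniform distance of y is an
    exponentially weighted distance of x; with l = 2 * \<Lambda> the map contracts by 1/2.\<close>
  define \<Phi> where "\<Phi> = (\<lambda>y t. exp (- (l * c t)) * (x0 + primitive T (\<lambda>s. \<gamma> s (exp (l * s) * y s)) (c t) + w (c t)))"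
  have yc: "continuous_on {0..T} (\<lambda>s. exp (l * s) * apply_bcontfun y s)" for y :: "real \<Rightarrow>\<^sub>C real"
    by (intro continuous_intros continuous_on_apply_bcontfun)
  have \<Phi>b: "\<Phi> (apply_bcontfun y) \<in> bcontfun" for y
  proof -
    define H where "H = (\<lambda>t. exp (- (l * t)) * (x0 + primitive T (\<lambda>s. \<gamma> s (exp (l * s) * apply_bcontfun y s)) t + w t))"
    have H: "continuous_on {0..T} H"
      unfolding H_def by (intro continuous_intros primitive_continuous sq yc w)
    have \<Phi>H: "\<Phi> (apply_bcontfun y) = (\<lambda>t. H (c t))" by (simp add: \<Phi>_def H_def)
    have "continuous_on UNIV (\<lambda>t. H (c t))"
      by (rule continuous_on_compose2[OF H c_cont]) (use c in auto)
    moreover have "bounded (H ` {0..T})" by (intro compact_imp_bounded compact_continuous_image H) simp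
    then have "bounded (range (\<lambda>t. H (c t)))" by (rule bounded_subset) (use c in auto)
    ultimately show ?thesis unfolding \<Phi>H by (simp add: bcontfun_def)
  qed
  define F where "F = (\<lambda>y. Bcontfun (\<Phi> (apply_bcontfun y)))"
  have F: "apply_bcontfun (F y) = \<Phi> (apply_bcontfun y)" for y
    unfolding F_def by (rule Bcontfun_inverse[OF \<Phi>b])
  have "\<exists>!y. F y = y"
  proof (rule banach_fix_type[where c="1/2"])
    show "\<forall>y z. dist (F y) (F z) \<le> 1/2 * dist y z"
    proof (intro allI dist_bound)
      fix y z :: "real \<Rightarrow>\<^sub>C real" and t :: real
      let ?gy = "\<lambda>s. \<gamma> s (exp (l * s) * apply_bcontfun y s)" and ?gz = "\<lambda>s. \<gamma> s (exp (l * s) * apply_bcontfun z s)"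
      have D: "\<bar>?gy s - ?gz s\<bar> \<le> 0 + \<Lambda> * dist y z * exp (l * s)" if "s \<in> {0..T}" for s
      proof -
        have "\<bar>?gy s - ?gz s\<bar> \<le> \<Lambda> * (exp (l * s) * \<bar>apply_bcontfun y s - apply_bcontfun z s\<bar>)"
          using lip[OF that, of "exp (l * s) * apply_bcontfun y s" "exp (l * s) * apply_bcontfun z s"]
          by (simp add: abs_mult flip: right_diff_distrib)
        also have "\<dots> \<le> \<Lambda> * (exp (l * s) * dist y z)"
          using dist_bounded[of y s z] \<Lambda> by (intro mult_left_mono) (auto simp: dist_real_def)
        finally show ?thesis by (simp add: ac_simps)
      qed
      have pd: "primitive T (\<lambda>s. f s - g s) r = primitive T f r - primitive T g r"
        if "square_integrable (lborel_upto T) f" "square_integrable (lborel_upto T) g" for f g r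
        unfolding primitive_def left_diff_distrib using that
        by (intro Bochner_Integration.integral_diff square_integrable_integrable_indicator) auto
      have one: "primitive T (\<lambda>s. f s - g s) (c t) \<le> dist y z / 2 * exp (l * c t)"
        if f: "square_integrable (lborel_upto T) f" and g: "square_integrable (lborel_upto T) g"
          and fg: "\<And>s. s \<in> {0..T} \<Longrightarrow> f s - g s \<le> 0 + \<Lambda> * dist y z * exp (l * s)" for f g
      proof -
        have "primitive T (\<lambda>s. f s - g s) (c t) - primitive T (\<lambda>s. f s - g s) 0
            \<le> 0 * T + \<Lambda> * dist y z / l * exp (l * c t)"
          by (rule primitive_increment_le_exp) (use f g fg c[of t] l \<Lambda> in \<open>auto intro!: square_integrable_integrable square_integrable_diff\<close>)
        then show ?thesis using \<Lambda> by (simp add: primitive_0 l_def)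
      qed
      have sy: "square_integrable (lborel_upto T) ?gy" "square_integrable (lborel_upto T) ?gz"
        by (intro sq yc)+
      have "\<bar>primitive T ?gy (c t) - primitive T ?gz (c t)\<bar> \<le> dist y z / 2 * exp (l * c t)"
        using one[OF sy(1,2)] one[OF sy(2,1)] D pd[OF sy(1,2), of "c t"] pd[OF sy(2,1), of "c t"]
        by (smt (verit))
      then have "exp (- (l * c t)) * \<bar>primitive T ?gy (c t) - primitive T ?gz (c t)\<bar>
          \<le> exp (- (l * c t)) * (dist y z / 2 * exp (l * c t))"
        by (intro mult_left_mono) auto
      also have "\<dots> = 1/2 * dist y z" by (simp add: exp_minus field_simps)
      finally show "dist (apply_bcontfun (F y) t) (apply_bcontfun (F z) t) \<le> 1/2 * dist y z"
        unfolding F \<Phi>_def dist_real_def by (simp add: abs_mult flip: right_diff_distrib)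
    qed
  qed auto
  then obtain y where y: "F y = y" by blast
  define x where "x = (\<lambda>s. exp (l * s) * apply_bcontfun y s)"
  have xc: "continuous_on {0..T} x" unfolding x_def by (rule yc)
  have xeq: "x t = x0 + primitive T (\<lambda>s. \<gamma> s (x s)) t + w t" if t: "t \<in> {0..T}" for t
  proof -
    have "c t = t" using t by (auto simp: c_def)
    then have "apply_bcontfun y t = exp (- (l * t)) * (x0 + primitive T (\<lambda>s. \<gamma> s (x s)) t + w t)"
      using fun_cong[OF F[of y, unfolded y], of t] by (simp add: \<Phi>_def x_def)
    then show ?thesis by (simp add: x_def exp_minus field_simps)
  qed
  have bound: "\<bar>x t\<bar> \<le> R" if t: "t \<in> {0..T}" for t
  proof -
    have "\<bar>x t\<bar> \<le> 2 * (\<bar>x0\<bar> + K * T + 2 * m) * exp (2 * L * T)"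
    proof (rule linear_growth[where \<gamma>=\<gamma>, OF xc _ xeq m t])
      show "integrable (lborel_upto T) (\<lambda>s. \<gamma> s (x s))" by (rule square_integrable_integrable[OF sq[OF xc]])
      show "\<gamma> s z \<le> K + L * z" if "s \<in> {0..T}" "z > 0" for s z
      proof -
        have "0 < clip R z" "clip R z \<le> z" using R that by (auto simp: clip_def)
        then show ?thesis
          using drift_less[OF that(1), of 0 "clip R z"] drift_zero[OF that(1)] L
          by (simp add: \<gamma>_def) (smt (verit) mult_left_mono)
      qed
      show "- \<gamma> s z \<le> K - L * z" if "s \<in> {0..T}" "z < 0" for s z
      proof -
        have "clip R z < 0" "z \<le> clip R z" using R that by (auto simp: clip_def)
        then show ?thesis
          using drift_less[OF that(1), of "clip R z" 0] drift_zero[OF that(1)] L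
          by (simp add: \<gamma>_def) (smt (verit) mult_left_mono)
      qed
    qed
    then show ?thesis by (simp add: R_def)
  qed
  have "primitive T (\<lambda>s. \<gamma> s (x s)) t = primitive T (\<lambda>s. \<beta> s (x s)) t" for t
    unfolding primitive_def
  proof (rule Bochner_Integration.integral_cong)
    fix s assume "s \<in> space (lborel_upto T)"
    then have "\<bar>x s\<bar> \<le> R" by (intro bound) (simp add: space_restrict_space)
    then have "clip R (x s) = x s" by (auto simp: clip_def)
    then show "\<gamma> s (x s) * indicator {0..t} s = \<beta> s (x s) * indicator {0..t} s" by (simp add: \<gamma>_def)
  qed simp
  with xc xeq have "solves x0 w x" by (simp add: solves_def)
  then show ?thesis by blast
qed

end

section \<open>The empirical drift and the path functional\<close>

lemma empirical_measure_P2: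
  assumes "N \<ge> 1"
  shows "empirical_measure N y \<in> P2"
proof -
  have p: "prob_space (uniform_count_measure {..<N})"
    by (rule prob_space_uniform_count_measure) (use assms in \<open>auto simp: lessThan_empty_iff\<close>)
  have m: "y \<in> uniform_count_measure {..<N} \<rightarrow>\<^sub>M borel"
    by (simp add: uniform_count_measure_def)
  have "integrable (uniform_count_measure {..<N}) (\<lambda>i. (y i)\<^sup>2)"
    unfolding uniform_count_measure_def by (rule integrable_point_measure_finite) simp
  then have "integrable (distr (uniform_count_measure {..<N}) borel y) (\<lambda>x. x\<^sup>2)"
    by (subst integrable_distr_eq[OF m]) auto
  moreover have "prob_space (distr (uniform_count_measure {..<N}) borel y)"
    by (rule prob_space.prob_space_distr[OF p m])
  ultimately show ?thesis by (simp add: P2_def empirical_measure_def)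
qed

text \<open>The coupling that pairs particles with equal labels bounds the infimum from
  above.\<close>

lemma wasserstein2_empirical_le:
  assumes N: "N \<ge> 1" and D: "\<And>i. i < N \<Longrightarrow> \<bar>y i - z i\<bar> \<le> D"
  shows "wasserstein2 (empirical_measure N y) (empirical_measure N z) \<le> D"
proof -
  let ?U = "uniform_count_measure {..<N}"
  interpret prob_space ?U
    by (rule prob_space_uniform_count_measure) (use N in \<open>auto simp: lessThan_empty_iff\<close>)
  have D0: "D \<ge> 0" using D[of 0] N by simp
  define \<pi> where "\<pi> = distr ?U (borel \<Otimes>\<^sub>M borel) (\<lambda>i. (y i, z i))"
  have m: "(\<lambda>i. (y i, z i)) \<in> ?U \<rightarrow>\<^sub>M borel \<Otimes>\<^sub>M borel"
    by (simp add: uniform_count_measure_def space_pair_measure)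
  have c: "\<pi> \<in> couplings (empirical_measure N y) (empirical_measure N z)"
    using m by (auto simp: couplings_def empirical_measure_def \<pi>_def distr_distr comp_def)
  have "(LINT u|\<pi>. (fst u - snd u)\<^sup>2) = (LINT i|?U. (y i - z i)\<^sup>2)"
    unfolding \<pi>_def by (subst integral_distr[OF m]) (auto)
  also have "\<dots> \<le> (LINT i|?U. D\<^sup>2)"
  proof (rule integral_mono)
    show "integrable ?U (\<lambda>i. (y i - z i)\<^sup>2)"
      unfolding uniform_count_measure_def by (rule integrable_point_measure_finite) simp
    show "(y i - z i)\<^sup>2 \<le> D\<^sup>2" if "i \<in> space ?U" for i
      using D[of i] that power_mono[of "\<bar>y i - z i\<bar>" D 2] by (simp add: space_uniform_count_measure)
  qed simp
  also have "\<dots> = D\<^sup>2" by (simp add: prob_space)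
  finally have le: "(LINT u|\<pi>. (fst u - snd u)\<^sup>2) \<le> D\<^sup>2" .
  have "(INF \<pi>\<in>couplings (empirical_measure N y) (empirical_measure N z). (LINT u|\<pi>. (fst u - snd u)\<^sup>2))
      \<le> (LINT u|\<pi>. (fst u - snd u)\<^sup>2)"
    by (rule cINF_lower[OF _ c]) (auto intro!: bdd_belowI2[where m=0])
  with le have "wasserstein2 (empirical_measure N y) (empirical_measure N z) \<le> sqrt (D\<^sup>2)"
    unfolding wasserstein2_def by (intro real_sqrt_le_mono) linarith
  then show ?thesis using D0 by simp
qed

context
  fixes T L :: real and N q :: nat and b :: "real \<Rightarrow> real \<Rightarrow> real measure \<Rightarrow> real"
  assumes T: "T > 0" and L: "L > 0" and N: "N \<ge> 1"
    and b_time: "\<And>x \<mu>. \<mu> \<in> P2 \<Longrightarrow> continuous_on {0..T} (\<lambda>t. b t x \<mu>)"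
    and b_onesided: "\<And>t x x' \<mu>. t \<in> {0..T} \<Longrightarrow> \<mu> \<in> P2 \<Longrightarrow>
          (x - x') * (b t x \<mu> - b t x' \<mu>) \<le> L * \<bar>x - x'\<bar>\<^sup>2"
    and b_measure: "\<And>t x \<mu> \<mu>'. t \<in> {0..T} \<Longrightarrow> \<mu> \<in> P2 \<Longrightarrow> \<mu>' \<in> P2 \<Longrightarrow>
          \<bar>b t x \<mu> - b t x \<mu>'\<bar> \<le> wasserstein2 \<mu> \<mu>'"
    and b_growth: "\<And>t x x' \<mu>. t \<in> {0..T} \<Longrightarrow> \<mu> \<in> P2 \<Longrightarrow>
          \<bar>b t x \<mu> - b t x' \<mu>\<bar> \<le> L * (1 + \<bar>x\<bar> ^ q + \<bar>x'\<bar> ^ q) * \<bar>x - x'\<bar>"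
begin

text \<open>Changing the state, the measure and the time one after another gives the three terms of
  R. With the vector of particles in place of the measure the drift becomes continuous on a product
  of real lines, so its composition with Borel particle paths is measurable.\<close>

lemma drift_jointly_continuous:
  "continuous_on ({0..T} \<times> UNIV \<times> UNIV) (\<lambda>(s, x, y). b s x (empirical_measure N y))"
  unfolding continuous_on_def
proof
  fix p :: "real \<times> real \<times> (nat \<Rightarrow> real)"
  assume p: "p \<in> {0..T} \<times> UNIV \<times> UNIV"
  obtain s x y where p_def: "p = (s, x, y)" by (cases p) auto
  let ?F = "at p within {0..T} \<times> UNIV \<times> UNIV"
  let ?E = "empirical_measure N"
  have s: "s \<in> {0..T}" using p by (simp add: p_def)
  define R where "R = (\<lambda>p' :: real \<times> real \<times> (nat \<Rightarrow> real).
      L * (1 + \<bar>fst (snd p')\<bar> ^ q + \<bar>x\<bar> ^ q) * \<bar>fst (snd p') - x\<bar> + (\<Sum>i<N. \<bar>snd (snd p') i - y i\<bar>)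
      + \<bar>b (fst p') x (?E y) - b s x (?E y)\<bar>)"
  have id: "((\<lambda>p'. p') \<longlongrightarrow> p) ?F" by (rule tendsto_ident_at)
  have t1: "((\<lambda>p'. fst p') \<longlongrightarrow> s) ?F" using tendsto_fst[OF id] by (simp add: p_def)
  have t2: "((\<lambda>p'. fst (snd p')) \<longlongrightarrow> x) ?F" using tendsto_fst[OF tendsto_snd[OF id]] by (simp add: p_def)
  have t3: "((\<lambda>p'. snd (snd p') i) \<longlongrightarrow> y i) ?F" for i
  proof -
    have "continuous_on UNIV (\<lambda>p' :: real \<times> real \<times> (nat \<Rightarrow> real). snd (snd p') i)"
      by (rule continuous_on_product_then_coordinatewise) (intro continuous_intros)
    then have "isCont (\<lambda>p' :: real \<times> real \<times> (nat \<Rightarrow> real). snd (snd p') i) p"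
      using continuous_on_eq_continuous_at[OF open_UNIV] by blast
    then have "((\<lambda>p'. snd (snd p') i) \<longlongrightarrow> snd (snd p) i) (at p)" by (simp add: isCont_def)
    then have "((\<lambda>p'. snd (snd p') i) \<longlongrightarrow> snd (snd p) i) ?F" by (rule tendsto_within_subset) simp
    then show ?thesis by (simp add: p_def)
  qed
  have t4: "((\<lambda>p'. b (fst p') x (?E y)) \<longlongrightarrow> b s x (?E y)) ?F"
  proof (rule continuous_on_tendsto_compose[OF b_time[OF empirical_measure_P2[OF N]] t1 s])
    show "\<forall>\<^sub>F p' in ?F. fst p' \<in> {0..T}"
      unfolding eventually_at_filter by (rule always_eventually) auto
  qed
  have "(R \<longlongrightarrow> L * (1 + \<bar>x\<bar> ^ q + \<bar>x\<bar> ^ q) * \<bar>x - x\<bar> + (\<Sum>i<N. \<bar>y i - y i\<bar>) + \<bar>b s x (?E y) - b s x (?E y)\<bar>) ?F"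
    unfolding R_def by (intro tendsto_intros t2 t3 t4)
  then have R0: "(R \<longlongrightarrow> 0) ?F" by simp
  have le: "\<bar>b s' x' (?E y') - b s x (?E y)\<bar> \<le> R (s', x', y')" if s': "s' \<in> {0..T}" for s' x' y'
  proof -
    have "\<bar>b s' x' (?E y') - b s' x (?E y')\<bar> \<le> L * (1 + \<bar>x'\<bar> ^ q + \<bar>x\<bar> ^ q) * \<bar>x' - x\<bar>"
      by (rule b_growth[OF s' empirical_measure_P2[OF N]])
    moreover have "\<bar>b s' x (?E y') - b s' x (?E y)\<bar> \<le> wasserstein2 (?E y') (?E y)"
      by (rule b_measure[OF s' empirical_measure_P2[OF N] empirical_measure_P2[OF N]])
    moreover have "wasserstein2 (?E y') (?E y) \<le> (\<Sum>i<N. \<bar>y' i - y i\<bar>)"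
    proof (rule wasserstein2_empirical_le[OF N])
      show "\<bar>y' i - y i\<bar> \<le> (\<Sum>i<N. \<bar>y' i - y i\<bar>)" if "i < N" for i
        using member_le_sum[of i "{..<N}" "\<lambda>i. \<bar>y' i - y i\<bar>"] that by simp
    qed
    ultimately show ?thesis unfolding R_def fst_conv snd_conv by linarith
  qed
  have "((\<lambda>p'. (case p' of (s, x, y) \<Rightarrow> b s x (?E y)) - b s x (?E y)) \<longlongrightarrow> 0) ?F"
  proof (rule Lim_null_comparison[OF _ R0])
    show "\<forall>\<^sub>F p' in ?F. norm ((case p' of (s, x, y) \<Rightarrow> b s x (?E y)) - b s x (?E y)) \<le> R p'"
      unfolding eventually_at_filter real_norm_def
    proof (rule always_eventually, intro allI impI)
      fix p' :: "real \<times> real \<times> (nat \<Rightarrow> real)"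
      assume "p' \<in> {0..T} \<times> UNIV \<times> UNIV"
      then show "\<bar>(case p' of (s, x, y) \<Rightarrow> b s x (?E y)) - b s x (?E y)\<bar> \<le> R p'"
        using le by (cases p') simp
    qed
  qed
  then have "((\<lambda>p'. case p' of (s, x, y) \<Rightarrow> b s x (?E y)) \<longlongrightarrow> b s x (?E y)) ?F"
    by (rule LIM_zero_cancel)
  moreover have "(case p of (s, x, y) \<Rightarrow> b s x (?E y)) = b s x (?E y)" by (simp add: p_def)
  ultimately show "((\<lambda>(s, x, y). b s x (?E y)) \<longlongrightarrow> (case p of (s, x, y) \<Rightarrow> b s x (?E y))) ?F"
    by simp
qed

lemma monotone_drift_empirical_flow:
  assumes Y_borel: "\<And>i. i < N \<Longrightarrow> (\<lambda>t. Y i t \<omega>) \<in> borel_measurable (restrict_space borel {0..T})"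
    and Y_bounded: "\<And>i. i < N \<Longrightarrow> bounded ((\<lambda>t. Y i t \<omega>) ` {0..T})"
  shows "\<exists>K. monotone_drift T L K q (\<lambda>s x. b s x (empirical_flow N Y \<omega> s))"
proof -
  let ?E = "empirical_measure N"
  \<comment> \<open>Coordinates from N on do not affect the empirical measure; setting them to 0
    makes the whole sequence of coordinates measurable.\<close>
  have flow: "empirical_flow N Y \<omega> s = ?E (\<lambda>i. if i < N then Y i s \<omega> else 0)" for s
    unfolding empirical_flow_def empirical_measure_def
    by (rule distr_cong) (auto simp: space_uniform_count_measure)
  have flow_P2: "empirical_flow N Y \<omega> s \<in> P2" for s
    unfolding empirical_flow_def by (rule empirical_measure_P2[OF N])
  have meas: "(\<lambda>s. b s (x s) (empirical_flow N Y \<omega> s)) \<in> borel_measurable (lborel_upto T)"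
    if x: "continuous_on {0..T} x" for x
  proof -
    let ?S = "{0..T} \<times> UNIV \<times> UNIV :: (real \<times> real \<times> (nat \<Rightarrow> real)) set"
    have f: "(\<lambda>(s, x, y). b s x (?E y)) \<in> borel_measurable (restrict_space borel ?S)"
      by (rule borel_measurable_continuous_on_restrict[OF drift_jointly_continuous])
    have sets_eq: "sets (lborel_upto T) = sets (restrict_space borel {0..T})"
      by (rule sets_restrict_space_cong) simp
    have xm: "x \<in> borel_measurable (lborel_upto T)"
      using borel_measurable_continuous_on_restrict[OF x] by (simp add: measurable_cong_sets[OF sets_eq refl])
    have ym: "(\<lambda>s. \<lambda>i. if i < N then Y i s \<omega> else 0) \<in> borel_measurable (lborel_upto T)"
    proof (rule measurable_coordinatewise_then_product)
      fix i
      show "(\<lambda>s. if i < N then Y i s \<omega> else 0) \<in> borel_measurable (lborel_upto T)"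
        using Y_borel[of i] by (cases "i < N") (auto simp: measurable_cong_sets[OF sets_eq refl])
    qed
    have "(\<lambda>s. (s, x s, \<lambda>i. if i < N then Y i s \<omega> else 0)) \<in> lborel_upto T \<rightarrow>\<^sub>M restrict_space borel ?S"
    proof (rule measurable_restrict_space2)
      show "(\<lambda>s. (s, x s, \<lambda>i. if i < N then Y i s \<omega> else 0)) \<in> borel_measurable (lborel_upto T)"
        unfolding borel_prod[symmetric]
        by (intro measurable_Pair measurable_restrict_space1 xm ym) simp
    qed (auto simp: space_restrict_space)
    from measurable_compose[OF this f] show ?thesis by (simp add: flow)
  qed
  have "\<exists>B. \<forall>i<N. \<forall>t\<in>{0..T}. \<bar>Y i t \<omega>\<bar> \<le> B"
  proof -
    have "bounded (\<Union>i<N. (\<lambda>t. Y i t \<omega>) ` {0..T})" by (intro bounded_UN) (use Y_bounded in auto)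
    then obtain B where "\<And>z. z \<in> (\<Union>i<N. (\<lambda>t. Y i t \<omega>) ` {0..T}) \<Longrightarrow> \<bar>z\<bar> \<le> B"
      unfolding bounded_iff real_norm_def by blast
    then show ?thesis by (intro exI[of _ B]) blast
  qed
  then obtain B where B: "\<And>i t. i < N \<Longrightarrow> t \<in> {0..T} \<Longrightarrow> \<bar>Y i t \<omega>\<bar> \<le> B" by blast
  have "bounded ((\<lambda>t. b t 0 (?E (\<lambda>_. 0))) ` {0..T})"
    by (intro compact_imp_bounded compact_continuous_image b_time empirical_measure_P2[OF N]) simp
  then obtain C where C: "\<And>t. t \<in> {0..T} \<Longrightarrow> \<bar>b t 0 (?E (\<lambda>_. 0))\<bar> \<le> C"
    unfolding bounded_iff by fastforce
  have "0 \<le> B" using B[of 0 0] N T by simp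
  moreover have "0 \<le> C" using C[of 0] T by simp
  ultimately have BC: "0 \<le> B + C" by simp
  \<comment> \<open>At x = 0, B bounds the Wasserstein distance of the flow from N particles at the
    origin, and C bounds the drift for the latter configuration.\<close>
  have "monotone_drift T L (B + C) q (\<lambda>s x. b s x (empirical_flow N Y \<omega> s))"
  proof
    fix s x y assume s: "s \<in> {0..T}"
    have "\<bar>b s 0 (empirical_flow N Y \<omega> s) - b s 0 (?E (\<lambda>_. 0))\<bar>
        \<le> wasserstein2 (empirical_flow N Y \<omega> s) (?E (\<lambda>_. 0))"
      by (rule b_measure[OF s flow_P2 empirical_measure_P2[OF N]])
    also have "\<dots> \<le> B"
      unfolding empirical_flow_def by (rule wasserstein2_empirical_le[OF N]) (use B s in simp)
    finally show "\<bar>b s 0 (empirical_flow N Y \<omega> s)\<bar> \<le> B + C" using C[OF s] by linarith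
    show "(x - y) * (b s x (empirical_flow N Y \<omega> s) - b s y (empirical_flow N Y \<omega> s)) \<le> L * \<bar>x - y\<bar>\<^sup>2"
      by (rule b_onesided[OF s flow_P2])
    show "\<bar>b s x (empirical_flow N Y \<omega> s) - b s y (empirical_flow N Y \<omega> s)\<bar>
        \<le> L * (1 + \<bar>x\<bar> ^ q + \<bar>y\<bar> ^ q) * \<bar>x - y\<bar>"
      by (rule b_growth[OF s flow_P2])
  qed (use T L BC meas in auto)
  then show ?thesis by blast
qed

end

section \<open>The solution map and the functional on Wiener space\<close>

lemma decoupled_solution_iff:
  assumes drift: "monotone_drift T L K q (\<lambda>s x. b s x (\<mu> s))"
  shows "decoupled_solution T b \<sigma> x0 \<mu> w x \<longleftrightarrow> x \<in> extensional {0..T}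
    \<and> monotone_drift.solves T (\<lambda>s x. b s x (\<mu> s)) x0 (\<lambda>t. \<sigma> * w t) x"
proof -
  interpret monotone_drift T L K q "\<lambda>s x. b s x (\<mu> s)" by fact
  have sp: "x \<in> mspace (path_metric T) \<longleftrightarrow> continuous_on {0..T} x \<and> x \<in> extensional {0..T}"
    using paths_from_iff[of T x "x 0"] T by (auto simp: paths_from_def)
  have "set_integrable lborel {0..T} (\<lambda>s. b s (x s) (\<mu> s))" if "continuous_on {0..T} x"
    using square_integrable_integrable[OF square_integrable_drift[OF that]]
    by (simp add: set_integrable_def integrable_restrict_space)
  then show ?thesis
    unfolding decoupled_solution_def solves_def sp by (auto simp: set_integral_eq_primitive)
qed

text \<open>Existence for the driving path \<sigma> * w, and uniqueness from the Lipschitz estimate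
  at distance 0, justify the definite description in \<open>Xbar\<close>.\<close>

lemma Xbar_solves:
  assumes drift: "monotone_drift T L K q (\<lambda>s x. b s x (\<mu> s))" and w: "w \<in> wiener_space T"
  shows "monotone_drift.solves T (\<lambda>s x. b s x (\<mu> s)) x0 (\<lambda>t. \<sigma> * w t) (Xbar T b \<sigma> x0 \<mu> w)"
    and "Xbar T b \<sigma> x0 \<mu> w \<in> paths_from T x0"
proof -
  interpret monotone_drift T L K q "\<lambda>s x. b s x (\<mu> s)" by fact
  have wc: "continuous_on {0..T} w" and w0: "w 0 = 0" using w T by (auto simp: paths_from_iff)
  obtain x where x: "solves x0 (\<lambda>t. \<sigma> * w t) x"
    using solves_exists[of "\<lambda>t. \<sigma> * w t" x0] continuous_on_mult_left[OF wc, of \<sigma>] by blast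
  have prim: "primitive T (\<lambda>s. b s (restrict x {0..T} s) (\<mu> s)) t = primitive T (\<lambda>s. b s (x s) (\<mu> s)) t" for t
    unfolding primitive_def
    by (rule Bochner_Integration.integral_cong) (auto simp: space_restrict_space)
  have rc: "continuous_on {0..T} (restrict x {0..T})"
    by (rule continuous_on_eq[of "{0..T}" x]) (use x in \<open>auto simp: solves_def\<close>)
  have "decoupled_solution T b \<sigma> x0 \<mu> w (restrict x {0..T})"
    unfolding decoupled_solution_iff[where T=T and L=L and K=K and q=q and b=b and \<mu>=\<mu>, OF drift] using x rc prim by (auto simp: solves_def)
  moreover have "y = z" if y: "decoupled_solution T b \<sigma> x0 \<mu> w y" and z: "decoupled_solution T b \<sigma> x0 \<mu> w z" for y z
  proof (rule extensionalityI)
    show "y \<in> extensional {0..T}" "z \<in> extensional {0..T}"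
      using y z unfolding decoupled_solution_iff[where T=T and L=L and K=K and q=q and b=b and \<mu>=\<mu>, OF drift] by auto
    show "y t = z t" if "t \<in> {0..T}" for t
      using solves_dist_le[of x0 "\<lambda>t. \<sigma> * w t" y "\<lambda>t. \<sigma> * w t" z 0 t] that y z
      unfolding decoupled_solution_iff[where T=T and L=L and K=K and q=q and b=b and \<mu>=\<mu>, OF drift] by simp
  qed
  ultimately have ex1: "\<exists>!x. decoupled_solution T b \<sigma> x0 \<mu> w x" by blast
  have "decoupled_solution T b \<sigma> x0 \<mu> w (Xbar T b \<sigma> x0 \<mu> w)"
    unfolding Xbar_def by (rule theI'[OF ex1])
  then have *: "Xbar T b \<sigma> x0 \<mu> w \<in> extensional {0..T}" "solves x0 (\<lambda>t. \<sigma> * w t) (Xbar T b \<sigma> x0 \<mu> w)"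
    unfolding decoupled_solution_iff[where T=T and L=L and K=K and q=q and b=b and \<mu>=\<mu>, OF drift] by auto
  then show "solves x0 (\<lambda>t. \<sigma> * w t) (Xbar T b \<sigma> x0 \<mu> w)" by simp
  have "Xbar T b \<sigma> x0 \<mu> w 0 = x0" using *(2) T w0 by (simp add: solves_def primitive_0)
  with * show "Xbar T b \<sigma> x0 \<mu> w \<in> paths_from T x0"
    using T by (simp add: paths_from_iff solves_def)
qed

text \<open>Topological continuity is turned into a statement with uniform balls of nonstrict
  radius; halving the radius of the open ball leaves room for that.\<close>

lemma paths_from_continuous_mapD:
  assumes T: "T \<ge> 0" and G: "continuous_map
      (subtopology (mtopology_of (path_metric T)) (paths_from T x0)) euclideanreal G"
    and x: "x \<in> paths_from T x0" and e: "e > 0"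
  obtains d where "d > 0"
    "\<And>y. y \<in> paths_from T x0 \<Longrightarrow> (\<And>t. t \<in> {0..T} \<Longrightarrow> \<bar>y t - x t\<bar> \<le> d) \<Longrightarrow> \<bar>G y - G x\<bar> < e"
proof -
  interpret M: Metric_space "mspace (path_metric T)" "mdist (path_metric T)" by (rule Metric_space_mspace_mdist)
  have top: "mtopology_of (path_metric T) = M.mtopology" by (simp add: mtopology_of_def)
  have xs: "paths_from T x0 \<subseteq> mspace (path_metric T)" unfolding paths_from_def by blast
  have "openin (subtopology M.mtopology (paths_from T x0))
     {y \<in> topspace (subtopology M.mtopology (paths_from T x0)). G y \<in> ball (G x) e}"
    using G unfolding top by (rule openin_continuous_map_preimage) simp
  then obtain V where V: "openin M.mtopology V"
    and eq: "{y \<in> topspace (subtopology M.mtopology (paths_from T x0)). G y \<in> ball (G x) e} = V \<inter> paths_from T x0"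
    unfolding openin_subtopology by blast
  have "x \<in> V" using eq x xs e unfolding topspace_subtopology M.topspace_mtopology by auto
  then obtain r where r: "r > 0" "M.mball x r \<subseteq> V"
    using V unfolding M.openin_mtopology by blast
  show ?thesis
  proof (rule that[of "r/2"])
    show "r / 2 > 0" using r by simp
    fix y assume y: "y \<in> paths_from T x0" and d: "\<And>t. t \<in> {0..T} \<Longrightarrow> \<bar>y t - x t\<bar> \<le> r/2"
    have "mdist (path_metric T) x y \<le> r/2"
      by (rule mdist_cfunspace_le) (use r d in \<open>auto simp: dist_real_def abs_minus_commute\<close>)
    then have "y \<in> M.mball x r" using x y xs r(1) by (simp only: M.in_mball) auto
    then have "y \<in> V \<inter> paths_from T x0" using r y by blast
    then show "\<bar>G y - G x\<bar> < e" unfolding eq[symmetric] by (simp add: dist_real_def abs_minus_commute)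
  qed
qed

text \<open>Only these properties of \<open>Gbar\<close> enter the asymptotics. Subquadratic growth
  of the logarithm is expressed with an arbitrary \<eta>, which frees the class from the exponent
  \<alpha> and makes it stable under powers.\<close>

locale path_functional =
  fixes T :: real and g :: "(real \<Rightarrow> real) \<Rightarrow> real"
  assumes T: "T > 0"
    and nonneg: "\<And>w. w \<in> wiener_space T \<Longrightarrow> g w \<ge> 0"
    and cont: "\<And>w e. w \<in> wiener_space T \<Longrightarrow> e > 0 \<Longrightarrow> \<exists>d>0. \<forall>w'\<in>wiener_space T.
          (\<forall>t\<in>{0..T}. \<bar>w' t - w t\<bar> \<le> d) \<longrightarrow> \<bar>g w' - g w\<bar> < e"
    and growth: "\<And>\<eta>. \<eta> > 0 \<Longrightarrow> \<exists>K. \<forall>w\<in>wiener_space T. \<forall>m. (\<forall>t\<in>{0..T}. \<bar>w t\<bar> \<le> m) \<longrightarrow> g w \<le> exp (K + \<eta> * m\<^sup>2)"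

text \<open>Second moments contain the square of the functional. The growth bound for the power
  comes from the one for g at \<eta> / p.\<close>

lemma path_functional_power:
  assumes "path_functional T g" "p > 0"
  shows "path_functional T (\<lambda>w. g w ^ p)"
proof -
  interpret path_functional T g by fact
  show ?thesis
  proof
    show "\<exists>d>0. \<forall>w'\<in>wiener_space T. (\<forall>t\<in>{0..T}. \<bar>w' t - w t\<bar> \<le> d) \<longrightarrow> \<bar>g w' ^ p - g w ^ p\<bar> < e"
      if w: "w \<in> wiener_space T" and e: "e > 0" for w e
    proof -
      have "isCont (\<lambda>x::real. x ^ p) (g w)" by (intro continuous_intros)
      then obtain r where r: "r > 0" "\<And>y. \<bar>y - g w\<bar> < r \<Longrightarrow> \<bar>y ^ p - g w ^ p\<bar> < e"
        using e by (auto simp: continuous_at_eps_delta dist_real_def)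
      from cont[OF w r(1)] r(2) show ?thesis by blast
    qed
    show "\<exists>K. \<forall>w\<in>wiener_space T. \<forall>m. (\<forall>t\<in>{0..T}. \<bar>w t\<bar> \<le> m) \<longrightarrow> g w ^ p \<le> exp (K + \<eta> * m\<^sup>2)"
      if \<eta>: "\<eta> > 0" for \<eta>
    proof -
      obtain K where K: "\<And>w m. w \<in> wiener_space T \<Longrightarrow> \<forall>t\<in>{0..T}. \<bar>w t\<bar> \<le> m \<Longrightarrow> g w \<le> exp (K + \<eta> / p * m\<^sup>2)"
        using growth[of "\<eta> / p"] \<eta> assms(2) by auto
      have "g w ^ p \<le> exp (p * K + \<eta> * m\<^sup>2)" if "w \<in> wiener_space T" "\<forall>t\<in>{0..T}. \<bar>w t\<bar> \<le> m" for w m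
      proof -
        have "g w ^ p \<le> exp (K + \<eta> / p * m\<^sup>2) ^ p"
          by (rule power_mono[OF K[OF that] nonneg[OF that(1)]])
        also have "\<dots> = exp (p * K + \<eta> * m\<^sup>2)"
          using assms(2) by (simp add: exp_of_nat_mult[symmetric] distrib_left)
        finally show ?thesis .
      qed
      then show ?thesis by blast
    qed
  qed (use T nonneg in auto)
qed

lemma elog_le_imp_le_exp:
  assumes "x \<ge> 0" "elog (ennreal x) \<le> ereal c"
  shows "x \<le> exp c"
proof (cases "x = 0")
  case False
  then have "x > 0" using assms(1) by simp
  then have "ln x \<le> c" using assms by (simp add: elog_def)
  then show ?thesis using \<open>x > 0\<close> by (metis exp_le_cancel_iff exp_ln)
qed simp

lemma powr_subquadratic:
  fixes A \<alpha> \<eta> :: real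
  assumes "\<eta> > 0" "1 \<le> \<alpha>" "\<alpha> < 2" "A \<ge> 0"
  shows "\<exists>K. \<forall>m\<ge>0. A * m powr \<alpha> \<le> K + \<eta> * m\<^sup>2"
proof -
  \<comment> \<open>For A > 0 this is the point where A * m powr \<alpha> and \<eta> * m^2 cross:
    below it the former is bounded, above it the latter dominates.\<close>
  define M where "M = (A / \<eta>) powr (1 / (2 - \<alpha>))"
  have "A * m powr \<alpha> \<le> A * M powr \<alpha> + \<eta> * m\<^sup>2" if m: "m \<ge> 0" for m
  proof (cases "m \<le> M")
    case True
    then have "A * m powr \<alpha> \<le> A * M powr \<alpha>" using assms m by (intro mult_left_mono powr_mono2) auto
    moreover have "0 \<le> \<eta> * m\<^sup>2" using assms by simp
    ultimately show ?thesis by linarith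
  next
    case False
    then have m0: "m > 0" and mM: "M < m" using m by (auto simp: M_def not_le intro: le_less_trans[OF powr_ge_zero])
    have "A / \<eta> \<le> m powr (2 - \<alpha>)"
    proof (cases "A = 0")
      case False
      then have "A / \<eta> = M powr (2 - \<alpha>)" using assms by (simp add: M_def powr_powr)
      also have "\<dots> \<le> m powr (2 - \<alpha>)" using assms mM by (intro powr_mono2) (auto simp: M_def)
      finally show ?thesis .
    qed simp
    then have "A \<le> \<eta> * m powr (2 - \<alpha>)" using assms by (simp add: field_simps)
    then have "A * m powr \<alpha> \<le> (\<eta> * m powr (2 - \<alpha>)) * m powr \<alpha>" by (intro mult_right_mono) auto
    also have "\<dots> = \<eta> * m\<^sup>2" using m0 by (simp add: mult.assoc powr_add[symmetric])
    also have "\<dots> \<le> A * M powr \<alpha> + \<eta> * m\<^sup>2" using assms by simp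
    finally show ?thesis .
  qed
  then show ?thesis by blast
qed

lemma path_functional_Gbar:
  assumes drift: "monotone_drift T L K q (\<lambda>s x. b s x (\<mu> s))" and \<sigma>: "\<sigma> > 0"
    and G_nonneg: "\<And>x. x \<in> paths_from T x0 \<Longrightarrow> G x \<ge> 0"
    and G_cont: "continuous_map
          (subtopology (mtopology_of (path_metric T)) (paths_from T x0)) euclideanreal G"
    and C: "C1 > 0" "C2 > 0" "1 \<le> \<alpha>" "\<alpha> < 2"
    and G_growth: "\<And>x. x \<in> paths_from T x0 \<Longrightarrow>
          elog (ennreal (G x)) \<le> ereal (C1 + C2 * (SUP t\<in>{0..T}. \<bar>x t\<bar> powr \<alpha>))"
  shows "path_functional T (Gbar T b \<sigma> x0 G \<mu>)"
proof -
  interpret monotone_drift T L K q "\<lambda>s x. b s x (\<mu> s)" by fact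
  let ?X = "Xbar T b \<sigma> x0 \<mu>"
  define E where "E = exp (2 * L * T)"
  have E: "E > 0" by (simp add: E_def)
  note X = Xbar_solves[where T=T and L=L and K=K and q=q and b=b and \<mu>=\<mu> and \<sigma>=\<sigma> and ?x0.0=x0, OF drift]
  show ?thesis
  proof
    show "0 < T" by (rule T)
    show "0 \<le> Gbar T b \<sigma> x0 G \<mu> w" if "w \<in> wiener_space T" for w
      unfolding Gbar_def by (intro G_nonneg X that)
    show "\<exists>d>0. \<forall>w'\<in>wiener_space T. (\<forall>t\<in>{0..T}. \<bar>w' t - w t\<bar> \<le> d) \<longrightarrow>
        \<bar>Gbar T b \<sigma> x0 G \<mu> w' - Gbar T b \<sigma> x0 G \<mu> w\<bar> < e" if w: "w \<in> wiener_space T" and e: "e > 0" for w e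
    proof -
      obtain d where d: "d > 0" and D: "\<And>y. y \<in> paths_from T x0 \<Longrightarrow>
          (\<And>t. t \<in> {0..T} \<Longrightarrow> \<bar>y t - ?X w t\<bar> \<le> d) \<Longrightarrow> \<bar>G y - G (?X w)\<bar> < e"
        using paths_from_continuous_mapD[OF less_imp_le[OF T] G_cont X(2)[OF w] e] by blast
      show ?thesis
      proof (intro exI conjI ballI impI)
        show "d / (4 * \<sigma> * E) > 0" using d \<sigma> E by simp
        fix w' assume w': "w' \<in> wiener_space T" and le: "\<forall>t\<in>{0..T}. \<bar>w' t - w t\<bar> \<le> d / (4 * \<sigma> * E)"
        have "\<bar>?X w' t - ?X w t\<bar> \<le> d" if t: "t \<in> {0..T}" for t
        proof -
          have "\<bar>?X w' t - ?X w t\<bar> \<le> 4 * (\<sigma> * (d / (4 * \<sigma> * E))) * exp (2 * L * T)"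
          proof (rule solves_dist_le[OF X(1)[OF w'] X(1)[OF w] _ t])
            fix t assume "t \<in> {0..T}"
            then have "\<sigma> * \<bar>w' t - w t\<bar> \<le> \<sigma> * (d / (4 * \<sigma> * E))" using le \<sigma> by (intro mult_left_mono) auto
            then show "\<bar>\<sigma> * w' t - \<sigma> * w t\<bar> \<le> \<sigma> * (d / (4 * \<sigma> * E))"
              using \<sigma> by (simp add: abs_mult flip: right_diff_distrib)
          qed
          also have "\<dots> = d" using \<sigma> E by (simp add: E_def[symmetric])
          finally show ?thesis .
        qed
        then show "\<bar>Gbar T b \<sigma> x0 G \<mu> w' - Gbar T b \<sigma> x0 G \<mu> w\<bar> < e"
          unfolding Gbar_def by (intro D X(2)[OF w'])
      qed
    qed
    show "\<exists>K'. \<forall>w\<in>wiener_space T. \<forall>m. (\<forall>t\<in>{0..T}. \<bar>w t\<bar> \<le> m) \<longrightarrow> Gbar T b \<sigma> x0 G \<mu> w \<le> exp (K' + \<eta> * m\<^sup>2)"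
      if \<eta>: "\<eta> > 0" for \<eta>
    proof -
      define p r where "p = 2 * (\<bar>x0\<bar> + K * T) * E" and "r = 4 * \<sigma> * E"
      have p: "p \<ge> 0" and r: "r > 0" using K T E \<sigma> by (auto simp: p_def r_def)
      \<comment> \<open>The solution is bounded by p + r * m, whose square is at most 2 * p^2 + 2 *
        r^2 * m^2; the factor \<eta> / (2 * r^2) leaves exactly \<eta> * m^2.\<close>
      obtain K' where K': "\<And>m. m \<ge> 0 \<Longrightarrow> C2 * m powr \<alpha> \<le> K' + \<eta> / (2 * r\<^sup>2) * m\<^sup>2"
        using powr_subquadratic[of "\<eta> / (2 * r\<^sup>2)" \<alpha> C2] \<eta> r C by auto
      have "Gbar T b \<sigma> x0 G \<mu> w \<le> exp ((C1 + K' + \<eta> * p\<^sup>2 / r\<^sup>2) + \<eta> * m\<^sup>2)"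
        if w: "w \<in> wiener_space T" and le: "\<forall>t\<in>{0..T}. \<bar>w t\<bar> \<le> m" for w m
      proof -
        have m: "m \<ge> 0" using le T by (auto dest!: bspec[of _ _ 0])
        have b: "\<bar>?X w t\<bar> \<le> p + r * m" if t: "t \<in> {0..T}" for t
        proof -
          have "\<bar>?X w t\<bar> \<le> 2 * (\<bar>x0\<bar> + K * T + 2 * (\<sigma> * m)) * exp (2 * L * T)"
            by (rule solves_bound[OF X(1)[OF w] _ t]) (use le \<sigma> in \<open>auto simp: abs_mult intro: mult_left_mono\<close>)
          then show ?thesis by (simp add: p_def r_def E_def algebra_simps)
        qed
        have "(SUP t\<in>{0..T}. \<bar>?X w t\<bar> powr \<alpha>) \<le> (p + r * m) powr \<alpha>"
          by (rule cSUP_least) (use T b C in \<open>auto intro: powr_mono2\<close>)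
        then have "C2 * (SUP t\<in>{0..T}. \<bar>?X w t\<bar> powr \<alpha>) \<le> C2 * (p + r * m) powr \<alpha>"
          using C by (intro mult_left_mono) auto
        also have "\<dots> \<le> K' + \<eta> / (2 * r\<^sup>2) * (p + r * m)\<^sup>2"
          by (rule K') (use p r m in auto)
        also have "\<dots> \<le> K' + \<eta> / (2 * r\<^sup>2) * (2 * p\<^sup>2 + 2 * (r * m)\<^sup>2)"
        proof -
          have "(p + r * m)\<^sup>2 \<le> 2 * p\<^sup>2 + 2 * (r * m)\<^sup>2"
            using zero_le_power2[of "p - r * m"] by (simp add: power2_sum power2_diff)
          then show ?thesis using \<eta> by (intro add_left_mono mult_left_mono) auto
        qed
        also have "\<dots> = K' + \<eta> * p\<^sup>2 / r\<^sup>2 + \<eta> * m\<^sup>2"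
          using r by (simp add: field_simps)
        finally have le2: "C1 + C2 * (SUP t\<in>{0..T}. \<bar>?X w t\<bar> powr \<alpha>) \<le> (C1 + K' + \<eta> * p\<^sup>2 / r\<^sup>2) + \<eta> * m\<^sup>2"
          by simp
        have "elog (ennreal (G (?X w))) \<le> ereal ((C1 + K' + \<eta> * p\<^sup>2 / r\<^sup>2) + \<eta> * m\<^sup>2)"
          using G_growth[OF X(2)[OF w]] le2 by (auto intro: order_trans)
        then show ?thesis
          unfolding Gbar_def by (rule elog_le_imp_le_exp[rotated]) (intro G_nonneg X(2)[OF w])
      qed
      then show ?thesis by blast
    qed
  qed
qed

section \<open>Wiener integrals\<close>

definition valid_steps :: "real \<Rightarrow> (real \<times> real \<times> real) list \<Rightarrow> bool" where
  "valid_steps T cs \<longleftrightarrow> (\<forall>(c, a, b)\<in>set cs. 0 \<le> a \<and> a \<le> b \<and> b \<le> T)"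

text \<open>At a Brownian path this is the step integral; for a valid list, at the function t |->
  \<open>indicator {s..} t\<close> it is the value of the step function at s. An identity valid for
  all w therefore settles both at once.\<close>

definition increment_sum :: "(real \<Rightarrow> real) \<Rightarrow> (real \<times> real \<times> real) list \<Rightarrow> real" where
  "increment_sum w cs = (\<Sum>(c, a, b)\<leftarrow>cs. c * (w b - w a))"

lemma increment_sum_Nil [simp]: "increment_sum w [] = 0"
  and increment_sum_Cons [simp]: "increment_sum w ((c, a, b) # cs) = c * (w b - w a) + increment_sum w cs"
  and increment_sum_append [simp]: "increment_sum w (cs @ cs') = increment_sum w cs + increment_sum w cs'"
  by (simp_all add: increment_sum_def)

lemma step_integral_eq: "step_integral W cs \<omega> = increment_sum (\<lambda>t. W t \<omega>) cs"
  by (simp add: step_integral_def increment_sum_def)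

lemma step_fun_eq:
  assumes "valid_steps T cs"
  shows "step_fun cs s = increment_sum (\<lambda>t. indicator {s..} t) cs"
proof -
  have "indicator {a<..b} s = (indicator {s..} b - indicator {s..} a :: real)" if "a \<le> b" for a b
    using that by (auto simp: indicator_def)
  then show ?thesis
    using assms unfolding step_fun_def increment_sum_def valid_steps_def
    by (intro arg_cong[of _ _ sum_list] map_cong) auto
qed

definition scale_steps :: "real \<Rightarrow> (real \<times> real \<times> real) list \<Rightarrow> (real \<times> real \<times> real) list" where
  "scale_steps k cs = map (\<lambda>(c, a, b). (k * c, a, b)) cs"

lemma valid_scale_steps [simp]: "valid_steps T (scale_steps k cs) \<longleftrightarrow> valid_steps T cs"
  by (auto simp: valid_steps_def scale_steps_def)

lemma valid_steps_append [simp]: "valid_steps T (cs @ cs') \<longleftrightarrow> valid_steps T cs \<and> valid_steps T cs'"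
  by (simp add: valid_steps_def ball_Un)

lemma increment_sum_scale: "increment_sum w (scale_steps k cs) = k * increment_sum w cs"
  by (induction cs) (auto simp: scale_steps_def increment_sum_def algebra_simps)

lemma step_integral_scale: "step_integral W (scale_steps k cs) \<omega> = k * step_integral W cs \<omega>"
  by (simp add: step_integral_eq increment_sum_scale)

lemma step_fun_scale: "step_fun (scale_steps k cs) s = k * step_fun cs s"
  by (induction cs) (auto simp: scale_steps_def step_fun_def algebra_simps)

lemma step_integral_append: "step_integral W (cs @ cs') \<omega> = step_integral W cs \<omega> + step_integral W cs' \<omega>"
  by (simp add: step_integral_def)

lemma step_fun_append: "step_fun (cs @ cs') s = step_fun cs s + step_fun cs' s"
  by (simp add: step_fun_def)

lemma square_integrable_step_fun: "square_integrable (lborel_upto T) (step_fun cs)"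
proof (induction cs)
  case Nil
  then show ?case using square_integrable_zero by (simp add: step_fun_def[abs_def])
next
  case (Cons x cs)
  obtain c a b where x: "x = (c, a, b)" by (cases x) auto
  have "square_integrable (lborel_upto T) (\<lambda>s. c * indicator {a<..b} s + step_fun cs s)"
    by (intro square_integrable_add square_integrable_cmult square_integrable_indicator Cons) simp
  then show ?case by (simp add: step_fun_def[abs_def] x)
qed

definition pdiff_steps :: "real \<Rightarrow> nat \<Rightarrow> (real \<Rightarrow> real) \<Rightarrow> (real \<times> real \<times> real) list" where
  "pdiff_steps T m w = map (\<lambda>i. ((w (grid T m (Suc i)) - w (grid T m i)) / (T / real m),
      grid T m i, grid T m (Suc i))) [0..<m]"

lemma valid_pdiff_steps:
  assumes "T \<ge> 0"
  shows "valid_steps T (pdiff_steps T m w)"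
  using assms grid_bounds[of T m] grid_mono[of T _ "Suc _" m]
  by (auto simp: valid_steps_def pdiff_steps_def Suc_le_eq)

lemma step_fun_pdiff_steps: "step_fun (pdiff_steps T m w) = pdiff T m w"
  by (rule ext) (simp add: step_fun_def pdiff_steps_def pdiff_def comp_def
      sum_list_distinct_conv_sum_set atLeast0LessThan interv_sum_list_conv_sum_set_nat)

lemma increment_sum_pdiff_steps:
  "increment_sum v (pdiff_steps T m w)
    = (\<Sum>i<m. (w (grid T m (Suc i)) - w (grid T m i)) / (T / real m) * (v (grid T m (Suc i)) - v (grid T m i)))"
  by (simp add: increment_sum_def pdiff_steps_def comp_def
      sum_list_distinct_conv_sum_set atLeast0LessThan interv_sum_list_conv_sum_set_nat)

text \<open>The intervals of a list may overlap. Telescoping each of them along a common monotone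
  grid collects the coefficients cell by cell, with one \<gamma> for every w.\<close>

lemma increment_sum_grid:
  fixes t :: "nat \<Rightarrow> real"
  assumes mono: "\<And>i j. i \<le> j \<Longrightarrow> j \<le> n \<Longrightarrow> t i \<le> t j"
    and pts: "\<And>c a b. (c, a, b) \<in> set cs \<Longrightarrow> a \<le> b \<and> a \<in> t ` {..n} \<and> b \<in> t ` {..n}"
  shows "\<exists>\<gamma>. \<forall>w. increment_sum w cs = (\<Sum>i<n. \<gamma> i * (w (t (Suc i)) - w (t i)))"
  using pts
proof (induction cs)
  case Nil
  show ?case by (intro exI[of _ "\<lambda>_. 0"]) simp
next
  case (Cons x cs)
  obtain c a b where x: "x = (c, a, b)" by (cases x) auto
  obtain \<gamma> where \<gamma>: "\<And>w. increment_sum w cs = (\<Sum>i<n. \<gamma> i * (w (t (Suc i)) - w (t i)))"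
    using Cons.IH Cons.prems by fastforce
  obtain j k where jk: "j \<le> n" "k \<le> n" "a = t j" "b = t k" "a \<le> b"
    using Cons.prems[of c a b] x by auto
  have tel: "w b - w a = (\<Sum>i<n. (if j \<le> i \<and> i < k then 1 else 0) * (w (t (Suc i)) - w (t i)))" for w :: "real \<Rightarrow> real"
  proof (cases "j \<le> k")
    case True
    have "(\<Sum>i<n. (if j \<le> i \<and> i < k then 1 else 0) * (w (t (Suc i)) - w (t i)))
        = (\<Sum>i<n. if i \<in> {i. j \<le> i \<and> i < k} then w (t (Suc i)) - w (t i) else 0)"
      by (intro sum.cong) auto
    also have "\<dots> = (\<Sum>i\<in>{..<n} \<inter> {i. j \<le> i \<and> i < k}. w (t (Suc i)) - w (t i))"
      by (rule sum.inter_restrict[symmetric]) simp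
    also have "{..<n} \<inter> {i. j \<le> i \<and> i < k} = {j..<k}" using jk by auto
    also have "(\<Sum>i\<in>{j..<k}. w (t (Suc i)) - w (t i)) = w (t k) - w (t j)"
      using sum_Suc_diff'[OF True, of "\<lambda>i. w (t i)"] by simp
    finally show ?thesis using jk by simp
  next
    \<comment> \<open>With j > k the ordering a \<le> b forces t j = t k, a repeated grid point, so
      the increment is 0.\<close>
    case False
    then have "t j = t k" using mono[of k j] jk by auto
    moreover have "(\<Sum>i<n. (if j \<le> i \<and> i < k then 1 else 0) * (w (t (Suc i)) - w (t i))) = 0"
      using False by (intro sum.neutral) auto
    ultimately show ?thesis using jk by simp
  qed
  have "increment_sum w (x # cs)
      = (\<Sum>i<n. (c * (if j \<le> i \<and> i < k then 1 else 0) + \<gamma> i) * (w (t (Suc i)) - w (t i)))" for w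
    using tel[of w] \<gamma>[of w] by (simp add: x distrib_right sum.distrib sum_distrib_left mult.assoc)
  then show ?case by (intro exI allI)
qed

lemma increment_sum_normal_form:
  assumes "valid_steps T cs" "T \<ge> 0"
  obtains t :: "nat \<Rightarrow> real" and \<gamma> :: "nat \<Rightarrow> real" and n :: nat
  where "mono t" "range t \<subseteq> {0..T}"
    "\<forall>w. increment_sum w cs = (\<Sum>i<n. \<gamma> i * (w (t (Suc i)) - w (t i)))"
proof -
  define A where "A = insert 0 (\<Union>(c, a, b)\<in>set cs. {a, b})"
  have A: "finite A" "0 \<in> A" "A \<subseteq> {0..T}"
    using assms by (auto simp: A_def valid_steps_def)
  define xs where "xs = sorted_list_of_set A"
  have xs: "sorted xs" "set xs = A" "xs \<noteq> []"
    using A by (auto simp: xs_def)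
  define n where "n = length xs - 1"
  \<comment> \<open>Beyond the last endpoint the sequence is constant, which keeps it monotone on
    all natural numbers.\<close>
  define t where "t = (\<lambda>i. xs ! min i n)"
  have len: "min i n < length xs" for i using xs(3) by (cases xs) (auto simp: n_def)
  have mono: "t i \<le> t j" if "i \<le> j" for i j
    unfolding t_def by (rule sorted_nth_mono[OF xs(1)]) (use that len in auto)
  have range: "t i \<in> A" for i unfolding t_def using len xs(2) nth_mem by blast
  have img: "A = t ` {..n}"
  proof
    show "A \<subseteq> t ` {..n}"
    proof
      fix x assume "x \<in> A"
      then obtain i where i: "i < length xs" "xs ! i = x" using xs(2) by (metis in_set_conv_nth)
      then have "i \<le> n" by (simp add: n_def)
      with i show "x \<in> t ` {..n}" by (intro image_eqI[of _ _ i]) (auto simp: t_def)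
    qed
  qed (use range in auto)
  have pts: "a \<le> b \<and> a \<in> t ` {..n} \<and> b \<in> t ` {..n}" if "(c, a, b) \<in> set cs" for c a b
    unfolding img[symmetric] using that assms(1) by (auto simp: valid_steps_def A_def)
  obtain \<gamma> where g: "\<forall>w. increment_sum w cs = (\<Sum>i<n. \<gamma> i * (w (t (Suc i)) - w (t i)))"
    using increment_sum_grid[of n t cs] mono pts by blast
  have "mono t" using mono by (simp add: monoI)
  moreover have "range t \<subseteq> {0..T}" using range A(3) by auto
  ultimately show ?thesis using that g by blast
qed

lemma sqnorm_step_normal_form:
  fixes t :: "nat \<Rightarrow> real"
  assumes mono: "\<And>i j. i \<le> j \<Longrightarrow> t i \<le> t j" and range: "\<And>i. t i \<in> {0..T}"
    and f: "\<And>s. f s = (\<Sum>i<n. \<gamma> i * indicator {t i<..t (Suc i)} s)"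
  shows "sqnorm (lborel_upto T) f = (\<Sum>i<n. (\<gamma> i)\<^sup>2 * (t (Suc i) - t i))"
proof -
  let ?X = "\<lambda>i s. indicator {t i<..t (Suc i)} s :: real"
  have prod: "?X i s * ?X j s = (if i = j then (?X i s)\<^sup>2 else 0)" for i j s
  proof (cases "i = j")
    case False
    then consider "Suc i \<le> j" | "Suc j \<le> i" by linarith
    then show ?thesis
      using mono[of "Suc i" j] mono[of "Suc j" i] False by cases (auto simp: indicator_def)
  qed (simp add: power2_eq_square)
  have "(f s)\<^sup>2 = (\<Sum>i<n. (\<gamma> i)\<^sup>2 * (?X i s)\<^sup>2)" for s
  proof -
    have "(f s)\<^sup>2 = (\<Sum>i<n. \<Sum>j<n. (\<gamma> i * \<gamma> j) * (?X i s * ?X j s))"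
      by (simp only: f power2_eq_square sum_product mult_ac)
    also have "\<dots> = (\<Sum>i<n. (\<gamma> i)\<^sup>2 * (?X i s)\<^sup>2)"
      unfolding prod
      by (intro sum.cong refl) (simp add: if_distrib[of "\<lambda>x. _ * x"] power2_eq_square cong: if_cong)
    finally show ?thesis .
  qed
  then have "sqnorm (lborel_upto T) f = (LINT s|lborel_upto T. (\<Sum>i<n. (\<gamma> i)\<^sup>2 * (?X i s)\<^sup>2))"
    by (simp add: sqnorm_def)
  also have "\<dots> = (\<Sum>i<n. (\<gamma> i)\<^sup>2 * sqnorm (lborel_upto T) (?X i))"
    unfolding sqnorm_def
    by (subst Bochner_Integration.integral_sum)
       (auto intro!: integrable_mult_right square_integrable_integrable_square square_integrable_indicator)
  also have "\<dots> = (\<Sum>i<n. (\<gamma> i)\<^sup>2 * (t (Suc i) - t i))"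
  proof (intro sum.cong refl)
    fix i
    show "(\<gamma> i)\<^sup>2 * sqnorm (lborel_upto T) (?X i) = (\<gamma> i)\<^sup>2 * (t (Suc i) - t i)"
      using range[of i] range[of "Suc i"] mono[of i "Suc i"] by (subst sqnorm_indicator) auto
  qed
  finally show ?thesis .
qed

section \<open>Gaussian integrals and elementary exponential inequalities\<close>

lemma nn_integral_normal_density: "\<sigma> > 0 \<Longrightarrow> (\<integral>\<^sup>+x. ennreal (normal_density \<mu> \<sigma> x) \<partial>lborel) = 1"
  using prob_space.emeasure_space_1[OF prob_space_normal_density[of \<sigma> \<mu>]] by (simp add: emeasure_density)

text \<open>Completing the square: a linear exponent shifts the mean by c * v.\<close>

lemma normal_density_exp_linear:
  assumes "v > 0"
  shows "normal_density 0 (sqrt v) x * exp (c * x) = exp (c\<^sup>2 * v / 2) * normal_density (c * v) (sqrt v) x"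
proof -
  have "- x\<^sup>2 / (2 * v) + c * x = c\<^sup>2 * v / 2 + - (x - c * v)\<^sup>2 / (2 * v)"
    using assms by (simp add: field_simps power2_eq_square)
  then show ?thesis
    using assms by (simp add: normal_density_def exp_add[symmetric])
qed

text \<open>A quadratic exponent changes the variance to v / (1 - lam), up to a constant factor, as
  long as lam < 1.\<close>

lemma normal_density_exp_square:
  assumes "v > 0" "lam < 1"
  shows "normal_density 0 (sqrt v) x * exp (lam * (x\<^sup>2 / v) / 2)
    = 1 / sqrt (1 - lam) * normal_density 0 (sqrt (v / (1 - lam))) x"
proof -
  have "- x\<^sup>2 / (2 * v) + lam * (x\<^sup>2 / v) / 2 = - x\<^sup>2 / (2 * (v / (1 - lam)))"
    using assms by (simp add: field_simps)
  then have e: "exp (- x\<^sup>2 / (2 * v)) * exp (lam * (x\<^sup>2 / v) / 2) = exp (- x\<^sup>2 / (2 * (v / (1 - lam))))"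
    by (simp only: exp_add[symmetric])
  have c: "1 / sqrt (2 * pi * v) = 1 / sqrt (1 - lam) * (1 / sqrt (2 * pi * (v / (1 - lam))))"
    using assms by (simp add: real_sqrt_mult[symmetric] real_sqrt_divide[symmetric])
  have s: "(sqrt v)\<^sup>2 = v" "(sqrt (v / (1 - lam)))\<^sup>2 = v / (1 - lam)"
    using assms by simp_all
  have "normal_density 0 (sqrt v) x * exp (lam * (x\<^sup>2 / v) / 2)
      = 1 / sqrt (2 * pi * v) * (exp (- x\<^sup>2 / (2 * v)) * exp (lam * (x\<^sup>2 / v) / 2))"
    unfolding normal_density_def s by simp
  also have "\<dots> = 1 / sqrt (1 - lam) * normal_density 0 (sqrt (v / (1 - lam))) x"
    unfolding e unfolding c normal_density_def s by simp
  finally show ?thesis .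
qed

text \<open>Second moments are obtained from moment generating functions through this bound. Its
  right-hand side vanishes at 0, so generating functions close to 1 give small second
  moments.\<close>

lemma square_le_exp: "x\<^sup>2 \<le> 2 * (exp x + exp (- x) - 2)" for x :: real
proof -
  have *: "x\<^sup>2 \<le> 2 * (exp x + exp (- x) - 2)" if "x \<ge> 0" for x :: real
    using exp_lower_Taylor_quadratic[OF that] exp_ge_add_one_self[of "- x"] by simp
  show ?thesis using *[of x] *[of "- x"] by (cases "x \<ge> 0") (auto simp: add.commute)
qed

lemma exp_diff_le: "\<bar>exp x - exp y\<bar> \<le> \<bar>x - y\<bar> * (exp x + exp y)" for x y :: real
proof -
  have *: "exp x - exp y \<le> (x - y) * (exp x + exp y)" if "y \<le> x" for x y :: real
  proof -
    have "exp x * (1 - exp (y - x)) \<le> exp x * (x - y)"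
      using exp_ge_add_one_self[of "y - x"] by (intro mult_left_mono) (linarith, simp)
    moreover have "exp x * (1 - exp (y - x)) = exp x - exp y" by (simp add: right_diff_distrib exp_add[symmetric])
    moreover have "0 \<le> (x - y) * exp y" using that by simp
    ultimately show ?thesis by (simp add: distrib_left mult.commute)
  qed
  show ?thesis using *[of x y] *[of y x] by (cases "x \<le> y") (auto simp: abs_if add.commute)
qed

section \<open>Brownian increments and step integrals\<close>

locale brownian = prob_space P for P :: "'a measure" +
  fixes W :: "real \<Rightarrow> 'a \<Rightarrow> real"
  assumes bm: "brownian_motion P W"
begin

lemma W_measurable [measurable]: "t \<ge> 0 \<Longrightarrow> W t \<in> borel_measurable P"
  using bm by (auto simp: brownian_motion_def)

lemma W_0: "\<omega> \<in> space P \<Longrightarrow> W 0 \<omega> = 0"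
  and W_continuous: "\<omega> \<in> space P \<Longrightarrow> continuous_on {0..} (\<lambda>t. W t \<omega>)"
  using bm by (auto simp: brownian_motion_def)

lemma W_increment_mgf:
  assumes "0 \<le> s" "s \<le> t"
  shows "(\<integral>\<^sup>+\<omega>. ennreal (exp (c * (W t \<omega> - W s \<omega>))) \<partial>P) = ennreal (exp (c\<^sup>2 * (t - s) / 2))"
proof (cases "s = t")
  case True
  then show ?thesis by (simp add: emeasure_space_1)
next
  case False
  then have st: "s < t" using assms by simp
  have D: "distributed P lborel (\<lambda>\<omega>. W t \<omega> - W s \<omega>) (\<lambda>x. ennreal (normal_density 0 (sqrt (t - s)) x))"
    using bm assms st by (auto simp: brownian_motion_def)
  have "(\<integral>\<^sup>+\<omega>. ennreal (exp (c * (W t \<omega> - W s \<omega>))) \<partial>P)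
      = (\<integral>\<^sup>+x. ennreal (normal_density 0 (sqrt (t - s)) x) * ennreal (exp (c * x)) \<partial>lborel)"
    by (rule distributed_nn_integral[OF D, symmetric]) simp
  also have "\<dots> = (\<integral>\<^sup>+x. ennreal (exp (c\<^sup>2 * (t - s) / 2)) * ennreal (normal_density (c * (t - s)) (sqrt (t - s)) x) \<partial>lborel)"
    using st by (intro nn_integral_cong)
      (simp add: ennreal_mult'[symmetric] normal_density_exp_linear)
  also have "\<dots> = ennreal (exp (c\<^sup>2 * (t - s) / 2))"
    using st by (simp add: nn_integral_cmult nn_integral_normal_density)
  finally show ?thesis .
qed

lemma W_increment_exp_square:
  assumes "0 \<le> s" "s < t" "lam < 1"
  shows "(\<integral>\<^sup>+\<omega>. ennreal (exp (lam * ((W t \<omega> - W s \<omega>)\<^sup>2 / (t - s)) / 2)) \<partial>P) = ennreal (1 / sqrt (1 - lam))"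
proof -
  have D: "distributed P lborel (\<lambda>\<omega>. W t \<omega> - W s \<omega>) (\<lambda>x. ennreal (normal_density 0 (sqrt (t - s)) x))"
    using bm assms by (auto simp: brownian_motion_def)
  have "(\<integral>\<^sup>+\<omega>. ennreal (exp (lam * ((W t \<omega> - W s \<omega>)\<^sup>2 / (t - s)) / 2)) \<partial>P)
      = (\<integral>\<^sup>+x. ennreal (normal_density 0 (sqrt (t - s)) x) * ennreal (exp (lam * (x\<^sup>2 / (t - s)) / 2)) \<partial>lborel)"
    by (rule distributed_nn_integral[OF D, symmetric]) simp
  also have "\<dots> = (\<integral>\<^sup>+x. ennreal (1 / sqrt (1 - lam)) * ennreal (normal_density 0 (sqrt ((t - s) / (1 - lam))) x) \<partial>lborel)"
    using assms by (intro nn_integral_cong)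
      (simp only: ennreal_mult'[symmetric] normal_density_nonneg exp_ge_zero normal_density_exp_square diff_gt_0_iff_gt,
       simp add: ennreal_mult'[symmetric])
  also have "\<dots> = ennreal (1 / sqrt (1 - lam))"
    using assms by (simp add: nn_integral_cmult nn_integral_normal_density)
  finally show ?thesis .
qed

lemma independent_increments:
  fixes t :: "nat \<Rightarrow> real" and f :: "nat \<Rightarrow> real \<Rightarrow> ennreal"
  assumes "t 0 \<ge> 0" "\<And>i. i < n \<Longrightarrow> t i \<le> t (Suc i)" "\<And>i. f i \<in> borel_measurable borel"
  shows "(\<integral>\<^sup>+\<omega>. (\<Prod>i<n. f i (W (t (Suc i)) \<omega> - W (t i) \<omega>)) \<partial>P)
    = (\<Prod>i<n. \<integral>\<^sup>+\<omega>. f i (W (t (Suc i)) \<omega> - W (t i) \<omega>) \<partial>P)"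
proof -
  have "indep_vars (\<lambda>_. borel) (\<lambda>i \<omega>. W (t (Suc i)) \<omega> - W (t i) \<omega>) {..<n}"
    using bm assms by (auto simp: brownian_motion_def)
  then have "indep_vars (\<lambda>_. borel) (\<lambda>i \<omega>. f i (W (t (Suc i)) \<omega> - W (t i) \<omega>)) {..<n}"
    by (rule indep_vars_compose2) (use assms in auto)
  then show ?thesis by (intro indep_vars_nn_integral) auto
qed

lemma step_integral_measurable:
  assumes "valid_steps T cs" shows "step_integral W cs \<in> borel_measurable P"
  using assms
proof (induction cs)
  case Nil
  then show ?case by (simp add: step_integral_def[abs_def])
next
  case (Cons x cs)
  obtain c a b where x: "x = (c, a, b)" by (cases x) auto
  have "valid_steps T cs" "a \<ge> 0" "b \<ge> 0" using Cons.prems by (auto simp: valid_steps_def x)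
  then have "(\<lambda>\<omega>. c * (W b \<omega> - W a \<omega>) + step_integral W cs \<omega>) \<in> borel_measurable P"
    using Cons.IH by (intro borel_measurable_add borel_measurable_times borel_measurable_diff W_measurable) auto
  then show ?case by (simp add: step_integral_def[abs_def] x)
qed

text \<open>In normal form the exponent is a sum of independent centred Gaussian increments, and the
  same coefficients compute the norm of the step function.\<close>

lemma step_integral_mgf:
  assumes cs: "valid_steps T cs" and T: "T \<ge> 0"
  shows "(\<integral>\<^sup>+\<omega>. ennreal (exp (step_integral W cs \<omega>)) \<partial>P) = ennreal (exp (sqnorm (lborel_upto T) (step_fun cs) / 2))"
proof -
  obtain t \<gamma> :: "nat \<Rightarrow> real" and n :: nat where tm: "mono t" and tr: "range t \<subseteq> {0..T}"
    and eq: "\<forall>w. increment_sum w cs = (\<Sum>i<n. \<gamma> i * (w (t (Suc i)) - w (t i)))"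
    by (rule increment_sum_normal_form[OF cs T])
  have mono: "t i \<le> t j" if "i \<le> j" for i j using monoD[OF tm that] .
  have range: "t i \<in> {0..T}" for i using tr by blast
  have sf: "step_fun cs s = (\<Sum>i<n. \<gamma> i * indicator {t i<..t (Suc i)} s)" for s
  proof -
    have "step_fun cs s = (\<Sum>i<n. \<gamma> i * (indicator {s..} (t (Suc i)) - indicator {s..} (t i)))"
      unfolding step_fun_eq[OF cs] by (rule spec[OF eq])
    also have "\<dots> = (\<Sum>i<n. \<gamma> i * indicator {t i<..t (Suc i)} s)"
    proof (intro sum.cong refl)
      fix i show "\<gamma> i * (indicator {s..} (t (Suc i)) - indicator {s..} (t i)) = \<gamma> i * indicator {t i<..t (Suc i)} s"
        using mono[of i "Suc i"] by (auto simp: indicator_def)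
    qed
    finally show ?thesis .
  qed
  have "(\<integral>\<^sup>+\<omega>. ennreal (exp (step_integral W cs \<omega>)) \<partial>P)
      = (\<integral>\<^sup>+\<omega>. (\<Prod>i<n. ennreal (exp (\<gamma> i * (W (t (Suc i)) \<omega> - W (t i) \<omega>)))) \<partial>P)"
  proof (rule nn_integral_cong)
    fix \<omega>
    have "step_integral W cs \<omega> = (\<Sum>i<n. \<gamma> i * (W (t (Suc i)) \<omega> - W (t i) \<omega>))"
      unfolding step_integral_eq by (rule spec[OF eq])
    then show "ennreal (exp (step_integral W cs \<omega>)) = (\<Prod>i<n. ennreal (exp (\<gamma> i * (W (t (Suc i)) \<omega> - W (t i) \<omega>))))"
      by (simp add: exp_sum prod_ennreal)
  qed
  also have "\<dots> = (\<Prod>i<n. \<integral>\<^sup>+\<omega>. ennreal (exp (\<gamma> i * (W (t (Suc i)) \<omega> - W (t i) \<omega>))) \<partial>P)"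
    using range[of 0] mono by (intro independent_increments[where f="\<lambda>i x. ennreal (exp (\<gamma> i * x))"]) auto
  also have "\<dots> = (\<Prod>i<n. ennreal (exp ((\<gamma> i)\<^sup>2 * (t (Suc i) - t i) / 2)))"
  proof (rule prod.cong[OF refl])
    fix i
    have "0 \<le> t i" "t i \<le> t (Suc i)" using range[of i] mono[of i "Suc i"] by simp_all
    then show "(\<integral>\<^sup>+\<omega>. ennreal (exp (\<gamma> i * (W (t (Suc i)) \<omega> - W (t i) \<omega>))) \<partial>P) = ennreal (exp ((\<gamma> i)\<^sup>2 * (t (Suc i) - t i) / 2))"
      by (rule W_increment_mgf)
  qed
  also have "\<dots> = ennreal (exp ((\<Sum>i<n. (\<gamma> i)\<^sup>2 * (t (Suc i) - t i)) / 2))"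
    by (simp add: prod_ennreal exp_sum[symmetric] sum_divide_distrib)
  also have "(\<Sum>i<n. (\<gamma> i)\<^sup>2 * (t (Suc i) - t i)) = sqnorm (lborel_upto T) (step_fun cs)"
    by (rule sqnorm_step_normal_form[OF mono range sf, symmetric])
  finally show ?thesis .
qed

text \<open>The energy is a sum of m squares of independent standard normal variables. The value
  depends on m and lam only, so for a fixed mesh it is a prefactor that is negligible on the
  exponential scale.\<close>

lemma chi_square_mgf:
  assumes T: "T > 0" and m: "m > 0" and lam: "lam < 1"
  shows "(\<integral>\<^sup>+\<omega>. ennreal (exp (lam * sqnorm (lborel_upto T) (pdiff T m (\<lambda>t. W t \<omega>)) / 2)) \<partial>P)
    = ennreal ((1 / sqrt (1 - lam)) ^ m)"
proof -
  have gm: "grid T m i \<le> grid T m (Suc i)" "grid T m i \<ge> 0" for i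
    using T by (auto simp: grid_def divide_right_mono)
  have "(\<integral>\<^sup>+\<omega>. ennreal (exp (lam * sqnorm (lborel_upto T) (pdiff T m (\<lambda>t. W t \<omega>)) / 2)) \<partial>P)
    = (\<integral>\<^sup>+\<omega>. (\<Prod>i<m. ennreal (exp (lam * ((W (grid T m (Suc i)) \<omega> - W (grid T m i) \<omega>)\<^sup>2 / (T / m)) / 2))) \<partial>P)"
    by (intro nn_integral_cong)
       (simp add: sqnorm_pdiff[OF T] prod_ennreal exp_sum[symmetric] sum_distrib_left sum_divide_distrib)
  also have "\<dots> = (\<Prod>i<m. \<integral>\<^sup>+\<omega>. ennreal (exp (lam * ((W (grid T m (Suc i)) \<omega> - W (grid T m i) \<omega>)\<^sup>2 / (T / m)) / 2)) \<partial>P)"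
    using gm by (intro independent_increments[where f="\<lambda>i x. ennreal (exp (lam * (x\<^sup>2 / (T / m)) / 2))"]) auto
  also have "\<dots> = (\<Prod>i<m. ennreal (1 / sqrt (1 - lam)))"
  proof (intro prod.cong refl)
    fix i
    have "grid T m (Suc i) - grid T m i = T / m" by (simp add: grid_Suc)
    then show "(\<integral>\<^sup>+\<omega>. ennreal (exp (lam * ((W (grid T m (Suc i)) \<omega> - W (grid T m i) \<omega>)\<^sup>2 / (T / m)) / 2)) \<partial>P)
        = ennreal (1 / sqrt (1 - lam))"
      using W_increment_exp_square[of "grid T m i" "grid T m (Suc i)" lam] gm[of i] T m lam
      by (simp add: grid_Suc)
  qed
  also have "\<dots> = ennreal ((1 / sqrt (1 - lam)) ^ m)"
    using lam by (simp add: ennreal_power)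
  finally show ?thesis .
qed

text \<open>A substitute for the Ito isometry, read off from the moment generating functions of the
  integral and of its negative. The bound tends to 0 with the norm of the step function, which
  suffices for Cauchy sequences.\<close>

lemma step_integral_second_moment:
  assumes cs: "valid_steps T cs" and T: "T \<ge> 0"
  shows "square_integrable P (step_integral W cs)"
    and "sqnorm P (step_integral W cs) \<le> 4 * (exp (sqnorm (lborel_upto T) (step_fun cs) / 2) - 1)"
proof -
  let ?S = "step_integral W cs" and ?s = "sqnorm (lborel_upto T) (step_fun cs)"
  have meas[measurable]: "?S \<in> borel_measurable P" by (rule step_integral_measurable[OF cs])
  have e1: "(\<integral>\<^sup>+\<omega>. ennreal (exp (?S \<omega>)) \<partial>P) = ennreal (exp (?s / 2))"
    by (rule step_integral_mgf[OF cs T])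
  have e2: "(\<integral>\<^sup>+\<omega>. ennreal (exp (- ?S \<omega>)) \<partial>P) = ennreal (exp (?s / 2))"
    using step_integral_mgf[of T "scale_steps (-1) cs"] cs T
    by (simp add: step_integral_scale step_fun_scale sqnorm_def)
  have i1: "integrable P (\<lambda>\<omega>. exp (?S \<omega>))" "integrable P (\<lambda>\<omega>. exp (- ?S \<omega>))"
    by (rule integrableI_nonneg; simp add: e1 e2)+
  have v1: "(LINT \<omega>|P. exp (?S \<omega>)) = exp (?s / 2)" "(LINT \<omega>|P. exp (- ?S \<omega>)) = exp (?s / 2)"
    by (simp_all add: integral_eq_nn_integral e1 e2)
  have i2: "integrable P (\<lambda>\<omega>. 2 * (exp (?S \<omega>) + exp (- ?S \<omega>) - 2))"
    by (intro integrable_mult_right Bochner_Integration.integrable_diff Bochner_Integration.integrable_add i1) simp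
  have i3: "integrable P (\<lambda>\<omega>. (?S \<omega>)\<^sup>2)"
  proof (rule Bochner_Integration.integrable_bound[OF i2])
    show "AE \<omega> in P. norm ((?S \<omega>)\<^sup>2) \<le> norm (2 * (exp (?S \<omega>) + exp (- ?S \<omega>) - 2))"
      using square_le_exp by (intro always_eventually) (auto intro: order_trans[OF _ abs_ge_self])
  qed simp
  then show "square_integrable P ?S" by (simp add: square_integrable_def)
  have "sqnorm P ?S \<le> (LINT \<omega>|P. 2 * (exp (?S \<omega>) + exp (- ?S \<omega>) - 2))"
    unfolding sqnorm_def by (rule integral_mono[OF i3 i2]) (rule square_le_exp)
  also have "\<dots> = 4 * (exp (?s / 2) - 1)"
    using i1 v1 by (simp add: prob_space)
  finally show "sqnorm P ?S \<le> 4 * (exp (?s / 2) - 1)" .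
qed

section \<open>Wiener integrals as limits of step integrals\<close>

lemma is_wiener_integral_iff:
  assumes f: "square_integrable (lborel_upto T) f"
  shows "is_wiener_integral P W T f I \<longleftrightarrow> I \<in> borel_measurable P \<and> (\<exists>cs. (\<forall>n. valid_steps T (cs n))
     \<and> (\<lambda>n. sqnorm (lborel_upto T) (\<lambda>t. f t - step_fun (cs n) t)) \<longlonglongrightarrow> 0
     \<and> (\<lambda>n. \<integral>\<^sup>+\<omega>. ennreal ((I \<omega> - step_integral W (cs n) \<omega>)\<^sup>2) \<partial>P) \<longlonglongrightarrow> 0)"
proof -
  have "(\<integral>\<^sup>+t\<in>{0..T}. ennreal ((f t - step_fun c t)\<^sup>2) \<partial>lborel)
      = ennreal (sqnorm (lborel_upto T) (\<lambda>t. f t - step_fun c t))" for c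
  proof -
    have "(\<integral>\<^sup>+t\<in>{0..T}. ennreal ((f t - step_fun c t)\<^sup>2) \<partial>lborel)
        = (\<integral>\<^sup>+t. ennreal ((f t - step_fun c t)\<^sup>2) \<partial>lborel_upto T)"
      by (subst nn_integral_restrict_space) auto
    then show ?thesis
      by (simp add: nn_integral_square square_integrable_diff f square_integrable_step_fun)
  qed
  moreover have "(\<lambda>n. ennreal (sqnorm (lborel_upto T) (g n))) \<longlonglongrightarrow> 0 \<longleftrightarrow> (\<lambda>n. sqnorm (lborel_upto T) (g n)) \<longlonglongrightarrow> 0" for g :: "nat \<Rightarrow> real \<Rightarrow> real"
    using tendsto_ennreal_iff[of "\<lambda>n. sqnorm (lborel_upto T) (g n)" sequentially 0] by (simp add: sqnorm_nonneg)
  ultimately show ?thesis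
    by (simp add: is_wiener_integral_def valid_steps_def)
qed

text \<open>The dyadic densities of h are step functions converging to \<open>cm_deriv T h\<close>.
  A difference of two step integrals is the step integral of a concatenated list, so the second
  moment bound makes the integrals Cauchy.\<close>

theorem wiener_integral_exists:
  assumes T: "T > 0" and h: "h \<in> cm_space T"
  shows "is_wiener_integral P W T (cm_deriv T h) (wiener_integral P W T (cm_deriv T h))"
proof -
  let ?U = "lborel_upto T"
  define cs where "cs = (\<lambda>k::nat. pdiff_steps T (2^k) h)"
  have valid: "valid_steps T (cs k)" for k
    unfolding cs_def using T by (intro valid_pdiff_steps) auto
  have sf: "step_fun (cs k) = pdiff T (2^k) h" for k
    unfolding cs_def by (rule step_fun_pdiff_steps)
  have lim: "(\<lambda>k. sqnorm ?U (\<lambda>t. cm_deriv T h t - step_fun (cs k) t)) \<longlonglongrightarrow> 0"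
    using cm_deriv_dyadic_limit[OF T h] by (simp add: sf sqnorm_diff_commute)
  have S2: "square_integrable P (step_integral W (cs k))" for k
    by (rule step_integral_second_moment(1)[OF valid less_imp_le[OF T]])
  have Sdiff: "sqnorm P (\<lambda>\<omega>. step_integral W (cs m) \<omega> - step_integral W (cs n) \<omega>)
      \<le> 4 * (exp (sqnorm ?U (\<lambda>t. step_fun (cs m) t - step_fun (cs n) t) / 2) - 1)" for m n
    using step_integral_second_moment(2)[of T "cs m @ scale_steps (-1) (cs n)"] valid T
    by (simp add: step_integral_append[abs_def] step_fun_append[abs_def] step_integral_scale step_fun_scale)
  have cauchy: "\<exists>N. \<forall>m\<ge>N. \<forall>n\<ge>N. sqnorm P (\<lambda>\<omega>. step_integral W (cs m) \<omega> - step_integral W (cs n) \<omega>) < e"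
    if e: "e > 0" for e
  proof -
    \<comment> \<open>Chosen such that the second moment bound becomes 4 * (exp (2 * d) - 1) = e /
      2.\<close>
    define d where "d = ln (1 + e / 8) / 2"
    have d: "d > 0" using e by (simp add: d_def)
    obtain N where N: "\<And>n. n \<ge> N \<Longrightarrow> sqnorm ?U (\<lambda>t. cm_deriv T h t - step_fun (cs n) t) < d"
      using order_tendstoD(2)[OF lim d] by (auto simp: eventually_sequentially)
    have "sqnorm P (\<lambda>\<omega>. step_integral W (cs m) \<omega> - step_integral W (cs n) \<omega>) < e" if mn: "m \<ge> N" "n \<ge> N" for m n
    proof -
      have sq: "square_integrable ?U (\<lambda>t. cm_deriv T h t - step_fun (cs n) t)" for n
        by (intro square_integrable_diff square_integrable_cm_deriv h square_integrable_step_fun)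
      have "sqnorm ?U (\<lambda>t. step_fun (cs m) t - step_fun (cs n) t)
          = sqnorm ?U (\<lambda>t. (cm_deriv T h t - step_fun (cs n) t) + (-1) * (cm_deriv T h t - step_fun (cs m) t))"
        by (rule arg_cong[of _ _ "sqnorm ?U"]) auto
      also have "\<dots> \<le> 2 * sqnorm ?U (\<lambda>t. cm_deriv T h t - step_fun (cs n) t)
          + 2 * sqnorm ?U (\<lambda>t. (-1) * (cm_deriv T h t - step_fun (cs m) t))"
        by (intro sqnorm_add_le sq square_integrable_cmult)
      also have "sqnorm ?U (\<lambda>t. (-1) * (cm_deriv T h t - step_fun (cs m) t))
          = sqnorm ?U (\<lambda>t. cm_deriv T h t - step_fun (cs m) t)"
        by (subst sqnorm_cmult) simp
      finally have "sqnorm ?U (\<lambda>t. step_fun (cs m) t - step_fun (cs n) t) / 2 < 2 * d"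
        using N[OF mn(1)] N[OF mn(2)] by linarith
      then have "exp (sqnorm ?U (\<lambda>t. step_fun (cs m) t - step_fun (cs n) t) / 2) < exp (2 * d)" by simp
      also have "exp (2 * d) = 1 + e / 8" using e by (simp add: d_def)
      finally have "exp (sqnorm ?U (\<lambda>t. step_fun (cs m) t - step_fun (cs n) t) / 2) - 1 \<le> e / 8" by simp
      then have "sqnorm P (\<lambda>\<omega>. step_integral W (cs m) \<omega> - step_integral W (cs n) \<omega>) \<le> 4 * (e / 8)"
        by (intro order_trans[OF Sdiff[of m n]] mult_left_mono) auto
      then show ?thesis using e by simp
    qed
    then show ?thesis by blast
  qed
  obtain I where I: "square_integrable P I" "(\<lambda>n. sqnorm P (\<lambda>\<omega>. step_integral W (cs n) \<omega> - I \<omega>)) \<longlonglongrightarrow> 0"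
    by (rule Riesz_Fischer[OF S2 cauchy])
  have "(\<lambda>n. ennreal (sqnorm P (\<lambda>\<omega>. I \<omega> - step_integral W (cs n) \<omega>))) \<longlonglongrightarrow> ennreal 0"
    using I(2) by (intro tendsto_ennrealI) (simp add: sqnorm_diff_commute)
  then have "(\<lambda>n. \<integral>\<^sup>+\<omega>. ennreal ((I \<omega> - step_integral W (cs n) \<omega>)\<^sup>2) \<partial>P) \<longlonglongrightarrow> 0"
    by (simp add: nn_integral_square[OF square_integrable_diff[OF I(1) S2]])
  then have "is_wiener_integral P W T (cm_deriv T h) I"
    unfolding is_wiener_integral_iff[OF square_integrable_cm_deriv[OF h]]
    using I(1) valid lim by (auto simp: square_integrable_def)
  then show ?thesis unfolding wiener_integral_def by (rule someI[where P="is_wiener_integral P W T (cm_deriv T h)"])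
qed

lemma is_wiener_integral_step:
  assumes "valid_steps T cs"
  shows "is_wiener_integral P W T (step_fun cs) (step_integral W cs)"
  unfolding is_wiener_integral_iff[OF square_integrable_step_fun]
  using step_integral_measurable[OF assms] assms
  by (auto intro!: exI[of _ "\<lambda>_. cs"] simp: sqnorm_def)

lemma is_wiener_integral_measurable: "is_wiener_integral P W T f I \<Longrightarrow> I \<in> borel_measurable P"
  by (simp add: is_wiener_integral_def)

text \<open>\<open>wiener_integral\<close> is a choice determined only almost surely, so linearity
  is proved for the relation, by concatenating the approximating lists.\<close>

lemma is_wiener_integral_add:
  assumes f: "square_integrable (lborel_upto T) f" and g: "square_integrable (lborel_upto T) g"
    and I: "is_wiener_integral P W T f I" and J: "is_wiener_integral P W T g J"
  shows "is_wiener_integral P W T (\<lambda>t. f t + g t) (\<lambda>\<omega>. I \<omega> + J \<omega>)"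
proof -
  let ?U = "lborel_upto T"
  obtain cs where cs: "\<And>n. valid_steps T (cs n)" "(\<lambda>n. sqnorm ?U (\<lambda>t. f t - step_fun (cs n) t)) \<longlonglongrightarrow> 0"
    "(\<lambda>n. \<integral>\<^sup>+\<omega>. ennreal ((I \<omega> - step_integral W (cs n) \<omega>)\<^sup>2) \<partial>P) \<longlonglongrightarrow> 0"
    using I unfolding is_wiener_integral_iff[OF f] by blast
  obtain ds where ds: "\<And>n. valid_steps T (ds n)" "(\<lambda>n. sqnorm ?U (\<lambda>t. g t - step_fun (ds n) t)) \<longlonglongrightarrow> 0"
    "(\<lambda>n. \<integral>\<^sup>+\<omega>. ennreal ((J \<omega> - step_integral W (ds n) \<omega>)\<^sup>2) \<partial>P) \<longlonglongrightarrow> 0"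
    using J unfolding is_wiener_integral_iff[OF g] by blast
  have Im[measurable]: "I \<in> borel_measurable P" and Jm[measurable]: "J \<in> borel_measurable P"
    using I J by (auto simp: is_wiener_integral_def)
  have sm[measurable]: "step_integral W (cs n) \<in> borel_measurable P" "step_integral W (ds n) \<in> borel_measurable P" for n
    using cs(1) ds(1) step_integral_measurable by blast+
  have sum2: "(x + y)\<^sup>2 \<le> 2 * x\<^sup>2 + 2 * y\<^sup>2" for x y :: real
    using zero_le_power2[of "x - y"] by (simp add: power2_sum power2_diff)
  have "(\<lambda>n. sqnorm ?U (\<lambda>t. (f t + g t) - step_fun (cs n @ ds n) t)) \<longlonglongrightarrow> 0"
  proof (rule tendsto_sandwich[where f="\<lambda>_. 0"])
    show "\<forall>\<^sub>F n in sequentially. sqnorm ?U (\<lambda>t. (f t + g t) - step_fun (cs n @ ds n) t)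
        \<le> 2 * sqnorm ?U (\<lambda>t. f t - step_fun (cs n) t) + 2 * sqnorm ?U (\<lambda>t. g t - step_fun (ds n) t)"
    proof (rule always_eventually, rule allI)
      fix n
      have "sqnorm ?U (\<lambda>t. (f t + g t) - step_fun (cs n @ ds n) t)
          = sqnorm ?U (\<lambda>t. (f t - step_fun (cs n) t) + (g t - step_fun (ds n) t))"
        by (rule arg_cong[of _ _ "sqnorm ?U"]) (auto simp: step_fun_append)
      also have "\<dots> \<le> 2 * sqnorm ?U (\<lambda>t. f t - step_fun (cs n) t) + 2 * sqnorm ?U (\<lambda>t. g t - step_fun (ds n) t)"
        by (intro sqnorm_add_le square_integrable_diff f g square_integrable_step_fun)
      finally show "sqnorm ?U (\<lambda>t. (f t + g t) - step_fun (cs n @ ds n) t)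
        \<le> 2 * sqnorm ?U (\<lambda>t. f t - step_fun (cs n) t) + 2 * sqnorm ?U (\<lambda>t. g t - step_fun (ds n) t)" .
    qed
    show "(\<lambda>n. 2 * sqnorm ?U (\<lambda>t. f t - step_fun (cs n) t) + 2 * sqnorm ?U (\<lambda>t. g t - step_fun (ds n) t)) \<longlonglongrightarrow> 0"
      using tendsto_add[OF tendsto_mult_left[OF cs(2), of 2] tendsto_mult_left[OF ds(2), of 2]] by simp
  qed (auto simp: sqnorm_nonneg)
  moreover have "(\<lambda>n. \<integral>\<^sup>+\<omega>. ennreal ((I \<omega> + J \<omega> - step_integral W (cs n @ ds n) \<omega>)\<^sup>2) \<partial>P) \<longlonglongrightarrow> 0"
  proof (rule tendsto_sandwich[where f="\<lambda>_. 0"])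
    let ?A = "\<lambda>n. \<integral>\<^sup>+\<omega>. ennreal ((I \<omega> - step_integral W (cs n) \<omega>)\<^sup>2) \<partial>P"
    let ?B = "\<lambda>n. \<integral>\<^sup>+\<omega>. ennreal ((J \<omega> - step_integral W (ds n) \<omega>)\<^sup>2) \<partial>P"
    show "\<forall>\<^sub>F n in sequentially. (\<integral>\<^sup>+\<omega>. ennreal ((I \<omega> + J \<omega> - step_integral W (cs n @ ds n) \<omega>)\<^sup>2) \<partial>P) \<le> 2 * ?A n + 2 * ?B n"
    proof (rule always_eventually, rule allI)
      fix n
      have "(\<integral>\<^sup>+\<omega>. ennreal ((I \<omega> + J \<omega> - step_integral W (cs n @ ds n) \<omega>)\<^sup>2) \<partial>P)
          \<le> (\<integral>\<^sup>+\<omega>. 2 * ennreal ((I \<omega> - step_integral W (cs n) \<omega>)\<^sup>2) + 2 * ennreal ((J \<omega> - step_integral W (ds n) \<omega>)\<^sup>2) \<partial>P)"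
      proof (rule nn_integral_mono)
        fix \<omega>
        have "(I \<omega> + J \<omega> - step_integral W (cs n @ ds n) \<omega>)\<^sup>2
            = ((I \<omega> - step_integral W (cs n) \<omega>) + (J \<omega> - step_integral W (ds n) \<omega>))\<^sup>2"
          by (simp add: step_integral_append algebra_simps)
        also have "\<dots> \<le> 2 * (I \<omega> - step_integral W (cs n) \<omega>)\<^sup>2 + 2 * (J \<omega> - step_integral W (ds n) \<omega>)\<^sup>2"
          by (rule sum2)
        finally have "ennreal ((I \<omega> + J \<omega> - step_integral W (cs n @ ds n) \<omega>)\<^sup>2)
            \<le> ennreal (2 * (I \<omega> - step_integral W (cs n) \<omega>)\<^sup>2 + 2 * (J \<omega> - step_integral W (ds n) \<omega>)\<^sup>2)"
          by (rule ennreal_leI)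
        also have "\<dots> = 2 * ennreal ((I \<omega> - step_integral W (cs n) \<omega>)\<^sup>2) + 2 * ennreal ((J \<omega> - step_integral W (ds n) \<omega>)\<^sup>2)"
          by (simp add: ennreal_plus ennreal_mult)
        finally show "ennreal ((I \<omega> + J \<omega> - step_integral W (cs n @ ds n) \<omega>)\<^sup>2)
            \<le> 2 * ennreal ((I \<omega> - step_integral W (cs n) \<omega>)\<^sup>2) + 2 * ennreal ((J \<omega> - step_integral W (ds n) \<omega>)\<^sup>2)" .
      qed
      also have "\<dots> = 2 * ?A n + 2 * ?B n"
        by (subst nn_integral_add) (auto simp: nn_integral_cmult)
      finally show "(\<integral>\<^sup>+\<omega>. ennreal ((I \<omega> + J \<omega> - step_integral W (cs n @ ds n) \<omega>)\<^sup>2) \<partial>P) \<le> 2 * ?A n + 2 * ?B n" .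
    qed
    have "(\<lambda>n. 2 * ?A n + 2 * ?B n) \<longlonglongrightarrow> 2 * 0 + 2 * 0"
      by (intro tendsto_add ennreal_tendsto_cmult cs(3) ds(3)) auto
    then show "(\<lambda>n. 2 * ?A n + 2 * ?B n) \<longlonglongrightarrow> 0" by simp
  qed auto
  ultimately show ?thesis
    unfolding is_wiener_integral_iff[OF square_integrable_add[OF f g]]
    using cs(1) ds(1) by (intro conjI exI[of _ "\<lambda>n. cs n @ ds n"]) auto
qed

lemma is_wiener_integral_scale:
  assumes f: "square_integrable (lborel_upto T) f" and I: "is_wiener_integral P W T f I"
  shows "is_wiener_integral P W T (\<lambda>t. c * f t) (\<lambda>\<omega>. c * I \<omega>)"
proof -
  let ?U = "lborel_upto T"
  obtain cs where cs: "\<And>n. valid_steps T (cs n)" "(\<lambda>n. sqnorm ?U (\<lambda>t. f t - step_fun (cs n) t)) \<longlonglongrightarrow> 0"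
    "(\<lambda>n. \<integral>\<^sup>+\<omega>. ennreal ((I \<omega> - step_integral W (cs n) \<omega>)\<^sup>2) \<partial>P) \<longlonglongrightarrow> 0"
    using I unfolding is_wiener_integral_iff[OF f] by blast
  have Im[measurable]: "I \<in> borel_measurable P"
    using I by (auto simp: is_wiener_integral_def)
  have sm[measurable]: "step_integral W (cs n) \<in> borel_measurable P" for n
    using cs(1) step_integral_measurable by blast
  have "sqnorm ?U (\<lambda>t. c * f t - step_fun (scale_steps c (cs n)) t) = c\<^sup>2 * sqnorm ?U (\<lambda>t. f t - step_fun (cs n) t)" for n
    by (simp add: step_fun_scale sqnorm_cmult[symmetric] right_diff_distrib)
  moreover have "(\<lambda>n. c\<^sup>2 * sqnorm ?U (\<lambda>t. f t - step_fun (cs n) t)) \<longlonglongrightarrow> 0"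
    using tendsto_mult_left[OF cs(2), of "c\<^sup>2"] by simp
  moreover have "(\<integral>\<^sup>+\<omega>. ennreal ((c * I \<omega> - step_integral W (scale_steps c (cs n)) \<omega>)\<^sup>2) \<partial>P)
      = ennreal (c\<^sup>2) * (\<integral>\<^sup>+\<omega>. ennreal ((I \<omega> - step_integral W (cs n) \<omega>)\<^sup>2) \<partial>P)" for n
    by (subst nn_integral_cmult[symmetric])
       (auto intro!: nn_integral_cong simp: step_integral_scale ennreal_mult[symmetric] power_mult_distrib[symmetric] right_diff_distrib)
  moreover have "(\<lambda>n. ennreal (c\<^sup>2) * (\<integral>\<^sup>+\<omega>. ennreal ((I \<omega> - step_integral W (cs n) \<omega>)\<^sup>2) \<partial>P)) \<longlonglongrightarrow> ennreal (c\<^sup>2) * 0"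
    by (intro ennreal_tendsto_cmult cs(3)) auto
  ultimately show ?thesis
    unfolding is_wiener_integral_iff[OF square_integrable_cmult[OF f]]
    using cs(1) by (intro conjI exI[of _ "\<lambda>n. scale_steps c (cs n)"]) auto
qed

text \<open>Fatou's lemma along an almost surely convergent subsequence. Applied to twice the
  integral, it provides the second moments of the exponentials from which equality is
  derived.\<close>

lemma wiener_mgf_le:
  assumes T: "T \<ge> 0" and f: "square_integrable (lborel_upto T) f" and I: "is_wiener_integral P W T f I"
  shows "(\<integral>\<^sup>+\<omega>. ennreal (exp (I \<omega>)) \<partial>P) \<le> ennreal (exp (sqnorm (lborel_upto T) f / 2))"
proof -
  let ?U = "lborel_upto T"
  obtain cs where cs: "\<And>n. valid_steps T (cs n)" "(\<lambda>n. sqnorm ?U (\<lambda>t. f t - step_fun (cs n) t)) \<longlonglongrightarrow> 0"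
    "(\<lambda>n. \<integral>\<^sup>+\<omega>. ennreal ((I \<omega> - step_integral W (cs n) \<omega>)\<^sup>2) \<partial>P) \<longlonglongrightarrow> 0"
    using I unfolding is_wiener_integral_iff[OF f] by blast
  have Im[measurable]: "I \<in> borel_measurable P"
    using I by (auto simp: is_wiener_integral_def)
  have sm[measurable]: "step_integral W (cs n) \<in> borel_measurable P" for n
    using cs(1) step_integral_measurable by blast
  let ?D = "\<lambda>n. \<integral>\<^sup>+\<omega>. ennreal ((I \<omega> - step_integral W (cs n) \<omega>)\<^sup>2) \<partial>P"
  \<comment> \<open>Only from some index on is the distance known to be finite, which makes the
    difference square integrable; hence the shift by n0 below.\<close>
  obtain n0 where n0: "\<And>n. n \<ge> n0 \<Longrightarrow> ?D n < 1"
    using order_tendstoD(2)[OF cs(3), of 1] by (auto simp: eventually_sequentially)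
  have sqi: "square_integrable P (\<lambda>\<omega>. I \<omega> - step_integral W (cs (n + n0)) \<omega>)" for n
    by (rule square_integrableI_nn) (use n0[of "n + n0"] in \<open>auto intro: less_trans\<close>)
  have lim0: "(\<lambda>n. LINT \<omega>|P. norm ((I \<omega> - step_integral W (cs (n + n0)) \<omega>)\<^sup>2)) \<longlonglongrightarrow> 0"
  proof -
    have "(\<lambda>n. ?D (n + n0)) \<longlonglongrightarrow> 0" by (rule LIMSEQ_ignore_initial_segment[OF cs(3)])
    then have "(\<lambda>n. ennreal (sqnorm P (\<lambda>\<omega>. I \<omega> - step_integral W (cs (n + n0)) \<omega>))) \<longlonglongrightarrow> ennreal 0"
      by (simp add: nn_integral_square[OF sqi])
    then show ?thesis
      by (subst (asm) tendsto_ennreal_iff) (auto simp: sqnorm_nonneg sqnorm_def)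
  qed
  obtain r :: "nat \<Rightarrow> nat" where r: "strict_mono r"
    and AE0: "AE \<omega> in P. (\<lambda>n. (I \<omega> - step_integral W (cs (r n + n0)) \<omega>)\<^sup>2) \<longlonglongrightarrow> 0"
    using tendsto_L1_AE_subseq[OF square_integrable_integrable_square[OF sqi] lim0] by blast
  have AE1: "AE \<omega> in P. ennreal (exp (I \<omega>)) = liminf (\<lambda>n. ennreal (exp (step_integral W (cs (r n + n0)) \<omega>)))"
    using AE0
  proof eventually_elim
    case (elim \<omega>)
    have "(\<lambda>n. sqrt ((I \<omega> - step_integral W (cs (r n + n0)) \<omega>)\<^sup>2)) \<longlonglongrightarrow> sqrt 0"
      by (rule tendsto_real_sqrt[OF elim])
    then have "(\<lambda>n. I \<omega> - step_integral W (cs (r n + n0)) \<omega>) \<longlonglongrightarrow> 0"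
      by (simp add: tendsto_rabs_zero_iff)
    then have "(\<lambda>n. I \<omega> - (I \<omega> - step_integral W (cs (r n + n0)) \<omega>)) \<longlonglongrightarrow> I \<omega> - 0"
      by (intro tendsto_intros)
    then have "(\<lambda>n. ennreal (exp (step_integral W (cs (r n + n0)) \<omega>))) \<longlonglongrightarrow> ennreal (exp (I \<omega>))"
      by (intro tendsto_ennrealI tendsto_exp) simp
    then show ?case using lim_imp_Liminf[OF sequentially_bot] by metis
  qed
  have "(\<lambda>n. sqnorm ?U (step_fun (cs n))) \<longlonglongrightarrow> sqnorm ?U f"
    using cs(2) by (intro sqnorm_tendsto square_integrable_step_fun f) (simp add: sqnorm_diff_commute)
  then have slim: "(\<lambda>n. ennreal (exp (sqnorm ?U (step_fun (cs (r n + n0))) / 2))) \<longlonglongrightarrow> ennreal (exp (sqnorm ?U f / 2))"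
    using LIMSEQ_subseq_LIMSEQ[OF LIMSEQ_ignore_initial_segment[of _ _ n0] r]
    by (intro tendsto_ennrealI tendsto_exp tendsto_divide tendsto_const) (auto simp: comp_def)
  have "(\<integral>\<^sup>+\<omega>. ennreal (exp (I \<omega>)) \<partial>P) = (\<integral>\<^sup>+\<omega>. liminf (\<lambda>n. ennreal (exp (step_integral W (cs (r n + n0)) \<omega>))) \<partial>P)"
    by (rule nn_integral_cong_AE[OF AE1])
  also have "\<dots> \<le> liminf (\<lambda>n. \<integral>\<^sup>+\<omega>. ennreal (exp (step_integral W (cs (r n + n0)) \<omega>)) \<partial>P)"
    by (rule nn_integral_liminf) measurable
  also have "\<dots> = liminf (\<lambda>n. ennreal (exp (sqnorm ?U (step_fun (cs (r n + n0))) / 2)))"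
    by (simp add: step_integral_mgf[OF cs(1) T])
  also have "\<dots> = ennreal (exp (sqnorm ?U f / 2))"
    by (rule lim_imp_Liminf[OF sequentially_bot slim])
  finally show ?thesis .
qed

text \<open>By \<open>exp_diff_le\<close> and Cauchy-Schwarz the distance of the exponentials is at
  most the distance of the integrals times the norms of the exponentials. The latter stay bounded,
  so the expectations converge.\<close>

theorem wiener_mgf:
  assumes T: "T \<ge> 0" and f: "square_integrable (lborel_upto T) f" and I: "is_wiener_integral P W T f I"
  shows "(\<integral>\<^sup>+\<omega>. ennreal (exp (I \<omega>)) \<partial>P) = ennreal (exp (sqnorm (lborel_upto T) f / 2))"
proof -
  let ?U = "lborel_upto T"
  obtain cs where cs: "\<And>n. valid_steps T (cs n)" "(\<lambda>n. sqnorm ?U (\<lambda>t. f t - step_fun (cs n) t)) \<longlonglongrightarrow> 0"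
    "(\<lambda>n. \<integral>\<^sup>+\<omega>. ennreal ((I \<omega> - step_integral W (cs n) \<omega>)\<^sup>2) \<partial>P) \<longlonglongrightarrow> 0"
    using I unfolding is_wiener_integral_iff[OF f] by blast
  let ?S = "\<lambda>n. step_integral W (cs n)"
  have Im[measurable]: "I \<in> borel_measurable P"
    using I by (auto simp: is_wiener_integral_def)
  have sm[measurable]: "?S n \<in> borel_measurable P" for n
    using cs(1) step_integral_measurable by blast
  have expI2: "(\<integral>\<^sup>+\<omega>. ennreal ((exp (J \<omega>))\<^sup>2) \<partial>P) \<le> ennreal (exp (2 * sqnorm ?U g))"
    if g: "square_integrable ?U g" and J: "is_wiener_integral P W T g J" for g J
  proof -
    have "(\<integral>\<^sup>+\<omega>. ennreal (exp (2 * J \<omega>)) \<partial>P) \<le> ennreal (exp (sqnorm ?U (\<lambda>t. 2 * g t) / 2))"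
      by (rule wiener_mgf_le[OF T square_integrable_cmult[OF g] is_wiener_integral_scale[OF g J]])
    then show ?thesis by (simp add: exp_double[symmetric] sqnorm_cmult)
  qed
  have sqe: "square_integrable P (\<lambda>\<omega>. exp (J \<omega>))"
    if g: "square_integrable ?U g" and J: "is_wiener_integral P W T g J" for g J
    by (rule square_integrableI_nn) (use is_wiener_integral_measurable[OF J] expI2[OF g J] in \<open>auto intro: le_less_trans\<close>)
  have sqe_le: "sqnorm P (\<lambda>\<omega>. exp (J \<omega>)) \<le> exp (2 * sqnorm ?U g)"
    if g: "square_integrable ?U g" and J: "is_wiener_integral P W T g J" for g J
    using expI2[OF g J] by (simp add: nn_integral_square[OF sqe[OF g J]])
  note stepw = square_integrable_step_fun is_wiener_integral_step[OF cs(1)]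
  let ?D = "\<lambda>n. \<integral>\<^sup>+\<omega>. ennreal ((I \<omega> - ?S n \<omega>)\<^sup>2) \<partial>P"
  obtain n0 where n0: "\<And>n. n \<ge> n0 \<Longrightarrow> ?D n < 1"
    using order_tendstoD(2)[OF cs(3), of 1] by (auto simp: eventually_sequentially)
  have sqi: "square_integrable P (\<lambda>\<omega>. I \<omega> - ?S (n + n0) \<omega>)" for n
    by (rule square_integrableI_nn) (use n0[of "n + n0"] in \<open>auto intro: less_trans\<close>)
  have lim0: "(\<lambda>n. sqnorm P (\<lambda>\<omega>. I \<omega> - ?S (n + n0) \<omega>)) \<longlonglongrightarrow> 0"
  proof -
    have "(\<lambda>n. ?D (n + n0)) \<longlonglongrightarrow> 0" by (rule LIMSEQ_ignore_initial_segment[OF cs(3)])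
    then have "(\<lambda>n. ennreal (sqnorm P (\<lambda>\<omega>. I \<omega> - ?S (n + n0) \<omega>))) \<longlonglongrightarrow> ennreal 0"
      by (simp add: nn_integral_square[OF sqi])
    then show ?thesis
      by (subst (asm) tendsto_ennreal_iff) (auto simp: sqnorm_nonneg)
  qed
  have slim: "(\<lambda>n. sqnorm ?U (step_fun (cs (n + n0)))) \<longlonglongrightarrow> sqnorm ?U f"
    using LIMSEQ_ignore_initial_segment[OF cs(2), of n0]
    by (intro sqnorm_tendsto square_integrable_step_fun f) (simp add: sqnorm_diff_commute)
  have prob_int: "integrable P g" if "square_integrable P g" for g
    using square_integrable_mult[OF that, of "\<lambda>_. 1"] by (simp add: square_integrable_def)
  have intS: "(LINT \<omega>|P. exp (?S n \<omega>)) = exp (sqnorm ?U (step_fun (cs n)) / 2)" for n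
    by (simp add: integral_eq_nn_integral step_integral_mgf[OF cs(1) T])
  let ?c = "\<lambda>n. sqrt (sqnorm P (\<lambda>\<omega>. I \<omega> - ?S (n + n0) \<omega>))
     * sqrt (2 * exp (2 * sqnorm ?U f) + 2 * exp (2 * sqnorm ?U (step_fun (cs (n + n0)))))"
  have bound: "\<bar>(LINT \<omega>|P. exp (I \<omega>)) - exp (sqnorm ?U (step_fun (cs (n + n0))) / 2)\<bar> \<le> ?c n" for n
  proof -
    let ?N = "n + n0"
    have sI: "square_integrable P (\<lambda>\<omega>. exp (I \<omega>))" by (rule sqe[OF f I])
    have sS: "square_integrable P (\<lambda>\<omega>. exp (?S ?N \<omega>))" by (rule sqe[OF stepw])
    have abs_sq: "square_integrable P (\<lambda>\<omega>. \<bar>I \<omega> - ?S ?N \<omega>\<bar>)"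
      using sqi[of n] by (simp add: square_integrable_def)
    have "\<bar>(LINT \<omega>|P. exp (I \<omega>)) - exp (sqnorm ?U (step_fun (cs ?N)) / 2)\<bar> = \<bar>LINT \<omega>|P. exp (I \<omega>) - exp (?S ?N \<omega>)\<bar>"
      using prob_int[OF sI] prob_int[OF sS] by (simp add: intS)
    also have "\<dots> \<le> (LINT \<omega>|P. \<bar>exp (I \<omega>) - exp (?S ?N \<omega>)\<bar>)"
      by (rule integral_abs_bound)
    also have "\<dots> \<le> (LINT \<omega>|P. \<bar>I \<omega> - ?S ?N \<omega>\<bar> * (exp (I \<omega>) + exp (?S ?N \<omega>)))"
      using prob_int[OF sI] prob_int[OF sS]
      by (intro integral_mono square_integrable_mult[OF abs_sq square_integrable_add[OF sI sS]] exp_diff_le) auto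
    also have "\<dots> \<le> sqrt (sqnorm P (\<lambda>\<omega>. \<bar>I \<omega> - ?S ?N \<omega>\<bar>)) * sqrt (sqnorm P (\<lambda>\<omega>. exp (I \<omega>) + exp (?S ?N \<omega>)))"
      using square_integrable_Cauchy_Schwarz[OF abs_sq square_integrable_add[OF sI sS]] by linarith
    also have "\<dots> \<le> ?c n"
    proof (intro mult_mono real_sqrt_le_mono)
      show "sqnorm P (\<lambda>\<omega>. \<bar>I \<omega> - ?S ?N \<omega>\<bar>) \<le> sqnorm P (\<lambda>\<omega>. I \<omega> - ?S ?N \<omega>)" by (simp add: sqnorm_def)
      have "sqnorm P (\<lambda>\<omega>. exp (I \<omega>) + exp (?S ?N \<omega>)) \<le> 2 * sqnorm P (\<lambda>\<omega>. exp (I \<omega>)) + 2 * sqnorm P (\<lambda>\<omega>. exp (?S ?N \<omega>))"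
        by (rule sqnorm_add_le[OF sI sS])
      then show "sqnorm P (\<lambda>\<omega>. exp (I \<omega>) + exp (?S ?N \<omega>))
          \<le> 2 * exp (2 * sqnorm ?U f) + 2 * exp (2 * sqnorm ?U (step_fun (cs ?N)))"
        using sqe_le[OF f I] sqe_le[OF stepw, of ?N] by linarith
    qed (auto simp: sqnorm_nonneg)
    finally show ?thesis .
  qed
  have "?c \<longlonglongrightarrow> sqrt 0 * sqrt (2 * exp (2 * sqnorm ?U f) + 2 * exp (2 * sqnorm ?U f))"
    by (intro tendsto_intros lim0 slim)
  then have c0: "?c \<longlonglongrightarrow> 0" by simp
  have "(\<lambda>n. (LINT \<omega>|P. exp (I \<omega>)) - exp (sqnorm ?U (step_fun (cs (n + n0))) / 2)) \<longlonglongrightarrow> 0"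
    by (rule Lim_null_comparison[OF always_eventually c0]) (use bound in simp)
  moreover have "(\<lambda>n. (LINT \<omega>|P. exp (I \<omega>)) - exp (sqnorm ?U (step_fun (cs (n + n0))) / 2))
      \<longlonglongrightarrow> (LINT \<omega>|P. exp (I \<omega>)) - exp (sqnorm ?U f / 2)"
    by (intro tendsto_intros slim) simp
  ultimately have "0 = (LINT \<omega>|P. exp (I \<omega>)) - exp (sqnorm ?U f / 2)"
    by (rule LIMSEQ_unique)
  then have "(LINT \<omega>|P. exp (I \<omega>)) = exp (sqnorm ?U f / 2)" by simp
  then show ?thesis
    using nn_integral_eq_integral[OF prob_int[OF sqe[OF f I]]] by simp
qed

end

section \<open>Chaining and exponential moments\<close>

text \<open>Markov's inequality for exp (c * X) with the optimal c = a / v, for X and for -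
  X.\<close>

lemma Chernoff_two_sided:
  assumes X[measurable]: "X \<in> borel_measurable M" and v: "v > 0" and a: "a \<ge> 0"
    and mgf: "\<And>c. (\<integral>\<^sup>+\<omega>. ennreal (exp (c * X \<omega>)) \<partial>M) \<le> ennreal (exp (c\<^sup>2 * v / 2))"
  shows "emeasure M {\<omega>\<in>space M. a \<le> \<bar>X \<omega>\<bar>} \<le> ennreal (2 * exp (- (a\<^sup>2 / (2 * v))))"
proof -
  have one: "emeasure M {\<omega>\<in>space M. a \<le> Y \<omega>} \<le> ennreal (exp (- (a\<^sup>2 / (2 * v))))"
    if Y[measurable]: "Y \<in> borel_measurable M"
      and Y_mgf: "(\<integral>\<^sup>+\<omega>. ennreal (exp (a / v * Y \<omega>)) \<partial>M) \<le> ennreal (exp ((a / v)\<^sup>2 * v / 2))" for Y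
  proof -
    have "emeasure M {\<omega>\<in>space M. a \<le> Y \<omega>} = (\<integral>\<^sup>+\<omega>. indicator {\<omega>\<in>space M. a \<le> Y \<omega>} \<omega> \<partial>M)"
      by simp
    also have "\<dots> \<le> (\<integral>\<^sup>+\<omega>. ennreal (exp (- (a / v * a))) * ennreal (exp (a / v * Y \<omega>)) \<partial>M)"
    proof (rule nn_integral_mono)
      fix \<omega>
      show "indicator {\<omega>\<in>space M. a \<le> Y \<omega>} \<omega> \<le> ennreal (exp (- (a / v * a))) * ennreal (exp (a / v * Y \<omega>))"
      proof (cases "a \<le> Y \<omega>")
        case True
        then have "a / v * a \<le> a / v * Y \<omega>" using a v by (intro mult_left_mono) auto
        then have "1 \<le> exp (- (a / v * a)) * exp (a / v * Y \<omega>)" by (simp add: exp_add[symmetric])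
        then show ?thesis by (simp add: ennreal_mult'[symmetric] indicator_def)
      qed simp
    qed
    also have "\<dots> = ennreal (exp (- (a / v * a))) * (\<integral>\<^sup>+\<omega>. ennreal (exp (a / v * Y \<omega>)) \<partial>M)"
      by (rule nn_integral_cmult) simp
    also have "\<dots> \<le> ennreal (exp (- (a / v * a))) * ennreal (exp ((a / v)\<^sup>2 * v / 2))"
      by (rule mult_left_mono[OF Y_mgf]) simp
    also have "\<dots> = ennreal (exp (- (a\<^sup>2 / (2 * v))))"
    proof -
      have "- (a / v * a) + (a / v)\<^sup>2 * v / 2 = - (a\<^sup>2 / (2 * v))"
        using v by (simp add: power2_eq_square field_simps)
      then show ?thesis by (simp add: ennreal_mult'[symmetric] exp_add[symmetric])
    qed
    finally show ?thesis .
  qed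
  have "{\<omega>\<in>space M. a \<le> \<bar>X \<omega>\<bar>} \<subseteq> {\<omega>\<in>space M. a \<le> X \<omega>} \<union> {\<omega>\<in>space M. a \<le> - X \<omega>}" by auto
  then have "emeasure M {\<omega>\<in>space M. a \<le> \<bar>X \<omega>\<bar>} \<le> emeasure M ({\<omega>\<in>space M. a \<le> X \<omega>} \<union> {\<omega>\<in>space M. a \<le> - X \<omega>})"
    by (rule emeasure_mono) measurable
  also have "\<dots> \<le> emeasure M {\<omega>\<in>space M. a \<le> X \<omega>} + emeasure M {\<omega>\<in>space M. a \<le> - X \<omega>}"
    by (rule emeasure_subadditive) measurable
  also have "\<dots> \<le> ennreal (exp (- (a\<^sup>2 / (2 * v)))) + ennreal (exp (- (a\<^sup>2 / (2 * v))))"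
    using mgf[of "a / v"] mgf[of "- (a / v)"] by (intro add_mono one) auto
  also have "\<dots> = ennreal (2 * exp (- (a\<^sup>2 / (2 * v))))"
    by (simp flip: ennreal_plus)
  finally show ?thesis .
qed

text \<open>The increments of level \<open>k\<close> are compared with \<open>a / 4 * (3 / 4) ^ k\<close>, and these
  thresholds sum up to \<open>a\<close>.\<close>

lemma dyadic_chaining:
  fixes X :: "real \<Rightarrow> 'a \<Rightarrow> real"
  assumes d: "d > 0" and v: "v > 0" and a: "a > 0" "512 * v * d \<le> a\<^sup>2"
    and meas: "\<And>t. t \<in> {s..s+d} \<Longrightarrow> X t \<in> borel_measurable M"
    and cont: "\<And>\<omega>. \<omega> \<in> space M \<Longrightarrow> continuous_on {s..s+d} (\<lambda>t. X t \<omega>)"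
    and tail: "\<And>r t x. s \<le> r \<Longrightarrow> r < t \<Longrightarrow> t \<le> s + d \<Longrightarrow> x \<ge> 0 \<Longrightarrow>
       emeasure M {\<omega>\<in>space M. x \<le> \<bar>X t \<omega> - X r \<omega>\<bar>} \<le> ennreal (2 * exp (- (x\<^sup>2 / (2 * (v * (t - r))))))"
  shows "\<exists>B\<in>sets M. emeasure M B \<le> ennreal (4 * exp (- (a\<^sup>2 / (32 * v * d))))
     \<and> (\<forall>\<omega>\<in>space M - B. \<forall>t\<in>{s..s+d}. \<bar>X t \<omega> - X s \<omega>\<bar> \<le> a)"
proof -
  define p where "p = (\<lambda>(k::nat) (i::nat). s + d * i / 2^k)"
  define x where "x = (\<lambda>k::nat. a / 4 * (3/4)^k)"
  \<comment> \<open>The hypothesis on a says that A \<ge> 16, which is what the union bound over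
    each level requires.\<close>
  define A where "A = a\<^sup>2 / (32 * v * d)"
  have A: "A \<ge> 16" using a d v by (simp add: A_def field_simps)
  have x0: "x k \<ge> 0" for k using a by (simp add: x_def)
  have p_in: "p k i \<in> {s..s+d}" if "i \<le> 2^k" for k i
  proof -
    have "real i \<le> 2^k" using that by (metis of_nat_le_iff of_nat_numeral of_nat_power)
    then have "d * i \<le> d * 2^k" using d by simp
    then show ?thesis using d by (simp add: p_def divide_le_eq)
  qed
  have p_step: "p k (Suc i) - p k i = d / 2^k" for k i
    by (simp add: p_def add_divide_distrib distrib_left)
  define E where "E = (\<lambda>k i. {\<omega>\<in>space M. x k \<le> \<bar>X (p k (Suc i)) \<omega> - X (p k i) \<omega>\<bar>})"
  have E_sets: "E k i \<in> sets M" if "i < 2^k" for k i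
    unfolding E_def
  proof -
    have [measurable]: "X (p k (Suc i)) \<in> borel_measurable M" "X (p k i) \<in> borel_measurable M"
      using p_in[of "Suc i" k] p_in[of i k] that by (auto intro!: meas)
    show "{\<omega>\<in>space M. x k \<le> \<bar>X (p k (Suc i)) \<omega> - X (p k i) \<omega>\<bar>} \<in> sets M" by measurable
  qed
  have E_le: "emeasure M (E k i) \<le> ennreal (2 * exp (- (A * (9/8)^k)))" if i: "i < 2^k" for k i
  proof -
    have "emeasure M (E k i) \<le> ennreal (2 * exp (- ((x k)\<^sup>2 / (2 * (v * (p k (Suc i) - p k i))))))"
      unfolding E_def using p_in[of i k] p_in[of "Suc i" k] i d p_step[of k i]
      by (intro tail x0) (auto simp: p_def divide_strict_right_mono)
    also have "(x k)\<^sup>2 / (2 * (v * (p k (Suc i) - p k i))) = A * (9/8)^k"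
    proof -
      \<comment> \<open>From one level to the next the variance is halved while the squared
        threshold shrinks by 9/16 only, so the exponent grows by the factor 9/8.\<close>
      have "((3/4)^k)\<^sup>2 * 2^k = ((9/8)^k :: real)"
        by (simp add: power_mult_distrib[symmetric] power2_eq_square)
      moreover have "(x k)\<^sup>2 * 2^k = a\<^sup>2 / 16 * (((3/4)^k)\<^sup>2 * 2^k)"
        unfolding x_def power_mult_distrib[of "a/4"] power_divide[of a] by simp
      ultimately have "(x k)\<^sup>2 * 2^k = a\<^sup>2 / 16 * (9/8)^k" by simp
      moreover have "(x k)\<^sup>2 / (2 * (v * (p k (Suc i) - p k i))) = (x k)\<^sup>2 * 2^k / (2 * v * d)"
        using v d by (simp add: p_step)
      ultimately have "(x k)\<^sup>2 / (2 * (v * (p k (Suc i) - p k i))) = a\<^sup>2 / 16 * (9/8)^k / (2 * v * d)"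
        by (simp only:)
      then show ?thesis by (simp add: A_def)
    qed
    finally show ?thesis .
  qed
  define B where "B = (\<Union>k. \<Union>i\<in>{..<2^k}. E k i)"
  have lev_sets: "(\<Union>i\<in>{..<2^k}. E k i) \<in> sets M" for k
    by (rule sets.finite_UN) (auto intro: E_sets)
  have B: "B \<in> sets M" unfolding B_def by (intro sets.countable_UN) (use lev_sets in auto)
  have lev_le: "emeasure M (\<Union>i\<in>{..<2^k}. E k i) \<le> ennreal (2 * exp (- A) * (1/2)^k)" for k
  proof -
    have "emeasure M (\<Union>i\<in>{..<2^k}. E k i) \<le> (\<Sum>i<2^k. emeasure M (E k i))"
      by (rule emeasure_subadditive_finite) (auto intro: E_sets)
    also have "\<dots> \<le> (\<Sum>i<(2::nat)^k. ennreal (2 * exp (- (A * (9/8)^k))))"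
      by (rule sum_mono) (auto intro: E_le)
    also have "\<dots> = ennreal (2^k * (2 * exp (- (A * (9/8)^k))))"
      by (simp add: ennreal_mult ennreal_of_nat_eq_real_of_nat ennreal_power[symmetric])
    also have "\<dots> \<le> ennreal (2 * exp (- A) * (1/2)^k)"
    proof (rule ennreal_leI)
      \<comment> \<open>Since A \<ge> 16, Bernoulli's inequality gives A * (9/8)^k \<ge> A + 2 * k;
        the factor exp (- 2 * k) \<le> (1/4)^k pays for the 2^k intervals of the level and leaves
        (1/2)^k.\<close>
      have "1 + real k * (1/8) \<le> (1 + 1/8)^k" by (rule Bernoulli_inequality) simp
      then have "A * (1 + real k * (1/8)) \<le> A * (9/8)^k" using A by (intro mult_left_mono) auto
      moreover have "2 * real k \<le> A * (real k * (1/8))" using mult_right_mono[OF A, of "real k / 8"] by simp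
      ultimately have "- (A * (9/8)^k) \<le> - A - 2 * real k" by (simp add: distrib_left)
      then have "exp (- (A * (9/8)^k)) \<le> exp (- A - 2 * real k)" by simp
      also have "\<dots> = exp (- A) * (exp (- 2))^k" by (simp add: exp_diff exp_of_nat_mult[symmetric] exp_minus field_simps)
      also have "\<dots> \<le> exp (- A) * (1/4)^k"
      proof (intro mult_left_mono power_mono)
        have "(2::real) \<le> exp 1" using exp_ge_add_one_self[of 1] by simp
        then have "(2::real) * 2 \<le> exp 1 * exp 1" by (intro mult_mono) auto
        then have "4 \<le> exp (2::real)" by (simp add: exp_add[symmetric])
        then show "exp (- 2) \<le> (1/4 :: real)" by (simp add: exp_minus inverse_eq_divide divide_le_eq)
      qed auto
      finally have "2^k * (2 * exp (- (A * (9/8)^k))) \<le> 2^k * (2 * (exp (- A) * (1/4)^k))" by simp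
      also have "\<dots> = 2 * exp (- A) * (2^k * (1/4)^k)" by simp
      also have "(2::real)^k * (1/4)^k = (1/2)^k" by (simp add: power_mult_distrib[symmetric])
      finally show "2^k * (2 * exp (- (A * (9/8)^k))) \<le> 2 * exp (- A) * (1/2)^k" .
    qed
    finally show ?thesis .
  qed
  have "emeasure M B \<le> (\<Sum>k. emeasure M (\<Union>i\<in>{..<2^k}. E k i))"
    unfolding B_def by (rule emeasure_subadditive_countably) (use lev_sets in auto)
  also have "\<dots> \<le> (\<Sum>k. ennreal (2 * exp (- A) * (1/2)^k))"
    by (rule suminf_le[OF lev_le]) auto
  also have "\<dots> = ennreal (\<Sum>k. 2 * exp (- A) * (1/2)^k)"
    by (rule suminf_ennreal2) (auto intro!: summable_mult summable_geometric)
  also have "(\<Sum>k. 2 * exp (- A) * (1/2)^k) = 4 * exp (- A)"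
    by (subst suminf_mult) (auto simp: suminf_geometric summable_geometric)
  finally have Ble: "emeasure M B \<le> ennreal (4 * exp (- A))" .
  have good: "\<bar>X t \<omega> - X s \<omega>\<bar> \<le> a" if \<omega>: "\<omega> \<in> space M - B" and t: "t \<in> {s..s+d}" for \<omega> t
  proof -
    have inc: "\<bar>X (p k (Suc i)) \<omega> - X (p k i) \<omega>\<bar> \<le> x k" if "i < 2^k" for k i
      using \<omega> that by (auto simp: B_def E_def not_le intro: less_imp_le)
    have dy: "\<bar>X (p k i) \<omega> - X s \<omega>\<bar> \<le> (\<Sum>j\<le>k. x j)" if "i \<le> 2^k" for k i
      using that
    proof (induction k arbitrary: i)
      case 0
      then consider "i = 0" | "i = 1" by fastforce
      then show ?case
      proof cases
        case 1
        then show ?thesis using x0[of 0] by (simp add: p_def)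
      next
        case 2
        then show ?thesis using inc[of 0 0] by (simp add: p_def)
      qed
    next
      case (Suc k)
      \<comment> \<open>Even points belong to the previous level; an odd point is one increment of
        the current level away from its even left neighbour.\<close>
      have pp: "p (Suc k) (2 * j) = p k j" for j by (simp add: p_def)
      show ?case
      proof (cases "even i")
        case True
        then obtain j where j: "i = 2 * j" by blast
        then have "\<bar>X (p k j) \<omega> - X s \<omega>\<bar> \<le> (\<Sum>j\<le>k. x j)" using Suc by simp
        then show ?thesis using x0[of "Suc k"] by (simp add: j pp)
      next
        case False
        then obtain j where j: "i = Suc (2 * j)" using oddE by fastforce
        have "\<bar>X (p k j) \<omega> - X s \<omega>\<bar> \<le> (\<Sum>j\<le>k. x j)" using Suc j by simp
        moreover have "\<bar>X (p (Suc k) (Suc (2 * j))) \<omega> - X (p (Suc k) (2 * j)) \<omega>\<bar> \<le> x (Suc k)"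
          using Suc.prems j by (intro inc) simp
        ultimately show ?thesis by (simp add: j pp)
      qed
    qed
    have sumx: "(\<Sum>j\<le>k. x j) \<le> a" for k
    proof -
      have "(\<Sum>j\<le>k. x j) \<le> (\<Sum>j. x j)"
        unfolding x_def using a by (intro sum_le_suminf summable_mult summable_geometric) auto
      also have "\<dots> = a" unfolding x_def by (subst suminf_mult) (auto simp: suminf_geometric summable_geometric)
      finally show ?thesis .
    qed
    \<comment> \<open>The points p k (i k) approach t from below on the dyadic grids, and continuity
      carries the bound over to t.\<close>
    define i where "i = (\<lambda>k. nat \<lfloor>2^k * (t - s) / d\<rfloor>)"
    have nn: "0 \<le> 2^k * (t - s) / d" for k using t d by simp
    have i: "real (i k) \<le> 2^k * (t - s) / d" "2^k * (t - s) / d < real (i k) + 1" for k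
      using nn[of k] unfolding i_def by linarith+
    have i_le: "i k \<le> 2^k" for k
    proof -
      have "2^k * (t - s) / d \<le> 2^k" using t d by (simp add: divide_le_eq)
      then have "real (i k) \<le> 2^k" using i(1)[of k] by linarith
      then show ?thesis by (metis of_nat_le_iff of_nat_numeral of_nat_power)
    qed
    have close: "\<bar>p k (i k) - t\<bar> \<le> d * (1/2)^k" for k
    proof -
      have "d * real (i k) / 2^k \<le> t - s" using i(1)[of k] d by (simp add: field_simps)
      moreover have "t - s \<le> d * (real (i k) + 1) / 2^k"
        using i(2)[of k] d by (simp add: field_simps)
      moreover have "d * (real (i k) + 1) / 2^k = d * real (i k) / 2^k + d * (1/2)^k"
        by (simp add: field_simps power_one_over)
      ultimately show ?thesis by (simp add: p_def)
    qed
    have "(\<lambda>k. d * (1/2)^k) \<longlonglongrightarrow> d * 0" by (intro tendsto_intros LIMSEQ_power_zero) simp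
    then have d0: "(\<lambda>k. d * (1/2)^k) \<longlonglongrightarrow> 0" by simp
    have "(\<lambda>k. p k (i k) - t) \<longlonglongrightarrow> 0"
      by (rule Lim_null_comparison[OF always_eventually d0]) (use close in simp)
    then have plim: "(\<lambda>k. p k (i k)) \<longlonglongrightarrow> t" by (simp add: LIM_zero_iff)
    have Xlim: "(\<lambda>k. X (p k (i k)) \<omega>) \<longlonglongrightarrow> X t \<omega>"
      by (rule continuous_on_tendsto_compose[OF cont plim t]) (use \<omega> p_in[OF i_le] in auto)
    have "(\<lambda>k. \<bar>X (p k (i k)) \<omega> - X s \<omega>\<bar>) \<longlonglongrightarrow> \<bar>X t \<omega> - X s \<omega>\<bar>"
      by (intro tendsto_intros Xlim)
    then show ?thesis
      by (rule LIMSEQ_le_const2) (use dy[OF i_le] sumx in \<open>auto intro: order_trans\<close>)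
  qed
  show ?thesis
    using B Ble good by (auto simp: A_def)
qed

section \<open>Measurability of path functionals and exponential integrability of the
  supremum\<close>

definition path_sup :: "real \<Rightarrow> (real \<Rightarrow> real) \<Rightarrow> real" where
  "path_sup T w = (SUP t\<in>{0..T}. \<bar>w t\<bar>)"

lemma path_sup_upper:
  assumes "w \<in> wiener_space T" "T > 0" "t \<in> {0..T}"
  shows "\<bar>w t\<bar> \<le> path_sup T w"
proof -
  have c: "continuous_on {0..T} w" using assms by (simp add: paths_from_iff)
  have "bdd_above ((\<lambda>t. \<bar>w t\<bar>) ` {0..T})"
    by (intro bounded_imp_bdd_above compact_imp_bounded compact_continuous_image continuous_on_rabs c) simp
  then show ?thesis unfolding path_sup_def by (rule cSUP_upper[OF assms(3)])
qed

lemma path_sup_least: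
  assumes "T > 0" "\<And>t. t \<in> {0..T} \<Longrightarrow> \<bar>w t\<bar> \<le> m"
  shows "path_sup T w \<le> m"
  unfolding path_sup_def by (rule cSUP_least) (use assms in auto)

lemma path_sup_continuous:
  assumes T: "T > 0" and w: "w \<in> wiener_space T" and w': "w' \<in> wiener_space T"
    and d: "\<And>t. t \<in> {0..T} \<Longrightarrow> \<bar>w' t - w t\<bar> \<le> d"
  shows "\<bar>path_sup T w' - path_sup T w\<bar> \<le> d"
proof -
  have "path_sup T w' \<le> path_sup T w + d"
  proof (rule path_sup_least[OF T])
    fix t assume t: "t \<in> {0..T}"
    then show "\<bar>w' t\<bar> \<le> path_sup T w + d" using d[OF t] path_sup_upper[OF w T t] by linarith
  qed
  moreover have "path_sup T w \<le> path_sup T w' + d"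
  proof (rule path_sup_least[OF T])
    fix t assume t: "t \<in> {0..T}"
    then show "\<bar>w t\<bar> \<le> path_sup T w' + d" using d[OF t] path_sup_upper[OF w' T t] by linarith
  qed
  ultimately show ?thesis by linarith
qed

lemma interp_cong:
  assumes "\<And>i. i \<le> m \<Longrightarrow> w (grid T m i) = w' (grid T m i)"
  shows "interp T m w = interp T m w'"
proof -
  have "pdiff T m w = pdiff T m w'"
    unfolding pdiff_def using assms by (intro ext sum.cong) auto
  then show ?thesis by (simp add: interp_def)
qed

text \<open>In the factor 4, one d is due to the left end of the cell, one to time 0, since the
  interpolation subtracts the initial value, and two to the increment over the cell.\<close>

lemma interp_dist_le:
  assumes T: "T > 0" and m: "m > 0" and d: "\<And>i. i \<le> m \<Longrightarrow> \<bar>w' (grid T m i) - w (grid T m i)\<bar> \<le> d"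
    and t: "t \<in> {0..T}"
  shows "\<bar>interp T m w' t - interp T m w t\<bar> \<le> 4 * d"
proof -
  obtain i where i: "i < m" "t \<in> {grid T m i..grid T m (Suc i)}"
    by (rule grid_cell_exists[OF T m t])
  define lam where "lam = (t - grid T m i) / (T / real m)"
  have lam: "0 \<le> lam" "lam \<le> 1"
    using i T m by (auto simp: lam_def grid_Suc field_simps)
  have eq: "interp T m u t = u (grid T m i) - u 0 + (u (grid T m (Suc i)) - u (grid T m i)) * lam" for u
    using interp_cell[OF T i, of u] by (simp add: lam_def)
  define e where "e = (\<lambda>i. w' (grid T m i) - w (grid T m i))"
  have e: "\<bar>e j\<bar> \<le> d" if "j \<le> m" for j using d[OF that] by (simp add: e_def)
  have "\<bar>(e (Suc i) - e i) * lam\<bar> \<le> (2 * d) * 1"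
    unfolding abs_mult using e[of i] e[of "Suc i"] i lam by (intro mult_mono) auto
  moreover have "interp T m w' t - interp T m w t = e i - e 0 + (e (Suc i) - e i) * lam"
    unfolding eq e_def by (simp add: algebra_simps)
  ultimately show ?thesis using e[of i] e[of 0] i by simp
qed

context brownian
begin

lemma scaled_path_wiener:
  assumes "T > 0" "\<omega> \<in> space P"
  shows "scaled_path W T \<epsilon> \<omega> \<in> wiener_space T"
proof -
  have "continuous_on {0..T} (\<lambda>t. sqrt \<epsilon> * W t \<omega>)"
    by (intro continuous_on_mult_left continuous_on_subset[OF W_continuous[OF assms(2)]]) auto
  then have "continuous_on {0..T} (scaled_path W T \<epsilon> \<omega>)"
    by (rule continuous_on_eq) (simp add: scaled_path_def)
  then show ?thesis
    using assms by (simp add: paths_from_iff) (simp add: scaled_path_def W_0)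
qed

text \<open>The interpolation only sees finitely many values of the path, so a functional of the interpolated
  path is a continuous function on a finite-dimensional space.\<close>

lemma path_functional_measurable:
  fixes F :: "(real \<Rightarrow> real) \<Rightarrow> real"
  assumes T: "T > 0"
    and F: "\<And>w e. w \<in> wiener_space T \<Longrightarrow> e > 0 \<Longrightarrow> \<exists>d>0. \<forall>w'\<in>wiener_space T.
          (\<forall>t\<in>{0..T}. \<bar>w' t - w t\<bar> \<le> d) \<longrightarrow> \<bar>F w' - F w\<bar> < e"
  shows "(\<lambda>\<omega>. F (scaled_path W T \<epsilon> \<omega>)) \<in> borel_measurable P"
proof (rule borel_measurable_LIMSEQ_real)
  \<comment> \<open>A path with prescribed values at the grid points; rounding t * m / T recovers
    the index there.\<close>
  define path where "path = (\<lambda>m (a :: nat \<Rightarrow> real) t. a (nat (round (t * real m / T))))"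
  have path_grid: "path m a (grid T m i) = a i" if "m > 0" for m a i
  proof -
    have "grid T m i * real m / T = real i" using that T by (simp add: grid_def)
    then show ?thesis by (simp add: path_def)
  qed
  define H where "H = (\<lambda>m a. F (interp T m (path m a)))"
  have iw: "interp T m w \<in> wiener_space T" for m w
    using cm_space_wiener[OF interp_in_cm_space] T by simp
  have H_cont: "continuous_on UNIV (H m)" if m: "m > 0" for m
    unfolding continuous_on_def
  proof
    fix a :: "nat \<Rightarrow> real"
    show "(H m \<longlongrightarrow> H m a) (at a within UNIV)"
    proof (rule tendstoI)
      fix e :: real assume e: "e > 0"
      obtain d where d: "d > 0" "\<forall>w'\<in>wiener_space T.
          (\<forall>t\<in>{0..T}. \<bar>w' t - interp T m (path m a) t\<bar> \<le> d) \<longrightarrow> \<bar>F w' - F (interp T m (path m a))\<bar> < e"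
        using F[OF iw e] by blast
      have "\<forall>\<^sub>F b in at a within UNIV. \<bar>b i - a i\<bar> < d/4" for i
      proof -
        have "continuous_on UNIV (\<lambda>b::nat \<Rightarrow> real. b i)" by simp
        then have "((\<lambda>b. b i) \<longlongrightarrow> a i) (at a within UNIV)" by (simp add: continuous_on_def)
        from tendstoD[OF this, of "d/4"] d(1) show ?thesis by (simp add: dist_real_def)
      qed
      then have "\<forall>\<^sub>F b in at a within UNIV. \<forall>i\<in>{..m}. \<bar>b i - a i\<bar> < d/4"
        by (intro eventually_ball_finite) auto
      then show "\<forall>\<^sub>F b in at a within UNIV. dist (H m b) (H m a) < e"
      proof eventually_elim
        case (elim b)
        have "\<bar>interp T m (path m b) t - interp T m (path m a) t\<bar> \<le> 4 * (d/4)" if "t \<in> {0..T}" for t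
        proof (rule interp_dist_le[OF T m _ that])
          fix i assume "i \<le> m"
          then show "\<bar>path m b (grid T m i) - path m a (grid T m i)\<bar> \<le> d/4"
            using elim by (simp add: path_grid[OF m] less_imp_le)
        qed
        then show ?case using d(2) iw by (simp add: H_def dist_real_def)
      qed
    qed
  qed
  fix k :: nat
  let ?m = "Suc k"
  have coord: "(\<lambda>\<omega> i. if i \<le> ?m then sqrt \<epsilon> * W (grid T ?m i) \<omega> else 0) \<in> borel_measurable P"
  proof (rule measurable_coordinatewise_then_product)
    fix i
    show "(\<lambda>\<omega>. if i \<le> ?m then sqrt \<epsilon> * W (grid T ?m i) \<omega> else 0) \<in> borel_measurable P"
      using grid_bounds[of T ?m i] T by (cases "i \<le> ?m") auto
  qed
  have "(\<lambda>\<omega>. H ?m (\<lambda>i. if i \<le> ?m then sqrt \<epsilon> * W (grid T ?m i) \<omega> else 0)) \<in> borel_measurable P"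
    by (rule measurable_compose[OF coord borel_measurable_continuous_onI[OF H_cont]]) simp
  moreover have "H ?m (\<lambda>i. if i \<le> ?m then sqrt \<epsilon> * W (grid T ?m i) \<omega> else 0) = F (interp T ?m (scaled_path W T \<epsilon> \<omega>))" for \<omega>
  proof -
    have "interp T ?m (path ?m (\<lambda>i. if i \<le> ?m then sqrt \<epsilon> * W (grid T ?m i) \<omega> else 0)) = interp T ?m (scaled_path W T \<epsilon> \<omega>)"
    proof (rule interp_cong)
      fix i assume i: "i \<le> ?m"
      then show "path ?m (\<lambda>i. if i \<le> ?m then sqrt \<epsilon> * W (grid T ?m i) \<omega> else 0) (grid T ?m i) = scaled_path W T \<epsilon> \<omega> (grid T ?m i)"
        using grid_bounds[of T ?m i] T by (simp add: path_grid scaled_path_def)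
    qed
    then show ?thesis by (simp add: H_def)
  qed
  ultimately show "(\<lambda>\<omega>. F (interp T ?m (scaled_path W T \<epsilon> \<omega>))) \<in> borel_measurable P" by simp
next
  fix \<omega> assume \<omega>: "\<omega> \<in> space P"
  let ?w = "scaled_path W T \<epsilon> \<omega>"
  have w: "?w \<in> wiener_space T" by (rule scaled_path_wiener[OF T \<omega>])
  show "(\<lambda>k. F (interp T (Suc k) ?w)) \<longlonglongrightarrow> F ?w"
  proof (rule LIMSEQ_I)
    fix e :: real assume "e > 0"
    then obtain d where d: "d > 0" "\<forall>w'\<in>wiener_space T. (\<forall>t\<in>{0..T}. \<bar>w' t - ?w t\<bar> \<le> d) \<longrightarrow> \<bar>F w' - F ?w\<bar> < e"
      using F[OF w] by blast
    obtain M where M: "\<forall>m\<ge>M. \<forall>t\<in>{0..T}. \<bar>interp T m ?w t - ?w t\<bar> \<le> d"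
      using interp_uniform_limit[OF T w d(1)] by blast
    have iw: "interp T m ?w \<in> wiener_space T" for m
      using cm_space_wiener[OF interp_in_cm_space] T by simp
    have "norm (F (interp T (Suc k) ?w) - F ?w) < e" if "k \<ge> M" for k
      unfolding real_norm_def by (rule d(2)[rule_format, OF iw]) (use M that in simp)
    then show "\<exists>no. \<forall>k\<ge>no. norm (F (interp T (Suc k) ?w) - F ?w) < e" by blast
  qed
qed

lemma path_sup_measurable:
  assumes T: "T > 0"
  shows "(\<lambda>\<omega>. path_sup T (scaled_path W T \<epsilon> \<omega>)) \<in> borel_measurable P"
proof (rule path_functional_measurable[OF T])
  fix w and e :: real assume w: "w \<in> wiener_space T" and e: "e > 0"
  then have "\<bar>path_sup T w' - path_sup T w\<bar> < e"
    if "w' \<in> wiener_space T" "\<forall>t\<in>{0..T}. \<bar>w' t - w t\<bar> \<le> e/2" for w'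
    using path_sup_continuous[OF T w that(1), of "e/2"] that(2) e by auto
  then show "\<exists>d>0. \<forall>w'\<in>wiener_space T. (\<forall>t\<in>{0..T}. \<bar>w' t - w t\<bar> \<le> d) \<longrightarrow> \<bar>path_sup T w' - path_sup T w\<bar> < e"
    using e by (intro exI[of _ "e/2"]) auto
qed

lemma increment_tail:
  assumes "0 \<le> r" "r < t" "x \<ge> 0"
  shows "emeasure P {\<omega>\<in>space P. x \<le> \<bar>W t \<omega> - W r \<omega>\<bar>} \<le> ennreal (2 * exp (- (x\<^sup>2 / (2 * (1 * (t - r))))))"
proof -
  have [measurable]: "W t \<in> borel_measurable P" "W r \<in> borel_measurable P" using assms by auto
  show ?thesis
    by (rule Chernoff_two_sided) (use assms W_increment_mgf[of r t] in auto)
qed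

lemma increment_sup_tail:
  assumes "0 \<le> s" "d > 0" "a > 0" "512 * d \<le> a\<^sup>2"
  shows "\<exists>B\<in>sets P. emeasure P B \<le> ennreal (4 * exp (- (a\<^sup>2 / (32 * d))))
     \<and> (\<forall>\<omega>\<in>space P - B. \<forall>t\<in>{s..s+d}. \<bar>W t \<omega> - W s \<omega>\<bar> \<le> a)"
proof -
  have "\<exists>B\<in>sets P. emeasure P B \<le> ennreal (4 * exp (- (a\<^sup>2 / (32 * 1 * d))))
     \<and> (\<forall>\<omega>\<in>space P - B. \<forall>t\<in>{s..s+d}. \<bar>W t \<omega> - W s \<omega>\<bar> \<le> a)"
  proof (rule dyadic_chaining)
    show "continuous_on {s..s+d} (\<lambda>t. W t \<omega>)" if "\<omega> \<in> space P" for \<omega>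
      by (rule continuous_on_subset[OF W_continuous[OF that]]) (use assms in auto)
    show "emeasure P {\<omega>\<in>space P. x \<le> \<bar>W t \<omega> - W r \<omega>\<bar>} \<le> ennreal (2 * exp (- (x\<^sup>2 / (2 * (1 * (t - r))))))"
      if "s \<le> r" "r < t" "t \<le> s + d" "x \<ge> 0" for r t x
      by (rule increment_tail) (use that assms in auto)
  qed (use assms in auto)
  then show ?thesis by simp
qed

text \<open>Chaining on {0..T} gives tails of order exp (- n^2 / (32 * T)), which beat exp (S^2 /
  (256 * T)) once the expectation is decomposed over the integer levels of the supremum S.\<close>

theorem Fernique:
  assumes T: "T > 0"
  shows "\<exists>C. (\<integral>\<^sup>+\<omega>. ennreal (exp ((path_sup T (scaled_path W T 1 \<omega>))\<^sup>2 / (256 * T))) \<partial>P) \<le> ennreal C"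
proof -
  define S where "S = (\<lambda>\<omega>. path_sup T (scaled_path W T 1 \<omega>))"
  have S[measurable]: "S \<in> borel_measurable P" unfolding S_def by (rule path_sup_measurable[OF T])
  \<comment> \<open>From n0 on, n^2 \<ge> 512 * T, as the chaining estimate requires for the
    interval length T and the threshold n.\<close>
  define n0 where "n0 = nat \<lceil>512 * T\<rceil> + 1"
  have n0: "real n0 \<ge> 512 * T" "n0 \<ge> 1" unfolding n0_def by linarith+
  have tail: "emeasure P {\<omega>\<in>space P. real n < S \<omega>} \<le> ennreal (4 * exp (- ((real n)\<^sup>2 / (32 * T))))" if n: "n \<ge> n0" for n
  proof -
    have n1: "real n \<ge> 1" "real n \<ge> 512 * T" using n n0 by auto
    have "512 * T \<le> (real n)\<^sup>2"
      using mult_left_mono[OF n1(1), of "real n"] n1 unfolding power2_eq_square by linarith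
    then obtain B where B: "B \<in> sets P" "emeasure P B \<le> ennreal (4 * exp (- ((real n)\<^sup>2 / (32 * T))))"
      "\<forall>\<omega>\<in>space P - B. \<forall>t\<in>{0..0+T}. \<bar>W t \<omega> - W 0 \<omega>\<bar> \<le> real n"
      using increment_sup_tail[of 0 T "real n"] T n1 by auto
    have "{\<omega>\<in>space P. real n < S \<omega>} \<subseteq> B"
    proof
      fix \<omega> assume \<omega>: "\<omega> \<in> {\<omega>\<in>space P. real n < S \<omega>}"
      show "\<omega> \<in> B"
      proof (rule ccontr)
        assume nB: "\<omega> \<notin> B"
        have "S \<omega> \<le> real n"
          unfolding S_def
        proof (rule path_sup_least[OF T])
          fix t assume "t \<in> {0..T}"
          then show "\<bar>scaled_path W T 1 \<omega> t\<bar> \<le> real n"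
            using B(3) \<omega> nB by (auto simp: scaled_path_def W_0)
        qed
        with \<omega> show False by simp
      qed
    qed
    then have "emeasure P {\<omega>\<in>space P. real n < S \<omega>} \<le> emeasure P B" by (rule emeasure_mono[OF _ B(1)])
    with B(2) show ?thesis by simp
  qed
  define c where "c = (\<lambda>n. exp ((real n + 1)\<^sup>2 / (256 * T)))"
  define J where "J = (\<lambda>n \<omega>. if n0 \<le> n then ennreal (c n) * indicator {\<omega>\<in>space P. real n < S \<omega>} \<omega> else 0)"
  have Jm[measurable]: "J n \<in> borel_measurable P" for n unfolding J_def by (cases "n0 \<le> n") auto
  have Jint: "(\<integral>\<^sup>+\<omega>. J n \<omega> \<partial>P) \<le> ennreal (4 * exp (- (1 / (64 * T)))^n)" for n
  proof (cases "n0 \<le> n")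
    case True
    have n1: "real n \<ge> 1" using True n0 by auto
    \<comment> \<open>For n \<ge> 1 passing from n to n + 1 costs at most a factor 4 in the square,
      so 256 becomes 64 and half of the exponent of the tail survives.\<close>
    have "(real n + 1)\<^sup>2 \<le> (2 * real n)\<^sup>2" using n1 by (intro power_mono) auto
    then have "(real n + 1)\<^sup>2 / (256 * T) \<le> (2 * real n)\<^sup>2 / (256 * T)" using T by (intro divide_right_mono) auto
    then have "(real n + 1)\<^sup>2 / (256 * T) + - ((real n)\<^sup>2 / (32 * T)) \<le> - ((real n)\<^sup>2 / (64 * T))"
      using T by (simp add: power_mult_distrib field_simps)
    also have "\<dots> \<le> - (real n / (64 * T))"
      using T n1 mult_mono[of 1 "real n" "real n" "real n"] by (simp add: divide_right_mono power2_eq_square)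
    finally have e: "c n * exp (- ((real n)\<^sup>2 / (32 * T))) \<le> exp (- (1 / (64 * T)))^n"
      by (simp add: c_def exp_add[symmetric] exp_of_nat_mult[symmetric])
    have "(\<integral>\<^sup>+\<omega>. J n \<omega> \<partial>P) = ennreal (c n) * emeasure P {\<omega>\<in>space P. real n < S \<omega>}"
      using True by (simp add: J_def nn_integral_cmult_indicator)
    also have "\<dots> \<le> ennreal (c n) * ennreal (4 * exp (- ((real n)\<^sup>2 / (32 * T))))"
      by (rule mult_left_mono[OF tail[OF True]]) simp
    also have "\<dots> = ennreal (4 * (c n * exp (- ((real n)\<^sup>2 / (32 * T)))))"
      by (subst ennreal_mult'[symmetric]) (auto simp: c_def ac_simps)
    also have "\<dots> \<le> ennreal (4 * exp (- (1 / (64 * T)))^n)"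
      using e by (intro ennreal_leI) simp
    finally show ?thesis .
  qed (simp add: J_def)
  have le: "ennreal (exp ((S \<omega>)\<^sup>2 / (256 * T))) \<le> ennreal (exp ((real n0)\<^sup>2 / (256 * T))) + (\<Sum>n. J n \<omega>)" if \<omega>: "\<omega> \<in> space P" for \<omega>
  proof (cases "S \<omega> \<le> real n0")
    case True
    have "S \<omega> \<ge> 0"
      unfolding S_def using path_sup_upper[OF scaled_path_wiener[OF T \<omega>] T, of 0 1] T by simp
    then have "(S \<omega>)\<^sup>2 \<le> (real n0)\<^sup>2" using True by (intro power_mono) auto
    then have "ennreal (exp ((S \<omega>)\<^sup>2 / (256 * T))) \<le> ennreal (exp ((real n0)\<^sup>2 / (256 * T)))"
      using T by (intro ennreal_leI) (simp add: divide_right_mono)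
    then show ?thesis by (rule order_trans) simp
  next
    case False
    define n where "n = nat (\<lceil>S \<omega>\<rceil> - 1)"
    have n: "real n < S \<omega>" "S \<omega> \<le> real n + 1" "n0 \<le> n"
      using False unfolding n_def by linarith+
    have "(S \<omega>)\<^sup>2 \<le> (real n + 1)\<^sup>2" using n by (intro power_mono) auto
    then have "ennreal (exp ((S \<omega>)\<^sup>2 / (256 * T))) \<le> ennreal (c n)"
      unfolding c_def using T by (intro ennreal_leI) (simp add: divide_right_mono)
    also have "\<dots> = J n \<omega>" using n \<omega> by (simp add: J_def)
    also have "\<dots> \<le> (\<Sum>n. J n \<omega>)"
      using sum_le_suminf[of "\<lambda>n. J n \<omega>" "{n}"] by simp
    finally show ?thesis by (rule order_trans) simp
  qed
  have "(\<integral>\<^sup>+\<omega>. ennreal (exp ((S \<omega>)\<^sup>2 / (256 * T))) \<partial>P)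
      \<le> (\<integral>\<^sup>+\<omega>. ennreal (exp ((real n0)\<^sup>2 / (256 * T))) + (\<Sum>n. J n \<omega>) \<partial>P)"
    by (rule nn_integral_mono) (rule le)
  also have "\<dots> = ennreal (exp ((real n0)\<^sup>2 / (256 * T))) + (\<Sum>n. \<integral>\<^sup>+\<omega>. J n \<omega> \<partial>P)"
    by (simp add: nn_integral_add nn_integral_suminf emeasure_space_1)
  also have "\<dots> \<le> ennreal (exp ((real n0)\<^sup>2 / (256 * T))) + (\<Sum>n. ennreal (4 * exp (- (1 / (64 * T)))^n))"
    by (intro add_left_mono suminf_le Jint) auto
  also have "(\<Sum>n. ennreal (4 * exp (- (1 / (64 * T)))^n)) = ennreal (\<Sum>n. 4 * exp (- (1 / (64 * T)))^n)"
    by (rule suminf_ennreal2) (use T in \<open>auto intro!: summable_mult summable_geometric\<close>)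
  also have "ennreal (exp ((real n0)\<^sup>2 / (256 * T))) + \<dots> = ennreal (exp ((real n0)\<^sup>2 / (256 * T)) + (\<Sum>n. 4 * exp (- (1 / (64 * T)))^n))"
    using T by (intro ennreal_plus[symmetric] suminf_nonneg) (auto intro!: summable_mult summable_geometric)
  finally show ?thesis unfolding S_def by blast
qed

end

section \<open>The Laplace principle\<close>

lemma eventually_exp_small:
  fixes C a b :: real
  assumes "a > 0" "b > 0"
  shows "\<forall>\<^sub>F \<epsilon> in at_right 0. C * exp (- (a / \<epsilon>)) \<le> b"
proof -
  have "((\<lambda>\<epsilon>. exp (- (a / \<epsilon>))) \<longlongrightarrow> 0) (at_right (0::real))"
    using assms(1) by real_asymp
  then have "((\<lambda>\<epsilon>. C * exp (- (a / \<epsilon>))) \<longlongrightarrow> C * 0) (at_right (0::real))"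
    by (intro tendsto_intros)
  then have "\<forall>\<^sub>F \<epsilon> in at_right 0. C * exp (- (a / \<epsilon>)) < b"
    using assms(2) by (intro order_tendstoD(2)) auto
  then show ?thesis by eventually_elim simp
qed

lemma eventually_exp_absorb:
  fixes C x y :: real
  assumes "x < y"
  shows "\<forall>\<^sub>F \<epsilon> in at_right 0. C * exp (x / \<epsilon>) \<le> exp (y / \<epsilon>)"
proof -
  have "\<forall>\<^sub>F \<epsilon> in at_right 0. C * exp (- ((y - x) / \<epsilon>)) \<le> 1"
    using assms by (intro eventually_exp_small) auto
  then show ?thesis
  proof eventually_elim
    case (elim \<epsilon>)
    have "C * exp (x / \<epsilon>) = (C * exp (- ((y - x) / \<epsilon>))) * exp (y / \<epsilon>)"
      by (simp add: exp_add[symmetric] diff_divide_distrib)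
    also have "\<dots> \<le> 1 * exp (y / \<epsilon>)" by (rule mult_right_mono[OF elim]) simp
    finally show ?case by simp
  qed
qed

lemma eventually_small: "c > 0 \<Longrightarrow> \<forall>\<^sub>F \<epsilon> in at_right 0. k * \<epsilon> \<le> c" for c k :: real
proof -
  assume c: "c > 0"
  have "((\<lambda>\<epsilon>. k * \<epsilon>) \<longlongrightarrow> k * 0) (at_right (0::real))" by (intro tendsto_intros)
  then have "\<forall>\<^sub>F \<epsilon> in at_right 0. k * \<epsilon> < c" using c by (intro order_tendstoD(2)) auto
  then show ?thesis by eventually_elim simp
qed

lemma eventually_right_pos: "\<forall>\<^sub>F \<epsilon> in at_right (0::real). \<epsilon> > 0"
  by (simp add: eventually_at_filter)

lemma divide_sqrt_eq: "\<epsilon> > 0 \<Longrightarrow> x / sqrt \<epsilon> = sqrt \<epsilon> * x / \<epsilon>"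
proof -
  assume e: "\<epsilon> > 0"
  have "sqrt \<epsilon> * x / \<epsilon> = sqrt \<epsilon> * x / (sqrt \<epsilon> * sqrt \<epsilon>)" using e by simp
  then show ?thesis using e by (simp del: real_sqrt_mult_self)
qed

lemma exp_le_powr:
  fixes x y \<epsilon> :: real
  assumes "exp x \<le> y" "\<epsilon> > 0"
  shows "exp (x / \<epsilon>) \<le> y powr (1 / \<epsilon>)"
proof -
  have "exp (x / \<epsilon>) = exp x powr (1 / \<epsilon>)" by (simp add: powr_def)
  also have "\<dots> \<le> y powr (1 / \<epsilon>)" using assms by (intro powr_mono2) auto
  finally show ?thesis .
qed

lemma powr_square: "(x powr a)\<^sup>2 = x powr (2 * a)" for x a :: real
  unfolding power2_eq_square powr_add[symmetric] mult_2 ..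

lemma powr_le_exp:
  fixes x y c :: real
  assumes "y \<le> exp x" "y \<ge> 0" "c > 0"
  shows "y powr c \<le> exp (c * x)"
proof -
  have "y powr c \<le> exp x powr c" using assms by (intro powr_mono2) auto
  then show ?thesis by (simp add: powr_def)
qed

section \<open>Exponential tilting along step functions\<close>

context brownian
begin

text \<open>The Girsanov density of a step function, where the Wiener integral is a finite sum of
  increments and no choice of a version is involved.\<close>

definition tilt :: "real \<Rightarrow> (real \<times> real \<times> real) list \<Rightarrow> real \<Rightarrow> 'a \<Rightarrow> real" where
  "tilt T cs \<epsilon> \<omega> = exp (step_integral W cs \<omega> / sqrt \<epsilon> - sqnorm (lborel_upto T) (step_fun cs) / (2 * \<epsilon>))"

lemma tilt_measurable: "valid_steps T cs \<Longrightarrow> tilt T cs \<epsilon> \<in> borel_measurable P"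
  using step_integral_measurable[of T cs] unfolding tilt_def by measurable

text \<open>The only consequence of the Girsanov theorem that is needed: under the tilted measure Wiener integrals
  have the moment generating function of a shifted Gaussian variable.\<close>

lemma tilted_mgf:
  assumes T: "T \<ge> 0" and cs: "valid_steps T cs" and e: "\<epsilon> > 0"
    and j: "square_integrable (lborel_upto T) j" and J: "is_wiener_integral P W T j J"
  shows "(\<integral>\<^sup>+\<omega>. ennreal (exp (c * (sqrt \<epsilon> * J \<omega> - (LINT s|lborel_upto T. j s * step_fun cs s))))
        \<partial>density P (\<lambda>\<omega>. ennreal (tilt T cs \<epsilon> \<omega>)))
      = ennreal (exp (c\<^sup>2 * (\<epsilon> * sqnorm (lborel_upto T) j) / 2))"
proof -
  let ?f = "step_fun cs" and ?U = "lborel_upto T" and ?Z = "step_integral W cs"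
  define p where "p = (LINT s|?U. j s * ?f s)"
  define s where "s = sqnorm ?U ?f"
  have f: "square_integrable ?U ?f" by (rule square_integrable_step_fun)
  have Z: "is_wiener_integral P W T ?f ?Z" by (rule is_wiener_integral_step[OF cs])
  have Jm[measurable]: "J \<in> borel_measurable P" by (rule is_wiener_integral_measurable[OF J])
  have Zm[measurable]: "?Z \<in> borel_measurable P" by (rule step_integral_measurable[OF cs])
  note tm[measurable] = tilt_measurable[OF cs, of \<epsilon>]
  define k where "k = c * sqrt \<epsilon>"
  have comb: "(\<integral>\<^sup>+\<omega>. ennreal (exp (k * J \<omega> + 1 / sqrt \<epsilon> * ?Z \<omega>)) \<partial>P)
      = ennreal (exp (sqnorm ?U (\<lambda>t. k * j t + 1 / sqrt \<epsilon> * ?f t) / 2))"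
    by (intro wiener_mgf T square_integrable_add square_integrable_cmult j f is_wiener_integral_add is_wiener_integral_scale J Z)
  have nrm: "sqnorm ?U (\<lambda>t. k * j t + 1 / sqrt \<epsilon> * ?f t) = c\<^sup>2 * (\<epsilon> * sqnorm ?U j) + 2 * c * p + s / \<epsilon>"
  proof -
    have "(LINT t|?U. k * j t * (1 / sqrt \<epsilon> * ?f t)) = (LINT t|?U. c * (j t * ?f t))"
      using e by (intro Bochner_Integration.integral_cong) (auto simp: k_def)
    then have "(LINT t|?U. k * j t * (1 / sqrt \<epsilon> * ?f t)) = c * p" by (simp add: p_def)
    moreover have "k\<^sup>2 = c\<^sup>2 * \<epsilon>" "(1 / sqrt \<epsilon>)\<^sup>2 = 1 / \<epsilon>"
      using e by (simp_all add: k_def power_mult_distrib power_divide)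
    ultimately show ?thesis
      by (simp only: sqnorm_add[OF square_integrable_cmult[OF j] square_integrable_cmult[OF f]] sqnorm_cmult)
         (simp add: s_def)
  qed
  have "(\<integral>\<^sup>+\<omega>. ennreal (exp (c * (sqrt \<epsilon> * J \<omega> - p))) \<partial>density P (\<lambda>\<omega>. ennreal (tilt T cs \<epsilon> \<omega>)))
      = (\<integral>\<^sup>+\<omega>. ennreal (tilt T cs \<epsilon> \<omega>) * ennreal (exp (c * (sqrt \<epsilon> * J \<omega> - p))) \<partial>P)"
    by (rule nn_integral_density) measurable
  also have "\<dots> = (\<integral>\<^sup>+\<omega>. ennreal (exp (- (c * p) - s / (2 * \<epsilon>))) * ennreal (exp (k * J \<omega> + 1 / sqrt \<epsilon> * ?Z \<omega>)) \<partial>P)"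
    by (intro nn_integral_cong)
       (simp add: tilt_def s_def k_def ennreal_mult'[symmetric] exp_add[symmetric] algebra_simps)
  also have "\<dots> = ennreal (exp (- (c * p) - s / (2 * \<epsilon>))) * ennreal (exp (sqnorm ?U (\<lambda>t. k * j t + 1 / sqrt \<epsilon> * ?f t) / 2))"
    unfolding comb[symmetric] by (rule nn_integral_cmult) measurable
  also have "\<dots> = ennreal (exp (c\<^sup>2 * (\<epsilon> * sqnorm ?U j) / 2))"
    unfolding nrm by (simp add: ennreal_mult'[symmetric] exp_add[symmetric] add_divide_distrib)
  finally show ?thesis by (simp add: p_def)
qed

lemma tilted_prob_space:
  assumes T: "T \<ge> 0" and cs: "valid_steps T cs" and e: "\<epsilon> > 0"
  shows "prob_space (density P (\<lambda>\<omega>. ennreal (tilt T cs \<epsilon> \<omega>)))"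
proof (rule prob_spaceI)
  let ?Q = "density P (\<lambda>\<omega>. ennreal (tilt T cs \<epsilon> \<omega>))"
  have "(\<integral>\<^sup>+\<omega>. 1 \<partial>?Q) = 1"
    using tilted_mgf[OF T cs e square_integrable_step_fun is_wiener_integral_step[OF cs], of 0] by simp
  then show "emeasure ?Q (space ?Q) = 1" by simp
qed

lemma tilted_tail:
  assumes T: "T \<ge> 0" and cs: "valid_steps T cs" and e: "\<epsilon> > 0"
    and j: "square_integrable (lborel_upto T) j" and J: "is_wiener_integral P W T j J"
    and \<kappa>: "\<kappa> > 0" "sqnorm (lborel_upto T) j \<le> \<kappa>" and x: "x \<ge> 0"
  shows "emeasure (density P (\<lambda>\<omega>. ennreal (tilt T cs \<epsilon> \<omega>)))
      {\<omega>\<in>space P. x \<le> \<bar>sqrt \<epsilon> * J \<omega> - (LINT s|lborel_upto T. j s * step_fun cs s)\<bar>}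
    \<le> ennreal (2 * exp (- (x\<^sup>2 / (2 * (\<epsilon> * \<kappa>)))))"
proof -
  let ?Q = "density P (\<lambda>\<omega>. ennreal (tilt T cs \<epsilon> \<omega>))"
  have Jm[measurable]: "J \<in> borel_measurable P" by (rule is_wiener_integral_measurable[OF J])
  have "emeasure ?Q {\<omega>\<in>space ?Q. x \<le> \<bar>sqrt \<epsilon> * J \<omega> - (LINT s|lborel_upto T. j s * step_fun cs s)\<bar>}
    \<le> ennreal (2 * exp (- (x\<^sup>2 / (2 * (\<epsilon> * \<kappa>)))))"
  proof (rule Chernoff_two_sided[OF _ _ x])
    fix c
    show "(\<integral>\<^sup>+\<omega>. ennreal (exp (c * (sqrt \<epsilon> * J \<omega> - (LINT s|lborel_upto T. j s * step_fun cs s)))) \<partial>?Q)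
        \<le> ennreal (exp (c\<^sup>2 * (\<epsilon> * \<kappa>) / 2))"
      unfolding tilted_mgf[OF T cs e j J] using \<kappa> e
      by (intro ennreal_leI) (simp add: mult_left_mono divide_right_mono)
  qed (use e \<kappa> in auto)
  then show ?thesis by simp
qed

end

section \<open>The weight and the lower bound\<close>

locale laplace = brownian P W + path_functional T g
  for P :: "'a measure" and W :: "real \<Rightarrow> 'a \<Rightarrow> real" and T :: real and g :: "(real \<Rightarrow> real) \<Rightarrow> real"
begin

definition wint :: "(real \<Rightarrow> real) \<Rightarrow> 'a \<Rightarrow> real" where
  "wint h = wiener_integral P W T (cm_deriv T h)"

lemma wint: "h \<in> cm_space T \<Longrightarrow> is_wiener_integral P W T (cm_deriv T h) (wint h)"
  unfolding wint_def by (rule wiener_integral_exists[OF T])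

lemma wint_measurable: "h \<in> cm_space T \<Longrightarrow> wint h \<in> borel_measurable P"
  by (rule is_wiener_integral_measurable[OF wint])

lemma g_measurable: "(\<lambda>\<omega>. g (scaled_path W T \<epsilon> \<omega>)) \<in> borel_measurable P"
  by (rule path_functional_measurable[OF T cont])

definition weight :: "(real \<Rightarrow> real) \<Rightarrow> real \<Rightarrow> 'a \<Rightarrow> real" where
  "weight h \<epsilon> \<omega> = g (scaled_path W T \<epsilon> \<omega>) powr (1 / \<epsilon>) * exp (- (wint h \<omega> / sqrt \<epsilon>))"

lemma weight_measurable: "h \<in> cm_space T \<Longrightarrow> weight h \<epsilon> \<in> borel_measurable P"
  using g_measurable[of \<epsilon>] wint_measurable[of h] unfolding weight_def by measurable

lemma weight_nonneg: "weight h \<epsilon> \<omega> \<ge> 0"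
  by (simp add: weight_def)

text \<open>Under the tilt, with probability at least 1/2, the scaled path is uniformly near u and
  the two Wiener integrals are near their shifted means. There the weight dominates a deterministic
  multiple of the tilt, and integrating the latter against P returns that multiple of the tilted
  probability.\<close>

lemma laplace_lower_step:
  assumes h: "h \<in> cm_space T" and cs: "valid_steps T cs" and u: "u \<in> cm_space T" "cm_density T u (step_fun cs)"
    and gu: "g u > 0" and \<eta>: "\<eta> > 0"
  shows "\<forall>\<^sub>F \<epsilon> in at_right 0.
    ennreal (exp ((ln (g u) - cm_inner T h u - cm_inner T u u / 2 - \<eta>) / \<epsilon>)) \<le> (\<integral>\<^sup>+\<omega>. ennreal (weight h \<epsilon> \<omega>) \<partial>P)"
proof -
  let ?U = "lborel_upto T" and ?f = "step_fun cs" and ?Z = "step_integral W cs"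
  let ?Q = "\<lambda>\<epsilon>. density P (\<lambda>\<omega>. ennreal (tilt T cs \<epsilon> \<omega>))"
  have T0: "T \<ge> 0" using T by simp
  \<comment> \<open>Three of the four parts are spent on the value of g, on the integral of h and on
    the exponent of the tilt, the fourth on the probability 1/2.\<close>
  define e where "e = \<eta> / 4"
  have e: "e > 0" using \<eta> by (simp add: e_def)
  define c where "c = cm_inner T h u"
  have c: "c = (LINT s|?U. cm_deriv T h s * ?f s)"
    unfolding c_def by (rule cm_inner_density[OF h cm_density_cm_deriv[OF h] u T0])
  define s where "s = cm_inner T u u"
  have s: "s = sqnorm ?U ?f" "s = (LINT r|?U. ?f r * ?f r)"
    unfolding s_def cm_inner_density[OF u u T0] by (simp_all add: sqnorm_def power2_eq_square)
  have uw: "u \<in> wiener_space T" by (rule cm_space_wiener[OF u(1)])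
  have uc: "continuous_on {0..T} u" and u0: "u 0 = 0" using uw T by (auto simp: paths_from_iff)
  have "g u * (1 - exp (- e)) > 0" using gu e by simp
  then obtain d where d: "d > 0"
    "\<And>w. w \<in> wiener_space T \<Longrightarrow> \<forall>t\<in>{0..T}. \<bar>w t - u t\<bar> \<le> d \<Longrightarrow> \<bar>g w - g u\<bar> < g u * (1 - exp (- e))"
    using cont[OF uw] by blast
  \<comment> \<open>Adding 1 makes the variance bounds positive even if h or u is zero.\<close>
  define k1 k2 where "k1 = sqnorm ?U (cm_deriv T h) + 1" and "k2 = s + 1"
  have k: "k1 > 0" "k2 > 0" using sqnorm_nonneg[of ?U] by (auto simp: k1_def k2_def s(1) add_nonneg_pos)
  have ev: "\<forall>\<^sub>F \<epsilon> in at_right 0. 512 * T * \<epsilon> \<le> d\<^sup>2"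
    "\<forall>\<^sub>F \<epsilon> in at_right 0. 4 * exp (- (d\<^sup>2 / (32 * T) / \<epsilon>)) \<le> 1/6"
    "\<forall>\<^sub>F \<epsilon> in at_right 0. 2 * exp (- (e\<^sup>2 / (2 * k1) / \<epsilon>)) \<le> 1/6"
    "\<forall>\<^sub>F \<epsilon> in at_right 0. 2 * exp (- (e\<^sup>2 / (2 * k2) / \<epsilon>)) \<le> 1/6"
    "\<forall>\<^sub>F \<epsilon> in at_right 0. 1 * exp (- (e / \<epsilon>)) \<le> 1/2"
    by (rule eventually_small eventually_exp_small; use d e k T in simp)+
  show ?thesis
    using ev eventually_right_pos
  proof eventually_elim
    case (elim \<epsilon>)
    have \<epsilon>: "\<epsilon> > 0" using elim by simp
    interpret Q: prob_space "?Q \<epsilon>" by (rule tilted_prob_space[OF T0 cs \<epsilon>])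
    have [measurable]: "wint h \<in> borel_measurable P" by (rule wint_measurable[OF h])
    have [measurable]: "?Z \<in> borel_measurable P" by (rule step_integral_measurable[OF cs])
    note tm[measurable] = tilt_measurable[OF cs, of \<epsilon>]
    define X where "X = (\<lambda>t \<omega>. sqrt \<epsilon> * W t \<omega> - u t)"
    \<comment> \<open>An increment of W is the step integral of an indicator, and after scaling its
      shifted mean is the increment of u; so X has increments with Gaussian tails of variance
      \<epsilon> * (t - r).\<close>
    have tail: "emeasure (?Q \<epsilon>) {\<omega>\<in>space (?Q \<epsilon>). x \<le> \<bar>X t \<omega> - X r \<omega>\<bar>} \<le> ennreal (2 * exp (- (x\<^sup>2 / (2 * (\<epsilon> * (t - r))))))"
      if rt: "0 \<le> r" "r < t" "t \<le> T" and x: "x \<ge> 0" for r t x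
    proof -
      define ds where "ds = [(1::real, r, t)]"
      have ds: "valid_steps T ds" using rt by (simp add: ds_def valid_steps_def)
      have sf: "step_fun ds = indicator {r<..t}" by (rule ext) (simp add: ds_def step_fun_def)
      have si: "step_integral W ds \<omega> = W t \<omega> - W r \<omega>" for \<omega> by (simp add: ds_def step_integral_def)
      have "(LINT q|?U. step_fun ds q * ?f q) = u t - u r"
      proof -
        have "(LINT q|?U. step_fun ds q * ?f q) = primitive T ?f t - primitive T ?f r"
          using primitive_diff[OF square_integrable_step_fun[of T cs], of r t] rt by (simp add: sf mult.commute)
        then show ?thesis using u(2) rt by (simp add: cm_density_iff)
      qed
      then have "sqrt \<epsilon> * step_integral W ds \<omega> - (LINT q|?U. step_fun ds q * ?f q) = X t \<omega> - X r \<omega>" for \<omega>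
        by (simp add: X_def si algebra_simps)
      moreover have "sqnorm ?U (step_fun ds) = t - r" using rt by (simp add: sf sqnorm_indicator)
      ultimately show ?thesis
        using tilted_tail[OF T0 cs \<epsilon> square_integrable_step_fun is_wiener_integral_step[OF ds], of "t - r" x] rt x by simp
    qed
    have "\<exists>B\<in>sets (?Q \<epsilon>). emeasure (?Q \<epsilon>) B \<le> ennreal (4 * exp (- (d\<^sup>2 / (32 * \<epsilon> * T))))
       \<and> (\<forall>\<omega>\<in>space (?Q \<epsilon>) - B. \<forall>t\<in>{0..0+T}. \<bar>X t \<omega> - X 0 \<omega>\<bar> \<le> d)"
    proof (rule dyadic_chaining)
      show "X t \<in> borel_measurable (?Q \<epsilon>)" if "t \<in> {0..0+T}" for t
      proof -
        have [measurable]: "W t \<in> borel_measurable P" using that by auto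
        show ?thesis unfolding X_def by measurable
      qed
      show "continuous_on {0..0+T} (\<lambda>t. X t \<omega>)" if "\<omega> \<in> space (?Q \<epsilon>)" for \<omega>
        unfolding X_def using that uc
        by (intro continuous_on_diff continuous_on_mult_left continuous_on_subset[OF W_continuous]) auto
      show "512 * \<epsilon> * T \<le> d\<^sup>2" using elim by (simp add: ac_simps)
    qed (use T \<epsilon> d tail in auto)
    then obtain B where B: "B \<in> sets P" "emeasure (?Q \<epsilon>) B \<le> ennreal (4 * exp (- (d\<^sup>2 / (32 * \<epsilon> * T))))"
      "\<And>\<omega> t. \<omega> \<in> space P \<Longrightarrow> \<omega> \<notin> B \<Longrightarrow> t \<in> {0..T} \<Longrightarrow> \<bar>X t \<omega> - X 0 \<omega>\<bar> \<le> d"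
      by auto
    define E1 where "E1 = {\<omega>\<in>space P. e \<le> \<bar>sqrt \<epsilon> * wint h \<omega> - c\<bar>}"
    define E2 where "E2 = {\<omega>\<in>space P. e \<le> \<bar>sqrt \<epsilon> * ?Z \<omega> - s\<bar>}"
    have [measurable]: "E1 \<in> sets P" "E2 \<in> sets P" "B \<in> sets P" using B(1) by (auto simp: E1_def E2_def)
    have e1: "emeasure (?Q \<epsilon>) E1 \<le> ennreal (2 * exp (- (e\<^sup>2 / (2 * (\<epsilon> * k1)))))"
      unfolding E1_def c
      by (rule tilted_tail[OF T0 cs \<epsilon> square_integrable_cm_deriv[OF h] wint[OF h] k(1)]) (use e in \<open>auto simp: k1_def\<close>)
    have e2: "emeasure (?Q \<epsilon>) E2 \<le> ennreal (2 * exp (- (e\<^sup>2 / (2 * (\<epsilon> * k2)))))"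
      unfolding E2_def s(2)
      by (rule tilted_tail[OF T0 cs \<epsilon> square_integrable_step_fun is_wiener_integral_step[OF cs] k(2)]) (use e in \<open>auto simp: k2_def s(1)\<close>)
    have "emeasure (?Q \<epsilon>) (B \<union> E1 \<union> E2) \<le> emeasure (?Q \<epsilon>) B + emeasure (?Q \<epsilon>) E1 + emeasure (?Q \<epsilon>) E2"
      by (intro order_trans[OF emeasure_subadditive] add_mono order_refl) auto
    also have "\<dots> \<le> ennreal (1/6) + ennreal (1/6) + ennreal (1/6)"
    proof (intro add_mono)
      show "emeasure (?Q \<epsilon>) B \<le> ennreal (1/6)"
        using elim(2) by (intro order_trans[OF B(2)] ennreal_leI) (simp add: ac_simps)
      show "emeasure (?Q \<epsilon>) E1 \<le> ennreal (1/6)"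
        using elim(3) by (intro order_trans[OF e1] ennreal_leI) (simp add: ac_simps)
      show "emeasure (?Q \<epsilon>) E2 \<le> ennreal (1/6)"
        using elim(4) by (intro order_trans[OF e2] ennreal_leI) (simp add: ac_simps)
    qed
    also have "\<dots> = ennreal (1/2)" by (simp flip: ennreal_plus)
    finally have "ennreal (Q.prob (B \<union> E1 \<union> E2)) \<le> ennreal (1/2)"
      unfolding Q.emeasure_eq_measure .
    then have "Q.prob (B \<union> E1 \<union> E2) \<le> 1/2"
      by (subst (asm) ennreal_le_iff) auto
    moreover define A where "A = space P - (B \<union> E1 \<union> E2)"
    moreover have [measurable]: "A \<in> sets P" unfolding A_def by measurable
    ultimately have "Q.prob A \<ge> 1/2"
      using Q.prob_compl[of "B \<union> E1 \<union> E2"] by simp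
    then have QA: "ennreal (exp (- (e / \<epsilon>))) \<le> emeasure (?Q \<epsilon>) A"
      using elim(5) by (simp add: Q.emeasure_eq_measure)
    define low where "low = ln (g u) - 3 * e - c - s / 2"
    have pt: "exp (low / \<epsilon>) * tilt T cs \<epsilon> \<omega> \<le> weight h \<epsilon> \<omega>" if \<omega>: "\<omega> \<in> A" for \<omega>
    proof -
      have \<omega>P: "\<omega> \<in> space P" and nB: "\<omega> \<notin> B" and nE: "\<bar>sqrt \<epsilon> * wint h \<omega> - c\<bar> < e" "\<bar>sqrt \<epsilon> * ?Z \<omega> - s\<bar> < e"
        using \<omega> by (auto simp: A_def E1_def E2_def)
      let ?w = "scaled_path W T \<epsilon> \<omega>"
      have ww: "?w \<in> wiener_space T" by (rule scaled_path_wiener[OF T \<omega>P])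
      have "\<bar>?w t - u t\<bar> \<le> d" if "t \<in> {0..T}" for t
        using B(3)[OF \<omega>P nB that] that u0 W_0[OF \<omega>P] by (simp add: X_def scaled_path_def)
      then have "\<bar>g ?w - g u\<bar> < g u * (1 - exp (- e))" by (intro d(2)[OF ww]) auto
      then have "g u * exp (- e) \<le> g ?w" by (simp add: algebra_simps)
      moreover have "g u * exp (- e) = exp (ln (g u) - e)" using gu by (simp add: exp_diff exp_minus field_simps)
      ultimately have 1: "exp ((ln (g u) - e) / \<epsilon>) \<le> g ?w powr (1 / \<epsilon>)" by (intro exp_le_powr \<epsilon>) simp
      have 2: "exp (- ((c + e) / \<epsilon>)) \<le> exp (- (wint h \<omega> / sqrt \<epsilon>))"
        unfolding divide_sqrt_eq[OF \<epsilon>] using nE(1) \<epsilon> by (simp add: divide_right_mono)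
      have "?Z \<omega> / sqrt \<epsilon> - s / (2 * \<epsilon>) \<le> (s / 2 + e) / \<epsilon>"
      proof -
        have "sqrt \<epsilon> * ?Z \<omega> / \<epsilon> \<le> (s + e) / \<epsilon>" using nE(2) \<epsilon> by (intro divide_right_mono) auto
        then show ?thesis unfolding divide_sqrt_eq[OF \<epsilon>] by (simp add: add_divide_distrib)
      qed
      then have "exp (low / \<epsilon>) * tilt T cs \<epsilon> \<omega> \<le> exp (low / \<epsilon>) * exp ((s / 2 + e) / \<epsilon>)"
        by (simp add: tilt_def s(1)[symmetric])
      also have "\<dots> = exp ((ln (g u) - e) / \<epsilon>) * exp (- ((c + e) / \<epsilon>))"
        by (simp add: exp_add[symmetric] low_def add_divide_distrib diff_divide_distrib)
      also have "\<dots> \<le> weight h \<epsilon> \<omega>"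
        unfolding weight_def by (rule mult_mono[OF 1 2]) auto
      finally show ?thesis .
    qed
    have "ennreal (exp ((ln (g u) - cm_inner T h u - cm_inner T u u / 2 - \<eta>) / \<epsilon>))
        = ennreal (exp (low / \<epsilon>)) * ennreal (exp (- (e / \<epsilon>)))"
      by (simp add: ennreal_mult'[symmetric] exp_add[symmetric] low_def e_def c_def s_def
          add_divide_distrib diff_divide_distrib)
    also have "\<dots> \<le> ennreal (exp (low / \<epsilon>)) * emeasure (?Q \<epsilon>) A"
      by (rule mult_left_mono[OF QA]) simp
    also have "\<dots> = ennreal (exp (low / \<epsilon>)) * (\<integral>\<^sup>+\<omega>. ennreal (tilt T cs \<epsilon> \<omega>) * indicator A \<omega> \<partial>P)"
      by (simp add: emeasure_density)
    also have "\<dots> = (\<integral>\<^sup>+\<omega>. ennreal (exp (low / \<epsilon>)) * (ennreal (tilt T cs \<epsilon> \<omega>) * indicator A \<omega>) \<partial>P)"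
      by (rule nn_integral_cmult[symmetric]) measurable
    also have "\<dots> \<le> (\<integral>\<^sup>+\<omega>. ennreal (weight h \<epsilon> \<omega>) \<partial>P)"
    proof (rule nn_integral_mono)
      fix \<omega>
      show "ennreal (exp (low / \<epsilon>)) * (ennreal (tilt T cs \<epsilon> \<omega>) * indicator A \<omega>) \<le> ennreal (weight h \<epsilon> \<omega>)"
        using pt[of \<omega>] by (cases "\<omega> \<in> A") (auto simp: ennreal_mult'[symmetric] intro: ennreal_leI)
    qed
    finally show ?case .
  qed
qed

text \<open>A general u is replaced by a fine dyadic interpolation: g is continuous at u, the inner
  product with h converges, and interpolation does not increase the energy.\<close>

theorem laplace_lower:
  assumes h: "h \<in> cm_space T" and u: "u \<in> cm_space T" and gu: "g u > 0" and \<eta>: "\<eta> > 0"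
  shows "\<forall>\<^sub>F \<epsilon> in at_right 0.
    ennreal (exp ((ln (g u) - cm_inner T h u - cm_inner T u u / 2 - \<eta>) / \<epsilon>)) \<le> (\<integral>\<^sup>+\<omega>. ennreal (weight h \<epsilon> \<omega>) \<partial>P)"
proof -
  let ?U = "lborel_upto T"
  have T0: "T \<ge> 0" using T by simp
  define e where "e = \<eta> / 3"
  have e: "e > 0" using \<eta> by (simp add: e_def)
  have uw: "u \<in> wiener_space T" by (rule cm_space_wiener[OF u])
  have "g u * (1 - exp (- e)) > 0" using gu e by simp
  then obtain d where d: "d > 0"
    "\<And>w. w \<in> wiener_space T \<Longrightarrow> \<forall>t\<in>{0..T}. \<bar>w t - u t\<bar> \<le> d \<Longrightarrow> \<bar>g w - g u\<bar> < g u * (1 - exp (- e))"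
    using cont[OF uw] by blast
  obtain M where M: "\<forall>m\<ge>M. \<forall>t\<in>{0..T}. \<bar>interp T m u t - u t\<bar> \<le> d"
    using interp_uniform_limit[OF T uw d(1)] by blast
  have "(\<lambda>k. LINT s|?U. pdiff T (2^k) u s * cm_deriv T h s) \<longlonglongrightarrow> (LINT s|?U. cm_deriv T u s * cm_deriv T h s)"
    by (rule sqnorm_tendsto_inner[OF square_integrable_pdiff square_integrable_cm_deriv[OF u]
        square_integrable_cm_deriv[OF h] cm_deriv_dyadic_limit[OF T u]])
  moreover have "(LINT s|?U. pdiff T (2^k) u s * cm_deriv T h s) = cm_inner T h (interp T (2^k) u)" for k
    using cm_inner_density[OF h cm_density_cm_deriv[OF h] interp_in_cm_space[OF T0] interp_density T0, of "2^k" u]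
    by (simp add: mult.commute)
  moreover have "(LINT s|?U. cm_deriv T u s * cm_deriv T h s) = cm_inner T h u"
    by (simp add: cm_inner_eq mult.commute)
  ultimately have "(\<lambda>k. cm_inner T h (interp T (2^k) u)) \<longlonglongrightarrow> cm_inner T h u" by simp
  then have "\<forall>\<^sub>F k in sequentially. cm_inner T h (interp T (2^k) u) < cm_inner T h u + e"
    using e by (intro order_tendstoD(2)) auto
  then obtain k0 where k0: "\<And>k. k \<ge> k0 \<Longrightarrow> cm_inner T h (interp T (2^k) u) < cm_inner T h u + e"
    by (auto simp: eventually_sequentially)
  define k where "k = max k0 M"
  define v where "v = interp T (2^k) u"
  have v: "v \<in> cm_space T" unfolding v_def by (rule interp_in_cm_space[OF T0])
  have kM: "2^k \<ge> M"
  proof -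
    have "M \<le> k" by (simp add: k_def)
    also have "k \<le> 2^k" by (simp add: less_imp_le)
    finally show ?thesis .
  qed
  have "\<bar>g v - g u\<bar> < g u * (1 - exp (- e))"
    by (rule d(2)[OF cm_space_wiener[OF v]]) (use M kM in \<open>auto simp: v_def\<close>)
  then have gv: "g u * exp (- e) \<le> g v" by (simp add: algebra_simps)
  have gv0: "g v > 0" using gu by (intro less_le_trans[OF _ gv]) simp
  have "ln (g u * exp (- e)) \<le> ln (g v)" using gv gu by (intro ln_mono) auto
  then have lnv: "ln (g u) - e \<le> ln (g v)" using gu by (simp add: ln_mult)
  have vv: "cm_inner T v v \<le> cm_inner T u u"
  proof -
    have "cm_inner T v v = sqnorm ?U (pdiff T (2^k) u)"
      using cm_inner_density[OF interp_in_cm_space[OF T0] interp_density interp_in_cm_space[OF T0] interp_density T0, of "2^k" u "2^k" u]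
      by (simp add: v_def sqnorm_def power2_eq_square)
    then show ?thesis using cm_space_pdiff_le[OF T u, of "2^k"] by (simp add: cm_inner_self)
  qed
  have dens: "cm_density T v (step_fun (pdiff_steps T (2^k) u))"
    unfolding v_def step_fun_pdiff_steps by (rule interp_density)
  from laplace_lower_step[OF h valid_pdiff_steps[OF T0] v dens gv0 e] eventually_right_pos
  show ?thesis
  proof eventually_elim
    case (elim \<epsilon>)
    have "(ln (g u) - cm_inner T h u - cm_inner T u u / 2 - \<eta>) / \<epsilon>
        \<le> (ln (g v) - cm_inner T h v - cm_inner T v v / 2 - e) / \<epsilon>"
      using elim(2) lnv vv k0[of k] by (intro divide_right_mono) (auto simp: e_def v_def k_def)
    then show ?case by (intro order_trans[OF ennreal_leI elim(1)]) simp
  qed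
qed

text \<open>Compactness of energy balls in the uniform topology: in a sequence of counterexamples
  the centres v converge uniformly to some u along a subsequence, the paths w follow them, and
  continuity of g at u contradicts the gap \<kappa>.\<close>

lemma compact_modulus:
  assumes \<kappa>: "\<kappa> > 0"
  shows "\<exists>d>0. \<forall>v\<in>cm_space T. cm_inner T v v \<le> a \<longrightarrow>
    (\<forall>w\<in>wiener_space T. (\<forall>t\<in>{0..T}. \<bar>w t - v t\<bar> \<le> d) \<longrightarrow> g w \<le> g v + \<kappa>)"
proof (rule ccontr)
  assume neg: "\<not> ?thesis"
  define Q where "Q = (\<lambda>(n::nat) v w. v \<in> cm_space T \<and> cm_inner T v v \<le> a \<and> w \<in> wiener_space T
      \<and> (\<forall>t\<in>{0..T}. \<bar>w t - v t\<bar> \<le> 1 / real (Suc n)) \<and> \<not> g w \<le> g v + \<kappa>)"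
  have "\<exists>v w. Q n v w" for n
  proof -
    have "1 / real (Suc n) > 0" by simp
    with neg show ?thesis unfolding Q_def by blast
  qed
  then obtain v w where Q: "\<And>n. Q n (v n) (w n)" by metis
  have v: "v n \<in> cm_space T" "cm_inner T (v n) (v n) \<le> a"
    and w: "w n \<in> wiener_space T" "\<And>t. t \<in> {0..T} \<Longrightarrow> \<bar>w n t - v n t\<bar> \<le> 1 / real (Suc n)"
    and gap: "g (v n) + \<kappa> < g (w n)" for n
    using Q[of n] by (auto simp: Q_def not_le)
  obtain u r where r: "strict_mono (r :: nat \<Rightarrow> nat)" and u: "u \<in> cm_space T"
    and lim: "\<forall>e>0. \<exists>N. \<forall>n\<ge>N. \<forall>t\<in>{0..T}. \<bar>v (r n) t - u t\<bar> < e"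
    by (rule cm_space_uniform_subsequence[where u=v and A=a, OF T v(1) v(2)[unfolded cm_inner_self]])
  obtain d where d: "d > 0" "\<And>w. w \<in> wiener_space T \<Longrightarrow> \<forall>t\<in>{0..T}. \<bar>w t - u t\<bar> \<le> d \<Longrightarrow> \<bar>g w - g u\<bar> < \<kappa> / 2"
    using cont[OF cm_space_wiener[OF u], of "\<kappa> / 2"] \<kappa> by auto
  obtain N where N: "\<forall>n\<ge>N. \<forall>t\<in>{0..T}. \<bar>v (r n) t - u t\<bar> < d / 2"
    using lim half_gt_zero[OF d(1)] by blast
  obtain n0 where n0: "1 / real (Suc n0) < d / 2" by (rule nat_approx_posE[OF half_gt_zero[OF d(1)]])
  define n where "n = max N n0"
  have "n0 \<le> r n" using seq_suble[OF r, of n] by (simp add: n_def)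
  then have "1 / real (Suc (r n)) \<le> 1 / real (Suc n0)" by (intro divide_left_mono) auto
  then have small: "1 / real (Suc (r n)) < d / 2" using n0 by linarith
  have vn: "\<bar>v (r n) t - u t\<bar> < d / 2" if "t \<in> {0..T}" for t using N that by (simp add: n_def)
  have "\<bar>g (v (r n)) - g u\<bar> < \<kappa> / 2"
  proof (rule d(2)[OF cm_space_wiener[OF v(1)]], rule ballI)
    fix t assume t: "t \<in> {0..T}"
    show "\<bar>v (r n) t - u t\<bar> \<le> d" using vn[OF t] d(1) by linarith
  qed
  moreover have "\<bar>g (w (r n)) - g u\<bar> < \<kappa> / 2"
  proof (rule d(2)[OF w(1)], rule ballI)
    fix t assume t: "t \<in> {0..T}"
    show "\<bar>w (r n) t - u t\<bar> \<le> d" using w(2)[of t "r n", OF t] vn[OF t] small by linarith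
  qed
  ultimately show False using gap[of "r n"] by linarith
qed

text \<open>With \<theta> = 1 / (256 * p * T) the power p / \<epsilon> cancels the scaling of the
  path: what remains is exp (p * K / \<epsilon>) times the variable integrated in
  \<open>Fernique\<close>.\<close>

lemma g_moment:
  assumes p: "p > 0"
  shows "\<exists>K C. C \<ge> 0 \<and> (\<forall>\<epsilon>>0. (\<integral>\<^sup>+\<omega>. ennreal (g (scaled_path W T \<epsilon> \<omega>) powr (p / \<epsilon>)) \<partial>P) \<le> ennreal (C * exp (K / \<epsilon>)))"
proof -
  define \<theta> where "\<theta> = 1 / (p * (256 * T))"
  have \<theta>: "\<theta> > 0" using p T by (simp add: \<theta>_def)
  obtain K where K: "\<And>w m. w \<in> wiener_space T \<Longrightarrow> \<forall>t\<in>{0..T}. \<bar>w t\<bar> \<le> m \<Longrightarrow> g w \<le> exp (K + \<theta> * m\<^sup>2)"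
    using growth[OF \<theta>] by blast
  define S where "S = (\<lambda>\<omega>. path_sup T (scaled_path W T 1 \<omega>))"
  obtain C where C: "(\<integral>\<^sup>+\<omega>. ennreal (exp ((S \<omega>)\<^sup>2 / (256 * T))) \<partial>P) \<le> ennreal C"
    using Fernique[OF T] unfolding S_def by blast
  have Sm[measurable]: "S \<in> borel_measurable P" unfolding S_def by (rule path_sup_measurable[OF T])
  have "(\<integral>\<^sup>+\<omega>. ennreal (g (scaled_path W T \<epsilon> \<omega>) powr (p / \<epsilon>)) \<partial>P) \<le> ennreal (max C 0 * exp (p * K / \<epsilon>))" if \<epsilon>: "\<epsilon> > 0" for \<epsilon>
  proof -
    have "(\<integral>\<^sup>+\<omega>. ennreal (g (scaled_path W T \<epsilon> \<omega>) powr (p / \<epsilon>)) \<partial>P)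
        \<le> (\<integral>\<^sup>+\<omega>. ennreal (exp (p * K / \<epsilon>)) * ennreal (exp ((S \<omega>)\<^sup>2 / (256 * T))) \<partial>P)"
    proof (rule nn_integral_mono)
      fix \<omega> assume \<omega>: "\<omega> \<in> space P"
      have "\<bar>scaled_path W T \<epsilon> \<omega> t\<bar> \<le> sqrt \<epsilon> * S \<omega>" if t: "t \<in> {0..T}" for t
      proof -
        have "\<bar>scaled_path W T 1 \<omega> t\<bar> \<le> S \<omega>"
          unfolding S_def by (rule path_sup_upper[OF scaled_path_wiener[OF T \<omega>] T t])
        then have "sqrt \<epsilon> * \<bar>W t \<omega>\<bar> \<le> sqrt \<epsilon> * S \<omega>"
          using t \<epsilon> by (intro mult_left_mono) (auto simp: scaled_path_def)
        then show ?thesis using t \<epsilon> by (simp add: scaled_path_def abs_mult)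
      qed
      then have "g (scaled_path W T \<epsilon> \<omega>) \<le> exp (K + \<theta> * (sqrt \<epsilon> * S \<omega>)\<^sup>2)"
        by (intro K scaled_path_wiener T \<omega>) auto
      then have "g (scaled_path W T \<epsilon> \<omega>) powr (p / \<epsilon>) \<le> exp (p / \<epsilon> * (K + \<theta> * (sqrt \<epsilon> * S \<omega>)\<^sup>2))"
        using p \<epsilon> by (intro powr_le_exp nonneg scaled_path_wiener T \<omega>) auto
      also have "p / \<epsilon> * (K + \<theta> * (sqrt \<epsilon> * S \<omega>)\<^sup>2) = p * K / \<epsilon> + (S \<omega>)\<^sup>2 / (256 * T)"
        using p \<epsilon> T by (simp add: \<theta>_def power_mult_distrib field_simps)
      finally show "ennreal (g (scaled_path W T \<epsilon> \<omega>) powr (p / \<epsilon>))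
          \<le> ennreal (exp (p * K / \<epsilon>)) * ennreal (exp ((S \<omega>)\<^sup>2 / (256 * T)))"
        by (simp add: ennreal_mult'[symmetric] exp_add ennreal_leI)
    qed
    also have "\<dots> = ennreal (exp (p * K / \<epsilon>)) * (\<integral>\<^sup>+\<omega>. ennreal (exp ((S \<omega>)\<^sup>2 / (256 * T))) \<partial>P)"
      by (rule nn_integral_cmult) measurable
    also have "\<dots> \<le> ennreal (exp (p * K / \<epsilon>)) * ennreal (max C 0)"
      by (intro mult_left_mono order_trans[OF C] ennreal_leI) auto
    also have "\<dots> = ennreal (max C 0 * exp (p * K / \<epsilon>))"
      by (metis ennreal_mult' exp_ge_zero mult.commute)
    finally show ?thesis .
  qed
  then show ?thesis by (intro exI[of _ "p * K"] exI[of _ "max C 0"]) auto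
qed

text \<open>The two factors are separated by x * y \<le> x^2 + y^2. The rate is crude, but its
  finiteness is all that the bound on the exceptional event asks for.\<close>

lemma weight_second_moment:
  assumes h: "h \<in> cm_space T"
  shows "\<exists>K C. C \<ge> 0 \<and> (\<forall>\<epsilon>>0. (\<integral>\<^sup>+\<omega>. ennreal ((weight h \<epsilon> \<omega>)\<^sup>2) \<partial>P) \<le> ennreal (C * exp (K / \<epsilon>)))"
proof -
  obtain K C where C: "C \<ge> 0" "\<And>\<epsilon>. \<epsilon> > 0 \<Longrightarrow>
      (\<integral>\<^sup>+\<omega>. ennreal (g (scaled_path W T \<epsilon> \<omega>) powr (4 / \<epsilon>)) \<partial>P) \<le> ennreal (C * exp (K / \<epsilon>))"
    using g_moment[of 4] by auto
  let ?H = "sqnorm (lborel_upto T) (cm_deriv T h)"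
  have [measurable]: "wint h \<in> borel_measurable P" by (rule wint_measurable[OF h])
  have "(\<integral>\<^sup>+\<omega>. ennreal ((weight h \<epsilon> \<omega>)\<^sup>2) \<partial>P) \<le> ennreal ((C + 1) * exp (max K (8 * ?H) / \<epsilon>))" if \<epsilon>: "\<epsilon> > 0" for \<epsilon>
  proof -
    have [measurable]: "(\<lambda>\<omega>. g (scaled_path W T \<epsilon> \<omega>)) \<in> borel_measurable P" by (rule g_measurable)
    have exp4: "(\<integral>\<^sup>+\<omega>. ennreal (exp (- 4 / sqrt \<epsilon> * wint h \<omega>)) \<partial>P) = ennreal (exp (8 * ?H / \<epsilon>))"
    proof -
      have "(\<integral>\<^sup>+\<omega>. ennreal (exp (- 4 / sqrt \<epsilon> * wint h \<omega>)) \<partial>P) = ennreal (exp (sqnorm (lborel_upto T) (\<lambda>t. - 4 / sqrt \<epsilon> * cm_deriv T h t) / 2))"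
        by (rule wiener_mgf[OF less_imp_le[OF T] square_integrable_cmult[OF square_integrable_cm_deriv[OF h]]
            is_wiener_integral_scale[OF square_integrable_cm_deriv[OF h] wint[OF h]]])
      also have "sqnorm (lborel_upto T) (\<lambda>t. - 4 / sqrt \<epsilon> * cm_deriv T h t) / 2 = 8 * ?H / \<epsilon>"
        using \<epsilon> by (subst sqnorm_cmult) (simp add: power_divide)
      finally show ?thesis .
    qed
    have "(\<integral>\<^sup>+\<omega>. ennreal ((weight h \<epsilon> \<omega>)\<^sup>2) \<partial>P)
        \<le> (\<integral>\<^sup>+\<omega>. ennreal (g (scaled_path W T \<epsilon> \<omega>) powr (4 / \<epsilon>)) + ennreal (exp (- 4 / sqrt \<epsilon> * wint h \<omega>)) \<partial>P)"
    proof (rule nn_integral_mono)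
      fix \<omega> assume \<omega>: "\<omega> \<in> space P"
      define x where "x = g (scaled_path W T \<epsilon> \<omega>) powr (2 / \<epsilon>)"
      define y where "y = exp (- 2 / sqrt \<epsilon> * wint h \<omega>)"
      have "(weight h \<epsilon> \<omega>)\<^sup>2 = x * y"
        by (simp add: weight_def x_def y_def power_mult_distrib powr_square exp_double[symmetric])
      also have "\<dots> \<le> x\<^sup>2 + y\<^sup>2"
      proof -
        have "0 \<le> (x - y)\<^sup>2" by simp
        then have "2 * (x * y) \<le> x\<^sup>2 + y\<^sup>2" by (simp add: power2_diff)
        moreover have "0 \<le> x * y" by (simp add: x_def y_def)
        ultimately show ?thesis by linarith
      qed
      also have "x\<^sup>2 = g (scaled_path W T \<epsilon> \<omega>) powr (4 / \<epsilon>)" by (simp add: x_def powr_square)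
      also have "y\<^sup>2 = exp (- 4 / sqrt \<epsilon> * wint h \<omega>)" by (simp add: y_def exp_double[symmetric])
      finally show "ennreal ((weight h \<epsilon> \<omega>)\<^sup>2) \<le> ennreal (g (scaled_path W T \<epsilon> \<omega>) powr (4 / \<epsilon>)) + ennreal (exp (- 4 / sqrt \<epsilon> * wint h \<omega>))"
        by (simp add: ennreal_plus[symmetric] ennreal_leI del: ennreal_plus)
    qed
    also have "\<dots> = (\<integral>\<^sup>+\<omega>. ennreal (g (scaled_path W T \<epsilon> \<omega>) powr (4 / \<epsilon>)) \<partial>P) + (\<integral>\<^sup>+\<omega>. ennreal (exp (- 4 / sqrt \<epsilon> * wint h \<omega>)) \<partial>P)"
      by (rule nn_integral_add) measurable
    also have "\<dots> \<le> ennreal (C * exp (K / \<epsilon>)) + ennreal (exp (8 * ?H / \<epsilon>))"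
      by (intro add_mono C(2) \<epsilon> order_eq_refl[OF exp4])
    also have "\<dots> = ennreal (C * exp (K / \<epsilon>) + exp (8 * ?H / \<epsilon>))" using C(1) by simp
    also have "\<dots> \<le> ennreal ((C + 1) * exp (max K (8 * ?H) / \<epsilon>))"
    proof (rule ennreal_leI)
      have "C * exp (K / \<epsilon>) \<le> C * exp (max K (8 * ?H) / \<epsilon>)"
        using C(1) \<epsilon> by (intro mult_left_mono) (auto simp: divide_right_mono)
      moreover have "exp (8 * ?H / \<epsilon>) \<le> exp (max K (8 * ?H) / \<epsilon>)" using \<epsilon> by (simp add: divide_right_mono)
      ultimately show "C * exp (K / \<epsilon>) + exp (8 * ?H / \<epsilon>) \<le> (C + 1) * exp (max K (8 * ?H) / \<epsilon>)"
        unfolding distrib_right mult_1 by (rule add_mono)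
    qed
    finally show ?thesis .
  qed
  then show ?thesis using C(1) by (intro exI[of _ "max K (8 * ?H)"] exI[of _ "C + 1"]) auto
qed

end

section \<open>The upper bound\<close>

context laplace
begin

lemma pdiff_scaled_path:
  assumes m: "m > 0"
  shows "pdiff T m (scaled_path W T \<epsilon> \<omega>) = (\<lambda>s. sqrt \<epsilon> * pdiff T m (\<lambda>t. W t \<omega>) s)"
proof
  fix s
  have "(scaled_path W T \<epsilon> \<omega> (grid T m (Suc i)) - scaled_path W T \<epsilon> \<omega> (grid T m i)) / (T / real m)
      = sqrt \<epsilon> * ((W (grid T m (Suc i)) \<omega> - W (grid T m i) \<omega>) / (T / real m))" if "i < m" for i
    using grid_bounds[of T m i] grid_bounds[of T m "Suc i"] T that
    by (simp add: scaled_path_def right_diff_distrib diff_divide_distrib)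
  then show "pdiff T m (scaled_path W T \<epsilon> \<omega>) s = sqrt \<epsilon> * pdiff T m (\<lambda>t. W t \<omega>) s"
    unfolding pdiff_def sum_distrib_left by (intro sum.cong) auto
qed

text \<open>The pairing sum of the increments of h and of W is symmetric: the inner product of h
  with the interpolated path is also the integral of the averaged derivative of h against W. The
  energy is a scaled chi-square variable.\<close>

lemma interp_scaled_path_inner:
  assumes m: "m > 0" and \<epsilon>: "\<epsilon> > 0" and h: "h \<in> cm_space T"
  shows "cm_inner T h (interp T m (scaled_path W T \<epsilon> \<omega>)) = sqrt \<epsilon> * step_integral W (pdiff_steps T m h) \<omega>"
    and "cm_inner T (interp T m (scaled_path W T \<epsilon> \<omega>)) (interp T m (scaled_path W T \<epsilon> \<omega>))
       = \<epsilon> * sqnorm (lborel_upto T) (pdiff T m (\<lambda>t. W t \<omega>))"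
proof -
  let ?U = "lborel_upto T" and ?v = "interp T m (scaled_path W T \<epsilon> \<omega>)" and ?p = "pdiff T m (\<lambda>t. W t \<omega>)"
  have T0: "T \<ge> 0" using T by simp
  have dens: "cm_density T ?v (\<lambda>s. sqrt \<epsilon> * ?p s)"
    using interp_density[of T m "scaled_path W T \<epsilon> \<omega>"] by (simp add: pdiff_scaled_path[OF m])
  have v: "?v \<in> cm_space T" by (rule interp_in_cm_space[OF T0])
  have "cm_inner T h ?v = (LINT s|?U. cm_deriv T h s * (sqrt \<epsilon> * ?p s))"
    by (rule cm_inner_density[OF h cm_density_cm_deriv[OF h] v dens T0])
  also have "\<dots> = sqrt \<epsilon> * (LINT s|?U. ?p s * cm_deriv T h s)"
    by (simp add: mult.left_commute mult.commute)
  also have "(LINT s|?U. ?p s * cm_deriv T h s) = step_integral W (pdiff_steps T m h) \<omega>"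
  proof -
    have "primitive T (cm_deriv T h) (grid T m i) = h (grid T m i)" if "i \<le> m" for i
      using cm_space_primitive[OF h grid_bounds[OF T0 m that]] by simp
    then show ?thesis
      unfolding pdiff_inner[OF square_integrable_cm_deriv[OF h] T0] step_integral_eq increment_sum_pdiff_steps
      by (intro sum.cong) (auto simp: Suc_le_eq)
  qed
  finally show "cm_inner T h ?v = sqrt \<epsilon> * step_integral W (pdiff_steps T m h) \<omega>" .
  have "cm_inner T ?v ?v = (LINT s|?U. (sqrt \<epsilon> * ?p s) * (sqrt \<epsilon> * ?p s))"
    by (rule cm_inner_density[OF v dens v dens T0])
  also have "\<dots> = sqnorm ?U (\<lambda>s. sqrt \<epsilon> * ?p s)" by (simp add: sqnorm_def power2_eq_square)
  also have "\<dots> = \<epsilon> * sqnorm ?U ?p" using \<epsilon> by (simp add: sqnorm_cmult)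
  finally show "cm_inner T ?v ?v = \<epsilon> * sqnorm ?U ?p" .
qed

lemma pdiff_energy_measurable:
  assumes m: "m > 0"
  shows "(\<lambda>\<omega>. sqnorm (lborel_upto T) (pdiff T m (\<lambda>t. W t \<omega>))) \<in> borel_measurable P"
proof -
  have "(\<lambda>\<omega>. \<Sum>i<m. (W (grid T m (Suc i)) \<omega> - W (grid T m i) \<omega>)\<^sup>2 / (T / real m)) \<in> borel_measurable P"
    using grid_bounds[of T m] T m
    by (intro borel_measurable_sum borel_measurable_divide borel_measurable_power borel_measurable_diff W_measurable)
       (auto simp: Suc_le_eq grid_def)
  then show ?thesis by (simp add: sqnorm_pdiff[OF T])
qed

text \<open>Markov's inequality for the exponential moment with lam = 1/2, whence the rate a /
  2.\<close>

lemma pdiff_energy_tail: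
  assumes m: "m > 0" and \<epsilon>: "\<epsilon> > 0"
  shows "emeasure P {\<omega>\<in>space P. a \<le> \<epsilon> * sqnorm (lborel_upto T) (pdiff T m (\<lambda>t. W t \<omega>)) / 2}
     \<le> ennreal ((1 / sqrt (1/2)) ^ m * exp (- (a / 2 / \<epsilon>)))"
proof -
  define N where "N = (\<lambda>\<omega>. sqnorm (lborel_upto T) (pdiff T m (\<lambda>t. W t \<omega>)))"
  have Nm[measurable]: "N \<in> borel_measurable P" unfolding N_def by (rule pdiff_energy_measurable[OF m])
  have "emeasure P {\<omega>\<in>space P. a \<le> \<epsilon> * N \<omega> / 2} = (\<integral>\<^sup>+\<omega>. indicator {\<omega>\<in>space P. a \<le> \<epsilon> * N \<omega> / 2} \<omega> \<partial>P)"
    by simp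
  also have "\<dots> \<le> (\<integral>\<^sup>+\<omega>. ennreal (exp (- (a / 2 / \<epsilon>))) * ennreal (exp (1/2 * N \<omega> / 2)) \<partial>P)"
  proof (rule nn_integral_mono)
    fix \<omega>
    show "indicator {\<omega>\<in>space P. a \<le> \<epsilon> * N \<omega> / 2} \<omega> \<le> ennreal (exp (- (a / 2 / \<epsilon>))) * ennreal (exp (1/2 * N \<omega> / 2))"
    proof (cases "a \<le> \<epsilon> * N \<omega> / 2")
      case True
      then have "a / 2 / \<epsilon> \<le> 1/2 * N \<omega> / 2" using \<epsilon> by (simp add: field_simps)
      then have "1 \<le> exp (- (a / 2 / \<epsilon>)) * exp (1/2 * N \<omega> / 2)" by (simp add: exp_add[symmetric])
      then have "1 \<le> ennreal (exp (- (a / 2 / \<epsilon>))) * ennreal (exp (1/2 * N \<omega> / 2))"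
        by (simp add: ennreal_mult'[symmetric] del: times_divide_eq_left)
      then show ?thesis by (auto simp: indicator_def intro: order_trans)
    qed simp
  qed
  also have "\<dots> = ennreal (exp (- (a / 2 / \<epsilon>))) * (\<integral>\<^sup>+\<omega>. ennreal (exp (1/2 * N \<omega> / 2)) \<partial>P)"
    by (rule nn_integral_cmult) measurable
  also have "(\<integral>\<^sup>+\<omega>. ennreal (exp (1/2 * N \<omega> / 2)) \<partial>P) = ennreal ((1 / sqrt (1 - 1/2)) ^ m)"
    unfolding N_def by (rule chi_square_mgf[OF T m]) simp
  also have "ennreal (exp (- (a / 2 / \<epsilon>))) * ennreal ((1 / sqrt (1 - 1/2)) ^ m) = ennreal ((1 / sqrt (1/2)) ^ m * exp (- (a / 2 / \<epsilon>)))"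
    by (subst ennreal_mult'[symmetric]) (simp_all add: mult.commute)
  finally show "emeasure P {\<omega>\<in>space P. a \<le> \<epsilon> * sqnorm (lborel_upto T) (pdiff T m (\<lambda>t. W t \<omega>)) / 2}
     \<le> ennreal ((1 / sqrt (1/2)) ^ m * exp (- (a / 2 / \<epsilon>)))"
    by (simp add: N_def)
qed

text \<open>The increment estimate is used on each of the m cells with threshold d / (2 * sqrt
  \<epsilon>), because interpolation may double the oscillation. The rate d^2 * m / (128 * T) grows
  with m, so a fine mesh beats any prescribed rate.\<close>

lemma interp_error_tail:
  assumes m: "m > 0" and \<epsilon>: "\<epsilon> > 0" and d: "d > 0" and small: "2048 * (T / m) * \<epsilon> \<le> d\<^sup>2"
  shows "\<exists>B\<in>sets P. emeasure P B \<le> ennreal (4 * real m * exp (- (d\<^sup>2 * m / (128 * T) / \<epsilon>)))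
    \<and> (\<forall>\<omega>\<in>space P - B. \<forall>t\<in>{0..T}. \<bar>scaled_path W T \<epsilon> \<omega> t - interp T m (scaled_path W T \<epsilon> \<omega>) t\<bar> \<le> d)"
proof -
  define a where "a = d / (2 * sqrt \<epsilon>)"
  have a: "a > 0" using d \<epsilon> by (simp add: a_def)
  have a2: "a\<^sup>2 = d\<^sup>2 / (4 * \<epsilon>)" using \<epsilon> by (simp add: a_def power_divide power_mult_distrib)
  have Tm: "T / m > 0" using T m by simp
  have "512 * (T / m) \<le> a\<^sup>2" unfolding a2 using small \<epsilon> by (simp add: pos_le_divide_eq ac_simps)
  then have "\<exists>B\<in>sets P. emeasure P B \<le> ennreal (4 * exp (- (a\<^sup>2 / (32 * (T / m)))))
     \<and> (\<forall>\<omega>\<in>space P - B. \<forall>t\<in>{grid T m i..grid T m i + T / m}. \<bar>W t \<omega> - W (grid T m i) \<omega>\<bar> \<le> a)" for i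
    using T m a by (intro increment_sup_tail Tm) (auto simp: grid_def)
  then obtain B where B: "\<And>i. B i \<in> sets P" "\<And>i. emeasure P (B i) \<le> ennreal (4 * exp (- (a\<^sup>2 / (32 * (T / m)))))"
    "\<And>i \<omega> t. \<omega> \<in> space P - B i \<Longrightarrow> t \<in> {grid T m i..grid T m i + T / m} \<Longrightarrow> \<bar>W t \<omega> - W (grid T m i) \<omega>\<bar> \<le> a"
    by metis
  have expo: "a\<^sup>2 / (32 * (T / m)) = d\<^sup>2 * m / (128 * T) / \<epsilon>"
    unfolding a2 using \<epsilon> T m by (simp add: field_simps)
  define E where "E = (\<Union>i\<in>{..<m}. B i)"
  have E: "E \<in> sets P" unfolding E_def by (intro sets.finite_UN) (auto simp: B(1))
  have "emeasure P E \<le> (\<Sum>i<m. emeasure P (B i))"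
    unfolding E_def by (rule emeasure_subadditive_finite) (auto simp: B(1))
  also have "\<dots> \<le> (\<Sum>i<m. ennreal (4 * exp (- (d\<^sup>2 * m / (128 * T) / \<epsilon>))))"
    using B(2) unfolding expo by (intro sum_mono) auto
  also have "\<dots> = ennreal (4 * real m * exp (- (d\<^sup>2 * m / (128 * T) / \<epsilon>)))"
    by (subst sum_ennreal) (simp_all add: ac_simps)
  finally have "emeasure P E \<le> ennreal (4 * real m * exp (- (d\<^sup>2 * m / (128 * T) / \<epsilon>)))" .
  moreover have "\<bar>scaled_path W T \<epsilon> \<omega> t - interp T m (scaled_path W T \<epsilon> \<omega>) t\<bar> \<le> d"
    if \<omega>: "\<omega> \<in> space P - E" and t: "t \<in> {0..T}" for \<omega> t
  proof -
    let ?w = "scaled_path W T \<epsilon> \<omega>"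
    obtain i where i: "i < m" "t \<in> {grid T m i..grid T m (Suc i)}"
      by (rule grid_cell_exists[OF T m t])
    have \<omega>i: "\<omega> \<in> space P - B i" using \<omega> i by (auto simp: E_def)
    have "?w 0 = 0" using scaled_path_wiener[OF T, of \<omega> \<epsilon>] \<omega> T by (auto simp: paths_from_iff)
    have "\<bar>interp T m ?w t - ?w t\<bar> \<le> 2 * (d / 2)"
    proof (rule interp_close[where w="?w" and e="d/2", OF T i \<open>?w 0 = 0\<close>])
      fix r assume r: "r \<in> {grid T m i..grid T m (Suc i)}"
      have rT: "r \<in> {0..T}" "grid T m i \<in> {0..T}"
        using grid_bounds[of T m i] grid_bounds[of T m "Suc i"] T m i r by auto
      have "\<bar>W r \<omega> - W (grid T m i) \<omega>\<bar> \<le> a" using B(3)[OF \<omega>i, of r] r by (simp add: grid_Suc)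
      then have "sqrt \<epsilon> * \<bar>W r \<omega> - W (grid T m i) \<omega>\<bar> \<le> sqrt \<epsilon> * a" using \<epsilon> by (intro mult_left_mono) auto
      also have "sqrt \<epsilon> * a = d / 2" using \<epsilon> by (simp add: a_def)
      finally show "\<bar>?w r - ?w (grid T m i)\<bar> \<le> d / 2"
        using rT \<epsilon> by (simp add: scaled_path_def abs_mult flip: right_diff_distrib)
    qed
    then show ?thesis by (simp add: abs_minus_commute)
  qed
  ultimately show ?thesis using E by blast
qed

text \<open>The difference is the Wiener integral of a function of small norm; its rate x^2 / (2 *
  \<kappa>) becomes arbitrarily large on fine dyadic grids.\<close>

lemma wint_error_tail:
  assumes h: "h \<in> cm_space T" and \<epsilon>: "\<epsilon> > 0" and \<kappa>: "\<kappa> > 0" and x: "x \<ge> 0"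
    and le: "sqnorm (lborel_upto T) (\<lambda>s. pdiff T m h s - cm_deriv T h s) \<le> \<kappa>"
  shows "emeasure P {\<omega>\<in>space P. x \<le> \<bar>sqrt \<epsilon> * (wint h \<omega> - step_integral W (pdiff_steps T m h) \<omega>)\<bar>}
    \<le> ennreal (2 * exp (- (x\<^sup>2 / (2 * \<kappa>) / \<epsilon>)))"
proof -
  let ?U = "lborel_upto T" and ?S = "step_integral W (pdiff_steps T m h)"
  have T0: "T \<ge> 0" using T by simp
  have [measurable]: "wint h \<in> borel_measurable P" by (rule wint_measurable[OF h])
  have [measurable]: "?S \<in> borel_measurable P" by (rule step_integral_measurable[OF valid_pdiff_steps[OF T0]])
  have S: "is_wiener_integral P W T (pdiff T m h) ?S"
    using is_wiener_integral_step[OF valid_pdiff_steps[OF T0, of m h]] by (simp add: step_fun_pdiff_steps)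
  note sqD = square_integrable_cm_deriv[OF h]
  have "emeasure P {\<omega>\<in>space P. x \<le> \<bar>sqrt \<epsilon> * (wint h \<omega> - ?S \<omega>)\<bar>} \<le> ennreal (2 * exp (- (x\<^sup>2 / (2 * (\<epsilon> * \<kappa>)))))"
  proof (rule Chernoff_two_sided[OF _ _ x])
    fix c
    define k where "k = c * sqrt \<epsilon>"
    have "(\<integral>\<^sup>+\<omega>. ennreal (exp (k * wint h \<omega> + - k * ?S \<omega>)) \<partial>P)
        = ennreal (exp (sqnorm ?U (\<lambda>s. k * cm_deriv T h s + - k * pdiff T m h s) / 2))"
      by (intro wiener_mgf T0 square_integrable_add square_integrable_cmult sqD square_integrable_pdiff
          is_wiener_integral_add is_wiener_integral_scale wint h S)
    also have "sqnorm ?U (\<lambda>s. k * cm_deriv T h s + - k * pdiff T m h s) = k\<^sup>2 * sqnorm ?U (\<lambda>s. pdiff T m h s - cm_deriv T h s)"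
      by (subst sqnorm_diff_commute, subst sqnorm_cmult[symmetric]) (simp add: right_diff_distrib)
    also have "k\<^sup>2 = c\<^sup>2 * \<epsilon>" using \<epsilon> by (simp add: k_def power_mult_distrib)
    finally have "(\<integral>\<^sup>+\<omega>. ennreal (exp (c * (sqrt \<epsilon> * (wint h \<omega> - ?S \<omega>)))) \<partial>P)
        = ennreal (exp (c\<^sup>2 * \<epsilon> * sqnorm ?U (\<lambda>s. pdiff T m h s - cm_deriv T h s) / 2))"
      by (simp add: k_def algebra_simps)
    also have "\<dots> \<le> ennreal (exp (c\<^sup>2 * (\<epsilon> * \<kappa>) / 2))"
      using le \<epsilon> by (intro ennreal_leI) (simp add: mult_left_mono divide_right_mono mult.assoc)
    finally show "(\<integral>\<^sup>+\<omega>. ennreal (exp (c * (sqrt \<epsilon> * (wint h \<omega> - ?S \<omega>)))) \<partial>P) \<le> ennreal (exp (c\<^sup>2 * (\<epsilon> * \<kappa>) / 2))" .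
  qed (use \<epsilon> \<kappa> in auto)
  then show ?thesis by (simp add: ac_simps)
qed

text \<open>On the good event the hypothesis is used at the interpolated path: its inner product
  with h cancels the Wiener integral up to e, and its energy is integrated through the chi-square
  moment. The complement is handled by the second moment of the weight together with a probability
  of large rate.\<close>

theorem laplace_upper:
  assumes h: "h \<in> cm_space T" and \<eta>: "\<eta> > 0"
    and S: "\<And>v. v \<in> cm_space T \<Longrightarrow> g v \<le> exp (S + cm_inner T h v + cm_inner T v v / 2)"
  shows "\<forall>\<^sub>F \<epsilon> in at_right 0. (\<integral>\<^sup>+\<omega>. ennreal (weight h \<epsilon> \<omega>) \<partial>P) \<le> ennreal (exp ((S + \<eta>) / \<epsilon>))"
proof -
  let ?U = "lborel_upto T"
  have T0: "T \<ge> 0" using T by simp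
  define e where "e = \<eta> / 5"
  have e: "e > 0" using \<eta> by (simp add: e_def)
  obtain M C where C: "C \<ge> 0" and M: "\<And>\<epsilon>. \<epsilon> > 0 \<Longrightarrow> (\<integral>\<^sup>+\<omega>. ennreal ((weight h \<epsilon> \<omega>)\<^sup>2) \<partial>P) \<le> ennreal (C * exp (M / \<epsilon>))"
    using weight_second_moment[OF h] by blast
  \<comment> \<open>The inequality y \<le> t * y^2 + 1 / t is used below with t = exp (- b /
    \<epsilon>): then t times the second moment has rate M - b = S, and 1 / t times the probability
    of the bad event has rate b - R \<le> S.\<close>
  define b where "b = M - S"
  define R where "R = max 0 (b - S)"
  have R: "R \<ge> 0" "R \<ge> b - S" by (auto simp: R_def)
  \<comment> \<open>The tail of the energy has rate a / 2 = R + 2; the surplus 2 absorbs the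
    prefactors of the three bad events.\<close>
  define a where "a = 2 * (R + 2)"
  have a: "a > 0" using R by (simp add: a_def)
  \<comment> \<open>A positive lower bound for the right-hand side of the hypothesis, obtained from
    the nonnegative squared norm of h + v. It converts the additive error \<kappa> in g into the
    factor exp e.\<close>
  define c0 where "c0 = exp (S - cm_inner T h h / 2)"
  define \<kappa> where "\<kappa> = c0 * (exp e - 1)"
  have \<kappa>: "\<kappa> > 0" using e by (simp add: \<kappa>_def c0_def)
  obtain d where d: "d > 0" and D: "\<And>v w. v \<in> cm_space T \<Longrightarrow> cm_inner T v v \<le> 2 * a \<Longrightarrow> w \<in> wiener_space T \<Longrightarrow>
      \<forall>t\<in>{0..T}. \<bar>w t - v t\<bar> \<le> d \<Longrightarrow> g w \<le> g v + \<kappa>"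
    using compact_modulus[OF \<kappa>, of "2 * a"] by blast
  have gw: "g w \<le> exp (e + S + cm_inner T h v + cm_inner T v v / 2)"
    if v: "v \<in> cm_space T" "cm_inner T v v \<le> 2 * a" and w: "w \<in> wiener_space T" "\<forall>t\<in>{0..T}. \<bar>w t - v t\<bar> \<le> d" for v w
  proof -
    have "0 \<le> sqnorm ?U (\<lambda>s. cm_deriv T h s + cm_deriv T v s)" by (rule sqnorm_nonneg)
    then have "0 \<le> cm_inner T h h + 2 * cm_inner T h v + cm_inner T v v"
      by (simp add: sqnorm_add square_integrable_cm_deriv h v(1) cm_inner_self cm_inner_eq[of T h v])
    then have "c0 \<le> exp (S + cm_inner T h v + cm_inner T v v / 2)" by (simp add: c0_def)
    then have "\<kappa> \<le> exp (S + cm_inner T h v + cm_inner T v v / 2) * (exp e - 1)"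
      unfolding \<kappa>_def using e by (intro mult_right_mono) auto
    then have "g w \<le> exp (S + cm_inner T h v + cm_inner T v v / 2) * exp e"
      using D[OF v w] S[OF v(1)] by (simp add: right_diff_distrib)
    also have "\<dots> = exp (e + S + cm_inner T h v + cm_inner T v v / 2)"
      by (simp add: exp_add[symmetric] ac_simps)
    finally show ?thesis .
  qed
  \<comment> \<open>With this bound on the squared norm, the error of the Wiener integral exceeds e
    with rate e^2 / (2 * k) = R + 2.\<close>
  define k where "k = e\<^sup>2 / (2 * (R + 2))"
  have k: "k > 0" using e R by (simp add: k_def)
  have "\<forall>\<^sub>F j in sequentially. sqnorm ?U (\<lambda>s. pdiff T (2^j) h s - cm_deriv T h s) < k"
    using cm_deriv_dyadic_limit[OF T h] k by (intro order_tendstoD(2)) auto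
  then obtain j0 where j0: "\<And>j. j \<ge> j0 \<Longrightarrow> sqnorm ?U (\<lambda>s. pdiff T (2^j) h s - cm_deriv T h s) < k"
    by (auto simp: eventually_sequentially)
  obtain j1 :: nat where j1: "(R + 2) * (128 * T) / d\<^sup>2 < real j1" using reals_Archimedean2 by blast
  define m :: nat where "m = 2 ^ max j0 j1"
  have m: "m > 0" by (simp add: m_def)
  have "j1 \<le> m"
  proof -
    have "j1 \<le> max j0 j1" by simp
    also have "max j0 j1 < m" unfolding m_def by (rule less_exp)
    finally show ?thesis by simp
  qed
  then have "(R + 2) * (128 * T) / d\<^sup>2 \<le> real m" using j1 by linarith
  then have mR: "R + 2 \<le> d\<^sup>2 * m / (128 * T)" using T d by (simp add: pos_divide_le_eq pos_le_divide_eq ac_simps)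
  have hm: "sqnorm ?U (\<lambda>s. pdiff T m h s - cm_deriv T h s) \<le> k"
    unfolding m_def using j0[of "max j0 j1"] by simp
  \<comment> \<open>On the good event half of the energy is below a, so lowering its coefficient
    from 1 to lam costs at most e; the chi-square moment is finite only for coefficients below
    1.\<close>
  define lam where "lam = 1 - e / (a + e)"
  have lam: "lam < 1" "(1 - lam) * a \<le> e" using a e by (auto simp: lam_def field_simps)
  define Cl where "Cl = (1 / sqrt (1 - lam)) ^ m"
  define Cb where "Cb = (1 / sqrt (1/2)) ^ m + 4 * real m + 2"
  have ev: "\<forall>\<^sub>F \<epsilon> in at_right 0. (2048 * (T / m)) * \<epsilon> \<le> d\<^sup>2"
    "\<forall>\<^sub>F \<epsilon> in at_right 0. Cb * exp ((- (R + 2)) / \<epsilon>) \<le> exp ((- R) / \<epsilon>)"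
    "\<forall>\<^sub>F \<epsilon> in at_right 0. Cl * exp ((S + 3 * e) / \<epsilon>) \<le> exp ((S + 4 * e) / \<epsilon>)"
    "\<forall>\<^sub>F \<epsilon> in at_right 0. (2 + C) * exp ((S + 4 * e) / \<epsilon>) \<le> exp ((S + 5 * e) / \<epsilon>)"
    using d e by (intro eventually_small eventually_exp_absorb; simp)+
  show ?thesis
    using ev eventually_right_pos
  proof eventually_elim
    case (elim \<epsilon>)
    have \<epsilon>: "\<epsilon> > 0" using elim by simp
    let ?w = "\<lambda>\<omega>. scaled_path W T \<epsilon> \<omega>"
    let ?v = "\<lambda>\<omega>. interp T m (?w \<omega>)"
    let ?Z = "step_integral W (pdiff_steps T m h)"
    define N where "N = (\<lambda>\<omega>. sqnorm ?U (pdiff T m (\<lambda>t. W t \<omega>)))"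
    have Nm[measurable]: "N \<in> borel_measurable P" unfolding N_def by (rule pdiff_energy_measurable[OF m])
    have [measurable]: "wint h \<in> borel_measurable P" by (rule wint_measurable[OF h])
    have [measurable]: "?Z \<in> borel_measurable P" by (rule step_integral_measurable[OF valid_pdiff_steps[OF T0]])
    note wm[measurable] = weight_measurable[OF h, of \<epsilon>]
    obtain E2 where E2[measurable]: "E2 \<in> sets P" and E2le: "emeasure P E2 \<le> ennreal (4 * real m * exp (- (d\<^sup>2 * m / (128 * T) / \<epsilon>)))"
      and E2good: "\<And>\<omega> t. \<omega> \<in> space P - E2 \<Longrightarrow> t \<in> {0..T} \<Longrightarrow> \<bar>?w \<omega> t - ?v \<omega> t\<bar> \<le> d"
      using interp_error_tail[OF m \<epsilon> d elim(1)] by blast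
    define E1 where "E1 = {\<omega>\<in>space P. a \<le> \<epsilon> * N \<omega> / 2}"
    define E3 where "E3 = {\<omega>\<in>space P. e \<le> \<bar>sqrt \<epsilon> * (wint h \<omega> - ?Z \<omega>)\<bar>}"
    have [measurable]: "E1 \<in> sets P" "E3 \<in> sets P" unfolding E1_def E3_def by measurable
    define F where "F = E1 \<union> E2 \<union> E3"
    have [measurable]: "F \<in> sets P" unfolding F_def by measurable
    have eqm: "(- (R + 2)) / \<epsilon> = - ((R + 2) / \<epsilon>)" by (rule minus_divide_left[symmetric])
    have x: "exp (- (y / \<epsilon>)) \<le> exp ((- (R + 2)) / \<epsilon>)" if "R + 2 \<le> y" for y
    proof -
      have "(R + 2) / \<epsilon> \<le> y / \<epsilon>" using that \<epsilon> by (intro divide_right_mono) auto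
      then show ?thesis unfolding eqm by simp
    qed
    have E1le: "emeasure P E1 \<le> ennreal ((1 / sqrt (1/2)) ^ m * exp ((- (R + 2)) / \<epsilon>))"
      unfolding E1_def N_def
      by (rule order_trans[OF pdiff_energy_tail[OF m \<epsilon>] ennreal_leI], rule mult_left_mono, rule x) (auto simp: a_def)
    have E2le': "emeasure P E2 \<le> ennreal (4 * real m * exp ((- (R + 2)) / \<epsilon>))"
      by (rule order_trans[OF E2le ennreal_leI], rule mult_left_mono, rule x[OF mR]) auto
    have E3le: "emeasure P E3 \<le> ennreal (2 * exp ((- (R + 2)) / \<epsilon>))"
    proof -
      have "e\<^sup>2 / (2 * k) = R + 2" using e R by (simp add: k_def)
      then show ?thesis
        unfolding E3_def eqm using wint_error_tail[OF h \<epsilon> k less_imp_le[OF e] hm] by simp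
    qed
    have "emeasure P F \<le> emeasure P E1 + emeasure P E2 + emeasure P E3"
      unfolding F_def by (intro order_trans[OF emeasure_subadditive] add_mono order_refl) auto
    also have "\<dots> \<le> ennreal ((1 / sqrt (1/2)) ^ m * exp ((- (R + 2)) / \<epsilon>)) + ennreal (4 * real m * exp ((- (R + 2)) / \<epsilon>))
        + ennreal (2 * exp ((- (R + 2)) / \<epsilon>))"
      by (intro add_mono E1le E2le' E3le)
    also have "\<dots> = ennreal (Cb * exp ((- (R + 2)) / \<epsilon>))"
      by (subst ennreal_plus[symmetric], simp, simp)+ (simp add: Cb_def distrib_right)
    also have "\<dots> \<le> ennreal (exp ((- R) / \<epsilon>))" by (rule ennreal_leI[OF elim(2)])
    finally have PF: "emeasure P F \<le> ennreal (exp ((- R) / \<epsilon>))" .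
    define t where "t = exp (- b / \<epsilon>)"
    have t: "t > 0" by (simp add: t_def)
    have good: "weight h \<epsilon> \<omega> \<le> exp ((S + 3 * e) / \<epsilon>) * exp (lam * N \<omega> / 2)" if \<omega>: "\<omega> \<in> space P - F" for \<omega>
    proof -
      have N1: "\<epsilon> * N \<omega> / 2 < a" and Z: "\<bar>sqrt \<epsilon> * (wint h \<omega> - ?Z \<omega>)\<bar> < e" and w2: "\<omega> \<in> space P - E2" and \<omega>P: "\<omega> \<in> space P"
        using \<omega> by (auto simp: F_def E1_def E3_def)
      note ip = interp_scaled_path_inner[OF m \<epsilon> h, of \<omega>]
      have vv: "cm_inner T (?v \<omega>) (?v \<omega>) = \<epsilon> * N \<omega>" unfolding N_def by (rule ip(2))
      have "g (?w \<omega>) \<le> exp (e + S + cm_inner T h (?v \<omega>) + cm_inner T (?v \<omega>) (?v \<omega>) / 2)"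
        using E2good[OF w2] N1
        by (intro gw interp_in_cm_space T0 scaled_path_wiener[OF T \<omega>P]) (auto simp: vv)
      then have "g (?w \<omega>) powr (1 / \<epsilon>) \<le> exp (1 / \<epsilon> * (e + S + sqrt \<epsilon> * ?Z \<omega> + \<epsilon> * N \<omega> / 2))"
        unfolding ip(1) vv using \<epsilon> by (intro powr_le_exp nonneg scaled_path_wiener[OF T \<omega>P]) auto
      then have "weight h \<epsilon> \<omega> \<le> exp (1 / \<epsilon> * (e + S + sqrt \<epsilon> * ?Z \<omega> + \<epsilon> * N \<omega> / 2)) * exp (- (wint h \<omega> / sqrt \<epsilon>))"
        unfolding weight_def by (intro mult_right_mono) auto
      also have "\<dots> = exp ((e + S + sqrt \<epsilon> * ?Z \<omega> + \<epsilon> * N \<omega> / 2 - sqrt \<epsilon> * wint h \<omega>) / \<epsilon>)"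
        unfolding divide_sqrt_eq[OF \<epsilon>] by (simp add: exp_add[symmetric] diff_divide_distrib)
      also have "\<dots> \<le> exp ((S + 3 * e) / \<epsilon> + lam * N \<omega> / 2)"
      proof -
        have "(1 - lam) * (\<epsilon> * N \<omega> / 2) \<le> (1 - lam) * a" using N1 lam(1) by (intro mult_left_mono) auto
        then have "(1 - lam) * (\<epsilon> * N \<omega> / 2) \<le> e" using lam(2) by linarith
        then have "\<epsilon> * N \<omega> / 2 \<le> e + lam * (\<epsilon> * N \<omega> / 2)" by (simp add: left_diff_distrib)
        moreover have "sqrt \<epsilon> * ?Z \<omega> - sqrt \<epsilon> * wint h \<omega> \<le> e" using Z by (simp add: right_diff_distrib)
        ultimately have "e + S + sqrt \<epsilon> * ?Z \<omega> + \<epsilon> * N \<omega> / 2 - sqrt \<epsilon> * wint h \<omega> \<le> S + 3 * e + \<epsilon> * (lam * N \<omega> / 2)"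
          by (simp add: algebra_simps)
        then have "(e + S + sqrt \<epsilon> * ?Z \<omega> + \<epsilon> * N \<omega> / 2 - sqrt \<epsilon> * wint h \<omega>) / \<epsilon> \<le> (S + 3 * e + \<epsilon> * (lam * N \<omega> / 2)) / \<epsilon>"
          using \<epsilon> by (intro divide_right_mono) auto
        also have "\<dots> = (S + 3 * e) / \<epsilon> + lam * N \<omega> / 2" using \<epsilon> by (simp add: add_divide_distrib)
        finally show ?thesis by simp
      qed
      finally show ?thesis by (simp add: exp_add)
    qed
    have pt: "ennreal (weight h \<epsilon> \<omega>) \<le> ennreal (exp ((S + 3 * e) / \<epsilon>)) * ennreal (exp (lam * N \<omega> / 2))
        + (ennreal t * ennreal ((weight h \<epsilon> \<omega>)\<^sup>2) + ennreal (1 / t) * indicator F \<omega>)" if \<omega>: "\<omega> \<in> space P" for \<omega>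
    proof (cases "\<omega> \<in> F")
      case False
      then have "ennreal (weight h \<epsilon> \<omega>) \<le> ennreal (exp ((S + 3 * e) / \<epsilon>)) * ennreal (exp (lam * N \<omega> / 2))"
        using good[of \<omega>] \<omega> by (simp add: ennreal_mult'[symmetric] ennreal_leI)
      then show ?thesis by (rule order_trans) simp
    next
      case True
      define y where "y = weight h \<epsilon> \<omega>"
      have y: "y \<ge> 0" by (simp add: y_def weight_nonneg)
      have "y \<le> t * y\<^sup>2 + 1 / t"
      proof -
        have "0 \<le> (t * y - 1)\<^sup>2" by simp
        then have "2 * (t * y) \<le> (t * y)\<^sup>2 + 1" by (simp add: power2_diff)
        moreover have "0 \<le> t * y" using t y by simp
        ultimately have "t * y \<le> (t * y)\<^sup>2 + 1" by linarith
        then have "t * y \<le> t * (t * y\<^sup>2 + 1 / t)" using t by (simp add: power2_eq_square algebra_simps)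
        then show ?thesis using t by simp
      qed
      then have "ennreal y \<le> ennreal (t * y\<^sup>2 + 1 / t)" by (rule ennreal_leI)
      also have "\<dots> = ennreal t * ennreal (y\<^sup>2) + ennreal (1 / t)"
        using t by (simp add: ennreal_mult'[symmetric])
      finally have "ennreal (weight h \<epsilon> \<omega>) \<le> ennreal t * ennreal ((weight h \<epsilon> \<omega>)\<^sup>2) + ennreal (1 / t) * indicator F \<omega>"
        using True by (simp add: y_def)
      then show ?thesis by (rule order_trans) simp
    qed
    have "(\<integral>\<^sup>+\<omega>. ennreal (weight h \<epsilon> \<omega>) \<partial>P)
        \<le> (\<integral>\<^sup>+\<omega>. ennreal (exp ((S + 3 * e) / \<epsilon>)) * ennreal (exp (lam * N \<omega> / 2))
        + (ennreal t * ennreal ((weight h \<epsilon> \<omega>)\<^sup>2) + ennreal (1 / t) * indicator F \<omega>) \<partial>P)"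
      by (rule nn_integral_mono) (rule pt)
    also have "\<dots> = ennreal (exp ((S + 3 * e) / \<epsilon>)) * (\<integral>\<^sup>+\<omega>. ennreal (exp (lam * N \<omega> / 2)) \<partial>P)
        + (ennreal t * (\<integral>\<^sup>+\<omega>. ennreal ((weight h \<epsilon> \<omega>)\<^sup>2) \<partial>P) + ennreal (1 / t) * emeasure P F)"
      by (subst nn_integral_add, measurable, subst nn_integral_add, measurable)
         (simp add: nn_integral_cmult nn_integral_cmult_indicator)
    also have "(\<integral>\<^sup>+\<omega>. ennreal (exp (lam * N \<omega> / 2)) \<partial>P) = ennreal Cl"
      unfolding N_def Cl_def by (rule chi_square_mgf[OF T m lam(1)])
    also have "ennreal (exp ((S + 3 * e) / \<epsilon>)) * ennreal Cl
        + (ennreal t * (\<integral>\<^sup>+\<omega>. ennreal ((weight h \<epsilon> \<omega>)\<^sup>2) \<partial>P) + ennreal (1 / t) * emeasure P F)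
      \<le> ennreal (exp ((S + 4 * e) / \<epsilon>)) + (ennreal (C * exp (S / \<epsilon>)) + ennreal (exp (S / \<epsilon>)))"
    proof (intro add_mono)
      have "ennreal (exp ((S + 3 * e) / \<epsilon>)) * ennreal Cl = ennreal (Cl * exp ((S + 3 * e) / \<epsilon>))"
        by (metis ennreal_mult' exp_ge_zero mult.commute)
      then show "ennreal (exp ((S + 3 * e) / \<epsilon>)) * ennreal Cl \<le> ennreal (exp ((S + 4 * e) / \<epsilon>))"
        using ennreal_leI[OF elim(3)] by simp
      have "ennreal t * (\<integral>\<^sup>+\<omega>. ennreal ((weight h \<epsilon> \<omega>)\<^sup>2) \<partial>P) \<le> ennreal t * ennreal (C * exp (M / \<epsilon>))"
        by (rule mult_left_mono[OF M[OF \<epsilon>]]) simp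
      also have "\<dots> = ennreal (t * (C * exp (M / \<epsilon>)))" using t by (intro ennreal_mult'[symmetric]) simp
      also have "t * (C * exp (M / \<epsilon>)) = C * exp (S / \<epsilon>)"
      proof -
        have "- b / \<epsilon> + M / \<epsilon> = S / \<epsilon>" by (simp add: b_def add_divide_distrib[symmetric])
        then have "t * exp (M / \<epsilon>) = exp (S / \<epsilon>)" by (simp only: t_def exp_add[symmetric])
        then show ?thesis by (simp add: mult.left_commute)
      qed
      finally show "ennreal t * (\<integral>\<^sup>+\<omega>. ennreal ((weight h \<epsilon> \<omega>)\<^sup>2) \<partial>P) \<le> ennreal (C * exp (S / \<epsilon>))" .
      have "ennreal (1 / t) * emeasure P F \<le> ennreal (1 / t) * ennreal (exp ((- R) / \<epsilon>))"
        by (rule mult_left_mono[OF PF]) simp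
      also have "\<dots> = ennreal (1 / t * exp ((- R) / \<epsilon>))" using t by (intro ennreal_mult'[symmetric]) simp
      also have "1 / t * exp ((- R) / \<epsilon>) = exp ((b - R) / \<epsilon>)"
        by (simp add: t_def exp_minus[symmetric] exp_add[symmetric] diff_divide_distrib inverse_eq_divide[symmetric])
      also have "ennreal (exp ((b - R) / \<epsilon>)) \<le> ennreal (exp (S / \<epsilon>))"
        using R(2) \<epsilon> by (intro ennreal_leI) (simp add: divide_right_mono)
      finally show "ennreal (1 / t) * emeasure P F \<le> ennreal (exp (S / \<epsilon>))" .
    qed
    also have "\<dots> = ennreal (exp ((S + 4 * e) / \<epsilon>) + (C * exp (S / \<epsilon>) + exp (S / \<epsilon>)))"
      using C by simp
    also have "\<dots> \<le> ennreal (exp ((S + 5 * e) / \<epsilon>))"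
    proof (rule ennreal_leI)
      have s: "exp (S / \<epsilon>) \<le> exp ((S + 4 * e) / \<epsilon>)" using e \<epsilon> by (simp add: divide_right_mono)
      have "C * exp (S / \<epsilon>) \<le> C * exp ((S + 4 * e) / \<epsilon>)" by (rule mult_left_mono[OF s C])
      then have "exp ((S + 4 * e) / \<epsilon>) + (C * exp (S / \<epsilon>) + exp (S / \<epsilon>)) \<le> (2 + C) * exp ((S + 4 * e) / \<epsilon>)"
        unfolding distrib_right using s by linarith
      then show "exp ((S + 4 * e) / \<epsilon>) + (C * exp (S / \<epsilon>) + exp (S / \<epsilon>)) \<le> exp ((S + 5 * e) / \<epsilon>)"
        using elim(4) by linarith
    qed
    also have "S + 5 * e = S + \<eta>" by (simp add: e_def)
    finally show ?case .
  qed
qed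

end

section \<open>The variational problems\<close>

lemma elog_pos: "x > 0 \<Longrightarrow> elog (ennreal x) = ereal (ln x)"
  by (simp add: elog_def ennreal_eq_0_iff)

lemma elog_zero: "elog 0 = - \<infinity>"
  by (simp add: elog_def)

lemma elog_mono:
  assumes "x \<le> y" shows "elog x \<le> elog y"
proof (cases "x = 0 \<or> y = \<top>")
  case True
  then show ?thesis by (auto simp: elog_def top_unique)
next
  case False
  then have fin: "x < \<top>" "y < \<top>" and x0: "x \<noteq> 0" using assms by (auto simp: less_top top_unique)
  then obtain a b where ab: "x = ennreal a" "a \<ge> 0" "y = ennreal b" "b \<ge> 0"
    by (cases x; cases y) auto
  then have "a > 0" "a \<le> b" using x0 assms by (auto simp: ennreal_le_iff ennreal_less_iff order_le_less)
  then show ?thesis using ab by (simp add: elog_pos)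
qed

lemma elog_square:
  assumes "x \<ge> 0" shows "elog (ennreal (x\<^sup>2)) = 2 * elog (ennreal x)"
proof (cases "x = 0")
  case False
  then have "x > 0" using assms by simp
  then have "elog (ennreal (x\<^sup>2)) = ereal (2 * ln x)" by (simp add: elog_pos ln_realpow)
  also have "\<dots> = 2 * elog (ennreal x)" using \<open>x > 0\<close> by (simp add: elog_pos)
  finally show ?thesis .
qed (simp add: elog_zero)

lemma log_rate_le:
  assumes "\<And>\<eta>. \<eta> > 0 \<Longrightarrow> \<forall>\<^sub>F \<epsilon> in at_right 0. f \<epsilon> \<le> ennreal (exp ((S + \<eta>) / \<epsilon>))"
  shows "log_rate f \<le> ereal S"
proof (rule ereal_le_epsilon2)
  fix \<eta> :: real assume \<eta>: "0 < \<eta>"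
  have "log_rate f \<le> ereal (S + \<eta>)"
    unfolding log_rate_def
  proof (rule Limsup_bounded)
    show "\<forall>\<^sub>F \<epsilon> in at_right 0. ereal \<epsilon> * elog (f \<epsilon>) \<le> ereal (S + \<eta>)"
      using assms[OF \<eta>] eventually_right_pos
    proof eventually_elim
      case (elim \<epsilon>)
      have "elog (f \<epsilon>) \<le> ereal ((S + \<eta>) / \<epsilon>)"
        using elog_mono[OF elim(1)] by (simp add: elog_pos)
      then have "ereal \<epsilon> * elog (f \<epsilon>) \<le> ereal \<epsilon> * ereal ((S + \<eta>) / \<epsilon>)"
        using elim(2) by (intro ereal_mult_left_mono) auto
      then show ?case using elim(2) by simp
    qed
  qed
  then show "log_rate f \<le> ereal S + ereal \<eta>" by simp
qed

lemma log_rate_ge: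
  assumes "\<And>\<eta>. \<eta> > 0 \<Longrightarrow> \<forall>\<^sub>F \<epsilon> in at_right 0. ennreal (exp ((S - \<eta>) / \<epsilon>)) \<le> f \<epsilon>"
  shows "ereal S \<le> log_rate f"
proof (rule ereal_le_epsilon2)
  fix \<eta> :: real assume \<eta>: "0 < \<eta>"
  have "ereal (S - \<eta>) \<le> log_rate f"
    unfolding log_rate_def
  proof (rule le_Limsup)
    show "\<forall>\<^sub>F \<epsilon> in at_right 0. ereal (S - \<eta>) \<le> ereal \<epsilon> * elog (f \<epsilon>)"
      using assms[OF \<eta>] eventually_right_pos
    proof eventually_elim
      case (elim \<epsilon>)
      have "ereal ((S - \<eta>) / \<epsilon>) \<le> elog (f \<epsilon>)"
        using elog_mono[OF elim(1)] by (simp add: elog_pos)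
      then have "ereal \<epsilon> * ereal ((S - \<eta>) / \<epsilon>) \<le> ereal \<epsilon> * elog (f \<epsilon>)"
        using elim(2) by (intro ereal_mult_left_mono) auto
      then show ?case using elim(2) by simp
    qed
  qed (simp add: trivial_limit_at_right_real)
  then have "ereal (S - \<eta>) + ereal \<eta> \<le> log_rate f + ereal \<eta>" by (rule add_right_mono)
  then show "ereal S \<le> log_rate f + ereal \<eta>" by simp
qed

lemma log_rate_cong:
  assumes "\<And>\<epsilon>. \<epsilon> > 0 \<Longrightarrow> f \<epsilon> = f' \<epsilon>" shows "log_rate f = log_rate f'"
  unfolding log_rate_def
  by (rule Limsup_eq, rule eventually_mono[OF eventually_right_pos]) (simp add: assms)

section \<open>The Laplace principle as an identity of rates\<close>

context laplace
begin

text \<open>The constant c makes room for the deterministic factor, with c half the squared norm of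
  h, in the second moment of the estimator. In the upper bound a supremum of + infinity is trivial,
  and u0 excludes - infinity.\<close>

theorem laplace_principle:
  assumes h: "h \<in> cm_space T" and u0: "u0 \<in> cm_space T" "g u0 > 0"
  shows "log_rate (\<lambda>\<epsilon>. ennreal (exp (c / \<epsilon>)) * (\<integral>\<^sup>+\<omega>. ennreal (weight h \<epsilon> \<omega>) \<partial>P))
    = (SUP u\<in>cm_space T. elog (ennreal (g u)) - ereal (cm_inner T h u) + ereal c - ereal (1/2 * cm_inner T u u))"
    (is "log_rate ?f = (SUP u\<in>_. ?V u)")
proof (rule antisym)
  have Vpos: "?V u = ereal (ln (g u) - cm_inner T h u + c - cm_inner T u u / 2)" if "g u > 0" for u
    using that by (simp add: elog_pos)
  have Vzero: "?V u = - \<infinity>" if "g u = 0" for u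
    using that by (simp add: elog_zero)
  show "(SUP u\<in>cm_space T. ?V u) \<le> log_rate ?f"
  proof (rule SUP_least)
    fix u assume u: "u \<in> cm_space T"
    show "?V u \<le> log_rate ?f"
    proof (cases "g u = 0")
      case False
      then have gu: "g u > 0" using nonneg[OF cm_space_wiener[OF u]] by simp
      show ?thesis
        unfolding Vpos[OF gu]
      proof (rule log_rate_ge)
        fix \<eta> :: real assume "\<eta> > 0"
        from laplace_lower[OF h u gu this]
        show "\<forall>\<^sub>F \<epsilon> in at_right 0. ennreal (exp ((ln (g u) - cm_inner T h u + c - cm_inner T u u / 2 - \<eta>) / \<epsilon>)) \<le> ?f \<epsilon>"
        proof eventually_elim
          case (elim \<epsilon>)
          have "exp ((ln (g u) - cm_inner T h u + c - cm_inner T u u / 2 - \<eta>) / \<epsilon>)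
              = exp (c / \<epsilon>) * exp ((ln (g u) - cm_inner T h u - cm_inner T u u / 2 - \<eta>) / \<epsilon>)"
            by (simp add: exp_add[symmetric] add_divide_distrib[symmetric] algebra_simps)
          then show ?case using mult_left_mono[OF elim, of "ennreal (exp (c / \<epsilon>))"] by (simp add: ennreal_mult')
        qed
      qed
    next
      case True
      show ?thesis unfolding Vzero[OF True] by simp
    qed
  qed
  show "log_rate ?f \<le> (SUP u\<in>cm_space T. ?V u)"
  proof (cases "(SUP u\<in>cm_space T. ?V u)")
    case (real S)
    have bound: "g v \<le> exp ((S - c) + cm_inner T h v + cm_inner T v v / 2)" if v: "v \<in> cm_space T" for v
    proof (cases "g v = 0")
      case False
      then have gv: "g v > 0" using nonneg[OF cm_space_wiener[OF v]] by simp
      have "?V v \<le> ereal S" unfolding real[symmetric] by (rule SUP_upper[OF v])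
      then have "ln (g v) \<le> (S - c) + cm_inner T h v + cm_inner T v v / 2"
        unfolding Vpos[OF gv] by simp
      then show ?thesis using gv by (metis exp_le_cancel_iff exp_ln)
    qed simp
    show ?thesis
      unfolding real
    proof (rule log_rate_le)
      fix \<eta> :: real assume \<eta>: "\<eta> > 0"
      have "\<forall>\<^sub>F \<epsilon> in at_right 0. (\<integral>\<^sup>+\<omega>. ennreal (weight h \<epsilon> \<omega>) \<partial>P) \<le> ennreal (exp ((S - c + \<eta>) / \<epsilon>))"
        by (rule laplace_upper[OF h \<eta>]) (rule bound)
      then show "\<forall>\<^sub>F \<epsilon> in at_right 0. ?f \<epsilon> \<le> ennreal (exp ((S + \<eta>) / \<epsilon>))"
      proof eventually_elim
        case (elim \<epsilon>)
        have "exp ((S + \<eta>) / \<epsilon>) = exp (c / \<epsilon>) * exp ((S - c + \<eta>) / \<epsilon>)"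
          by (simp add: exp_add[symmetric] add_divide_distrib[symmetric] algebra_simps)
        then show ?case using mult_left_mono[OF elim, of "ennreal (exp (c / \<epsilon>))"] by (simp add: ennreal_mult')
      qed
    qed
  next
    case MInf
    have "?V u0 \<le> - \<infinity>" unfolding MInf[symmetric] by (rule SUP_upper[OF u0(1)])
    then show ?thesis unfolding Vpos[OF u0(2)] by simp
  qed simp
qed

end

text \<open>Strong convexity (the parallelogram identity) makes every minimizing sequence Cauchy.\<close>

lemma sup_of_quadratics_minimizer:
  fixes r :: "(real \<Rightarrow> real) \<Rightarrow> real"
  assumes T: "T > 0" and A: "A \<subseteq> cm_space T" and u0: "u0 \<in> A"
  defines "F \<equiv> \<lambda>h c. \<forall>u\<in>A. r u - cm_inner T h u + cm_inner T h h / 2 \<le> c"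
  shows "\<exists>h\<in>cm_space T. \<forall>k\<in>cm_space T. \<forall>c. F k c \<longrightarrow> F h c"
proof (cases "\<exists>k\<in>cm_space T. \<exists>c. F k c")
  case False
  then show ?thesis using u0 A by blast
next
  case True
  let ?U = "lborel_upto T"
  have T0: "T \<ge> 0" using T by simp
  \<comment> \<open>\<open>F h c\<close> expresses that the supremum at h is at most c, so C
    consists of the real bounds reached by some k and its infimum is the minimal value.\<close>
  define C where "C = {c. \<exists>k\<in>cm_space T. F k c}"
  have Cne: "C \<noteq> {}" using True by (auto simp: C_def)
  note sq = square_integrable_cm_deriv
  have norm_diff: "sqnorm ?U (\<lambda>s. cm_deriv T k s - cm_deriv T u s) = cm_inner T k k - 2 * cm_inner T k u + cm_inner T u u"
    if "k \<in> cm_space T" "u \<in> cm_space T" for k u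
    using sqnorm_diff[OF sq[OF that(1)] sq[OF that(2)]] by (simp add: cm_inner_self cm_inner_eq[of T k u])
  have bdd: "bdd_below C"
  proof (rule bdd_belowI)
    fix c assume "c \<in> C"
    then obtain k where k: "k \<in> cm_space T" "F k c" by (auto simp: C_def)
    have "r u0 - cm_inner T k u0 + cm_inner T k k / 2 \<le> c" using k u0 by (simp add: F_def)
    moreover have "0 \<le> cm_inner T k k - 2 * cm_inner T k u0 + cm_inner T u0 u0"
      using norm_diff[OF k(1), of u0] u0 A sqnorm_nonneg[of ?U] by (metis subsetD)
    ultimately show "r u0 - cm_inner T u0 u0 / 2 \<le> c" by linarith
  qed
  define m where "m = Inf C"
  have "\<exists>h\<in>cm_space T. F h (m + 1 / real (Suc n))" for n
  proof -
    have "Inf C < m + 1 / real (Suc n)" by (simp add: m_def)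
    then obtain c where "c \<in> C" "c < m + 1 / real (Suc n)" using cInf_lessD[OF Cne] by blast
    then show ?thesis by (force simp: C_def F_def)
  qed
  then obtain h where h: "\<And>n. h n \<in> cm_space T" and hF: "\<And>n. F (h n) (m + 1 / real (Suc n))" by metis
  have close: "sqnorm ?U (\<lambda>s. cm_deriv T h1 s - cm_deriv T h2 s) \<le> 8 * d"
    if h1: "h1 \<in> cm_space T" "F h1 (m + d)" and h2: "h2 \<in> cm_space T" "F h2 (m + d)" for h1 h2 d
  proof -
    define q where "q = (\<lambda>s. 1/2 * cm_deriv T h1 s + 1/2 * cm_deriv T h2 s)"
    have q: "square_integrable ?U q"
      unfolding q_def by (intro square_integrable_add square_integrable_cmult sq h1 h2)
    have qc: "cm_path T q \<in> cm_space T" "cm_density T (cm_path T q) q"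
      using q T0 by (auto intro: cm_path_in_cm_space cm_density_cm_path)
    define N where "N = sqnorm ?U (\<lambda>s. cm_deriv T h1 s - cm_deriv T h2 s)"
    have N: "N = cm_inner T h1 h1 - 2 * cm_inner T h1 h2 + cm_inner T h2 h2"
      unfolding N_def by (rule norm_diff[OF h1(1) h2(1)])
    have qq: "cm_inner T (cm_path T q) (cm_path T q) = 1/4 * cm_inner T h1 h1 + 1/2 * cm_inner T h1 h2 + 1/4 * cm_inner T h2 h2"
    proof -
      have "cm_inner T (cm_path T q) (cm_path T q) = sqnorm ?U q"
        using cm_inner_cm_path[OF q q T0] by (simp add: sqnorm_def power2_eq_square)
      also have "\<dots> = sqnorm ?U (\<lambda>s. 1/2 * cm_deriv T h1 s) + 2 * (LINT s|?U. 1/2 * cm_deriv T h1 s * (1/2 * cm_deriv T h2 s))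
          + sqnorm ?U (\<lambda>s. 1/2 * cm_deriv T h2 s)"
        unfolding q_def by (intro sqnorm_add square_integrable_cmult sq h1 h2)
      also have "(LINT s|?U. 1/2 * cm_deriv T h1 s * (1/2 * cm_deriv T h2 s)) = (LINT s|?U. 1/4 * (cm_deriv T h1 s * cm_deriv T h2 s))"
        by (intro Bochner_Integration.integral_cong) auto
      also have "\<dots> = 1/4 * cm_inner T h1 h2" unfolding cm_inner_eq by (rule integral_mult_right_zero)
      finally show ?thesis unfolding sqnorm_cmult by (simp add: cm_inner_self power_divide)
    qed
    have qu: "cm_inner T (cm_path T q) u = 1/2 * cm_inner T h1 u + 1/2 * cm_inner T h2 u" if u: "u \<in> cm_space T" for u
    proof -
      have "cm_inner T (cm_path T q) u = (LINT s|?U. q s * cm_deriv T u s)"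
        by (rule cm_inner_density[OF qc u cm_density_cm_deriv[OF u] T0])
      also have "\<dots> = (LINT s|?U. 1/2 * (cm_deriv T h1 s * cm_deriv T u s) + 1/2 * (cm_deriv T h2 s * cm_deriv T u s))"
        by (intro Bochner_Integration.integral_cong) (auto simp: q_def algebra_simps)
      also have "\<dots> = (LINT s|?U. 1/2 * (cm_deriv T h1 s * cm_deriv T u s)) + (LINT s|?U. 1/2 * (cm_deriv T h2 s * cm_deriv T u s))"
        by (intro Bochner_Integration.integral_add integrable_mult_right square_integrable_mult sq h1 h2 u)
      finally show ?thesis by (simp add: cm_inner_eq)
    qed
    \<comment> \<open>At the midpoint half of the squared norm lies below the average of the two end
      values by N / 8, the parallelogram identity, while the linear terms are averaged exactly. As
      no bound lies below m, this gives N \<le> 8 * d.\<close>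
    have "F (cm_path T q) (m + d - N / 8)"
      unfolding F_def
    proof
      fix u assume u: "u \<in> A"
      have "r u - cm_inner T h1 u + cm_inner T h1 h1 / 2 \<le> m + d" "r u - cm_inner T h2 u + cm_inner T h2 h2 / 2 \<le> m + d"
        using h1(2) h2(2) u by (auto simp: F_def)
      moreover have "u \<in> cm_space T" using u A by blast
      ultimately show "r u - cm_inner T (cm_path T q) u + cm_inner T (cm_path T q) (cm_path T q) / 2 \<le> m + d - N / 8"
        unfolding qq qu[OF \<open>u \<in> cm_space T\<close>] N by argo
    qed
    then have "m + d - N / 8 \<in> C" using qc by (auto simp: C_def)
    then have "m \<le> m + d - N / 8" unfolding m_def by (rule cInf_lower[OF _ bdd])
    then show ?thesis by (simp add: N_def)
  qed
  have cauchy: "\<exists>n0. \<forall>i\<ge>n0. \<forall>j\<ge>n0. sqnorm ?U (\<lambda>s. cm_deriv T (h i) s - cm_deriv T (h j) s) < e" if e: "e > 0" for e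
  proof -
    obtain n0 where n0: "1 / real (Suc n0) < e / 8" by (rule nat_approx_posE[of "e / 8"]) (use e in auto)
    have "sqnorm ?U (\<lambda>s. cm_deriv T (h i) s - cm_deriv T (h j) s) < e" if ij: "i \<ge> n0" "j \<ge> n0" for i j
    proof -
      have F: "F (h i) (m + 1 / real (Suc n0))" if "i \<ge> n0" for i
      proof -
        have "1 / real (Suc i) \<le> 1 / real (Suc n0)" using that by (intro divide_left_mono) auto
        then have "m + 1 / real (Suc i) \<le> m + 1 / real (Suc n0)" by simp
        then show ?thesis using hF[of i] unfolding F_def by (meson order_trans)
      qed
      show ?thesis using close[OF h F[OF ij(1)] h F[OF ij(2)]] n0 by linarith
    qed
    then show ?thesis by blast
  qed
  obtain f where f: "square_integrable ?U f" and lim: "(\<lambda>n. sqnorm ?U (\<lambda>s. cm_deriv T (h n) s - f s)) \<longlonglongrightarrow> 0"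
    by (rule Riesz_Fischer[OF sq[OF h] cauchy])
  have fc: "cm_path T f \<in> cm_space T" "cm_density T (cm_path T f) f"
    using f T0 by (auto intro: cm_path_in_cm_space cm_density_cm_path)
  have Fm: "F (cm_path T f) m"
    unfolding F_def
  proof
    fix u assume u: "u \<in> A"
    then have uc: "u \<in> cm_space T" using A by blast
    have fu: "cm_inner T (cm_path T f) u = (LINT s|?U. f s * cm_deriv T u s)"
      by (rule cm_inner_density[OF fc uc cm_density_cm_deriv[OF uc] T0])
    have "(\<lambda>n. cm_inner T (h n) u) \<longlonglongrightarrow> cm_inner T (cm_path T f) u"
      unfolding fu cm_inner_eq[of T "h _"]
      by (rule sqnorm_tendsto_inner[OF sq[OF h] f sq[OF uc] lim])
    moreover have "(\<lambda>n. cm_inner T (h n) (h n)) \<longlonglongrightarrow> cm_inner T (cm_path T f) (cm_path T f)"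
    proof -
      have "cm_inner T (cm_path T f) (cm_path T f) = sqnorm ?U f"
        using cm_inner_cm_path[OF f f T0] by (simp add: sqnorm_def power2_eq_square)
      then show ?thesis unfolding cm_inner_self[of T "h _"] using sqnorm_tendsto[OF sq[OF h] f lim] by simp
    qed
    ultimately have "(\<lambda>n. r u - cm_inner T (h n) u + cm_inner T (h n) (h n) / 2)
        \<longlonglongrightarrow> r u - cm_inner T (cm_path T f) u + cm_inner T (cm_path T f) (cm_path T f) / 2"
      by (intro tendsto_intros) auto
    moreover have "(\<lambda>n. m + 1 / real (Suc n)) \<longlonglongrightarrow> m + 0"
      by (intro tendsto_intros LIMSEQ_Suc[OF lim_1_over_n])
    ultimately have "r u - cm_inner T (cm_path T f) u + cm_inner T (cm_path T f) (cm_path T f) / 2 \<le> m + 0"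
      by (rule LIMSEQ_le) (use hF u in \<open>auto simp: F_def\<close>)
    then show "r u - cm_inner T (cm_path T f) u + cm_inner T (cm_path T f) (cm_path T f) / 2 \<le> m" by simp
  qed
  have "F (cm_path T f) c" if "k \<in> cm_space T" "F k c" for k c
  proof -
    have "c \<in> C" using that by (auto simp: C_def)
    then have "m \<le> c" unfolding m_def by (rule cInf_lower[OF _ bdd])
    then show ?thesis using Fm unfolding F_def by (meson order_trans)
  qed
  then show ?thesis using fc(1) by blast
qed

section \<open>Existence of the minimizer and of the maximizer\<close>

context path_functional
begin

text \<open>Paths with g u = 0 contribute - infinity and drop out, which leaves a supremum of real
  quadratics; values of J are compared through their real upper bounds.\<close>

lemma variational_minimizer:
  assumes u0: "u0 \<in> cm_space T" "g u0 > 0"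
  defines "J \<equiv> \<lambda>h. SUP u\<in>cm_space T. 2 * elog (ennreal (g u)) - ereal (cm_inner T h u)
        + ereal (1/2 * cm_inner T h h) - ereal (1/2 * cm_inner T u u)"
  shows "\<exists>h\<in>cm_space T. \<forall>k\<in>cm_space T. J h \<le> J k"
proof -
  define A where "A = {u\<in>cm_space T. g u > 0}"
  define r where "r = (\<lambda>u. 2 * ln (g u) - cm_inner T u u / 2)"
  have J_le: "J h \<le> ereal c \<longleftrightarrow> (\<forall>u\<in>A. r u - cm_inner T h u + cm_inner T h h / 2 \<le> c)" for h c
  proof -
    have "2 * elog (ennreal (g u)) - ereal (cm_inner T h u) + ereal (1/2 * cm_inner T h h) - ereal (1/2 * cm_inner T u u) \<le> ereal c
      \<longleftrightarrow> (g u > 0 \<longrightarrow> r u - cm_inner T h u + cm_inner T h h / 2 \<le> c)" if u: "u \<in> cm_space T" for u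
    proof (cases "g u = 0")
      case True
      then show ?thesis by (simp add: elog_zero)
    next
      case False
      then have "g u > 0" using nonneg[OF cm_space_wiener[OF u]] by simp
      then show ?thesis by (simp add: elog_pos r_def algebra_simps)
    qed
    then show ?thesis unfolding J_def SUP_le_iff by (auto simp: A_def)
  qed
  obtain h where h: "h \<in> cm_space T" and min: "\<And>k c. k \<in> cm_space T \<Longrightarrow>
      \<forall>u\<in>A. r u - cm_inner T k u + cm_inner T k k / 2 \<le> c \<Longrightarrow> \<forall>u\<in>A. r u - cm_inner T h u + cm_inner T h h / 2 \<le> c"
    using sup_of_quadratics_minimizer[OF T, of A u0 r] u0 by (auto simp: A_def)
  have "J h \<le> J k" if k: "k \<in> cm_space T" for k
  proof (cases "J k")
    case (real c)
    then have "J k \<le> ereal c" by simp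
    then have "J h \<le> ereal c" unfolding J_le by (rule min[OF k])
    then show ?thesis by (simp add: real)
  next
    case MInf
    then have "J k \<le> ereal c" for c by simp
    then have "\<forall>c. r u0 - cm_inner T k u0 + cm_inner T k k / 2 \<le> c"
      unfolding J_le using u0 by (auto simp: A_def)
    then have "r u0 - cm_inner T k u0 + cm_inner T k k / 2 \<le> r u0 - cm_inner T k u0 + cm_inner T k k / 2 - 1" by blast
    then have False by simp
    then show ?thesis ..
  qed simp
  with h show ?thesis by blast
qed

text \<open>Growth with \<eta> = 1 / (4 * T), together with the bound of the uniform norm by the
  energy, makes the objective coercive: it is at most 2 * K - <u, u> / 2. A maximizing sequence thus
  has bounded energy and a uniformly convergent subsequence.\<close>

lemma simplified_maximizer:
  assumes u0: "u0 \<in> cm_space T" "g u0 > 0"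
  shows "\<exists>v\<in>cm_space T. g v > 0 \<and> (\<forall>u\<in>cm_space T. g u > 0 \<longrightarrow>
    2 * ln (g u) - cm_inner T u u \<le> 2 * ln (g v) - cm_inner T v v)"
proof -
  define A where "A = {u\<in>cm_space T. g u > 0}"
  define f where "f = (\<lambda>u. 2 * ln (g u) - cm_inner T u u)"
  obtain K where K: "\<And>w m. w \<in> wiener_space T \<Longrightarrow> \<forall>t\<in>{0..T}. \<bar>w t\<bar> \<le> m \<Longrightarrow> g w \<le> exp (K + 1 / (4 * T) * m\<^sup>2)"
    using growth[of "1 / (4 * T)"] T by auto
  have f_le: "f u \<le> 2 * K - cm_inner T u u / 2" if u: "u \<in> A" for u
  proof -
    have uc: "u \<in> cm_space T" and gu: "g u > 0" using u by (auto simp: A_def)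
    define m where "m = sqrt (cm_inner T u u) * sqrt T"
    have "\<bar>u t\<bar> \<le> m" if "t \<in> {0..T}" for t
      using primitive_bound[OF square_integrable_cm_deriv[OF uc] that] cm_space_primitive[OF uc that]
      by (simp add: m_def cm_inner_self)
    then have "g u \<le> exp (K + 1 / (4 * T) * m\<^sup>2)" by (intro K cm_space_wiener[OF uc]) auto
    then have "ln (g u) \<le> ln (exp (K + 1 / (4 * T) * m\<^sup>2))" using gu by (intro ln_mono) auto
    also have "\<dots> = K + cm_inner T u u / 4"
      using T sqnorm_nonneg[of "lborel_upto T"] by (simp add: m_def power_mult_distrib cm_inner_self)
    finally show ?thesis by (simp add: f_def)
  qed
  have inner0: "cm_inner T u u \<ge> 0" for u by (simp add: cm_inner_self sqnorm_nonneg)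
  have ne: "f ` A \<noteq> {}" using u0 by (auto simp: A_def)
  have bdd: "bdd_above (f ` A)"
  proof (rule bdd_aboveI2)
    fix u assume "u \<in> A" then show "f u \<le> 2 * K" using f_le[of u] inner0[of u] by linarith
  qed
  define s where "s = Sup (f ` A)"
  have "\<exists>u\<in>A. s - 1 / real (Suc n) < f u" for n
  proof -
    have "s - 1 / real (Suc n) < Sup (f ` A)" by (simp add: s_def)
    then show ?thesis using less_cSup_iff[OF ne bdd] by auto
  qed
  then obtain u where u: "\<And>n. u n \<in> A" and uf: "\<And>n. s - 1 / real (Suc n) < f (u n)" by metis
  have uc: "u n \<in> cm_space T" and gu: "g (u n) > 0" for n using u by (auto simp: A_def)
  have one: "1 / real (Suc n) \<le> 1" for n by simp
  have uf1: "s - 1 < f (u n)" for n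
    by (rule le_less_trans[OF diff_left_mono[OF one] uf])
  have "cm_inner T (u n) (u n) \<le> 2 * (2 * K - s + 1)" for n
    using uf1[of n] f_le[OF u[of n]] by argo
  then have ub: "sqnorm (lborel_upto T) (cm_deriv T (u n)) \<le> 2 * (2 * K - s + 1)" for n
    by (simp add: cm_inner_self)
  obtain v r where r: "strict_mono (r :: nat \<Rightarrow> nat)" and v: "v \<in> cm_space T"
    and lim: "\<forall>e>0. \<exists>N. \<forall>n\<ge>N. \<forall>t\<in>{0..T}. \<bar>u (r n) t - v t\<bar> < e"
    by (rule cm_space_uniform_subsequence[where u=u, OF T uc ub])
  have vw: "v \<in> wiener_space T" by (rule cm_space_wiener[OF v])
  have glim: "(\<lambda>n. g (u (r n))) \<longlonglongrightarrow> g v"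
  proof (rule LIMSEQ_I)
    fix e :: real assume "e > 0"
    then obtain d where d: "d > 0" "\<And>w. w \<in> wiener_space T \<Longrightarrow> \<forall>t\<in>{0..T}. \<bar>w t - v t\<bar> \<le> d \<Longrightarrow> \<bar>g w - g v\<bar> < e"
      using cont[OF vw] by blast
    obtain N where N: "\<forall>n\<ge>N. \<forall>t\<in>{0..T}. \<bar>u (r n) t - v t\<bar> < d" using lim d(1) by blast
    have "norm (g (u (r n)) - g v) < e" if "n \<ge> N" for n
      unfolding real_norm_def
    proof (rule d(2)[OF cm_space_wiener[OF uc]], rule ballI)
      fix t assume "t \<in> {0..T}"
      then have "\<bar>u (r n) t - v t\<bar> < d" using N that by blast
      then show "\<bar>u (r n) t - v t\<bar> \<le> d" by simp
    qed
    then show "\<exists>no. \<forall>n\<ge>no. norm (g (u (r n)) - g v) < e" by blast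
  qed
  \<comment> \<open>This keeps g away from 0 along the sequence, so that the logarithm is continuous
    at the limit.\<close>
  have "exp ((s - 1) / 2) \<le> g (u n)" for n
  proof -
    have "(s - 1) / 2 \<le> ln (g (u n))" using uf1[of n] inner0[of "u n"] by (simp add: f_def)
    then show ?thesis using gu[of n] by (metis exp_le_cancel_iff exp_ln)
  qed
  then have "exp ((s - 1) / 2) \<le> g v" by (intro LIMSEQ_le_const[OF glim]) auto
  then have gv: "g v > 0" using exp_gt_zero less_le_trans by blast
  have lnlim: "(\<lambda>n. ln (g (u (r n)))) \<longlonglongrightarrow> ln (g v)"
    by (rule tendsto_ln[OF glim]) (use gv in simp)
  have plim: "(\<lambda>n. u (r n) t) \<longlonglongrightarrow> v t" if t: "t \<in> {0..T}" for t
  proof (rule LIMSEQ_I)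
    fix e :: real assume "e > 0"
    then obtain N where N: "\<forall>n\<ge>N. \<forall>t\<in>{0..T}. \<bar>u (r n) t - v t\<bar> < e" using lim by blast
    then show "\<exists>no. \<forall>n\<ge>no. norm (u (r n) t - v t) < e" using t by (intro exI[of _ N]) simp
  qed
  \<comment> \<open>Near-maximality bounds the energy of \<open>u n\<close> by 2 * ln (g (u n)) - s
    + 1 / (n + 1). Convergence of the logarithms and lower semicontinuity of the energy pass this to
    v, up to e.\<close>
  have "cm_inner T v v \<le> 2 * ln (g v) - s + e" if e: "e > 0" for e
  proof -
    have l1: "(\<lambda>n. 2 * ln (g (u (r n))) + 1 / real (Suc (r n))) \<longlonglongrightarrow> 2 * ln (g v) + 0"
    proof (rule tendsto_add[OF tendsto_mult_left[OF lnlim]])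
      have "(\<lambda>n. 1 / real (Suc n)) \<longlonglongrightarrow> 0" by (rule LIMSEQ_Suc[OF lim_1_over_n])
      then show "(\<lambda>n. 1 / real (Suc (r n))) \<longlonglongrightarrow> 0" using LIMSEQ_subseq_LIMSEQ[OF _ r] by (fastforce simp: comp_def)
    qed
    have "\<forall>\<^sub>F n in sequentially. 2 * ln (g (u (r n))) + 1 / real (Suc (r n)) < 2 * ln (g v) + e"
      by (rule order_tendstoD(2)[OF l1]) (use e in simp)
    then have "\<forall>\<^sub>F n in sequentially. sqnorm (lborel_upto T) (cm_deriv T (u (r n))) \<le> 2 * ln (g v) - s + e"
    proof eventually_elim
      case (elim n)
      then show ?case using uf[of "r n"] by (simp add: f_def cm_inner_self)
    qed
    then have "\<exists>\<^sub>F n in sequentially. sqnorm (lborel_upto T) (cm_deriv T (u (r n))) \<le> 2 * ln (g v) - s + e"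
      by (rule eventually_frequently[OF sequentially_bot])
    from cm_space_lower_semicontinuous(2)[where u="\<lambda>n. u (r n)", OF T uc vw plim this]
    show ?thesis by (simp add: cm_inner_self)
  qed
  then have "cm_inner T v v \<le> 2 * ln (g v) - s" by (rule field_le_epsilon)
  then have "s \<le> f v" by (simp add: f_def)
  moreover have "f w \<le> s" if "w \<in> A" for w unfolding s_def by (rule cSup_upper[OF _ bdd]) (use that in simp)
  ultimately have "\<forall>w\<in>A. f w \<le> f v" by (auto intro: order_trans)
  then show ?thesis using v gv by (auto simp: A_def f_def)
qed

end

section \<open>Importance sampling\<close>

lemma eexp_real: "eexp (ereal r) = ennreal (exp r)"
  by (simp add: eexp_def)

lemma eexp_MInf: "eexp (- \<infinity>) = 0"
  by (simp add: eexp_def)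

text \<open>Cauchy-Schwarz against 1. The right-hand side is a nonnegative integral because
  competing estimators are only assumed integrable.\<close>

lemma prob_space_integral_square_le:
  assumes "prob_space Q" and Z: "integrable Q Z"
  shows "ennreal ((LINT \<omega>|Q. Z \<omega>)\<^sup>2) \<le> (\<integral>\<^sup>+\<omega>. ennreal ((Z \<omega>)\<^sup>2) \<partial>Q)"
proof (cases "(\<integral>\<^sup>+\<omega>. ennreal ((Z \<omega>)\<^sup>2) \<partial>Q) = \<infinity>")
  case False
  interpret prob_space Q by fact
  have sq: "square_integrable Q Z"
    by (rule square_integrableI_nn) (use Z False in \<open>auto simp: less_top\<close>)
  have "square_integrable Q (\<lambda>_. 1)" by (simp add: square_integrable_def)
  from square_integrable_Cauchy_Schwarz[OF sq this]
  have "\<bar>LINT \<omega>|Q. Z \<omega>\<bar> \<le> sqrt (sqnorm Q Z)" by (simp add: sqnorm_def prob_space)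
  then have "\<bar>LINT \<omega>|Q. Z \<omega>\<bar>\<^sup>2 \<le> (sqrt (sqnorm Q Z))\<^sup>2" by (rule power_mono) simp
  then have "(LINT \<omega>|Q. Z \<omega>)\<^sup>2 \<le> sqnorm Q Z" by (simp add: sqnorm_nonneg)
  then show ?thesis by (simp add: nn_integral_square[OF sq] ennreal_leI)
qed simp

context laplace
begin

lemma zero_path: "cm_path T (\<lambda>_. 0) \<in> cm_space T" "cm_density T (cm_path T (\<lambda>_. 0)) (\<lambda>_. 0)"
  using T by (auto intro!: cm_path_in_cm_space cm_density_cm_path square_integrable_zero)

lemma zero_path_inner: "u \<in> cm_space T \<Longrightarrow> cm_inner T (cm_path T (\<lambda>_. 0)) u = 0"
  using cm_inner_density[OF zero_path _ cm_density_cm_deriv less_imp_le[OF T], of u] by simp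

text \<open>\<open>cm_deriv\<close> and \<open>wiener_integral\<close> are choices, so the value 0
  has to be proved: the integral and its negative both have exponential moment 1, and
  \<open>square_le_exp\<close> then forces a vanishing second moment.\<close>

lemma wint_zero_path: "AE \<omega> in P. wint (cm_path T (\<lambda>_. 0)) \<omega> = 0"
proof -
  let ?h = "cm_path T (\<lambda>_. 0)" and ?U = "lborel_upto T"
  let ?I = "wint ?h"
  have T0: "T \<ge> 0" using T by simp
  have sq: "square_integrable ?U (cm_deriv T ?h)" by (rule square_integrable_cm_deriv[OF zero_path(1)])
  have n0: "sqnorm ?U (cm_deriv T ?h) = 0"
    using zero_path_inner[OF zero_path(1)] by (simp add: cm_inner_self)
  have [measurable]: "?I \<in> borel_measurable P" by (rule wint_measurable[OF zero_path(1)])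
  have e1: "(\<integral>\<^sup>+\<omega>. ennreal (exp (?I \<omega>)) \<partial>P) = 1"
    using wiener_mgf[OF T0 sq wint[OF zero_path(1)]] by (simp add: n0)
  have e2: "(\<integral>\<^sup>+\<omega>. ennreal (exp (- ?I \<omega>)) \<partial>P) = 1"
    using wiener_mgf[OF T0 square_integrable_cmult[OF sq] is_wiener_integral_scale[OF sq wint[OF zero_path(1)], of "-1"]]
    unfolding sqnorm_cmult n0 by simp
  have i: "integrable P (\<lambda>\<omega>. exp (?I \<omega>))" "integrable P (\<lambda>\<omega>. exp (- ?I \<omega>))"
    by (rule integrableI_nonneg; simp add: e1 e2)+
  have v: "(LINT \<omega>|P. exp (?I \<omega>)) = 1" "(LINT \<omega>|P. exp (- ?I \<omega>)) = 1"
    by (simp_all add: integral_eq_nn_integral e1 e2)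
  have i2: "integrable P (\<lambda>\<omega>. 2 * (exp (?I \<omega>) + exp (- ?I \<omega>) - 2))"
    by (intro integrable_mult_right Bochner_Integration.integrable_diff Bochner_Integration.integrable_add i) simp
  have i3: "integrable P (\<lambda>\<omega>. (?I \<omega>)\<^sup>2)"
  proof (rule Bochner_Integration.integrable_bound[OF i2])
    show "AE \<omega> in P. norm ((?I \<omega>)\<^sup>2) \<le> norm (2 * (exp (?I \<omega>) + exp (- ?I \<omega>) - 2))"
      using square_le_exp by (intro always_eventually) (auto intro: order_trans[OF _ abs_ge_self])
  qed simp
  have "(LINT \<omega>|P. (?I \<omega>)\<^sup>2) \<le> (LINT \<omega>|P. 2 * (exp (?I \<omega>) + exp (- ?I \<omega>) - 2))"
    by (rule integral_mono[OF i3 i2]) (rule square_le_exp)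
  also have "\<dots> = 0" using i v by (simp add: prob_space)
  finally have "(LINT \<omega>|P. (?I \<omega>)\<^sup>2) = 0" by (simp add: antisym)
  then have "AE \<omega> in P. (?I \<omega>)\<^sup>2 = 0"
    using integral_nonneg_eq_0_iff_AE[OF i3] by simp
  then show ?thesis by eventually_elim simp
qed

text \<open>The Laplace lower bound at the zero path, where the weight is almost surely the random
  variable to be estimated.\<close>

lemma theta_lower:
  assumes u: "u \<in> cm_space T" "g u > 0" and \<eta>: "\<eta> > 0"
  shows "\<forall>\<^sub>F \<epsilon> in at_right 0. ennreal (exp ((ln (g u) - cm_inner T u u / 2 - \<eta>) / \<epsilon>))
    \<le> (\<integral>\<^sup>+\<omega>. ennreal (g (scaled_path W T \<epsilon> \<omega>) powr (1 / \<epsilon>)) \<partial>P)"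
proof -
  have "(\<integral>\<^sup>+\<omega>. ennreal (weight (cm_path T (\<lambda>_. 0)) \<epsilon> \<omega>) \<partial>P)
      = (\<integral>\<^sup>+\<omega>. ennreal (g (scaled_path W T \<epsilon> \<omega>) powr (1 / \<epsilon>)) \<partial>P)" for \<epsilon>
    by (rule nn_integral_cong_AE, use wint_zero_path in eventually_elim) (simp add: weight_def)
  then show ?thesis
    using laplace_lower[OF zero_path(1) u \<eta>] zero_path_inner[OF u(1)] by simp
qed

text \<open>\<open>tau\<close>, \<open>imp_est\<close> and \<open>rate\<close> are \<open>theta\<close>, \<open>importance_estimator\<close> and \<open>small_noise_L\<close> without
  the extended logarithms and exponentials.\<close>

definition tau :: "real \<Rightarrow> real" where
  "tau \<epsilon> = enn2real (\<integral>\<^sup>+\<omega>. ennreal (g (scaled_path W T \<epsilon> \<omega>) powr (1 / \<epsilon>)) \<partial>P)"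

lemma tau_ennreal:
  assumes "\<epsilon> > 0"
  shows "(\<integral>\<^sup>+\<omega>. ennreal (g (scaled_path W T \<epsilon> \<omega>) powr (1 / \<epsilon>)) \<partial>P) = ennreal (tau \<epsilon>)"
proof -
  obtain K C where "(\<integral>\<^sup>+\<omega>. ennreal (g (scaled_path W T \<epsilon> \<omega>) powr (1 / \<epsilon>)) \<partial>P) \<le> ennreal (C * exp (K / \<epsilon>))"
    using g_moment[of 1] assms by auto
  then have "(\<integral>\<^sup>+\<omega>. ennreal (g (scaled_path W T \<epsilon> \<omega>) powr (1 / \<epsilon>)) \<partial>P) < \<top>"
    using ennreal_less_top le_less_trans by blast
  then show ?thesis by (simp add: tau_def)
qed

text \<open>Relative unbiasedness gives an expectation of at least tau / 2 for small \<epsilon>; the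
  lower bound on tau is then squared.\<close>

lemma unbiased_second_moment_ge:
  assumes ub: "asymp_rel_unbiased P tau Q Z" and u: "u \<in> cm_space T" "g u > 0"
  shows "ereal (2 * ln (g u) - cm_inner T u u) \<le> second_moment_rate Q Z"
  unfolding second_moment_rate_def
proof (rule log_rate_ge)
  fix \<eta> :: real assume \<eta>: "\<eta> > 0"
  \<comment> \<open>Squaring costs twice \<eta> / 4, and the remaining \<eta> / 2 absorbs the factor
    1/4.\<close>
  define l where "l = ln (g u) - cm_inner T u u / 2 - \<eta> / 4"
  have Q: "\<And>\<epsilon>. \<epsilon> > 0 \<Longrightarrow> prob_space (Q \<epsilon>)" "\<And>\<epsilon>. \<epsilon> > 0 \<Longrightarrow> integrable (Q \<epsilon>) (Z \<epsilon>)"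
    and lim: "((\<lambda>\<epsilon>. ((LINT \<omega>|Q \<epsilon>. Z \<epsilon> \<omega>) - tau \<epsilon>) / tau \<epsilon>) \<longlongrightarrow> 0) (at_right 0)"
    using ub by (auto simp: asymp_rel_unbiased_def)
  have "\<forall>\<^sub>F \<epsilon> in at_right 0. dist (((LINT \<omega>|Q \<epsilon>. Z \<epsilon> \<omega>) - tau \<epsilon>) / tau \<epsilon>) 0 < 1/2"
    by (rule tendstoD[OF lim]) simp
  moreover have "\<forall>\<^sub>F \<epsilon> in at_right 0. ennreal (exp (l / \<epsilon>)) \<le> (\<integral>\<^sup>+\<omega>. ennreal (g (scaled_path W T \<epsilon> \<omega>) powr (1 / \<epsilon>)) \<partial>P)"
    unfolding l_def using \<eta> by (intro theta_lower u) auto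
  moreover have "\<forall>\<^sub>F \<epsilon> in at_right 0. 4 * exp ((2 * l - \<eta> / 2) / \<epsilon>) \<le> exp ((2 * l) / \<epsilon>)"
    using \<eta> by (intro eventually_exp_absorb) simp
  ultimately show "\<forall>\<^sub>F \<epsilon> in at_right 0. ennreal (exp ((2 * ln (g u) - cm_inner T u u - \<eta>) / \<epsilon>)) \<le> (\<integral>\<^sup>+\<omega>. ennreal ((Z \<epsilon> \<omega>)\<^sup>2) \<partial>Q \<epsilon>)"
    using eventually_right_pos
  proof eventually_elim
    case (elim \<epsilon>)
    let ?E = "LINT \<omega>|Q \<epsilon>. Z \<epsilon> \<omega>"
    have tau: "exp (l / \<epsilon>) \<le> tau \<epsilon>"
      using elim(2) unfolding tau_ennreal[OF elim(4)] by (simp add: tau_def)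
    then have tau0: "tau \<epsilon> > 0" by (rule less_le_trans[OF exp_gt_zero])
    have "\<bar>?E - tau \<epsilon>\<bar> / tau \<epsilon> < 1/2" using elim(1) tau0 by simp
    then have "\<bar>?E - tau \<epsilon>\<bar> < 1/2 * tau \<epsilon>" using tau0 by (simp only: pos_divide_less_eq)
    then have "1/2 * tau \<epsilon> \<le> ?E" by argo
    then have E: "1/2 * exp (l / \<epsilon>) \<le> ?E" using tau by argo
    have "exp ((2 * ln (g u) - cm_inner T u u - \<eta>) / \<epsilon>) = exp ((2 * l - \<eta> / 2) / \<epsilon>)"
      by (rule arg_cong[where f="\<lambda>x. exp (x / \<epsilon>)"]) (simp add: l_def field_simps)
    also have "\<dots> \<le> 1/4 * exp ((2 * l) / \<epsilon>)" using elim(3) by argo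
    also have "exp ((2 * l) / \<epsilon>) = (exp (l / \<epsilon>))\<^sup>2" by (simp add: exp_double[symmetric])
    also have "1/4 * (exp (l / \<epsilon>))\<^sup>2 = (1/2 * exp (l / \<epsilon>))\<^sup>2" by (simp add: power_mult_distrib power_divide)
    also have "\<dots> \<le> ?E\<^sup>2" by (rule power_mono[OF E]) simp
    finally have "ennreal (exp ((2 * ln (g u) - cm_inner T u u - \<eta>) / \<epsilon>)) \<le> ennreal (?E\<^sup>2)" by (rule ennreal_leI)
    also have "\<dots> \<le> (\<integral>\<^sup>+\<omega>. ennreal ((Z \<epsilon> \<omega>)\<^sup>2) \<partial>Q \<epsilon>)"
      by (rule prob_space_integral_square_le[OF Q[OF elim(4)]])
    finally show ?case .
  qed
qed

lemma girsanov_density_eq: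
  "girsanov_density P W T h \<epsilon> \<omega> = exp (wint h \<omega> / sqrt \<epsilon> - cm_inner T h h / (2 * \<epsilon>))"
  by (simp add: girsanov_density_def wint_def)

lemma changed_measure_nn_integral:
  assumes h: "h \<in> cm_space T" and f: "f \<in> borel_measurable P"
  shows "(\<integral>\<^sup>+\<omega>. f \<omega> \<partial>changed_measure P W T h \<epsilon>) = (\<integral>\<^sup>+\<omega>. ennreal (girsanov_density P W T h \<epsilon> \<omega>) * f \<omega> \<partial>P)"
proof -
  have [measurable]: "wint h \<in> borel_measurable P" by (rule wint_measurable[OF h])
  have "(\<lambda>\<omega>. ennreal (girsanov_density P W T h \<epsilon> \<omega>)) \<in> borel_measurable P"
    unfolding girsanov_density_eq by measurable
  then show ?thesis unfolding changed_measure_def by (rule nn_integral_density[OF _ f])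
qed

lemma changed_measure_prob_space:
  assumes h: "h \<in> cm_space T" and \<epsilon>: "\<epsilon> > 0"
  shows "prob_space (changed_measure P W T h \<epsilon>)"
proof (rule prob_spaceI)
  note sq = square_integrable_cm_deriv[OF h]
  have [measurable]: "wint h \<in> borel_measurable P" by (rule wint_measurable[OF h])
  have "(\<integral>\<^sup>+\<omega>. 1 \<partial>changed_measure P W T h \<epsilon>) = (\<integral>\<^sup>+\<omega>. ennreal (exp (- cm_inner T h h / (2 * \<epsilon>))) * ennreal (exp (1 / sqrt \<epsilon> * wint h \<omega>)) \<partial>P)"
    by (subst changed_measure_nn_integral[OF h])
       (auto intro!: nn_integral_cong simp: girsanov_density_eq ennreal_mult'[symmetric] exp_add[symmetric])
  also have "\<dots> = ennreal (exp (- cm_inner T h h / (2 * \<epsilon>))) * (\<integral>\<^sup>+\<omega>. ennreal (exp (1 / sqrt \<epsilon> * wint h \<omega>)) \<partial>P)"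
    by (rule nn_integral_cmult) measurable
  also have "(\<integral>\<^sup>+\<omega>. ennreal (exp (1 / sqrt \<epsilon> * wint h \<omega>)) \<partial>P) = ennreal (exp (sqnorm (lborel_upto T) (\<lambda>t. 1 / sqrt \<epsilon> * cm_deriv T h t) / 2))"
    by (rule wiener_mgf[OF less_imp_le[OF T] square_integrable_cmult[OF sq] is_wiener_integral_scale[OF sq wint[OF h]]])
  also have "sqnorm (lborel_upto T) (\<lambda>t. 1 / sqrt \<epsilon> * cm_deriv T h t) / 2 = cm_inner T h h / (2 * \<epsilon>)"
    unfolding sqnorm_cmult cm_inner_self using \<epsilon> by (simp add: power_divide)
  also have "ennreal (exp (- cm_inner T h h / (2 * \<epsilon>))) * ennreal (exp (cm_inner T h h / (2 * \<epsilon>))) = 1"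
    by (simp add: ennreal_mult'[symmetric] exp_add[symmetric])
  finally show "emeasure (changed_measure P W T h \<epsilon>) (space (changed_measure P W T h \<epsilon>)) = 1" by simp
qed

definition imp_est :: "(real \<Rightarrow> real) \<Rightarrow> real \<Rightarrow> 'a \<Rightarrow> real" where
  "imp_est h \<epsilon> \<omega> = g (scaled_path W T \<epsilon> \<omega>) powr (1 / \<epsilon>) * (1 / girsanov_density P W T h \<epsilon> \<omega>)"

lemma imp_est_measurable:
  assumes h: "h \<in> cm_space T" shows "imp_est h \<epsilon> \<in> borel_measurable P"
proof -
  have [measurable]: "wint h \<in> borel_measurable P" by (rule wint_measurable[OF h])
  have [measurable]: "(\<lambda>\<omega>. g (scaled_path W T \<epsilon> \<omega>)) \<in> borel_measurable P" by (rule g_measurable)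
  show ?thesis unfolding imp_est_def girsanov_density_eq by measurable
qed

text \<open>The density cancels against its reciprocal, so the estimator is exactly unbiased for
  every positive \<epsilon>.\<close>

lemma imp_est_first_moment:
  assumes h: "h \<in> cm_space T" and \<epsilon>: "\<epsilon> > 0"
  shows "integrable (changed_measure P W T h \<epsilon>) (imp_est h \<epsilon>)"
    and "(LINT \<omega>|changed_measure P W T h \<epsilon>. imp_est h \<epsilon> \<omega>) = tau \<epsilon>"
proof -
  let ?Q = "changed_measure P W T h \<epsilon>"
  have nn: "imp_est h \<epsilon> \<omega> \<ge> 0" for \<omega> by (simp add: imp_est_def girsanov_density_eq)
  note [measurable] = imp_est_measurable[OF h, of \<epsilon>]
  have m: "imp_est h \<epsilon> \<in> borel_measurable ?Q" unfolding changed_measure_def by measurable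
  have "(\<integral>\<^sup>+\<omega>. ennreal (imp_est h \<epsilon> \<omega>) \<partial>?Q) = (\<integral>\<^sup>+\<omega>. ennreal (girsanov_density P W T h \<epsilon> \<omega>) * ennreal (imp_est h \<epsilon> \<omega>) \<partial>P)"
    by (rule changed_measure_nn_integral[OF h]) measurable
  also have "\<dots> = (\<integral>\<^sup>+\<omega>. ennreal (g (scaled_path W T \<epsilon> \<omega>) powr (1 / \<epsilon>)) \<partial>P)"
    by (intro nn_integral_cong) (simp add: imp_est_def girsanov_density_eq ennreal_mult'[symmetric])
  also have "\<dots> = ennreal (tau \<epsilon>)" by (rule tau_ennreal[OF \<epsilon>])
  finally have I: "(\<integral>\<^sup>+\<omega>. ennreal (imp_est h \<epsilon> \<omega>) \<partial>?Q) = ennreal (tau \<epsilon>)" .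
  show "integrable ?Q (imp_est h \<epsilon>)"
    by (rule integrableI_nonneg) (use m nn I in auto)
  show "(LINT \<omega>|?Q. imp_est h \<epsilon> \<omega>) = tau \<epsilon>"
    using m nn by (simp add: integral_eq_nn_integral I) (simp add: tau_def)
qed

lemma imp_est_unbiased:
  assumes h: "h \<in> cm_space T"
  shows "asymp_rel_unbiased P tau (changed_measure P W T h) (imp_est h)"
proof -
  have "\<forall>\<^sub>F \<epsilon> in at_right 0. ((LINT \<omega>|changed_measure P W T h \<epsilon>. imp_est h \<epsilon> \<omega>) - tau \<epsilon>) / tau \<epsilon> = 0"
    using eventually_right_pos by eventually_elim (simp add: imp_est_first_moment(2)[OF h])
  then have "((\<lambda>\<epsilon>. ((LINT \<omega>|changed_measure P W T h \<epsilon>. imp_est h \<epsilon> \<omega>) - tau \<epsilon>) / tau \<epsilon>) \<longlongrightarrow> 0) (at_right 0)"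
    by (rule tendsto_eventually)
  moreover have "sets (changed_measure P W T h \<epsilon>) = sets P" for \<epsilon> by (simp add: changed_measure_def)
  ultimately show ?thesis
    using changed_measure_prob_space[OF h] imp_est_first_moment(1)[OF h] by (simp add: asymp_rel_unbiased_def)
qed

lemma square_laplace: "laplace P W T (\<lambda>w. (g w)\<^sup>2)"
  unfolding laplace_def
  using brownian_axioms path_functional_power[OF path_functional_axioms, of 2] by simp

text \<open>Of the two reciprocal densities in the square, one is cancelled by the change of
  measure. The other splits into a deterministic factor and the exponential of the Wiener integral
  that occurs in \<open>weight\<close>.\<close>

lemma imp_est_second_moment:
  assumes h: "h \<in> cm_space T" and \<epsilon>: "\<epsilon> > 0"
  shows "(\<integral>\<^sup>+\<omega>. ennreal ((imp_est h \<epsilon> \<omega>)\<^sup>2) \<partial>changed_measure P W T h \<epsilon>)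
    = ennreal (exp (1/2 * cm_inner T h h / \<epsilon>)) * (\<integral>\<^sup>+\<omega>. ennreal (laplace.weight P W T (\<lambda>w. (g w)\<^sup>2) h \<epsilon> \<omega>) \<partial>P)"
proof -
  interpret sq: laplace P W T "\<lambda>w. (g w)\<^sup>2" by (rule square_laplace)
  note [measurable] = imp_est_measurable[OF h, of \<epsilon>] sq.weight_measurable[OF h, of \<epsilon>]
  have "(\<integral>\<^sup>+\<omega>. ennreal ((imp_est h \<epsilon> \<omega>)\<^sup>2) \<partial>changed_measure P W T h \<epsilon>)
      = (\<integral>\<^sup>+\<omega>. ennreal (girsanov_density P W T h \<epsilon> \<omega>) * ennreal ((imp_est h \<epsilon> \<omega>)\<^sup>2) \<partial>P)"
    by (rule changed_measure_nn_integral[OF h]) measurable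
  also have "\<dots> = (\<integral>\<^sup>+\<omega>. ennreal (exp (1/2 * cm_inner T h h / \<epsilon>)) * ennreal (sq.weight h \<epsilon> \<omega>) \<partial>P)"
  proof (rule nn_integral_cong)
    fix \<omega> assume \<omega>: "\<omega> \<in> space P"
    define x where "x = g (scaled_path W T \<epsilon> \<omega>)"
    define D where "D = girsanov_density P W T h \<epsilon> \<omega>"
    have D: "D > 0" by (simp add: D_def girsanov_density_eq)
    have x0: "x \<ge> 0" unfolding x_def by (rule nonneg[OF scaled_path_wiener[OF T \<omega>]])
    have "D * (imp_est h \<epsilon> \<omega>)\<^sup>2 = (x powr (1 / \<epsilon>))\<^sup>2 * (1 / D)"
      unfolding imp_est_def x_def[symmetric] D_def[symmetric] using D by (simp add: power_mult_distrib power2_eq_square)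
    also have "(x powr (1 / \<epsilon>))\<^sup>2 = x\<^sup>2 powr (1 / \<epsilon>)" using x0 by (simp add: power2_eq_square powr_mult)
    also have "1 / D = exp (1/2 * cm_inner T h h / \<epsilon>) * exp (- (wint h \<omega> / sqrt \<epsilon>))"
      by (simp add: D_def girsanov_density_eq exp_diff exp_minus field_simps)
    finally have "D * (imp_est h \<epsilon> \<omega>)\<^sup>2 = exp (1/2 * cm_inner T h h / \<epsilon>) * sq.weight h \<epsilon> \<omega>"
      by (simp add: sq.weight_def x_def sq.wint_def wint_def)
    then show "ennreal D * ennreal ((imp_est h \<epsilon> \<omega>)\<^sup>2) = ennreal (exp (1/2 * cm_inner T h h / \<epsilon>)) * ennreal (sq.weight h \<epsilon> \<omega>)"
      using D by (simp add: ennreal_mult'[symmetric])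
  qed
  also have "\<dots> = ennreal (exp (1/2 * cm_inner T h h / \<epsilon>)) * (\<integral>\<^sup>+\<omega>. ennreal (sq.weight h \<epsilon> \<omega>) \<partial>P)"
    by (rule nn_integral_cmult) measurable
  finally show ?thesis .
qed

definition rate :: "(real \<Rightarrow> real) \<Rightarrow> ereal" where
  "rate h = log_rate (\<lambda>\<epsilon>. ennreal (exp (1/2 * cm_inner T h h / \<epsilon>))
     * (\<integral>\<^sup>+\<omega>. ennreal (laplace.weight P W T (\<lambda>w. (g w)\<^sup>2) h \<epsilon> \<omega>) \<partial>P))"

lemma rate_eq:
  assumes h: "h \<in> cm_space T" and u0: "u0 \<in> cm_space T" "g u0 > 0"
  shows "rate h = (SUP u\<in>cm_space T. 2 * elog (ennreal (g u)) - ereal (cm_inner T h u)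
        + ereal (1/2 * cm_inner T h h) - ereal (1/2 * cm_inner T u u))"
proof -
  interpret sq: laplace P W T "\<lambda>w. (g w)\<^sup>2" by (rule square_laplace)
  have "rate h = (SUP u\<in>cm_space T. elog (ennreal ((g u)\<^sup>2)) - ereal (cm_inner T h u)
        + ereal (1/2 * cm_inner T h h) - ereal (1/2 * cm_inner T u u))"
    unfolding rate_def by (rule sq.laplace_principle[OF h u0(1)]) (use u0 in simp)
  also have "\<dots> = (SUP u\<in>cm_space T. 2 * elog (ennreal (g u)) - ereal (cm_inner T h u)
        + ereal (1/2 * cm_inner T h h) - ereal (1/2 * cm_inner T u u))"
    by (intro SUP_cong refl) (simp add: elog_square nonneg cm_space_wiener)
  finally show ?thesis .
qed

lemma second_moment_rate_imp_est:
  assumes h: "h \<in> cm_space T"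
  shows "second_moment_rate (changed_measure P W T h) (imp_est h) = rate h"
  unfolding second_moment_rate_def rate_def by (rule log_rate_cong) (rule imp_est_second_moment[OF h])

theorem optimality_and_uniqueness:
  assumes h: "h \<in> cm_space T" "g h > 0"
    and eq: "rate h = ereal (2 * ln (g h) - cm_inner T h h)"
  shows "asymp_optimal P tau (changed_measure P W T h) (imp_est h)"
    and "k \<in> cm_space T \<Longrightarrow> g k > 0 \<Longrightarrow> 2 * ln (g h) - cm_inner T h h \<le> 2 * ln (g k) - cm_inner T k k \<Longrightarrow> k = h"
proof -
  have "second_moment_rate (changed_measure P W T h) (imp_est h)
      = (INF (Q', Z')\<in>{(Q', Z'). asymp_rel_unbiased P tau Q' Z'}. second_moment_rate Q' Z')"
  proof (rule antisym)
    show "second_moment_rate (changed_measure P W T h) (imp_est h)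
      \<le> (INF (Q', Z')\<in>{(Q', Z'). asymp_rel_unbiased P tau Q' Z'}. second_moment_rate Q' Z')"
      unfolding second_moment_rate_imp_est[OF h(1)] eq
      by (rule INF_greatest) (use unbiased_second_moment_ge[OF _ h] in auto)
    show "(INF (Q', Z')\<in>{(Q', Z'). asymp_rel_unbiased P tau Q' Z'}. second_moment_rate Q' Z')
      \<le> second_moment_rate (changed_measure P W T h) (imp_est h)"
      by (rule INF_lower2[of "(changed_measure P W T h, imp_est h)"]) (use imp_est_unbiased[OF h(1)] in auto)
  qed
  then show "asymp_optimal P tau (changed_measure P W T h) (imp_est h)"
    using imp_est_unbiased[OF h(1)] by (simp add: asymp_optimal_def)
next
  assume k: "k \<in> cm_space T" "g k > 0" and le: "2 * ln (g h) - cm_inner T h h \<le> 2 * ln (g k) - cm_inner T k k"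
  have "2 * elog (ennreal (g k)) - ereal (cm_inner T h k) + ereal (1/2 * cm_inner T h h) - ereal (1/2 * cm_inner T k k) \<le> rate h"
    unfolding rate_eq[OF h(1) h] by (rule SUP_upper[OF k(1)])
  then have "2 * ln (g k) - cm_inner T h k + 1/2 * cm_inner T h h - 1/2 * cm_inner T k k \<le> 2 * ln (g h) - cm_inner T h h"
    unfolding eq using k(2) by (simp add: elog_pos)
  \<comment> \<open>The two inequalities together say that half of the squared distance of h and k
    is at most 0.\<close>
  then have "cm_inner T h h - 2 * cm_inner T h k + cm_inner T k k \<le> 0"
    using le by argo
  moreover have "sqnorm (lborel_upto T) (\<lambda>s. cm_deriv T h s - cm_deriv T k s) = cm_inner T h h - 2 * cm_inner T h k + cm_inner T k k"
    using sqnorm_diff[OF square_integrable_cm_deriv[OF h(1)] square_integrable_cm_deriv[OF k(1)]]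
    by (simp add: cm_inner_self cm_inner_eq[of T h k])
  ultimately show "k = h" using cm_eqI[OF h(1) k(1)] T by simp
qed

end

text \<open>The conventions agree at x = 0: the logarithm is - infinity, its exponential is 0, and
  so is 0 powr (1 / \<epsilon>).\<close>

lemma eexp_log_divide:
  assumes "x \<ge> 0" "\<epsilon> > 0"
  shows "eexp (elog (ennreal x) / ereal \<epsilon>) = ennreal (x powr (1 / \<epsilon>))"
proof (cases "x = 0")
  case True
  have "(- \<infinity>) / ereal \<epsilon> = - \<infinity>" using assms(2) by (simp add: divide_ereal_def)
  then show ?thesis using True by (simp add: elog_zero eexp_MInf)
next
  case False
  then have "x > 0" using assms by simp
  then show ?thesis using assms(2) by (simp add: elog_pos eexp_real powr_def)
qed

lemma eexp_tilted:
  assumes "x \<ge> 0" "\<epsilon> > 0"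
  shows "eexp (ereal (1 / \<epsilon>) * (2 * elog (ennreal x) - ereal (sqrt \<epsilon> * i) + ereal c))
    = ennreal (exp (c / \<epsilon>) * (x\<^sup>2 powr (1 / \<epsilon>) * exp (- (i / sqrt \<epsilon>))))"
proof (cases "x = 0")
  case True
  then show ?thesis using assms(2) by (simp add: elog_zero eexp_MInf)
next
  case False
  then have x: "x > 0" using assms by simp
  have "1 / \<epsilon> * (2 * ln x - sqrt \<epsilon> * i + c) = c / \<epsilon> + (1 / \<epsilon> * ln (x\<^sup>2) + - (i / sqrt \<epsilon>))"
    unfolding divide_sqrt_eq[OF assms(2)] using x by (simp add: ln_realpow add_divide_distrib diff_divide_distrib)
  then have "exp (1 / \<epsilon> * (2 * ln x - sqrt \<epsilon> * i + c)) = exp (c / \<epsilon>) * (x\<^sup>2 powr (1 / \<epsilon>) * exp (- (i / sqrt \<epsilon>)))"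
    using x by (simp only: exp_add powr_def) simp
  then show ?thesis using x by (simp add: elog_pos eexp_real)
qed

theorem theorem4p7:
  fixes P :: "'a measure" and W :: "real \<Rightarrow> 'a \<Rightarrow> real"
    and P' :: "'c measure" and B :: "nat \<Rightarrow> real \<Rightarrow> 'c \<Rightarrow> real"
    and Y :: "nat \<Rightarrow> real \<Rightarrow> 'c \<Rightarrow> real"
    and b :: "real \<Rightarrow> real \<Rightarrow> real measure \<Rightarrow> real"
    and G :: "(real \<Rightarrow> real) \<Rightarrow> real"
    and T \<sigma> x0 L C1 C2 \<alpha> :: real and N q :: nat
  assumes "T > 0" and "\<sigma> > 0" and "N \<ge> 1"
    and "brownian_motion P W"
    and "brownian_motion_dim N P' B"
    and Y_adapted: "\<And>i t. i < N \<Longrightarrow> t \<in> {0..T} \<Longrightarrow>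
          Y i t \<in> borel_measurable (natural_filtration N P' B t)"
    and Y_start: "\<And>i \<omega>'. i < N \<Longrightarrow> \<omega>' \<in> space P' \<Longrightarrow> Y i 0 \<omega>' = x0"
    and Y_borel: "\<And>i \<omega>'. i < N \<Longrightarrow> \<omega>' \<in> space P' \<Longrightarrow>
          (\<lambda>t. Y i t \<omega>') \<in> borel_measurable (restrict_space borel {0..T})"
    and Y_bounded: "\<And>i \<omega>'. i < N \<Longrightarrow> \<omega>' \<in> space P' \<Longrightarrow> bounded ((\<lambda>t. Y i t \<omega>') ` {0..T})"
    and b_time: "\<And>x \<mu>. \<mu> \<in> P2 \<Longrightarrow> continuous_on {0..T} (\<lambda>t. b t x \<mu>)"
    and "L > 0" and "q > 1"
    and b_onesided: "\<And>t x x' \<mu>. t \<in> {0..T} \<Longrightarrow> \<mu> \<in> P2 \<Longrightarrow>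
          (x - x') * (b t x \<mu> - b t x' \<mu>) \<le> L * \<bar>x - x'\<bar>\<^sup>2"
    and b_measure: "\<And>t x \<mu> \<mu>'. t \<in> {0..T} \<Longrightarrow> \<mu> \<in> P2 \<Longrightarrow> \<mu>' \<in> P2 \<Longrightarrow>
          \<bar>b t x \<mu> - b t x \<mu>'\<bar> \<le> wasserstein2 \<mu> \<mu>'"
    and b_growth: "\<And>t x x' \<mu>. t \<in> {0..T} \<Longrightarrow> \<mu> \<in> P2 \<Longrightarrow>
          \<bar>b t x \<mu> - b t x' \<mu>\<bar> \<le> L * (1 + \<bar>x\<bar> ^ q + \<bar>x'\<bar> ^ q) * \<bar>x - x'\<bar>"
    and G_nonneg: "\<And>x. x \<in> paths_from T x0 \<Longrightarrow> G x \<ge> 0"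
    and G_cont: "continuous_map
          (subtopology (mtopology_of (path_metric T)) (paths_from T x0)) euclideanreal G"
    and "C1 > 0" and "C2 > 0" and "1 \<le> \<alpha>" and "\<alpha> < 2"
    and G_growth: "\<And>x. x \<in> paths_from T x0 \<Longrightarrow>
          elog (ennreal (G x)) \<le> ereal (C1 + C2 * (SUP t\<in>{0..T}. \<bar>x t\<bar> powr \<alpha>))"
  shows "AE \<omega>' in P'.
    (\<exists>u\<in>cm_space T. Gbar T b \<sigma> x0 G (empirical_flow N Y \<omega>') u > 0) \<longrightarrow>
      (\<forall>h\<in>cm_space T. cm_deriv_finite_variation T h \<longrightarrow>
         small_noise_L P W T b \<sigma> x0 G (empirical_flow N Y) h \<omega>'
           = variational_rhs T b \<sigma> x0 G (empirical_flow N Y \<omega>') h)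
    \<and> (\<exists>h\<in>cm_space T. \<forall>k\<in>cm_space T.
         variational_rhs T b \<sigma> x0 G (empirical_flow N Y \<omega>') h
           \<le> variational_rhs T b \<sigma> x0 G (empirical_flow N Y \<omega>') k)
    \<and> (\<exists>h. is_maximizer (cm_space T)
              (simplified_objective T b \<sigma> x0 G (empirical_flow N Y \<omega>')) h)
    \<and> (\<forall>h. is_maximizer (cm_space T)
              (simplified_objective T b \<sigma> x0 G (empirical_flow N Y \<omega>')) h
          \<and> small_noise_L P W T b \<sigma> x0 G (empirical_flow N Y) h \<omega>'
              = 2 * log_Gbar T b \<sigma> x0 G (empirical_flow N Y \<omega>') h - ereal (cm_inner T h h)
        \<longrightarrow> optimal_measure_change P W T b \<sigma> x0 G (empirical_flow N Y) \<omega>' h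
          \<and> (\<forall>k. is_maximizer (cm_space T)
                (simplified_objective T b \<sigma> x0 G (empirical_flow N Y \<omega>')) k \<longrightarrow> k = h))"
proof (rule AE_I2, rule impI)
  \<comment> \<open>The copy-space point stays fixed from here on: \<open>copy_cond_exp\<close>
    freezes it, so everything is a statement about Brownian motion and one measure flow.\<close>
  fix \<omega>' assume \<omega>': "\<omega>' \<in> space P'"
  let ?\<mu> = "empirical_flow N Y \<omega>'"
  define g where "g = Gbar T b \<sigma> x0 G ?\<mu>"
  assume "\<exists>u\<in>cm_space T. Gbar T b \<sigma> x0 G (empirical_flow N Y \<omega>') u > 0"
  then obtain u0 where u0: "u0 \<in> cm_space T" "g u0 > 0" by (auto simp: g_def)
  have "\<exists>K. monotone_drift T L K q (\<lambda>s x. b s x (?\<mu> s))"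
    by (rule monotone_drift_empirical_flow[OF \<open>T > 0\<close> \<open>L > 0\<close> \<open>N \<ge> 1\<close>])
       (rule b_time b_onesided b_measure b_growth Y_borel Y_bounded; (assumption | rule \<omega>'))+
  then obtain K where drift: "monotone_drift T L K q (\<lambda>s x. b s x (?\<mu> s))" by blast
  have pf: "path_functional T g"
    unfolding g_def
    by (rule path_functional_Gbar[where T=T and L=L and K=K and q=q and b=b and \<mu>="?\<mu>", OF drift \<open>\<sigma> > 0\<close> G_nonneg G_cont \<open>C1 > 0\<close> \<open>C2 > 0\<close> \<open>1 \<le> \<alpha>\<close> \<open>\<alpha> < 2\<close> G_growth])
  have br: "brownian P W"
    using \<open>brownian_motion P W\<close> by (simp add: brownian_def brownian_axioms_def brownian_motion_def)
  interpret laplace P W T g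
    unfolding laplace_def using br pf by simp
  \<comment> \<open>Two instances of the same setting: g governs the quantity to be estimated, its
    square the second moments in \<open>small_noise_L\<close>.\<close>
  interpret sq: laplace P W T "\<lambda>w. (g w)\<^sup>2" by (rule square_laplace)
  have logG: "log_Gbar T b \<sigma> x0 G ?\<mu> w = elog (ennreal (g w))" for w
    by (simp add: log_Gbar_def g_def)
  have L_eq: "small_noise_L P W T b \<sigma> x0 G (empirical_flow N Y) h \<omega>' = rate h" if h: "h \<in> cm_space T" for h
    unfolding small_noise_L_def rate_def
  proof (rule log_rate_cong)
    fix \<epsilon> :: real assume \<epsilon>: "\<epsilon> > 0"
    note [measurable] = sq.weight_measurable[OF h, of \<epsilon>]
    have "copy_cond_exp P
       (\<lambda>(\<omega>, \<omega>''). eexp (ereal (1 / \<epsilon>) *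
          (2 * log_Gbar T b \<sigma> x0 G (empirical_flow N Y \<omega>'') (scaled_path W T \<epsilon> \<omega>)
           - ereal (sqrt \<epsilon> * wiener_integral P W T (cm_deriv T h) \<omega>)
           + ereal (1/2 * cm_inner T h h)))) \<omega>'
      = (\<integral>\<^sup>+\<omega>. ennreal (exp (1/2 * cm_inner T h h / \<epsilon>)) * ennreal (sq.weight h \<epsilon> \<omega>) \<partial>P)"
      unfolding copy_cond_exp_def prod.case
    proof (rule nn_integral_cong)
      fix \<omega> assume "\<omega> \<in> space P"
      then have "g (scaled_path W T \<epsilon> \<omega>) \<ge> 0" by (intro nonneg scaled_path_wiener T)
      from eexp_tilted[OF this \<epsilon>, of "wiener_integral P W T (cm_deriv T h) \<omega>" "1/2 * cm_inner T h h"]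
      show "eexp (ereal (1 / \<epsilon>) *
          (2 * log_Gbar T b \<sigma> x0 G ?\<mu> (scaled_path W T \<epsilon> \<omega>)
           - ereal (sqrt \<epsilon> * wiener_integral P W T (cm_deriv T h) \<omega>)
           + ereal (1/2 * cm_inner T h h))) = ennreal (exp (1/2 * cm_inner T h h / \<epsilon>)) * ennreal (sq.weight h \<epsilon> \<omega>)"
        unfolding logG sq.weight_def sq.wint_def by (simp only: ennreal_mult' exp_ge_zero)
    qed
    also have "\<dots> = ennreal (exp (1/2 * cm_inner T h h / \<epsilon>)) * (\<integral>\<^sup>+\<omega>. ennreal (sq.weight h \<epsilon> \<omega>) \<partial>P)"
      by (rule nn_integral_cmult) measurable
    finally show "copy_cond_exp P
       (\<lambda>(\<omega>, \<omega>''). eexp (ereal (1 / \<epsilon>) *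
          (2 * log_Gbar T b \<sigma> x0 G (empirical_flow N Y \<omega>'') (scaled_path W T \<epsilon> \<omega>)
           - ereal (sqrt \<epsilon> * wiener_integral P W T (cm_deriv T h) \<omega>)
           + ereal (1/2 * cm_inner T h h)))) \<omega>'
      = ennreal (exp (1/2 * cm_inner T h h / \<epsilon>)) * (\<integral>\<^sup>+\<omega>. ennreal (sq.weight h \<epsilon> \<omega>) \<partial>P)" .
  qed
  have V_eq: "variational_rhs T b \<sigma> x0 G ?\<mu> h = (SUP u\<in>cm_space T. 2 * elog (ennreal (g u)) - ereal (cm_inner T h u)
        + ereal (1/2 * cm_inner T h h) - ereal (1/2 * cm_inner T u u))" for h
    by (simp only: variational_rhs_def logG)
  have obj_pos: "simplified_objective T b \<sigma> x0 G ?\<mu> u = ereal (2 * ln (g u) - cm_inner T u u)" if "g u > 0" for u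
    using that by (simp add: simplified_objective_def logG elog_pos)
  have obj_zero: "simplified_objective T b \<sigma> x0 G ?\<mu> u = - \<infinity>" if "g u = 0" for u
    using that by (simp add: simplified_objective_def logG elog_zero)
  have g_cases: "g u = 0 \<or> g u > 0" if "u \<in> cm_space T" for u
    using nonneg[OF cm_space_wiener[OF that]] by linarith
  \<comment> \<open>The path u0 has a finite objective, so a maximizer cannot have the value -
    infinity.\<close>
  have maximizer_pos: "g h > 0" if "is_maximizer (cm_space T) (simplified_objective T b \<sigma> x0 G ?\<mu>) h" for h
  proof (rule ccontr)
    assume "\<not> g h > 0"
    then have "g h = 0" using g_cases[of h] that by (auto simp: is_maximizer_def)
    moreover have "simplified_objective T b \<sigma> x0 G ?\<mu> u0 \<le> simplified_objective T b \<sigma> x0 G ?\<mu> h"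
      using that u0(1) by (simp add: is_maximizer_def)
    ultimately show False by (simp add: obj_zero obj_pos[OF u0(2)])
  qed
  have theta_eq: "theta P W T b \<sigma> x0 G (empirical_flow N Y) \<omega>' \<epsilon> = tau \<epsilon>" if \<epsilon>: "\<epsilon> > 0" for \<epsilon>
    unfolding theta_def tau_def copy_cond_exp_def prod.case
    by (intro arg_cong[where f=enn2real] nn_integral_cong)
       (simp add: logG eexp_log_divide[OF nonneg[OF scaled_path_wiener[OF T]] \<epsilon>])
  have est_eq: "importance_estimator P W T b \<sigma> x0 G ?\<mu> h \<epsilon> \<omega> = imp_est h \<epsilon> \<omega>" if "\<epsilon> > 0" "\<omega> \<in> space P" for h \<epsilon> \<omega>
    using eexp_log_divide[OF nonneg[OF scaled_path_wiener[OF T that(2)]] that(1)]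
    by (simp add: importance_estimator_def imp_est_def logG)
  \<comment> \<open>\<open>theta\<close> and \<open>tau\<close> are identified for positive
    \<epsilon>, which is all that the limit from the right sees.\<close>
  have unbiased_iff: "asymp_rel_unbiased P (theta P W T b \<sigma> x0 G (empirical_flow N Y) \<omega>') Q Z \<longleftrightarrow> asymp_rel_unbiased P tau Q Z" for Q Z
  proof -
    have "((\<lambda>\<epsilon>. ((LINT \<omega>|Q \<epsilon>. Z \<epsilon> \<omega>) - theta P W T b \<sigma> x0 G (empirical_flow N Y) \<omega>' \<epsilon>) / theta P W T b \<sigma> x0 G (empirical_flow N Y) \<omega>' \<epsilon>) \<longlongrightarrow> 0) (at_right 0)
      \<longleftrightarrow> ((\<lambda>\<epsilon>. ((LINT \<omega>|Q \<epsilon>. Z \<epsilon> \<omega>) - tau \<epsilon>) / tau \<epsilon>) \<longlongrightarrow> 0) (at_right 0)"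
      by (rule tendsto_cong, rule eventually_mono[OF eventually_right_pos]) (simp add: theta_eq)
    then show ?thesis unfolding asymp_rel_unbiased_def by simp
  qed
  have optimal_iff: "optimal_measure_change P W T b \<sigma> x0 G (empirical_flow N Y) \<omega>' h
      \<longleftrightarrow> asymp_optimal P tau (changed_measure P W T h) (imp_est h)" for h
  proof -
    let ?Q = "changed_measure P W T h" and ?Z = "importance_estimator P W T b \<sigma> x0 G ?\<mu> h"
    have sp: "space (?Q \<epsilon>) = space P" for \<epsilon> by (simp add: changed_measure_def)
    have int: "integrable (?Q \<epsilon>) (?Z \<epsilon>) \<longleftrightarrow> integrable (?Q \<epsilon>) (imp_est h \<epsilon>)" "(LINT \<omega>|?Q \<epsilon>. ?Z \<epsilon> \<omega>) = (LINT \<omega>|?Q \<epsilon>. imp_est h \<epsilon> \<omega>)" if "\<epsilon> > 0" for \<epsilon>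
      using est_eq[OF that] by (auto intro!: Bochner_Integration.integrable_cong Bochner_Integration.integral_cong simp: sp)
    have "((\<lambda>\<epsilon>. ((LINT \<omega>|?Q \<epsilon>. ?Z \<epsilon> \<omega>) - tau \<epsilon>) / tau \<epsilon>) \<longlongrightarrow> 0) (at_right 0)
      \<longleftrightarrow> ((\<lambda>\<epsilon>. ((LINT \<omega>|?Q \<epsilon>. imp_est h \<epsilon> \<omega>) - tau \<epsilon>) / tau \<epsilon>) \<longlongrightarrow> 0) (at_right 0)"
      by (rule tendsto_cong, rule eventually_mono[OF eventually_right_pos]) (simp add: int)
    then have ub: "asymp_rel_unbiased P tau ?Q ?Z \<longleftrightarrow> asymp_rel_unbiased P tau ?Q (imp_est h)"
      unfolding asymp_rel_unbiased_def using int(1) by simp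
    have sm: "second_moment_rate ?Q ?Z = second_moment_rate ?Q (imp_est h)"
      unfolding second_moment_rate_def
      by (rule log_rate_cong, rule nn_integral_cong) (simp add: est_eq sp)
    show ?thesis
      unfolding optimal_measure_change_def asymp_optimal_def unbiased_iff ub sm by (rule refl)
  qed
  show "(\<forall>h\<in>cm_space T. cm_deriv_finite_variation T h \<longrightarrow>
         small_noise_L P W T b \<sigma> x0 G (empirical_flow N Y) h \<omega>'
           = variational_rhs T b \<sigma> x0 G (empirical_flow N Y \<omega>') h)
    \<and> (\<exists>h\<in>cm_space T. \<forall>k\<in>cm_space T.
         variational_rhs T b \<sigma> x0 G (empirical_flow N Y \<omega>') h
           \<le> variational_rhs T b \<sigma> x0 G (empirical_flow N Y \<omega>') k)
    \<and> (\<exists>h. is_maximizer (cm_space T)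
              (simplified_objective T b \<sigma> x0 G (empirical_flow N Y \<omega>')) h)
    \<and> (\<forall>h. is_maximizer (cm_space T)
              (simplified_objective T b \<sigma> x0 G (empirical_flow N Y \<omega>')) h
          \<and> small_noise_L P W T b \<sigma> x0 G (empirical_flow N Y) h \<omega>'
              = 2 * log_Gbar T b \<sigma> x0 G (empirical_flow N Y \<omega>') h - ereal (cm_inner T h h)
        \<longrightarrow> optimal_measure_change P W T b \<sigma> x0 G (empirical_flow N Y) \<omega>' h
          \<and> (\<forall>k. is_maximizer (cm_space T)
                (simplified_objective T b \<sigma> x0 G (empirical_flow N Y \<omega>')) k \<longrightarrow> k = h))"
  proof (intro conjI ballI impI allI)
    fix h assume h: "h \<in> cm_space T"
    show "small_noise_L P W T b \<sigma> x0 G (empirical_flow N Y) h \<omega>' = variational_rhs T b \<sigma> x0 G ?\<mu> h"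
      unfolding L_eq[OF h] V_eq by (rule rate_eq[OF h u0])
  next
    show "\<exists>h\<in>cm_space T. \<forall>k\<in>cm_space T. variational_rhs T b \<sigma> x0 G ?\<mu> h \<le> variational_rhs T b \<sigma> x0 G ?\<mu> k"
      unfolding V_eq by (rule variational_minimizer[OF u0])
  next
    obtain v where v: "v \<in> cm_space T" "g v > 0" "\<forall>u\<in>cm_space T. g u > 0 \<longrightarrow>
        2 * ln (g u) - cm_inner T u u \<le> 2 * ln (g v) - cm_inner T v v"
      using simplified_maximizer[OF u0] by blast
    have "simplified_objective T b \<sigma> x0 G ?\<mu> u \<le> simplified_objective T b \<sigma> x0 G ?\<mu> v" if u: "u \<in> cm_space T" for u
      using g_cases[OF u]
    proof
      assume "g u > 0"
      then show ?thesis using v u by (simp add: obj_pos)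
    qed (simp add: obj_zero)
    then show "\<exists>h. is_maximizer (cm_space T) (simplified_objective T b \<sigma> x0 G ?\<mu>) h"
      using v(1) by (auto simp: is_maximizer_def)
  next
    fix h assume "is_maximizer (cm_space T) (simplified_objective T b \<sigma> x0 G ?\<mu>) h
          \<and> small_noise_L P W T b \<sigma> x0 G (empirical_flow N Y) h \<omega>'
              = 2 * log_Gbar T b \<sigma> x0 G ?\<mu> h - ereal (cm_inner T h h)"
    then have max: "is_maximizer (cm_space T) (simplified_objective T b \<sigma> x0 G ?\<mu>) h"
      and L: "small_noise_L P W T b \<sigma> x0 G (empirical_flow N Y) h \<omega>'
              = 2 * log_Gbar T b \<sigma> x0 G ?\<mu> h - ereal (cm_inner T h h)" by auto
    have h: "h \<in> cm_space T" "g h > 0" using max maximizer_pos by (auto simp: is_maximizer_def)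
    have eq: "rate h = ereal (2 * ln (g h) - cm_inner T h h)"
      using L h(2) unfolding L_eq[OF h(1)] logG by (simp add: elog_pos)
    show "optimal_measure_change P W T b \<sigma> x0 G (empirical_flow N Y) \<omega>' h"
      unfolding optimal_iff by (rule optimality_and_uniqueness(1)[OF h eq])
    fix k assume max_k: "is_maximizer (cm_space T) (simplified_objective T b \<sigma> x0 G ?\<mu>) k"
    have k: "k \<in> cm_space T" "g k > 0" using max_k maximizer_pos by (auto simp: is_maximizer_def)
    have "simplified_objective T b \<sigma> x0 G ?\<mu> h \<le> simplified_objective T b \<sigma> x0 G ?\<mu> k"
      using max_k h(1) by (simp add: is_maximizer_def)
    then have "2 * ln (g h) - cm_inner T h h \<le> 2 * ln (g k) - cm_inner T k k"
      by (simp add: obj_pos h(2) k(2))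
    then show "k = h" by (rule optimality_and_uniqueness(2)[OF h eq k])
  qed
qed

end
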